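(* Let $r\ge 0$ and $R\ge r$ be fixed integers, and for each $T$ let $N=N_T$ with $N/T\to\phi\in(0,\infty)$, $\phi\ne1$, as $T\to\infty$. Let $X=(x_1,\dots,x_T)=M+U\in\mathbb{R}^{N\times T}$ with $M=BF'$ and $U=\Sigma_e^{1/2}E$, where $B\in\mathbb{R}^{N\times r}$ is deterministic with rows $b_i'$, $F\in\mathbb{R}^{T\times r}$ is random with rows $f_t'$ of mean zero, $\Sigma_e$ is a deterministic $N\times N$ positive definite matrix, $E=(e_{i,t})\in\mathbb{R}^{N\times T}$ is random, and $F$ is independent of $U$ (when $r=0$, $M=0$ and $X=U$). Let $S_f=T^{-1}F'F$. For $t=1,\dots,T$ let scalars $y_t,g_t,z_t$ satisfy $$y_t=\mu_y+\beta g_t+\rho'f_t+\eta_t,\qquad g_t=\mu_g+\alpha_g'f_t+\varepsilon_{g,t},\qquad z_t=\mu_z+\alpha_z'f_t+\varepsilon_{z,t},$$ with fixed parameters $\mu_y,\mu_g,\mu_z,\beta\in\mathbb{R}$ and $\rho,\alpha_g,\alpha_z\in\mathbb{R}^r$. The case $z_t=g_t$ is allowed. Assume that for constants $0<c\le C<\infty$ not depending on $(i,t,N,T)$: (a) the entries $e_{i,t}$ are independent with $\mathbb{E}[e_{i,t}]=0$, $\mathbb{E}[e_{i,t}^2]=1$ and $\sup_{i,t}\|e_{i,t}\|_{\psi_1}\le C$; (b) the eigenvalues of $\Sigma_e$ lie in $[c,C]$ and the associated deformed Marchenko--Pastur law has regular edges and bulks; (c) if $r\ge1$: $\max_{i\le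 N}\|b_i\|\le C$ and $\max_{t\le T}\|f_t\|=O_P(\log T)$; (d) if $r\ge1$: there is a sequence $\nu_M\to\infty$ with $\nu_M=O(\sqrt N)$ such that, with probability approaching one, $c\,\nu_M\sqrt T\le\lambda_r(M)<\cdots<\lambda_1(M)\le C\nu_M\sqrt T$ and $c\le\lambda_r(S_f)\le\cdots\le\lambda_1(S_f)\le C$; (e) $(\eta_t,\varepsilon_{g,t},\varepsilon_{z,t})$ is i.i.d. across $t$ and independent of $(F,U)$, with $\mathbb{E}[\eta_t]=\mathbb{E}[\varepsilon_{g,t}]=\mathbb{E}[\varepsilon_{z,t}]=0$, $\mathbb{E}[\eta_t\varepsilon_{z,t}]=0$ and $\gamma:=\mathbb{E}[\varepsilon_{g,t}\varepsilon_{z,t}]\ne0$; (f) if $r\ge1$: $\sqrt T\,\log T=o(\nu_M^2)$; (g) $\mathbb{E}|\eta_t|^8+\mathbb{E}|\varepsilon_{g,t}|^8+\mathbb{E}|\varepsilon_{z,t}|^8\le C$ and $\mathbb{E}[\varepsilon_{z,t}^2\eta_t^2]>0$; (h) if $r\ge1$: $T^{-1/2}\sum_{t=1}^Tf_t=O_P(1)$; (i) if $r\ge2$: for some constant $c>0$, with probability converging to one, $\min_{1\le k<r}\{\lambda_k(M)-\lambda_{k+1}(M)\}\ge c\,\nu_M\sqrt T$. Let $\widehat\Xi_R\in\mathbb{R}^{N\times R}$ collect the top $R$ left singular vectors of $X$ and $\widehat F=N^{-1/2}X'\widehat\Xi_R\in\mathbb{R}^{T\times R}$. With $Y=(y_1,\dots,y_T)'$,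 $G=(g_1,\dots,g_T)'$, $Z=(z_1,\dots,z_T)'$, let $\widehat\varepsilon_y=(I-P_{[1_T,\widehat F]})Y$, $\widehat\varepsilon_g=(I-P_{[1_T,\widehat F]})G$, $\widehat\varepsilon_z=(I-P_{[1_T,\widehat F]})Z$, and define $$\widehat\beta=(\widehat\varepsilon_z'\widehat\varepsilon_g)^{-1}\widehat\varepsilon_z'\widehat\varepsilon_y,\qquad \widehat\eta_t=\widehat\varepsilon_{y,t}-\widehat\beta\,\widehat\varepsilon_{g,t},$$ $$\widehat\sigma^2=\bigl(\widehat\varepsilon_z'\widehat\varepsilon_g/T\bigr)^{-1}\Bigl(\tfrac1T\sum_{t=1}^T\widehat\varepsilon_{z,t}^{\,2}\widehat\eta_t^{\,2}\Bigr)\bigl(\widehat\varepsilon_z'\widehat\varepsilon_g/T\bigr)^{-1}.$$ Then $$\sqrt T\,\widehat\sigma^{-1}(\widehat\beta-\beta)\ \overset{d}{\longrightarrow}\ \mathcal N(0,1),$$ and $\widehat\sigma^2$ is consistent for $\sigma^2=\gamma^{-2}\,\mathbb{E}[\varepsilon_{z,t}^2\eta_t^2]$ (in the special case $z_t=g_t$, $\sigma^2=\mathbb{E}[\varepsilon_{g,t}^2]^{-2}\,\mathbb{E}[\varepsilon_{g,t}^2\eta_t^2]$).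
   Context: Notation. $\lambda_k(A)$ is the $k$-th largest singular value of $A$; $\|\cdot\|$ is the spectral/Euclidean norm; $1_T\in\mathbb{R}^T$ is the all-ones vector; $P_A=AA^{+}$ (with $A^+$ the Moore--Penrose pseudoinverse) is the orthogonal projection onto the column space of $A$. $\|\xi\|_{\psi_1}=\inf\{K>0:\mathbb{E}\exp(|\xi|/K)\le2\}$. All limits are as $T\to\infty$. Regularity of the deformed Marchenko--Pastur law. Let $\sigma_1\ge\cdots\ge\sigma_N>0$ be the eigenvalues of $\Sigma_e$, $\pi=N^{-1}\sum_i\delta_{\sigma_i}$, and $\phi_T=N/T$. The deformed MP law $\varrho$ is the measure whose Stieltjes transform $m=m(z)$ is the unique solution in $\mathbb{C}^+$ of $\frac1m=-z+\phi_T\int\frac{x}{1+mx}\,\pi(dx)$, $z\in\mathbb{C}^+$. Let $s_1>\cdots>s_n$ be the distinct (nonzero) eigenvalues of $\Sigma_e$, $r_i=\phi_T\,\pi(\{s_i\})$, and $f(x)=-\frac1x+\sum_{i=1}^n\frac{r_i}{x+s_i^{-1}}$. On the real projective line $\overline{\mathbb{R}}=\mathbb{R}\cup\{\infty\}$ put $I_1=(-s_1^{-1},0)$, $I_i=(-s_i^{-1},-s_{i-1}^{-1})$ for $2\le i\le n$, and $I_0=\overline{\mathbb{R}}\setminus\bigcup_{i=1}^n\overline{I_i}$. Let $\mathcal C$ be the multiset of critical points of $f$ in $\overline{\mathbb R}$ (degenerate ones counted twice; $\infty$ counted as a nondegenerate critical point when $\phi_T=1$). Then $|\mathcal C\cap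 I_0|=|\mathcal C\cap I_1|=1$, $|\mathcal C\cap I_i|\in\{0,2\}$ for $i\ge2$, and $|\mathcal C|=2p$. Label the critical points in $I_1\cup\cdots\cup I_n$ as $x_1\ge\cdots\ge x_{2p-1}$ and let $x_{2p}$ be the one in $I_0$; set $a_k=f(x_k)$. One has $a_1\ge\cdots\ge a_{2p}$ and $\operatorname{supp}\varrho\cap(0,\infty)=\bigcup_{k=1}^p[a_{2k},a_{2k-1}]\cap(0,\infty)$. For a fixed small constant $\delta>0$ (independent of $N,T$): edge $k\in\{1,\dots,2p\}$ is regular if $a_k\ge\delta$, $\min_{l\ne k}|a_k-a_l|\ge\delta$ and $\min_{1\le i\le n}|x_k+s_i^{-1}|\ge\delta$; bulk component $k\in\{1,\dots,p\}$ is regular if for every fixed $\delta'>0$ there is a constant $c_{\delta,\delta'}>0$ such that the density of $\varrho$ is at least $c_{\delta,\delta'}$ on $[a_{2k}+\delta',a_{2k-1}-\delta']$. "Regular edges and bulks" means that all edges and all bulk components are regular. *)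

theory Defs
  imports
    "HOL-Probability.Probability"
    "HOL-Library.Landau_Symbols"
    "Jordan_Normal_Form.Char_Poly"
begin

no_notation inner (infix "\<bullet>" 70)

section \<open>Matrices\<close>

definition vnorm :: "real vec \<Rightarrow> real" where
  "vnorm v = sqrt (v \<bullet> v)"

definition eigs :: "real mat \<Rightarrow> real multiset" where
  "eigs A = proots (char_poly A)"

text \<open>The \<open>k\<close>-th largest singular value, \<open>k \<ge> 1\<close>. Since \<open>A\<^sup>T * A\<close> has as many eigenvalues
  as \<open>A\<close> has columns, the list is padded by zeros when \<open>A\<close> has more columns than rows.\<close>

definition sing_val :: "nat \<Rightarrow> real mat \<Rightarrow> real" where
  "sing_val k A = rev (sorted_list_of_multiset (image_mset sqrt (eigs (transpose_mat A * A)))) ! (k - 1)"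

definition sym_mat :: "nat \<Rightarrow> real mat \<Rightarrow> bool" where
  "sym_mat n A \<longleftrightarrow> A \<in> carrier_mat n n \<and> transpose_mat A = A"

definition pos_def :: "nat \<Rightarrow> real mat \<Rightarrow> bool" where
  "pos_def n A \<longleftrightarrow> sym_mat n A \<and> (\<forall>v \<in> carrier_vec n. v \<noteq> 0\<^sub>v n \<longrightarrow> v \<bullet> (A *\<^sub>v v) > 0)"

definition pos_semidef :: "nat \<Rightarrow> real mat \<Rightarrow> bool" where
  "pos_semidef n A \<longleftrightarrow> sym_mat n A \<and> (\<forall>v \<in> carrier_vec n. v \<bullet> (A *\<^sub>v v) \<ge> 0)"

definition mat_sqrt :: "real mat \<Rightarrow> real mat" where
  "mat_sqrt A = (THE S. pos_semidef (dim_row A) S \<and> S * S = A)"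

definition is_pinv :: "real mat \<Rightarrow> real mat \<Rightarrow> bool" where
  "is_pinv A X \<longleftrightarrow> X \<in> carrier_mat (dim_col A) (dim_row A) \<and>
     A * X * A = A \<and> X * A * X = X \<and>
     transpose_mat (A * X) = A * X \<and> transpose_mat (X * A) = X * A"

definition pinv :: "real mat \<Rightarrow> real mat" where
  "pinv A = (THE X. is_pinv A X)"

definition col_proj :: "real mat \<Rightarrow> real mat" where
  "col_proj A = A * pinv A"

text \<open>The columns of \<open>\<Xi>\<close> are left singular vectors of the \<open>N \<times> T\<close> matrix \<open>X\<close> for its \<open>R\<close> largest
  singular values; \<open>V\<close> collects the matching right singular vectors. Meaningful for
  \<open>R \<le> min N T\<close>.\<close>

definition top_left_singular :: "nat \<Rightarrow> real mat \<Rightarrow> real mat \<Rightarrow> bool" where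
  "top_left_singular R X \<Xi> \<longleftrightarrow> \<Xi> \<in> carrier_mat (dim_row X) R \<and>
     (\<exists>V \<in> carrier_mat (dim_col X) R.
        transpose_mat \<Xi> * \<Xi> = 1\<^sub>m R \<and> transpose_mat V * V = 1\<^sub>m R \<and>
        (\<forall>k\<in>{1..R}. X *\<^sub>v col V (k - 1) = sing_val k X \<cdot>\<^sub>v col \<Xi> (k - 1) \<and>
           transpose_mat X *\<^sub>v col \<Xi> (k - 1) = sing_val k X \<cdot>\<^sub>v col V (k - 1)))"

section \<open>Probability\<close>

text \<open>The Borel sigma-algebra on \<open>n \<times> m\<close> matrices. A random matrix is a measurable map into it.\<close>

definition mat_borel :: "nat \<Rightarrow> nat \<Rightarrow> real mat measure" where
  "mat_borel n m = vimage_algebra (carrier_mat n m)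
     (\<lambda>A. \<lambda>ij\<in>{..<n} \<times> {..<m}. A $$ ij) (PiM ({..<n} \<times> {..<m}) (\<lambda>_. borel))"

text \<open>Independence of two random elements; unlike \<^const>\<open>prob_space.indep_var\<close> the two value
  types may differ.\<close>

definition indep_elems ::
  "'w measure \<Rightarrow> 'a measure \<Rightarrow> ('w \<Rightarrow> 'a) \<Rightarrow> 'b measure \<Rightarrow> ('w \<Rightarrow> 'b) \<Rightarrow> bool" where
  "indep_elems P S X S' Y \<longleftrightarrow> X \<in> measurable P S \<and> Y \<in> measurable P S' \<and>
     prob_space.indep_set P {X -` A \<inter> space P |A. A \<in> sets S} {Y -` A \<inter> space P |A. A \<in> sets S'}"

text \<open>Valued in \<^typ>\<open>ennreal\<close>, so that the norm is infinite when no \<open>K\<close> is admissible.\<close>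

definition psi1_norm :: "'w measure \<Rightarrow> ('w \<Rightarrow> real) \<Rightarrow> ennreal" where
  "psi1_norm P \<xi> = Inf {ennreal K |K. K > 0 \<and> (\<integral>\<^sup>+\<omega>. ennreal (exp (\<bar>\<xi> \<omega>\<bar> / K)) \<partial>P) \<le> 2}"

text \<open>The probability space may change with the sample size \<open>T\<close>.\<close>

definition wp_to_one :: "(nat \<Rightarrow> 'w measure) \<Rightarrow> (nat \<Rightarrow> 'w \<Rightarrow> bool) \<Rightarrow> bool" where
  "wp_to_one P Q \<longleftrightarrow> (\<lambda>T. measure (P T) {\<omega> \<in> space (P T). Q T \<omega>}) \<longlonglongrightarrow> 1"

definition bigO_prob :: "(nat \<Rightarrow> 'w measure) \<Rightarrow> (nat \<Rightarrow> 'w \<Rightarrow> real) \<Rightarrow> (nat \<Rightarrow> real) \<Rightarrow> bool" where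
  "bigO_prob P X a \<longleftrightarrow> (\<forall>\<epsilon>>0. \<exists>K>0. \<forall>\<^sub>F T in sequentially.
     measure (P T) {\<omega> \<in> space (P T). \<bar>X T \<omega>\<bar> > K * \<bar>a T\<bar>} \<le> \<epsilon>)"

definition conv_in_prob :: "(nat \<Rightarrow> 'w measure) \<Rightarrow> (nat \<Rightarrow> 'w \<Rightarrow> real) \<Rightarrow> real \<Rightarrow> bool" where
  "conv_in_prob P X l \<longleftrightarrow> (\<forall>\<^sub>F T in sequentially. X T \<in> borel_measurable (P T)) \<and>
     (\<forall>\<epsilon>>0. (\<lambda>T. measure (P T) {\<omega> \<in> space (P T). \<bar>X T \<omega> - l\<bar> > \<epsilon>}) \<longlonglongrightarrow> 0)"

definition conv_in_distr :: "(nat \<Rightarrow> 'w measure) \<Rightarrow> (nat \<Rightarrow> 'w \<Rightarrow> real) \<Rightarrow> real measure \<Rightarrow> bool" where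
  "conv_in_distr P X \<mu> \<longleftrightarrow> (\<forall>\<^sub>F T in sequentially. X T \<in> borel_measurable (P T)) \<and>
     weak_conv_m (\<lambda>T. distr (P T) borel (X T)) \<mu>"

section \<open>The deformed Marchenko--Pastur law\<close>

text \<open>Throughout, \<open>\<pi>\<close> is the empirical eigenvalue distribution of the covariance matrix and
  \<open>\<phi> = N / T\<close>.\<close>

definition esd :: "real mat \<Rightarrow> real pmf" where
  "esd A = pmf_of_multiset (eigs A)"

definition stieltjes :: "real measure \<Rightarrow> complex \<Rightarrow> complex" where
  "stieltjes \<rho> z = (\<integral>x. 1 / (of_real x - z) \<partial>\<rho>)"

definition mp_stieltjes :: "real pmf \<Rightarrow> real \<Rightarrow> complex \<Rightarrow> complex" where
  "mp_stieltjes \<pi> \<phi> z = (THE m. Im m > 0 \<and>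
     1 / m = - z + of_real \<phi> * (\<integral>x. of_real x / (1 + m * of_real x) \<partial>measure_pmf \<pi>))"

definition mp_law :: "real pmf \<Rightarrow> real \<Rightarrow> real measure" where
  "mp_law \<pi> \<phi> = (THE \<rho>. sets \<rho> = sets borel \<and> prob_space \<rho> \<and>
     (\<forall>z. Im z > 0 \<longrightarrow> stieltjes \<rho> z = mp_stieltjes \<pi> \<phi> z))"

definition mp_n :: "real pmf \<Rightarrow> nat" where
  "mp_n \<pi> = card (set_pmf \<pi>)"

text \<open>\<open>mp_s \<pi> 1 > \<dots> > mp_s \<pi> (mp_n \<pi>)\<close> are the distinct eigenvalues.\<close>

definition mp_s :: "real pmf \<Rightarrow> nat \<Rightarrow> real" where
  "mp_s \<pi> i = rev (sorted_list_of_set (set_pmf \<pi>)) ! (i - 1)"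

definition mp_f :: "real pmf \<Rightarrow> real \<Rightarrow> real \<Rightarrow> real" where
  "mp_f \<pi> \<phi> x = - 1 / x + (\<Sum>i=1..mp_n \<pi>. \<phi> * pmf \<pi> (mp_s \<pi> i) / (x + 1 / mp_s \<pi> i))"

datatype proj_real = Pt (pt: real) | Infty

fun mp_f_proj :: "real pmf \<Rightarrow> real \<Rightarrow> proj_real \<Rightarrow> real" where
  "mp_f_proj \<pi> \<phi> (Pt x) = mp_f \<pi> \<phi> x"
| "mp_f_proj \<pi> \<phi> Infty = 0"

definition mp_I :: "real pmf \<Rightarrow> nat \<Rightarrow> real set" where
  "mp_I \<pi> i = (if i = 1 then {- 1 / mp_s \<pi> 1 <..< 0} else {- 1 / mp_s \<pi> i <..< - 1 / mp_s \<pi> (i - 1)})"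

definition mp_I0 :: "real pmf \<Rightarrow> proj_real set" where
  "mp_I0 \<pi> = - Pt ` (\<Union>i\<in>{1..mp_n \<pi>}. closure (mp_I \<pi> i))"

text \<open>The poles of \<open>f\<close> have to be excluded by hand because division by zero is total. In the
  chart \<open>w = 1 / x\<close> one has \<open>f = (\<phi> - 1) w + O(w\<^sup>2)\<close>, hence \<open>\<infinity>\<close> is critical iff \<open>\<phi> = 1\<close>.\<close>

definition mp_crit_set :: "real pmf \<Rightarrow> real \<Rightarrow> proj_real set" where
  "mp_crit_set \<pi> \<phi> =
     Pt ` {x. x \<noteq> 0 \<and> (\<forall>i\<in>{1..mp_n \<pi>}. x \<noteq> - 1 / mp_s \<pi> i) \<and> deriv (mp_f \<pi> \<phi>) x = 0} \<union>
     (if \<phi> = 1 then {Infty} else {})"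

definition mp_crit :: "real pmf \<Rightarrow> real \<Rightarrow> proj_real multiset" where
  "mp_crit \<pi> \<phi> = mset_set (mp_crit_set \<pi> \<phi>) +
     mset_set {q \<in> mp_crit_set \<pi> \<phi>. \<exists>x. q = Pt x \<and> deriv (deriv (mp_f \<pi> \<phi>)) x = 0}"

definition mp_p :: "real pmf \<Rightarrow> real \<Rightarrow> nat" where
  "mp_p \<pi> \<phi> = size (mp_crit \<pi> \<phi>) div 2"

text \<open>\<open>x\<^sub>1 \<ge> \<dots> \<ge> x\<^bsub>2p-1\<^esub>\<close> are the critical points in \<open>I\<^sub>1 \<union> \<dots> \<union> I\<^sub>n\<close>, and \<open>x\<^bsub>2p\<^esub>\<close> is the one in
  \<open>I\<^sub>0\<close>.\<close>

definition mp_x :: "real pmf \<Rightarrow> real \<Rightarrow> nat \<Rightarrow> proj_real" where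
  "mp_x \<pi> \<phi> k =
     (if k = 2 * mp_p \<pi> \<phi> then (THE q. q \<in># mp_crit \<pi> \<phi> \<and> q \<in> mp_I0 \<pi>)
      else Pt (rev (sorted_list_of_multiset
             (image_mset pt {#q \<in># mp_crit \<pi> \<phi>. q \<in> Pt ` (\<Union>i\<in>{1..mp_n \<pi>}. mp_I \<pi> i)#})) ! (k - 1)))"

definition mp_a :: "real pmf \<Rightarrow> real \<Rightarrow> nat \<Rightarrow> real" where
  "mp_a \<pi> \<phi> k = mp_f_proj \<pi> \<phi> (mp_x \<pi> \<phi> k)"

definition regular_edge :: "real \<Rightarrow> real pmf \<Rightarrow> real \<Rightarrow> nat \<Rightarrow> bool" where
  "regular_edge \<delta> \<pi> \<phi> k \<longleftrightarrow> mp_a \<pi> \<phi> k \<ge> \<delta> \<and>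
     (\<forall>l\<in>{1..2 * mp_p \<pi> \<phi>} - {k}. \<bar>mp_a \<pi> \<phi> k - mp_a \<pi> \<phi> l\<bar> \<ge> \<delta>) \<and>
     (\<forall>i\<in>{1..mp_n \<pi>}. \<forall>x. mp_x \<pi> \<phi> k = Pt x \<longrightarrow> \<bar>x + 1 / mp_s \<pi> i\<bar> \<ge> \<delta>)"

text \<open>The law may have an atom at \<open>0\<close>; on the positive half-line it has a unique continuous
  density, and the lower bounds below refer to that version.\<close>

definition has_density_pos :: "real measure \<Rightarrow> (real \<Rightarrow> real) \<Rightarrow> bool" where
  "has_density_pos \<rho> g \<longleftrightarrow> continuous_on {0<..} g \<and> (\<forall>x>0. g x \<ge> 0) \<and>
     (\<forall>A\<in>sets borel. A \<subseteq> {0<..} \<longrightarrow> emeasure \<rho> A = (\<integral>\<^sup>+x\<in>A. ennreal (g x) \<partial>lborel))"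

text \<open>The sequences are indexed by the sample size \<open>T \<ge> 1\<close>; the constants \<open>\<delta>\<close> and \<open>\<kappa> = c\<^bsub>\<delta>,\<delta>'\<^esub>\<close> do
  not depend on it.\<close>

definition regular_edges_and_bulks :: "(nat \<Rightarrow> real pmf) \<Rightarrow> (nat \<Rightarrow> real) \<Rightarrow> bool" where
  "regular_edges_and_bulks \<pi> \<phi> \<longleftrightarrow>
     (\<exists>\<delta>>0. \<forall>T\<ge>1. \<forall>k\<in>{1..2 * mp_p (\<pi> T) (\<phi> T)}. regular_edge \<delta> (\<pi> T) (\<phi> T) k) \<and>
     (\<forall>\<delta>'>0. \<exists>\<kappa>>0. \<forall>T\<ge>1. \<exists>g. has_density_pos (mp_law (\<pi> T) (\<phi> T)) g \<and>
        (\<forall>k\<in>{1..mp_p (\<pi> T) (\<phi> T)}.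
           \<forall>x\<in>{mp_a (\<pi> T) (\<phi> T) (2 * k) + \<delta>' .. mp_a (\<pi> T) (\<phi> T) (2 * k - 1) - \<delta>'}. g x \<ge> \<kappa>))"

section \<open>The estimators\<close>

definition factor_hat :: "real mat \<Rightarrow> real mat \<Rightarrow> real mat" where
  "factor_hat X \<Xi> = (1 / sqrt (real (dim_row X))) \<cdot>\<^sub>m (transpose_mat X * \<Xi>)"

text \<open>The matrix \<open>[1\<^sub>T, A]\<close>.\<close>

definition with_ones :: "real mat \<Rightarrow> real mat" where
  "with_ones A = mat (dim_row A) (1 + dim_col A) (\<lambda>(t, j). if j = 0 then 1 else A $$ (t, j - 1))"

definition resid :: "real mat \<Rightarrow> real vec \<Rightarrow> real vec" where
  "resid A v = (1\<^sub>m (dim_row A) - col_proj (with_ones A)) *\<^sub>v v"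

text \<open>Arguments: estimated factors, then the vectors \<open>Y\<close>, \<open>G\<close>, \<open>Z\<close>.\<close>

definition beta_hat :: "real mat \<Rightarrow> real vec \<Rightarrow> real vec \<Rightarrow> real vec \<Rightarrow> real" where
  "beta_hat A Y G Z = inverse (resid A Z \<bullet> resid A G) * (resid A Z \<bullet> resid A Y)"

definition eta_hat :: "real mat \<Rightarrow> real vec \<Rightarrow> real vec \<Rightarrow> real vec \<Rightarrow> real vec" where
  "eta_hat A Y G Z = resid A Y - beta_hat A Y G Z \<cdot>\<^sub>v resid A G"

definition sigma2_hat :: "real mat \<Rightarrow> real vec \<Rightarrow> real vec \<Rightarrow> real vec \<Rightarrow> real" where
  "sigma2_hat A Y G Z = (let T = dim_row A in
     inverse (resid A Z \<bullet> resid A G / real T) *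
     (1 / real T * (\<Sum>t<T. (vec_index (resid A Z) t)\<^sup>2 * (vec_index (eta_hat A Y G Z) t)\<^sup>2)) *
     inverse (resid A Z \<bullet> resid A G / real T))"

end

theory Submission
  imports Defs "HOL-Real_Asymp.Real_Asymp"
begin

text \<open>
  Let \<open>Q\<close> be the orthogonal projection off \<open>[1, F\<^sub>h]\<close>, where \<open>F\<^sub>h\<close> is the estimated factor matrix. The top
  \<open>R \<ge> r\<close> left singular vectors of \<open>X = B F' + U\<close> leave a residual of \<open>X\<close> whose norm is at most that of
  \<open>U\<close>; since the loadings are bounded below by \<open>\<nu>\<^sup>2\<close>, this yields \<open>\<parallel>Q F a\<parallel>\<^sup>2 \<le> \<kappa> \<parallel>a\<parallel>\<^sup>2\<close> with
  \<open>\<kappa>\<close> of the order \<open>\<parallel>U\<parallel>\<^sup>2 / \<nu>\<^sup>2\<close>. Counting closed walks in the moment method bounds \<open>\<parallel>E\<parallel>\<^sup>2\<close> by a multiple of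
  \<open>T ln T\<close>, so that (f) gives \<open>\<kappa> = o(\<surd>T)\<close>.

  The noise triples are independent of \<open>Q\<close>, and \<open>I - Q\<close> has rank at most \<open>R + 1\<close>; hence the projected
  noise is bounded in probability and the estimator behaves like the one with known factors, to which the
  law of large numbers and the central limit theorem apply. If \<open>z = g\<close>, then \<open>\<epsilon>\<^sub>g - \<epsilon>\<^sub>z\<close> is a
  function of \<open>F\<close> and independent of \<open>F\<close>, so it vanishes almost surely.
\<close>

section \<open>Quadratic forms and singular values\<close>

text \<open>The threshold \<open>o(sqrt T)\<close> comes from the numerator of the estimator. Each
  residual is noise plus a remainder whose squared norm is \<open>o_P(sqrt T)\<close>. After
  division by \<open>sqrt T\<close>, a product of two remainders vanishes by Cauchy-Schwarz, but
  noise times remainder does not: that route only gives a bound of order \<open>T\<close> to the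
  power 3/4 before the division. The remainder is therefore split. Its factor part is a function of
  \<open>(F, U)\<close>, so independence makes its inner product with the noise have variance of
  order \<kappa>. Its other part is projected noise, which depends on the noise it is paired with;
  for a symmetric idempotent \<open>p\<close> one has \<open><e, p e'> = <p e, p e'>\<close>, again
  a product of two short vectors. Only the span of the estimated factors enters, through the
  residual it leaves, so \<open>R > r\<close> needs no separate argument. Two measurability issues
  shape the form. Events about singular values are handled through measurable events contained in
  them, and the projection on estimated factors, built from a discontinuous pseudoinverse, is
  reached as a pointwise limit of ridge projections.\<close>

no_notation vec_nth (infixl "$" 90)

definition sqn :: "real vec \<Rightarrow> real" where
  "sqn v = v \<bullet> v"

lemma sqn_sum: "v \<in> carrier_vec n \<Longrightarrow> sqn v = (\<Sum>i<n. (v $ i)\<^sup>2)"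
  by (auto simp: sqn_def scalar_prod_def power2_eq_square lessThan_atLeast0)

lemma sqn_nonneg [simp]: "0 \<le> sqn v"
  using sqn_sum[of v "dim_vec v"] by (simp add: sum_nonneg)

lemma sqn_eq_0: "v \<in> carrier_vec n \<Longrightarrow> sqn v = 0 \<longleftrightarrow> v = 0\<^sub>v n"
  by (subst sqn_sum) (auto simp: sum_nonneg_eq_0_iff intro!: eq_vecI)

lemma scalar_prod_Cauchy_Schwarz:
  assumes "u \<in> carrier_vec n" "v \<in> carrier_vec n"
  shows "(u \<bullet> v)\<^sup>2 \<le> sqn u * sqn v"
proof -
  have "(u \<bullet> v)\<^sup>2 = (\<Sum>i<n. u $ i * v $ i)\<^sup>2"
    using assms by (simp add: scalar_prod_def lessThan_atLeast0)
  also have "\<dots> \<le> (\<Sum>i<n. (u $ i)\<^sup>2) * (\<Sum>i<n. (v $ i)\<^sup>2)"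
    by (rule Cauchy_Schwarz_ineq_sum)
  finally show ?thesis using assms by (simp add: sqn_sum)
qed

lemma scalar_prod_transpose:
  fixes A :: "real mat"
  assumes "A \<in> carrier_mat n m" "u \<in> carrier_vec m" "v \<in> carrier_vec n"
  shows "u \<bullet> (transpose_mat A *\<^sub>v v) = (A *\<^sub>v u) \<bullet> v"
proof -
  have "u \<bullet> (transpose_mat A *\<^sub>v v) = (transpose_mat A *\<^sub>v v) \<bullet> u"
    using assms by (intro comm_scalar_prod[of _ m]) auto
  also have "\<dots> = v \<bullet> (A *\<^sub>v u)"
    using assms by (intro transpose_vec_mult_scalar) auto
  also have "\<dots> = (A *\<^sub>v u) \<bullet> v"
    using assms by (intro comm_scalar_prod[of _ n]) auto
  finally show ?thesis .
qed

lemma sqn_mult_mat_vec: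
  assumes "A \<in> carrier_mat n m" "v \<in> carrier_vec m"
  shows "sqn (A *\<^sub>v v) = v \<bullet> ((transpose_mat A * A) *\<^sub>v v)"
  using assms scalar_prod_transpose[of A n m v "A *\<^sub>v v"] 
  by (simp add: sqn_def assoc_mult_mat_vec[of _ m n _ m])

lemma sqn_orthonormal:
  assumes "Q \<in> carrier_mat n m" "transpose_mat Q * Q = 1\<^sub>m m" "v \<in> carrier_vec m"
  shows "sqn (Q *\<^sub>v v) = sqn v"
  using assms by (simp add: sqn_mult_mat_vec[of Q n m]) (simp add: sqn_def)

section \<open>Diagonalisation of real symmetric matrices\<close>

lemma dim_mat_diag [simp]: "dim_row (mat_diag n f) = n" "dim_col (mat_diag n f) = n"
  by (simp_all add: mat_diag_def)

text \<open>The reflection that exchanges \<open>v\<close> and the unit vector with index 0, when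
  \<open>v\<close> has norm one. If \<open>v\<close> is that unit vector, then \<open>u = 0\<close>,
  and division by zero turns the matrix into the identity, as it should.\<close>

definition householder :: "nat \<Rightarrow> real vec \<Rightarrow> real mat" where
  "householder n v = (let u = v - unit_vec n 0 in
     mat n n (\<lambda>(i, j). (if i = j then 1 else 0) - 2 * (u $ i) * (u $ j) / sqn u))"

text \<open>For a unit vector, \<open>sqn u = 2 - 2 * v $ 0\<close>; this is the normalisation that
  sends the unit vector with index 0 to \<open>v\<close>. It provides an orthogonal matrix with
  prescribed first column, without a Gram-Schmidt argument.\<close>

lemma householder:
  assumes v: "v \<in> carrier_vec n" and v1: "sqn v = 1" and n: "0 < n"
  shows "householder n v \<in> carrier_mat n n"
    and "transpose_mat (householder n v) = householder n v"
    and "householder n v * householder n v = 1\<^sub>m n"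
    and "col (householder n v) 0 = v"
proof -
  define u where "u = v - unit_vec n 0"
  have u: "u \<in> carrier_vec n" using v by (auto simp: u_def)
  have ui: "u $ i = v $ i - (if i = 0 then 1 else 0)" if "i < n" for i
    using that v by (auto simp: u_def unit_vec_def)
  have su: "sqn u = 2 - 2 * v $ 0"
  proof -
    have "sqn u = (\<Sum>i<n. (v $ i)\<^sup>2 + (if i = 0 then 1 - 2 * v $ i else 0))"
      unfolding sqn_sum[OF u] by (intro sum.cong) (auto simp: ui power2_eq_square algebra_simps)
    also have "\<dots> = sqn v + (1 - 2 * v $ 0)"
      using n by (simp add: sum.distrib sqn_sum[OF v])
    finally show ?thesis using v1 by simp
  qed
  have X: "(\<Sum>k<n. c * (u $ k)\<^sup>2) = c * sqn u" for c
    by (simp add: sqn_sum[OF u] sum_distrib_left)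
  have H: "householder n v = mat n n (\<lambda>(i, j). (if i = j then 1 else 0) - 2 * (u $ i) * (u $ j) / sqn u)"
    by (simp add: householder_def Let_def u_def)
  show "householder n v \<in> carrier_mat n n" by (simp add: H)
  show "transpose_mat (householder n v) = householder n v"
    unfolding H by (rule eq_matI) auto
  show "householder n v * householder n v = 1\<^sub>m n"
  proof (rule eq_matI)
    fix i j assume "i < dim_row (1\<^sub>m n :: real mat)" "j < dim_col (1\<^sub>m n :: real mat)"
    then have ij: "i < n" "j < n" by auto
    have "(householder n v * householder n v) $$ (i, j) =
       (\<Sum>k<n. ((if i = k then 1 else 0) - 2 * (u $ i) * (u $ k) / sqn u) *
               ((if k = j then 1 else 0) - 2 * (u $ k) * (u $ j) / sqn u))"
      using ij by (simp add: H scalar_prod_def lessThan_atLeast0)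
    also have "\<dots> = (\<Sum>k<n. (if k = i then (if i = j then 1 else 0) - 2 * u $ i * u $ j / sqn u else 0)
         + (if k = j then - 2 * u $ i * u $ j / sqn u else 0)
         + 4 * u $ i * u $ j / (sqn u)\<^sup>2 * (u $ k)\<^sup>2)"
      by (intro sum.cong) (auto simp: algebra_simps power2_eq_square diff_divide_distrib add_divide_distrib)
    also have "\<dots> = (if i = j then 1 else 0) - 4 * u $ i * u $ j / sqn u
         + 4 * u $ i * u $ j / (sqn u)\<^sup>2 * sqn u"
      unfolding sum.distrib X using ij by simp
    also have "\<dots> = (if i = j then 1 else 0)"
      by (simp add: power2_eq_square)
    finally show "(householder n v * householder n v) $$ (i, j) = 1\<^sub>m n $$ (i, j)"
      using ij by simp
  qed (auto simp: H)
  show "col (householder n v) 0 = v"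
  proof (rule eq_vecI)
    fix i assume "i < dim_vec v"
    then have i: "i < n" using v by simp
    show "col (householder n v) 0 $ i = v $ i"
    proof (cases "sqn u = 0")
      case True
      then have "u = 0\<^sub>v n" using sqn_eq_0[OF u] by simp
      then have "u $ i = 0" using i by simp
      then show ?thesis using i n True ui[OF i] by (auto simp: H)
    next
      case False
      then have "2 * u $ 0 / sqn u = - 1" using su n by (simp add: ui field_simps)
      then have "2 * u $ i * u $ 0 / sqn u = - u $ i"
        by (metis (no_types, opaque_lifting) mult.assoc mult.commute mult_minus1_right times_divide_eq_right)
      then show ?thesis using i n ui[OF i] by (simp add: H)
    qed
  qed (use v in \<open>simp add: H\<close>)
qed

text \<open>For an eigenvector \<open>v\<close> the Hermitian form \<open>S = v* A v\<close> equals
  its own conjugate, hence is real, and it also equals \<open>a\<close> times the squared norm of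
  \<open>v\<close>.\<close>

lemma real_sym_eigenvalue:
  fixes A :: "real mat"
  assumes A: "A \<in> carrier_mat n n" "transpose_mat A = A"
    and ev: "eigenvalue (map_mat complex_of_real A) a"
  shows "Im a = 0"
proof -
  obtain v where v: "v \<in> carrier_vec n" "v \<noteq> 0\<^sub>v n"
    and eq: "map_mat complex_of_real A *\<^sub>v v = a \<cdot>\<^sub>v v"
    using ev A unfolding eigenvalue_def eigenvector_def by auto
  have Asym: "A $$ (i, j) = A $$ (j, i)" if "i < n" "j < n" for i j
    using A that by (metis carrier_matD index_transpose_mat(1))
  define S where "S = (\<Sum>i<n. \<Sum>j<n. cnj (v $ i) * complex_of_real (A $$ (i, j)) * v $ j)"
  have row: "(\<Sum>j<n. complex_of_real (A $$ (i, j)) * v $ j) = a * v $ i" if "i < n" for i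
  proof -
    have "(map_mat complex_of_real A *\<^sub>v v) $ i = (\<Sum>j<n. complex_of_real (A $$ (i, j)) * v $ j)"
      using that A v by (simp add: scalar_prod_def lessThan_atLeast0)
    then show ?thesis using eq that v by simp
  qed
  have S1: "S = a * (\<Sum>i<n. cnj (v $ i) * v $ i)"
    unfolding S_def sum_distrib_left
    by (intro sum.cong refl) (simp add: row mult.assoc mult.left_commute flip: sum_distrib_left)
  have "cnj S = (\<Sum>i<n. \<Sum>j<n. v $ i * complex_of_real (A $$ (i, j)) * cnj (v $ j))"
    by (simp add: S_def)
  also have "\<dots> = (\<Sum>j<n. \<Sum>i<n. v $ i * complex_of_real (A $$ (i, j)) * cnj (v $ j))"
    by (rule sum.swap)
  also have "\<dots> = S" unfolding S_def
    by (intro sum.cong refl) (simp add: Asym mult_ac)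
  finally have "cnj S = S" .
  define N where "N = (\<Sum>i<n. (cmod (v $ i))\<^sup>2)"
  have N: "(\<Sum>i<n. cnj (v $ i) * v $ i) = complex_of_real N"
    by (simp add: N_def complex_norm_square mult.commute del: of_real_power)
  have "N \<noteq> 0"
  proof
    assume "N = 0"
    then have "\<forall>i<n. v $ i = 0" by (auto simp: N_def sum_nonneg_eq_0_iff)
    then have "v = 0\<^sub>v n" using v by auto
    with v show False by simp
  qed
  have "Im S = 0" using \<open>cnj S = S\<close> by (metis Reals_cnj_iff complex_is_Real_iff)
  then have "Im a * N = 0" using S1 N by simp
  with \<open>N \<noteq> 0\<close> show ?thesis by simp
qed

text \<open>Over the complex numbers the characteristic polynomial splits, and every root is real;
  the factorisation then descends along the injective embedding of the real polynomials.\<close>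

lemma real_sym_char_poly:
  fixes A :: "real mat"
  assumes A: "A \<in> carrier_mat n n" "transpose_mat A = A"
  obtains bs where "char_poly A = (\<Prod>b\<leftarrow>bs. [:- b, 1:])" "eigs A = mset bs" "length bs = n"
proof -
  let ?C = "map_mat complex_of_real A"
  have C: "?C \<in> carrier_mat n n" using A by simp
  from char_poly_factorized[OF C] obtain as
    where as: "char_poly ?C = (\<Prod>a\<leftarrow>as. [:- a, 1:])" "length as = n" by auto
  have Re: "complex_of_real (Re a) = a" if "a \<in> set as" for a
  proof -
    have "poly (char_poly ?C) a = 0" unfolding as(1) using that
      by (auto simp: poly_prod_list o_def prod_list_zero_iff)
    then have "eigenvalue ?C a" using eigenvalue_root_char_poly[OF C] by simp
    then have "Im a = 0" by (rule real_sym_eigenvalue[OF A])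
    then show ?thesis by (simp add: complex_eq_iff)
  qed
  define bs where "bs = map Re as"
  interpret of_real_poly: map_poly_inj_idom_hom complex_of_real ..
  have ofr: "map_poly complex_of_real (\<Prod>b\<leftarrow>bs. [:- b, 1:]) = (\<Prod>b\<leftarrow>bs. [:- complex_of_real b, 1:])" for bs
    by (induction bs) (simp_all add: of_real_poly.hom_mult del: mult_pCons_left)
  have "map_poly complex_of_real (char_poly A) = char_poly ?C"
    by (rule of_real_hom.char_poly_hom[OF A(1), symmetric])
  also have "\<dots> = (\<Prod>b\<leftarrow>bs. [:- complex_of_real b, 1:])"
    unfolding as(1) bs_def by (rule arg_cong[of _ _ prod_list]) (auto simp: Re)
  also have "\<dots> = map_poly complex_of_real (\<Prod>b\<leftarrow>bs. [:- b, 1:])" by (rule ofr[symmetric])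
  finally have cp: "char_poly A = (\<Prod>b\<leftarrow>bs. [:- b, 1:])"
    by simp
  moreover have "eigs A = mset bs"
  proof -
    have "proots (\<Prod>b\<leftarrow>bs. [:- b, 1:]) = mset bs" for bs :: "real list"
    proof (induction bs)
      case (Cons b bs)
      have "(\<Prod>b\<leftarrow>bs. [:- b, 1:]) \<noteq> 0" by (auto simp: prod_list_zero_iff)
      then show ?case using Cons by (simp add: proots_mult del: mult_pCons_left)
    qed simp
    then show ?thesis by (simp add: eigs_def cp)
  qed
  ultimately show ?thesis by (rule that) (simp add: bs_def as(2))
qed

text \<open>Deflation: conjugation with a reflection whose first column is a unit eigenvector splits
  off a 1x1 block, and the remaining block has the remaining roots. The eigenvalue list is an input
  in arbitrary order, so a caller can prescribe the order of the diagonal.\<close>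

lemma sym_diagonalization:
  fixes A :: "real mat"
  assumes "A \<in> carrier_mat n n" "transpose_mat A = A"
    and "char_poly A = (\<Prod>e\<leftarrow>es. [:- e, 1:])"
  shows "\<exists>Q\<in>carrier_mat n n. transpose_mat Q * Q = 1\<^sub>m n \<and>
     A = Q * mat_diag n (\<lambda>i. es ! i) * transpose_mat Q"
  using assms
proof (induction es arbitrary: n A)
  case Nil
  then have "n = 0" using degree_monic_char_poly[of A n] by simp
  then show ?case using Nil by (intro bexI[of _ "1\<^sub>m 0"]) (auto intro!: eq_matI)
next
  case (Cons e es n A)
  note A = Cons.prems(1,2)
  have mon: "monic (\<Prod>e\<leftarrow>es. [:- e, 1:] :: real poly)" by (rule monic_prod_list) auto
  have "degree (char_poly A) = Suc (degree (\<Prod>e\<leftarrow>es. [:- e, 1:] :: real poly))"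
    unfolding Cons.prems(3) using mon by (simp del: mult_pCons_left, subst degree_mult_eq) auto
  then have "n \<noteq> 0" using degree_monic_char_poly[OF A(1)] by simp
  then obtain m where n: "n = 1 + m" by (cases n) auto
  have "eigenvalue A e" using Cons.prems(3) eigenvalue_root_char_poly[OF A(1)] by simp
  then obtain v0 where v0: "v0 \<in> carrier_vec n" "v0 \<noteq> 0\<^sub>v n" and ev0: "A *\<^sub>v v0 = e \<cdot>\<^sub>v v0"
    using A unfolding eigenvalue_def eigenvector_def by auto
  have pos: "sqn v0 > 0" using sqn_eq_0[OF v0(1)] v0(2) sqn_nonneg[of v0] by linarith
  define v where "v = (1 / sqrt (sqn v0)) \<cdot>\<^sub>v v0"
  have v: "v \<in> carrier_vec n" using v0 by (simp add: v_def)
  have "sqn v = (1 / sqrt (sqn v0))\<^sup>2 * sqn v0" using v0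
    by (simp add: v_def sqn_def power2_eq_square)
  then have v1: "sqn v = 1" using pos by (simp add: power_divide)
  have ev: "A *\<^sub>v v = e \<cdot>\<^sub>v v"
    unfolding v_def using A v0 by (simp add: mult_mat_vec[OF A(1) v0(1)] ev0 smult_smult_assoc mult.commute)
  define H where "H = householder n v"
  note Hh = householder[OF v v1, folded H_def]
  have H: "H \<in> carrier_mat n n" "transpose_mat H = H" "H * H = 1\<^sub>m n" "col H 0 = v"
    using Hh n by auto
  define A' where "A' = H * A * H"
  have A': "A' \<in> carrier_mat n n" using H A by (simp add: A'_def)
  have symA': "transpose_mat A' = A'"
    using H A by (simp add: A'_def transpose_mult[of _ n n _ n] assoc_mult_mat[of _ n n _ n _ n])
  have AA': "A = H * A' * H"
  proof -
    have "H * A' * H = (H * H) * A * (H * H)"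
      using H(1) A by (simp add: A'_def assoc_mult_mat[of _ n n _ n _ n] del: H(3))
    then show ?thesis using H A by simp
  qed
  \<comment> \<open>\<open>H\<close> is an involution with first column \<open>v\<close>, so it maps
    \<open>v\<close> back to the unit vector. Hence the first column of \<open>A'\<close> is
    \<open>e\<close> times that unit vector, and symmetry clears the first row as well.\<close>
  have "col (H * H) 0 = H *\<^sub>v col H 0" by (rule col_mult2[OF H(1) H(1)]) (use n in auto)
  then have Hv: "H *\<^sub>v v = unit_vec n 0" using H n by simp
  have "col A' 0 = H *\<^sub>v (A *\<^sub>v v)"
    unfolding A'_def using H(1,4) A n
    by (simp add: col_mult2[of _ n n _ n] assoc_mult_mat[of _ n n _ n _ n] del: col_mult)
  also have "\<dots> = e \<cdot>\<^sub>v unit_vec n 0"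
    using H v by (simp add: ev mult_mat_vec[OF H(1) v] Hv)
  finally have colA': "col A' 0 = e \<cdot>\<^sub>v unit_vec n 0" .
  have A'0: "A' $$ (i, 0) = (if i = 0 then e else 0)" if "i < n" for i
  proof -
    have "A' $$ (i, 0) = col A' 0 $ i" using that A' n by auto
    also have "\<dots> = (if i = 0 then e else 0)" using that by (simp add: colA')
    finally show ?thesis .
  qed
  have A'sym: "A' $$ (i, j) = A' $$ (j, i)" if "i < n" "j < n" for i j
    using symA' A' that by (metis carrier_matD index_transpose_mat(1))
  define A1 where "A1 = mat 1 1 (\<lambda>_. e)"
  define A3 where "A3 = mat m m (\<lambda>(i, j). A' $$ (Suc i, Suc j))"
  have c13: "A1 \<in> carrier_mat 1 1" "A3 \<in> carrier_mat m m" by (auto simp: A1_def A3_def)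
  have blk: "A' = four_block_mat A1 (0\<^sub>m 1 m) (0\<^sub>m m 1) A3"
  proof (rule eq_matI)
    fix i j assume "i < dim_row (four_block_mat A1 (0\<^sub>m 1 m) (0\<^sub>m m 1) A3)"
      "j < dim_col (four_block_mat A1 (0\<^sub>m 1 m) (0\<^sub>m m 1) A3)"
    then have ij: "i < n" "j < n" using c13 by (auto simp: n A1_def A3_def)
    then show "A' $$ (i, j) = four_block_mat A1 (0\<^sub>m 1 m) (0\<^sub>m m 1) A3 $$ (i, j)"
      using A'0[of i] A'0[of j] A'sym[of 0 j] n
      by (auto simp: A1_def A3_def less_Suc_eq_0_disj)
  qed (use A' c13 in \<open>auto simp: n\<close>)
  have cp1: "char_poly A1 = [:- e, 1:]"
    by (subst char_poly_upper_triangular[OF c13(1)]) (auto simp: A1_def diag_mat_def)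
  have "similar_mat_wit A A' H H"
    by (rule similar_mat_witI[of _ _ n]) (use H A A' AA' in auto)
  then have "char_poly A = char_poly A'"
    by (intro char_poly_similar) (auto simp: similar_mat_def)
  also have "\<dots> = [:- e, 1:] * char_poly A3"
    unfolding blk by (subst char_poly_four_block_zeros_col[OF c13(1) _ c13(2)]) (auto simp: cp1)
  finally have "[:- e, 1:] * (\<Prod>e\<leftarrow>es. [:- e, 1:]) = [:- e, 1:] * char_poly A3"
    using Cons.prems(3) by simp
  then have cp3: "char_poly A3 = (\<Prod>e\<leftarrow>es. [:- e, 1:])"
    by (subst (asm) mult_left_cancel) auto
  have sym3: "transpose_mat A3 = A3"
    unfolding A3_def using A'sym n by (intro eq_matI) auto
  from Cons.IH[OF c13(2) sym3 cp3] obtain Q3 where Q3: "Q3 \<in> carrier_mat m m"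
    "transpose_mat Q3 * Q3 = 1\<^sub>m m" "A3 = Q3 * mat_diag m (\<lambda>i. es ! i) * transpose_mat Q3" by auto
  define K where "K = four_block_mat (1\<^sub>m 1) (0\<^sub>m 1 m) (0\<^sub>m m 1) Q3"
  have K: "K \<in> carrier_mat n n" unfolding K_def n by (rule four_block_carrier_mat[OF one_carrier_mat Q3(1)])
  have KT: "transpose_mat K = four_block_mat (1\<^sub>m 1) (0\<^sub>m 1 m) (0\<^sub>m m 1) (transpose_mat Q3)"
    unfolding K_def by (subst transpose_four_block_mat[of _ 1 1 _ m _ m]) (use Q3 in auto)
  have KK: "transpose_mat K * K = 1\<^sub>m n"
    unfolding KT unfolding K_def
    by (subst mult_four_block_mat[of _ 1 1 _ m _ m _ _ 1 _ m]) (use Q3 n in auto)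
  have D: "mat_diag n (\<lambda>i. (e # es) ! i) = four_block_mat A1 (0\<^sub>m 1 m) (0\<^sub>m m 1) (mat_diag m (\<lambda>i. es ! i))"
    by (rule eq_matI) (auto simp: mat_diag_def A1_def n)
  have KDK: "K * mat_diag n (\<lambda>i. (e # es) ! i) * transpose_mat K = A'"
  proof -
    have "K * mat_diag n (\<lambda>i. (e # es) ! i) = four_block_mat A1 (0\<^sub>m 1 m) (0\<^sub>m m 1) (Q3 * mat_diag m (\<lambda>i. es ! i))"
      unfolding D unfolding K_def
      by (subst mult_four_block_mat[of _ 1 1 _ m _ m _ _ 1 _ m]) (use Q3 c13 in auto)
    then show ?thesis unfolding KT blk
      by (simp, subst mult_four_block_mat[of _ 1 1 _ m _ m _ _ 1 _ m]) (use Q3 c13 in auto)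
  qed
  show ?case
  proof (intro bexI conjI)
    show HK: "H * K \<in> carrier_mat n n" using H K by simp
    have HKT: "transpose_mat (H * K) = transpose_mat K * H"
      using H K by (simp add: transpose_mult[of _ n n _ n])
    have "transpose_mat (H * K) * (H * K) = transpose_mat K * ((H * H) * K)"
      unfolding HKT using H(1) K by (simp add: assoc_mult_mat[of _ n n _ n _ n])
    then show "transpose_mat (H * K) * (H * K) = 1\<^sub>m n" using H K KK by simp
    have "H * K * mat_diag n (\<lambda>i. (e # es) ! i) * transpose_mat (H * K)
        = H * (K * mat_diag n (\<lambda>i. (e # es) ! i) * transpose_mat K) * H"
      unfolding HKT using H(1) K by (simp add: assoc_mult_mat[of _ n n _ n _ n] mult_carrier_mat[of _ n n _ n])
    then show "A = H * K * mat_diag n (\<lambda>i. (e # es) ! i) * transpose_mat (H * K)"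
      unfolding KDK using AA' by simp
  qed
qed

text \<open>The roots are sorted decreasingly before diagonalising, so that index
  \<open>k - 1\<close> of the diagonal is the \<open>k\<close>-th largest eigenvalue.\<close>

theorem real_spectral_theorem:
  fixes A :: "real mat"
  assumes A: "A \<in> carrier_mat n n" "transpose_mat A = A"
  obtains Q d where "Q \<in> carrier_mat n n" "transpose_mat Q * Q = 1\<^sub>m n" "Q * transpose_mat Q = 1\<^sub>m n"
    "A = Q * mat_diag n d * transpose_mat Q" "\<forall>i j. i \<le> j \<longrightarrow> j < n \<longrightarrow> d j \<le> d i"
    "eigs A = mset (map d [0..<n])"
proof -
  obtain bs where bs: "char_poly A = (\<Prod>b\<leftarrow>bs. [:- b, 1:])" "eigs A = mset bs" "length bs = n"
    using real_sym_char_poly[OF A] .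
  define es where "es = rev (sort bs)"
  have es: "mset es = mset bs" "length es = n" using bs by (auto simp: es_def)
  have "char_poly A = (\<Prod>e\<leftarrow>es. [:- e, 1:])"
    unfolding bs(1) using es(1) by (metis mset_map prod_mset_prod_list)
  from sym_diagonalization[OF A this] obtain Q where Q: "Q \<in> carrier_mat n n"
    "transpose_mat Q * Q = 1\<^sub>m n" "A = Q * mat_diag n (\<lambda>i. es ! i) * transpose_mat Q" by auto
  show ?thesis
  proof (rule that[of Q "\<lambda>i. es ! i"])
    show "Q * transpose_mat Q = 1\<^sub>m n"
      using Q mat_mult_left_right_inverse[of "transpose_mat Q" n Q] by auto
    show "\<forall>i j. i \<le> j \<longrightarrow> j < n \<longrightarrow> es ! j \<le> es ! i"
      using es sorted_rev_nth_mono[of es] by (simp add: es_def)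
    show "eigs A = mset (map (\<lambda>i. es ! i) [0..<n])"
      using bs es by (metis map_nth)
  qed (use Q in auto)
qed

section \<open>Quadratic forms in an eigenbasis and squared singular values\<close>

lemma sqn_zero [simp]: "sqn (0\<^sub>v n) = 0"
  using sqn_eq_0[of "0\<^sub>v n" n] by simp

lemma sqn_add_le:
  assumes "u \<in> carrier_vec n" "v \<in> carrier_vec n"
  shows "sqn (u + v) \<le> 2 * sqn u + 2 * sqn v" and "sqn (u - v) \<le> 2 * sqn u + 2 * sqn v"
proof -
  have ab: "(a + b)\<^sup>2 \<le> 2 * a\<^sup>2 + 2 * b\<^sup>2" "(a - b)\<^sup>2 \<le> 2 * a\<^sup>2 + 2 * b\<^sup>2" for a b :: real
    using sum_squares_bound[of a b] sum_squares_bound[of a "- b"]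
    by (simp_all add: power2_eq_square algebra_simps)
  have "2 * sqn u + 2 * sqn v = (\<Sum>i<n. 2 * (u $ i)\<^sup>2 + 2 * (v $ i)\<^sup>2)"
    by (simp add: sqn_sum[OF assms(1)] sqn_sum[OF assms(2)] sum.distrib sum_distrib_left)
  moreover have "sqn (u + v) = (\<Sum>i<n. (u $ i + v $ i)\<^sup>2)" "sqn (u - v) = (\<Sum>i<n. (u $ i - v $ i)\<^sup>2)"
    using assms by (auto simp: sqn_sum[of _ n])
  ultimately show "sqn (u + v) \<le> 2 * sqn u + 2 * sqn v" "sqn (u - v) \<le> 2 * sqn u + 2 * sqn v"
    by (auto intro!: sum_mono ab)
qed

lemma index_mat_diag_mult_vec [simp]:
  fixes d :: "nat \<Rightarrow> real"
  assumes "c \<in> carrier_vec n" "i < n"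
  shows "(mat_diag n d *\<^sub>v c) $ i = d i * c $ i"
proof -
  have "(mat_diag n d *\<^sub>v c) $ i = (\<Sum>j<n. (if i = j then d j else 0) * c $ j)"
    using assms by (simp add: mat_diag_def scalar_prod_def lessThan_atLeast0)
  also have "\<dots> = (\<Sum>j<n. if j = i then d i * c $ i else 0)" by (intro sum.cong) auto
  finally show ?thesis using assms by simp
qed

lemma scalar_prod_mat_diag:
  fixes d :: "nat \<Rightarrow> real"
  assumes "c \<in> carrier_vec n"
  shows "c \<bullet> (mat_diag n d *\<^sub>v c) = (\<Sum>i<n. d i * (c $ i)\<^sup>2)"
proof -
  have "c \<bullet> (mat_diag n d *\<^sub>v c) = (\<Sum>i<n. c $ i * (d i * c $ i))"
    unfolding scalar_prod_def using assms
    by (intro sum.cong) (auto simp: lessThan_atLeast0 simp del: index_mult_mat_vec)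
  then show ?thesis by (simp add: power2_eq_square mult_ac)
qed

lemma sqn_orthonormal_transpose:
  assumes Q: "Q \<in> carrier_mat n n" "Q * transpose_mat Q = 1\<^sub>m n" and v: "v \<in> carrier_vec n"
  shows "sqn (transpose_mat Q *\<^sub>v v) = sqn v" "Q *\<^sub>v (transpose_mat Q *\<^sub>v v) = v"
proof -
  show "sqn (transpose_mat Q *\<^sub>v v) = sqn v"
    using assms sqn_orthonormal[of "transpose_mat Q" n n v] by simp
  have "Q *\<^sub>v (transpose_mat Q *\<^sub>v v) = (Q * transpose_mat Q) *\<^sub>v v"
    by (rule assoc_mult_mat_vec[symmetric]) (use Q v in auto)
  then show "Q *\<^sub>v (transpose_mat Q *\<^sub>v v) = v" using Q v by simp
qed

lemma orthonormal_cancel: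
  fixes Q :: "real mat"
  assumes "Q \<in> carrier_mat n m" "transpose_mat Q * Q = 1\<^sub>m m" "c \<in> carrier_vec m"
  shows "transpose_mat Q *\<^sub>v (Q *\<^sub>v c) = c"
proof -
  have "transpose_mat Q *\<^sub>v (Q *\<^sub>v c) = (transpose_mat Q * Q) *\<^sub>v c"
    by (rule assoc_mult_mat_vec[symmetric]) (use assms in auto)
  then show ?thesis using assms by simp
qed

lemma quadratic_form_diag:
  fixes d :: "nat \<Rightarrow> real"
  assumes Q: "Q \<in> carrier_mat n n" "transpose_mat Q * Q = 1\<^sub>m n"
    and A: "A = Q * mat_diag n d * transpose_mat Q" and c: "c \<in> carrier_vec n"
  shows "(Q *\<^sub>v c) \<bullet> (A *\<^sub>v (Q *\<^sub>v c)) = (\<Sum>i<n. d i * (c $ i)\<^sup>2)"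
proof -
  have D: "mat_diag n d \<in> carrier_mat n n" by simp
  have Dc: "mat_diag n d *\<^sub>v c \<in> carrier_vec n" by (rule mult_mat_vec_carrier[OF D c])
  have Qc: "Q *\<^sub>v c \<in> carrier_vec n" by (rule mult_mat_vec_carrier[OF Q(1) c])
  have QT: "transpose_mat Q \<in> carrier_mat n n" using Q by simp
  have "A *\<^sub>v (Q *\<^sub>v c) = (Q * mat_diag n d) *\<^sub>v (transpose_mat Q *\<^sub>v (Q *\<^sub>v c))"
    unfolding A by (rule assoc_mult_mat_vec[OF mult_carrier_mat[OF Q(1) D] QT Qc])
  also have "transpose_mat Q *\<^sub>v (Q *\<^sub>v c) = c" by (rule orthonormal_cancel[OF Q c])
  also have "(Q * mat_diag n d) *\<^sub>v c = Q *\<^sub>v (mat_diag n d *\<^sub>v c)"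
    by (rule assoc_mult_mat_vec[OF Q(1) D c])
  finally have "(Q *\<^sub>v c) \<bullet> (A *\<^sub>v (Q *\<^sub>v c)) = (Q *\<^sub>v c) \<bullet> (Q *\<^sub>v (mat_diag n d *\<^sub>v c))" by simp
  also have "\<dots> = c \<bullet> (transpose_mat Q *\<^sub>v (Q *\<^sub>v (mat_diag n d *\<^sub>v c)))"
    by (rule scalar_prod_transpose[OF Q(1) c mult_mat_vec_carrier[OF Q(1) Dc], symmetric])
  also have "transpose_mat Q *\<^sub>v (Q *\<^sub>v (mat_diag n d *\<^sub>v c)) = mat_diag n d *\<^sub>v c"
    by (rule orthonormal_cancel[OF Q Dc])
  finally show ?thesis using scalar_prod_mat_diag[OF c] by simp
qed

text \<open>A right singular basis of \<open>A\<close>: the columns of \<open>Q\<close>, with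
  squared singular values \<open>d\<close> in decreasing order. The index runs over all
  \<open>n\<close> columns, so \<open>d\<close> contains the zeros by which \<open>sing_val\<close>
  is padded. The squared norm of \<open>A\<close> applied to a vector becomes a weighted sum of
  squared coordinates, and this is how all norm bounds below are read off.\<close>

definition gram_diag :: "nat \<Rightarrow> real mat \<Rightarrow> real mat \<Rightarrow> (nat \<Rightarrow> real) \<Rightarrow> bool" where
  "gram_diag n A Q d \<longleftrightarrow> Q \<in> carrier_mat n n \<and> transpose_mat Q * Q = 1\<^sub>m n \<and> Q * transpose_mat Q = 1\<^sub>m n \<and>
    transpose_mat A * A = Q * mat_diag n d * transpose_mat Q \<and>
    (\<forall>i j. i \<le> j \<longrightarrow> j < n \<longrightarrow> d j \<le> d i) \<and> (\<forall>i<n. 0 \<le> d i) \<and>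
    (\<forall>c\<in>carrier_vec n. sqn (A *\<^sub>v (Q *\<^sub>v c)) = (\<Sum>i<n. d i * (c $ i)\<^sup>2)) \<and>
    (\<forall>k. 1 \<le> k \<longrightarrow> k \<le> n \<longrightarrow> sing_val k A = sqrt (d (k - 1)))"

lemma gram_diagD:
  assumes "gram_diag n A Q d"
  shows "Q \<in> carrier_mat n n" "transpose_mat Q * Q = 1\<^sub>m n" "Q * transpose_mat Q = 1\<^sub>m n"
    "transpose_mat A * A = Q * mat_diag n d * transpose_mat Q"
    "\<And>i j. i \<le> j \<Longrightarrow> j < n \<Longrightarrow> d j \<le> d i" "\<And>i. i < n \<Longrightarrow> 0 \<le> d i"
    "\<And>c. c \<in> carrier_vec n \<Longrightarrow> sqn (A *\<^sub>v (Q *\<^sub>v c)) = (\<Sum>i<n. d i * (c $ i)\<^sup>2)"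
    "\<And>k. 1 \<le> k \<Longrightarrow> k \<le> n \<Longrightarrow> sing_val k A = sqrt (d (k - 1))"
proof -
  note * = assms[unfolded gram_diag_def]
  note 1 = *[THEN conjunct1] and 2 = *[THEN conjunct2]
  note 3 = 2[THEN conjunct1] and 4 = 2[THEN conjunct2]
  note 5 = 4[THEN conjunct1] and 6 = 4[THEN conjunct2]
  note 7 = 6[THEN conjunct1] and 8 = 6[THEN conjunct2]
  note 9 = 8[THEN conjunct1] and 10 = 8[THEN conjunct2]
  note 11 = 10[THEN conjunct1] and 12 = 10[THEN conjunct2]
  note 13 = 12[THEN conjunct1] and 14 = 12[THEN conjunct2]
  show "Q \<in> carrier_mat n n" "transpose_mat Q * Q = 1\<^sub>m n" "Q * transpose_mat Q = 1\<^sub>m n"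
    "transpose_mat A * A = Q * mat_diag n d * transpose_mat Q"
    by (fact 1 3 5 7)+
  show "\<And>i j. i \<le> j \<Longrightarrow> j < n \<Longrightarrow> d j \<le> d i" "\<And>i. i < n \<Longrightarrow> 0 \<le> d i"
    "\<And>c. c \<in> carrier_vec n \<Longrightarrow> sqn (A *\<^sub>v (Q *\<^sub>v c)) = (\<Sum>i<n. d i * (c $ i)\<^sup>2)"
    "\<And>k. 1 \<le> k \<Longrightarrow> k \<le> n \<Longrightarrow> sing_val k A = sqrt (d (k - 1))"
    by (fact 9[rule_format] 11[rule_format] 13[rule_format] 14[rule_format])+
qed

lemma gram_spectral:
  fixes A :: "real mat"
  assumes A: "A \<in> carrier_mat m n"
  obtains Q d where "gram_diag n A Q d"
proof -
  have G: "transpose_mat A * A \<in> carrier_mat n n" using A by auto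
  have symG: "transpose_mat (transpose_mat A * A) = transpose_mat A * A"
    using A by (simp add: transpose_mult[of _ n m _ n])
  obtain Q d where Q: "Q \<in> carrier_mat n n" "transpose_mat Q * Q = 1\<^sub>m n" "Q * transpose_mat Q = 1\<^sub>m n"
    "transpose_mat A * A = Q * mat_diag n d * transpose_mat Q" "\<forall>i j. i \<le> j \<longrightarrow> j < n \<longrightarrow> d j \<le> d i"
    "eigs (transpose_mat A * A) = mset (map d [0..<n])"
    by (rule real_spectral_theorem[OF G symG])
  have form: "sqn (A *\<^sub>v (Q *\<^sub>v c)) = (\<Sum>i<n. d i * (c $ i)\<^sup>2)" if c: "c \<in> carrier_vec n" for c
    using sqn_mult_mat_vec[OF A, of "Q *\<^sub>v c"] quadratic_form_diag[OF Q(1,2,4) c] Q(1) c by simp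
  have d0: "0 \<le> d i" if "i < n" for i
  proof -
    have "(\<Sum>j<n. d j * (unit_vec n i $ j)\<^sup>2) = (\<Sum>j<n. if j = i then d i else 0)"
      using that by (intro sum.cong) (auto simp: unit_vec_def)
    then have "d i = (\<Sum>j<n. d j * (unit_vec n i $ j)\<^sup>2)" using that by simp
    also have "\<dots> = sqn (A *\<^sub>v (Q *\<^sub>v unit_vec n i))" by (rule form[symmetric]) simp
    finally show ?thesis by simp
  qed
  have "sing_val k A = sqrt (d (k - 1))" if k: "1 \<le> k" "k \<le> n" for k
  proof -
    define l where "l = rev (map (sqrt \<circ> d) [0..<n])"
    have "sorted l"
      unfolding l_def sorted_rev_iff_nth_mono using Q(5) by auto
    moreover have "image_mset sqrt (eigs (transpose_mat A * A)) = mset l"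
      unfolding Q(6) l_def by (simp add: image_mset.compositionality flip: mset_map)
    ultimately have "sorted_list_of_multiset (image_mset sqrt (eigs (transpose_mat A * A))) = l"
      by (simp add: sorted_sort_id)
    then show ?thesis unfolding sing_val_def using k by (simp add: l_def)
  qed
  then have "gram_diag n A Q d" unfolding gram_diag_def by (intro conjI allI impI ballI Q(1-4) Q(5)[rule_format] d0 form)
  then show ?thesis by (rule that)
qed

lemma sqn_le_sing_val:
  assumes A: "A \<in> carrier_mat m n" "0 < n" and le: "sing_val 1 A \<le> C" and v: "v \<in> carrier_vec n"
  shows "sqn (A *\<^sub>v v) \<le> C\<^sup>2 * sqn v"
proof -
  obtain Q d where "gram_diag n A Q d" by (rule gram_spectral[OF A(1)])
  note Q = gram_diagD[OF this]
  define c where "c = transpose_mat Q *\<^sub>v v"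
  have c: "c \<in> carrier_vec n" using Q v by (simp add: c_def mult_mat_vec_carrier[of _ n n])
  have vc: "v = Q *\<^sub>v c" "sqn c = sqn v" using sqn_orthonormal_transpose[OF Q(1,3) v] by (auto simp: c_def)
  have "sqrt (d 0) \<le> C" using le Q(8)[of 1] A(2) by simp
  then have d0: "d 0 \<le> C\<^sup>2" using power_mono[of "sqrt (d 0)" C 2] Q(6)[of 0] A(2) by simp
  have "sqn (A *\<^sub>v v) = (\<Sum>i<n. d i * (c $ i)\<^sup>2)" using Q(7)[OF c] vc by simp
  also have "\<dots> \<le> (\<Sum>i<n. C\<^sup>2 * (c $ i)\<^sup>2)"
  proof (intro sum_mono mult_right_mono)
    fix i assume "i \<in> {..<n}"
    then show "d i \<le> C\<^sup>2" using Q(5)[of 0 i] d0 by simp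
  qed simp
  also have "\<dots> = C\<^sup>2 * sqn v" unfolding vc(2)[symmetric] sqn_sum[OF c] by (simp add: sum_distrib_left)
  finally show ?thesis .
qed

text \<open>Appending zero rows gives a square matrix whose transpose annihilates the last unit
  vector; its determinant vanishes, and so it has a kernel.\<close>

lemma underdetermined_nonzero_solution:
  fixes A :: "real mat"
  assumes A: "A \<in> carrier_mat m n" "m < n"
  obtains c where "c \<in> carrier_vec n" "c \<noteq> 0\<^sub>v n" "A *\<^sub>v c = 0\<^sub>v m"
proof -
  define A' where "A' = mat n n (\<lambda>(i, j). if i < m then A $$ (i, j) else 0)"
  have A': "A' \<in> carrier_mat n n" by (simp add: A'_def)
  have "transpose_mat A' *\<^sub>v unit_vec n (n - 1) = 0\<^sub>v n"
  proof (rule eq_vecI)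
    fix i assume "i < dim_vec (0\<^sub>v n :: real vec)"
    then show "(transpose_mat A' *\<^sub>v unit_vec n (n - 1)) $ i = 0\<^sub>v n $ i"
      using A by (simp add: A'_def)
  qed (simp add: A'_def)
  moreover have "(unit_vec n (n - 1) :: real vec) \<noteq> 0\<^sub>v n" using A(2) by simp
  moreover have "transpose_mat A' \<in> carrier_mat n n" using A' by simp
  ultimately have "Determinant.det (transpose_mat A') = 0"
    using det_0_iff_vec_prod_zero_field[of "transpose_mat A'" n] unit_vec_carrier[of n "n - 1"] by metis
  then have "Determinant.det A' = 0" using det_transpose[OF A'] by simp
  then obtain c where c: "c \<in> carrier_vec n" "c \<noteq> 0\<^sub>v n" "A' *\<^sub>v c = 0\<^sub>v n"
    using det_0_iff_vec_prod_zero_field[OF A'] by auto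
  have "A *\<^sub>v c = 0\<^sub>v m"
  proof (rule eq_vecI)
    fix i assume "i < dim_vec (0\<^sub>v m :: real vec)"
    then have i: "i < m" "i < n" using A by auto
    have "row A i = row A' i" using i A by (auto simp: A'_def)
    moreover have "(A' *\<^sub>v c) $ i = 0" using c i by simp
    ultimately show "(A *\<^sub>v c) $ i = 0\<^sub>v m $ i" using i A A' by simp
  qed (use A in simp)
  then show ?thesis using c that by blast
qed

lemma surjective_of_injective:
  fixes A :: "real mat"
  assumes A: "A \<in> carrier_mat n n" and inj: "\<And>c. c \<in> carrier_vec n \<Longrightarrow> A *\<^sub>v c = 0\<^sub>v n \<Longrightarrow> c = 0\<^sub>v n"
    and w: "w \<in> carrier_vec n"
  obtains c where "c \<in> carrier_vec n" "A *\<^sub>v c = w"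
proof -
  have "Determinant.det A \<noteq> 0" using det_0_iff_vec_prod_zero_field[OF A] inj by auto
  then have "A \<in> Units (ring_mat TYPE(real) n ())" by (rule det_non_zero_imp_unit[OF A])
  then obtain A' where "A' \<in> carrier_mat n n" "A * A' = 1\<^sub>m n"
    unfolding Units_def ring_mat_simps by blast
  moreover have "A *\<^sub>v (A' *\<^sub>v w) = (A * A') *\<^sub>v w"
    by (rule assoc_mult_mat_vec[symmetric]) (use A w calculation in auto)
  ultimately have "A *\<^sub>v (A' *\<^sub>v w) = w" using w by simp
  then show ?thesis using that[of "A' *\<^sub>v w"] w \<open>A' \<in> _\<close> by auto
qed

section \<open>Pseudoinverses, projections and square roots\<close>

lemma mat_mult_assoc:
  fixes A B C :: "real mat"
  assumes "dim_col A = dim_row B" "dim_col B = dim_row C"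
  shows "(A * B) * C = A * (B * C)"
  by (rule assoc_mult_mat[of _ "dim_row A" "dim_row B" _ "dim_row C" _ "dim_col C"]) (use assms in auto)

lemma mat_mult_transpose:
  fixes A B :: "real mat"
  assumes "dim_col A = dim_row B"
  shows "transpose_mat (A * B) = transpose_mat B * transpose_mat A"
  by (rule transpose_mult[of _ "dim_row A" "dim_row B" _ "dim_col B"]) (use assms in auto)

lemma sandwich_diag:
  fixes f g :: "nat \<Rightarrow> real"
  assumes Q: "Q \<in> carrier_mat n n" "transpose_mat Q * Q = 1\<^sub>m n"
  shows "(Q * mat_diag n f * transpose_mat Q) * (Q * mat_diag n g * transpose_mat Q)
       = Q * mat_diag n (\<lambda>i. f i * g i) * transpose_mat Q"
    and "transpose_mat (Q * mat_diag n f * transpose_mat Q) = Q * mat_diag n f * transpose_mat Q"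
proof -
  have d: "dim_row Q = n" "dim_col Q = n" using Q by auto
  have "(Q * mat_diag n f * transpose_mat Q) * (Q * mat_diag n g * transpose_mat Q)
      = Q * mat_diag n f * (transpose_mat Q * Q) * mat_diag n g * transpose_mat Q"
    using d by (simp add: mat_mult_assoc)
  also have "\<dots> = Q * (mat_diag n f * mat_diag n g) * transpose_mat Q"
    using d Q by (simp add: mat_mult_assoc del: mat_diag_diag)
  finally show "(Q * mat_diag n f * transpose_mat Q) * (Q * mat_diag n g * transpose_mat Q)
       = Q * mat_diag n (\<lambda>i. f i * g i) * transpose_mat Q" by simp
  have "transpose_mat (mat_diag n f) = mat_diag n f" by (rule eq_matI) (auto simp: mat_diag_def)
  then show "transpose_mat (Q * mat_diag n f * transpose_mat Q) = Q * mat_diag n f * transpose_mat Q"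
    using d by (simp add: mat_mult_transpose mat_mult_assoc)
qed

lemma gram_eq_0:
  fixes Y :: "real mat"
  assumes "transpose_mat Y * Y = 0\<^sub>m (dim_col Y) (dim_col Y)"
  shows "Y = 0\<^sub>m (dim_row Y) (dim_col Y)"
proof (rule eq_matI)
  fix i j assume "i < dim_row (0\<^sub>m (dim_row Y) (dim_col Y) :: real mat)"
    "j < dim_col (0\<^sub>m (dim_row Y) (dim_col Y) :: real mat)"
  then have ij: "i < dim_row Y" "j < dim_col Y" by auto
  have "(transpose_mat Y * Y) $$ (j, j) = sqn (col Y j)" using ij by (simp add: sqn_def)
  then have "sqn (col Y j) = 0" using assms ij by simp
  then have "col Y j = 0\<^sub>v (dim_row Y)" using sqn_eq_0[of "col Y j" "dim_row Y"] by simp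
  then have "col Y j $ i = 0" using ij by simp
  then show "Y $$ (i, j) = 0\<^sub>m (dim_row Y) (dim_col Y) $$ (i, j)" using ij by simp
qed auto

text \<open>The Penrose equations and symmetry of the four products force \<open>A X = A Y\<close>
  and \<open>X A = Y A\<close>; then \<open>X = X A X = Y A Y = Y\<close>.\<close>

lemma is_pinv_unique:
  assumes X: "is_pinv A X" and Y: "is_pinv A Y"
  shows "X = Y"
proof -
  have dX: "dim_row X = dim_col A" "dim_col X = dim_row A" and X1: "A * X * A = A" and X2: "X * A * X = X"
    and X3: "transpose_mat (A * X) = A * X" and X4: "transpose_mat (X * A) = X * A"
    using X by (auto simp: is_pinv_def)
  have dY: "dim_row Y = dim_col A" "dim_col Y = dim_row A" and Y1: "A * Y * A = A" and Y2: "Y * A * Y = Y"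
    and Y3: "transpose_mat (A * Y) = A * Y" and Y4: "transpose_mat (Y * A) = Y * A"
    using Y by (auto simp: is_pinv_def)
  have "A * X = (A * Y * A) * X" by (simp only: Y1)
  also have "\<dots> = (A * Y) * (A * X)" using dX dY by (simp add: mat_mult_assoc)
  also have "\<dots> = transpose_mat (A * Y) * transpose_mat (A * X)" by (simp only: X3 Y3)
  also have "\<dots> = transpose_mat (A * X * (A * Y))" using dX dY by (subst mat_mult_transpose[of "A * X"]) auto
  also have "A * X * (A * Y) = A * X * A * Y" using dX dY by (simp add: mat_mult_assoc)
  also have "\<dots> = A * Y" by (simp only: X1)
  also have "transpose_mat (A * Y) = A * Y" by (rule Y3)
  finally have AX: "A * X = A * Y" .
  have "X * A = X * (A * Y * A)" by (simp only: Y1)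
  also have "\<dots> = (X * A) * (Y * A)" using dX dY by (simp add: mat_mult_assoc)
  also have "\<dots> = transpose_mat (X * A) * transpose_mat (Y * A)" by (simp only: X4 Y4)
  also have "\<dots> = transpose_mat (Y * A * (X * A))" using dX dY by (subst mat_mult_transpose[of "Y * A"]) auto
  also have "Y * A * (X * A) = Y * (A * X * A)" using dX dY by (simp add: mat_mult_assoc)
  also have "\<dots> = Y * A" by (simp only: X1)
  also have "transpose_mat (Y * A) = Y * A" by (rule Y4)
  finally have XA: "X * A = Y * A" .
  have "X = X * (A * X)" using X2 dX by (simp add: mat_mult_assoc)
  also have "\<dots> = Y * A * Y" using dX dY by (simp add: AX XA flip: mat_mult_assoc)
  finally show ?thesis using Y2 by simp
qed

text \<open>The witness is the pseudoinverse of the Gram matrix times the transpose of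
  \<open>A\<close>, with the Gram matrix inverted eigenvalue by eigenvalue.\<close>

lemma pinv: "is_pinv A (pinv A)"
proof -
  define n where "n = dim_col A"
  obtain Q d where "gram_diag n A Q d" by (rule gram_spectral[of A "dim_row A" n]) (auto simp: n_def)
  note Q = gram_diagD[OF this]
  define S where "S f = Q * mat_diag n f * transpose_mat Q" for f
  have S: "S f * S g = S (\<lambda>i. f i * g i)" "transpose_mat (S f) = S f"
    "dim_row (S f) = n" "dim_col (S f) = n" for f g
    using sandwich_diag[OF Q(1,2)] Q(1) by (auto simp: S_def)
  have G: "transpose_mat A * A = S d" using Q(4) by (simp add: S_def)
  \<comment> \<open>Since \<open>inverse 0 = 0\<close>, this inverts the nonzero eigenvalues and
    leaves the kernel at zero, so no case distinction on the rank is required.\<close>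
  define e where "e i = inverse (d i)" for i
  have dd: "dim_col A = n" by (simp add: n_def)
  have de: "(\<lambda>i. d i * (e i * d i)) = d" "(\<lambda>i. e i * (d i * e i)) = e" 
  proof -
    have "d i * (e i * d i) = d i" "e i * (d i * e i) = e i" for i
      by (cases "d i = 0"; simp add: e_def)+
    then show "(\<lambda>i. d i * (e i * d i)) = d" "(\<lambda>i. e i * (d i * e i)) = e" by (simp_all only:)
  qed
  define W where "W = S (\<lambda>i. e i * d i)"
  have W: "dim_row W = n" "dim_col W = n" "transpose_mat W = W" "S d * W = S d" "W * S e = S e" "S e * S d = W"
    by (auto simp: W_def S de mult.assoc)
  \<comment> \<open>\<open>W\<close> is the orthogonal projection on the row space. The difference
    \<open>A - A * W\<close> has zero Gram matrix, hence is zero.\<close>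
  have AW: "A * W = A"
  proof -
    define Y where "Y = A - A * W"
    have Y: "dim_row Y = dim_row A" "dim_col Y = n" using W by (auto simp: Y_def)
    have AY: "transpose_mat A * Y = 0\<^sub>m n n"
    proof -
      have "transpose_mat A * Y = transpose_mat A * A - transpose_mat A * (A * W)"
        unfolding Y_def by (rule mult_minus_distrib_mat[of _ n "dim_row A" _ n]) (use W in \<open>auto simp: n_def\<close>)
      also have "transpose_mat A * (A * W) = S d * W" using W dd by (simp add: G flip: mat_mult_assoc)
      finally show ?thesis unfolding W(4) G by (simp add: minus_r_inv_mat[OF carrier_matI[OF S(3,4)]])
    qed
    have "transpose_mat Y * Y = transpose_mat A * Y - transpose_mat (A * W) * Y"
    proof -
      have "transpose_mat Y = transpose_mat A - transpose_mat (A * W)"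
        unfolding Y_def by (rule transpose_minus[of _ "dim_row A" n]) (use W in \<open>auto simp: n_def\<close>)
      then show ?thesis
        by (simp, intro minus_mult_distrib_mat[of _ n "dim_row A" _ _ n]) (use W Y in \<open>auto simp: n_def\<close>)
    qed
    also have "transpose_mat (A * W) * Y = W * (transpose_mat A * Y)"
      using W dd Y by (simp add: mat_mult_transpose mat_mult_assoc)
    finally have "transpose_mat Y * Y = 0\<^sub>m (dim_col Y) (dim_col Y)" using AY W Y by simp
    from gram_eq_0[OF this] have Y0: "Y = 0\<^sub>m (dim_row A) n" using Y by simp
    have "A $$ (i, j) = (A * W) $$ (i, j)" if "i < dim_row A" "j < n" for i j
    proof -
      have "Y $$ (i, j) = A $$ (i, j) - (A * W) $$ (i, j)" using that W by (simp add: Y_def dd del: index_mult_mat(1))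
      then show ?thesis using that by (simp add: Y0 del: index_mult_mat(1))
    qed
    then show ?thesis using W dd by (intro eq_matI) auto
  qed
  have XA: "S e * transpose_mat A * A = W" using S dd by (simp add: mat_mult_assoc G W_def)
  have pX: "is_pinv A (S e * transpose_mat A)"
    unfolding is_pinv_def
  proof (intro conjI)
    show "S e * transpose_mat A \<in> carrier_mat (dim_col A) (dim_row A)" using S dd by auto
    have "A * (S e * transpose_mat A) * A = A * (S e * transpose_mat A * A)"
      using S dd by (simp add: mat_mult_assoc)
    then show "A * (S e * transpose_mat A) * A = A" by (simp only: XA AW)
    have "S e * transpose_mat A * A * (S e * transpose_mat A) = W * (S e * transpose_mat A)" by (simp only: XA)
    also have "\<dots> = W * S e * transpose_mat A" by (rule mat_mult_assoc[symmetric]) (use W(1,2) S(3,4) dd in auto)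
    finally show "S e * transpose_mat A * A * (S e * transpose_mat A) = S e * transpose_mat A" by (simp only: W)
    show "transpose_mat (A * (S e * transpose_mat A)) = A * (S e * transpose_mat A)"
      using S dd by (simp add: mat_mult_transpose mat_mult_assoc)
    show "transpose_mat (S e * transpose_mat A * A) = S e * transpose_mat A * A"
      unfolding XA by (rule W)
  qed
  show ?thesis unfolding pinv_def by (rule theI[of "is_pinv A", OF pX]) (rule is_pinv_unique[OF _ pX])
qed

text \<open>The trace bound stands in for a rank bound: the trace of \<open>A * pinv A\<close>
  equals that of \<open>W = pinv A * A\<close>, which has only \<open>n\<close> diagonal entries. As
  \<open>W\<close> is symmetric and idempotent, each diagonal entry is the squared norm of its row,
  hence at least its own square, hence at most one.\<close>

lemma col_proj:
  assumes A: "A \<in> carrier_mat m n"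
  shows "col_proj A \<in> carrier_mat m m" "transpose_mat (col_proj A) = col_proj A"
    "col_proj A * col_proj A = col_proj A" "col_proj A * A = A"
    "(\<Sum>i<m. col_proj A $$ (i, i)) \<le> real n"
proof -
  have X: "pinv A \<in> carrier_mat n m" "A * pinv A * A = A" "pinv A * A * pinv A = pinv A"
    "transpose_mat (A * pinv A) = A * pinv A" "transpose_mat (pinv A * A) = pinv A * A"
    using pinv[of A] A by (auto simp: is_pinv_def)
  have d: "dim_row A = m" "dim_col A = n" "dim_row (pinv A) = n" "dim_col (pinv A) = m" using A X by auto
  show "col_proj A \<in> carrier_mat m m" "transpose_mat (col_proj A) = col_proj A" "col_proj A * A = A"
    using X A by (auto simp: col_proj_def)
  have "col_proj A * col_proj A = A * pinv A * A * pinv A" using d by (simp add: col_proj_def mat_mult_assoc)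
  then show "col_proj A * col_proj A = col_proj A" by (simp only: X col_proj_def)
  define W where "W = pinv A * A"
  have W: "dim_row W = n" "dim_col W = n" "transpose_mat W = W" using X d by (auto simp: W_def)
  have WW: "W * W = W"
  proof -
    have "W * W = pinv A * A * pinv A * A" using d by (simp add: W_def mat_mult_assoc)
    then show ?thesis by (simp only: X W_def)
  qed
  have W1: "W $$ (j, j) \<le> 1" if j: "j < n" for j
  proof -
    have sym: "W $$ (k, j) = W $$ (j, k)" if "k < n" for k
      using W that j by (metis index_transpose_mat(1))
    have "W $$ (j, j) = (W * W) $$ (j, j)" by (simp only: WW)
    also have "\<dots> = (\<Sum>k<n. W $$ (j, k) * W $$ (k, j))" using W j by (simp add: scalar_prod_def lessThan_atLeast0)
    also have "\<dots> = (\<Sum>k<n. (W $$ (j, k))\<^sup>2)" using sym by (simp add: power2_eq_square)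
    also have "\<dots> \<ge> (W $$ (j, j))\<^sup>2" using j by (intro member_le_sum) auto
    finally have "(W $$ (j, j))\<^sup>2 \<le> W $$ (j, j)" .
    then show ?thesis by (smt (verit) mult_left_le_imp_le mult_cancel_left1 power2_eq_square mult_less_cancel_left1)
  qed
  have "(\<Sum>i<m. col_proj A $$ (i, i)) = (\<Sum>i<m. \<Sum>j<n. A $$ (i, j) * pinv A $$ (j, i))"
    using d by (simp add: col_proj_def scalar_prod_def lessThan_atLeast0)
  also have "\<dots> = (\<Sum>j<n. \<Sum>i<m. pinv A $$ (j, i) * A $$ (i, j))"
    by (subst sum.swap) (simp add: mult.commute)
  also have "\<dots> = (\<Sum>j<n. W $$ (j, j))"
    using d by (simp add: W_def scalar_prod_def lessThan_atLeast0)
  also have "\<dots> \<le> (\<Sum>j<n. 1)" by (intro sum_mono W1) auto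
  finally show "(\<Sum>i<m. col_proj A $$ (i, i)) \<le> real n" by simp
qed

text \<open>Let \<open>x\<close> be a unit eigenvector of \<open>S - R\<close> with eigenvalue
  \<open>d\<close>. Expanding \<open>d * (x'Sx + x'Rx)\<close> gives
  \<open>x'(SS - RR)x = 0\<close>. If \<open>d\<close> were nonzero, both nonnegative forms would
  vanish, but their difference is \<open>d\<close>.\<close>

lemma pos_semidef_sqrt_unique:
  assumes S: "pos_semidef n S" and R: "pos_semidef n R" and eq: "S * S = R * R"
  shows "S = R"
proof -
  have cS: "S \<in> carrier_mat n n" "transpose_mat S = S" "\<And>v. v \<in> carrier_vec n \<Longrightarrow> 0 \<le> v \<bullet> (S *\<^sub>v v)"
    and cR: "R \<in> carrier_mat n n" "transpose_mat R = R" "\<And>v. v \<in> carrier_vec n \<Longrightarrow> 0 \<le> v \<bullet> (R *\<^sub>v v)"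
    using S R by (auto simp: pos_semidef_def sym_mat_def)
  define D where "D = S - R"
  have D: "D \<in> carrier_mat n n" using cS cR by (auto simp: D_def)
  have symD: "transpose_mat D = D"
    using transpose_minus[OF cS(1) cR(1)] by (simp add: D_def cS cR)
  obtain Q d where Q: "Q \<in> carrier_mat n n" "transpose_mat Q * Q = 1\<^sub>m n" "Q * transpose_mat Q = 1\<^sub>m n"
    "D = Q * mat_diag n d * transpose_mat Q" "\<forall>i j. i \<le> j \<longrightarrow> j < n \<longrightarrow> d j \<le> d i"
    "eigs D = mset (map d [0..<n])"
    by (rule real_spectral_theorem[OF D symD])
  have "d i = 0" if i: "i < n" for i
  proof (rule ccontr)
    assume di: "d i \<noteq> 0"
    define x where "x = Q *\<^sub>v unit_vec n i"
    have x: "x \<in> carrier_vec n" using Q by (simp add: x_def mult_mat_vec_carrier[of _ n n])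
    have "D *\<^sub>v x = (Q * mat_diag n d) *\<^sub>v (transpose_mat Q *\<^sub>v x)"
      unfolding Q(4) by (rule assoc_mult_mat_vec) (use Q x in auto)
    also have "transpose_mat Q *\<^sub>v x = unit_vec n i"
      unfolding x_def by (rule orthonormal_cancel[OF Q(1,2)]) simp
    also have "(Q * mat_diag n d) *\<^sub>v unit_vec n i = Q *\<^sub>v (mat_diag n d *\<^sub>v unit_vec n i)"
      by (rule assoc_mult_mat_vec) (use Q in auto)
    also have "mat_diag n d *\<^sub>v unit_vec n i = d i \<cdot>\<^sub>v unit_vec n i"
      using i by (intro eq_vecI) (auto simp del: index_mult_mat_vec)
    also have "Q *\<^sub>v (d i \<cdot>\<^sub>v unit_vec n i) = d i \<cdot>\<^sub>v x"
      unfolding x_def by (rule mult_mat_vec[OF Q(1)]) simp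
    finally have Dx: "D *\<^sub>v x = d i \<cdot>\<^sub>v x" .
    have DSR: "D *\<^sub>v u = S *\<^sub>v u - R *\<^sub>v u" if "u \<in> carrier_vec n" for u
      unfolding D_def by (rule minus_mult_distrib_mat_vec[OF cS(1) cR(1) that])
    have Sx: "S *\<^sub>v x \<in> carrier_vec n" "R *\<^sub>v x \<in> carrier_vec n"
      using cS cR x by auto
    have sym: "u \<bullet> (K *\<^sub>v w) = (K *\<^sub>v u) \<bullet> w"
      if "K \<in> carrier_mat n n" "transpose_mat K = K" "u \<in> carrier_vec n" "w \<in> carrier_vec n" for K :: "real mat" and u w
      using scalar_prod_transpose[OF that(1,3,4)] that(2) by simp
    have 1: "x \<bullet> (S *\<^sub>v x) - x \<bullet> (R *\<^sub>v x) = d i * sqn x"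
    proof -
      have "x \<bullet> (D *\<^sub>v x) = x \<bullet> (S *\<^sub>v x) - x \<bullet> (R *\<^sub>v x)"
        unfolding DSR[OF x] using scalar_prod_minus_distrib[OF x Sx] .
      moreover have "x \<bullet> (D *\<^sub>v x) = d i * sqn x" unfolding Dx using x by (simp add: sqn_def)
      ultimately show ?thesis by simp
    qed
    have SSx: "S *\<^sub>v (S *\<^sub>v x) = R *\<^sub>v (R *\<^sub>v x)"
      using eq assoc_mult_mat_vec[OF cS(1) cS(1) x] assoc_mult_mat_vec[OF cR(1) cR(1) x] by simp
    have "d i * (x \<bullet> (S *\<^sub>v x)) = (D *\<^sub>v x) \<bullet> (S *\<^sub>v x)" unfolding Dx using x Sx by simp
    also have "\<dots> = (S *\<^sub>v x) \<bullet> (S *\<^sub>v x) - (R *\<^sub>v x) \<bullet> (S *\<^sub>v x)"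
      unfolding DSR[OF x] by (rule minus_scalar_prod_distrib[OF Sx(1) Sx(2) Sx(1)])
    also have "(S *\<^sub>v x) \<bullet> (S *\<^sub>v x) = x \<bullet> (S *\<^sub>v (S *\<^sub>v x))" by (rule sym[OF cS(1,2) x Sx(1), symmetric])
    finally have 2: "d i * (x \<bullet> (S *\<^sub>v x)) = x \<bullet> (R *\<^sub>v (R *\<^sub>v x)) - (R *\<^sub>v x) \<bullet> (S *\<^sub>v x)" by (simp only: SSx)
    have "d i * (x \<bullet> (R *\<^sub>v x)) = (D *\<^sub>v x) \<bullet> (R *\<^sub>v x)" unfolding Dx using x Sx by simp
    also have "\<dots> = (S *\<^sub>v x) \<bullet> (R *\<^sub>v x) - (R *\<^sub>v x) \<bullet> (R *\<^sub>v x)"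
      unfolding DSR[OF x] by (rule minus_scalar_prod_distrib[OF Sx(1) Sx(2) Sx(2)])
    also have "(R *\<^sub>v x) \<bullet> (R *\<^sub>v x) = x \<bullet> (R *\<^sub>v (R *\<^sub>v x))" by (rule sym[OF cR(1,2) x Sx(2), symmetric])
    also have "(S *\<^sub>v x) \<bullet> (R *\<^sub>v x) = (R *\<^sub>v x) \<bullet> (S *\<^sub>v x)" by (rule comm_scalar_prod[OF Sx])
    finally have "d i * (x \<bullet> (S *\<^sub>v x) + x \<bullet> (R *\<^sub>v x)) = 0" using 2 by (simp add: distrib_left)
    then have "x \<bullet> (S *\<^sub>v x) + x \<bullet> (R *\<^sub>v x) = 0" using di by simp
    then have "x \<bullet> (S *\<^sub>v x) = 0" "x \<bullet> (R *\<^sub>v x) = 0" using cS(3)[OF x] cR(3)[OF x] by linarith+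
    then have "sqn x = 0" using 1 di by simp
    moreover have "sqn x = 1" unfolding x_def using sqn_orthonormal[OF Q(1,2), of "unit_vec n i"] i
      by (simp add: sqn_def)
    ultimately show False by simp
  qed
  then have "mat_diag n d = 0\<^sub>m n n" by (intro eq_matI) (auto simp: mat_diag_def)
  then have "D = 0\<^sub>m n n" using Q by simp
  then show "S = R" using cS cR
    by (intro eq_matI) (auto simp: D_def mat_eq_iff)
qed

lemma mat_sqrt:
  assumes "pos_def n A"
  shows "pos_semidef n (mat_sqrt A)" "mat_sqrt A * mat_sqrt A = A"
proof -
  have A: "A \<in> carrier_mat n n" "transpose_mat A = A" and pd: "\<And>v. v \<in> carrier_vec n \<Longrightarrow> v \<noteq> 0\<^sub>v n \<Longrightarrow> v \<bullet> (A *\<^sub>v v) > 0"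
    using assms by (auto simp: pos_def_def sym_mat_def)
  obtain Q d where Q: "Q \<in> carrier_mat n n" "transpose_mat Q * Q = 1\<^sub>m n" "Q * transpose_mat Q = 1\<^sub>m n"
    "A = Q * mat_diag n d * transpose_mat Q" "\<forall>i j. i \<le> j \<longrightarrow> j < n \<longrightarrow> d j \<le> d i"
    "eigs A = mset (map d [0..<n])"
    by (rule real_spectral_theorem[OF A])
  have d0: "0 \<le> d i" if i: "i < n" for i
  proof -
    have "(\<Sum>j<n. d j * (unit_vec n i $ j)\<^sup>2) = (\<Sum>j<n. if j = i then d i else 0)"
      using that by (intro sum.cong) (auto simp: unit_vec_def)
    then have "d i = (Q *\<^sub>v unit_vec n i) \<bullet> (A *\<^sub>v (Q *\<^sub>v unit_vec n i))"
      using quadratic_form_diag[OF Q(1,2,4), of "unit_vec n i"] i by simp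
    moreover have "Q *\<^sub>v unit_vec n i \<in> carrier_vec n" using Q by simp
    moreover have "0\<^sub>v n \<bullet> (A *\<^sub>v 0\<^sub>v n) = 0" using A by simp
    ultimately show ?thesis using pd by (metis less_imp_le order_refl)
  qed
  define S where "S = Q * mat_diag n (\<lambda>i. sqrt (d i)) * transpose_mat Q"
  have S: "S \<in> carrier_mat n n" using Q by (auto simp: S_def)
  have "S * S = Q * mat_diag n (\<lambda>i. sqrt (d i) * sqrt (d i)) * transpose_mat Q"
    unfolding S_def by (rule sandwich_diag[OF Q(1,2)])
  also have "mat_diag n (\<lambda>i. sqrt (d i) * sqrt (d i)) = mat_diag n d"
    using d0 by (intro eq_matI) (auto simp: mat_diag_def)
  finally have SS: "S * S = A" using Q by simp
  have "0 \<le> v \<bullet> (S *\<^sub>v v)" if v: "v \<in> carrier_vec n" for v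
  proof -
    have c: "transpose_mat Q *\<^sub>v v \<in> carrier_vec n" using Q v by (simp add: mult_mat_vec_carrier[of _ n n])
    show ?thesis
      using quadratic_form_diag[OF Q(1,2) S_def c] d0
      by (auto simp: sqn_orthonormal_transpose(2)[OF Q(1,3) v] intro!: sum_nonneg)
  qed
  then have psd: "pos_semidef n S" using S sandwich_diag(2)[OF Q(1,2)] by (simp add: pos_semidef_def sym_mat_def S_def)
  have "mat_sqrt A = S" unfolding mat_sqrt_def
    using psd SS A pos_semidef_sqrt_unique by (intro the_equality) auto
  then show "pos_semidef n (mat_sqrt A)" "mat_sqrt A * mat_sqrt A = A" using psd SS by auto
qed

lemma sqn_mat_sqrt_le:
  assumes pd: "pos_def n A" and eigs: "set_mset (eigs A) \<subseteq> {..C}" and v: "v \<in> carrier_vec n"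
  shows "sqn (mat_sqrt A *\<^sub>v v) \<le> C * sqn v"
proof -
  have A: "A \<in> carrier_mat n n" "transpose_mat A = A" using pd by (auto simp: pos_def_def sym_mat_def)
  have S: "mat_sqrt A \<in> carrier_mat n n" "transpose_mat (mat_sqrt A) = mat_sqrt A"
    using mat_sqrt(1)[OF pd] by (auto simp: pos_semidef_def sym_mat_def)
  obtain Q d where Q: "Q \<in> carrier_mat n n" "transpose_mat Q * Q = 1\<^sub>m n" "Q * transpose_mat Q = 1\<^sub>m n"
    "A = Q * mat_diag n d * transpose_mat Q" "\<forall>i j. i \<le> j \<longrightarrow> j < n \<longrightarrow> d j \<le> d i"
    "eigs A = mset (map d [0..<n])"
    by (rule real_spectral_theorem[OF A])
  define c where "c = transpose_mat Q *\<^sub>v v"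
  have c: "c \<in> carrier_vec n" using Q v by (simp add: c_def mult_mat_vec_carrier[of _ n n])
  have vc: "Q *\<^sub>v c = v" "sqn c = sqn v" unfolding c_def by (rule sqn_orthonormal_transpose[OF Q(1,3) v])+
  have "sqn (mat_sqrt A *\<^sub>v v) = v \<bullet> (A *\<^sub>v v)"
    using sqn_mult_mat_vec[OF S(1) v] S mat_sqrt(2)[OF pd] by simp
  also have "\<dots> = (\<Sum>i<n. d i * (c $ i)\<^sup>2)" using quadratic_form_diag[OF Q(1,2,4) c] vc by simp
  also have "\<dots> \<le> (\<Sum>i<n. C * (c $ i)\<^sup>2)"
  proof (intro sum_mono mult_right_mono)
    fix i assume "i \<in> {..<n}"
    then have "d i \<in># eigs A" unfolding Q(6) by auto
    then show "d i \<le> C" using eigs by auto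
  qed simp
  also have "\<dots> = C * sqn v" unfolding vc(2)[symmetric] sqn_sum[OF c] by (simp add: sum_distrib_left)
  finally show ?thesis .
qed

section \<open>The residual of a factor direction\<close>

text \<open>A coordinate vector of length \<open>k\<close> seen as supported on the first
  \<open>k\<close> of \<open>n\<close> coordinates; applying \<open>Q\<close> to it ranges over the
  span of the \<open>k\<close> leading singular vectors.\<close>

definition pad_vec :: "nat \<Rightarrow> real vec \<Rightarrow> real vec" where
  "pad_vec n c = vec n (\<lambda>i. if i < dim_vec c then c $ i else 0)"

lemma pad_vec_carrier [simp]: "pad_vec n c \<in> carrier_vec n"
  by (simp add: pad_vec_def)

lemma sum_pad_vec:
  assumes "c \<in> carrier_vec k" "k \<le> n"
  shows "(\<Sum>i<n. f i * pad_vec n c $ i) = (\<Sum>i<k. f i * c $ i)"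
    and "(\<Sum>i<n. f i * (pad_vec n c $ i)\<^sup>2) = (\<Sum>i<k. f i * (c $ i)\<^sup>2)"
  using assms by (auto simp: pad_vec_def intro!: sum.mono_neutral_cong_right split: if_splits)

lemma sqn_pad_vec: "c \<in> carrier_vec k \<Longrightarrow> k \<le> n \<Longrightarrow> sqn (pad_vec n c) = sqn c"
  using sum_pad_vec(2)[of c k n "\<lambda>_. 1"] by (simp add: sqn_sum[of _ n] sqn_sum[of _ k])

lemma mult_mat_pad_vec:
  assumes A: "A \<in> carrier_mat m n" and c: "c \<in> carrier_vec k" "k \<le> n"
  shows "A *\<^sub>v pad_vec n c = mat m k (\<lambda>(i, j). A $$ (i, j)) *\<^sub>v c"
proof (rule eq_vecI)
  fix i assume "i < dim_vec (mat m k (\<lambda>(i, j). A $$ (i, j)) *\<^sub>v c)"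
  then have i: "i < m" by simp
  have "(A *\<^sub>v pad_vec n c) $ i = (\<Sum>j<n. A $$ (i, j) * pad_vec n c $ j)"
    using i A by (simp add: scalar_prod_def lessThan_atLeast0 pad_vec_def)
  also have "\<dots> = (\<Sum>j<k. A $$ (i, j) * c $ j)" by (rule sum_pad_vec(1)[OF c])
  also have "\<dots> = (mat m k (\<lambda>(i, j). A $$ (i, j)) *\<^sub>v c) $ i"
    using i c by (simp add: scalar_prod_def lessThan_atLeast0)
  finally show "(A *\<^sub>v pad_vec n c) $ i = (mat m k (\<lambda>(i, j). A $$ (i, j)) *\<^sub>v c) $ i" .
qed (use A in simp)

text \<open>A matrix and its transpose have the same norm. With \<open>w\<close> the image of
  \<open>v\<close> under the transpose, \<open>sqn w\<close> equals \<open>F w\<close> paired with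
  \<open>v\<close>, and Cauchy-Schwarz lets one factor \<open>sqn w\<close> be cancelled.\<close>

lemma sqn_transpose_le:
  assumes F: "F \<in> carrier_mat n r" and K: "\<And>w. w \<in> carrier_vec r \<Longrightarrow> sqn (F *\<^sub>v w) \<le> K * sqn w"
    and K0: "0 \<le> K" and v: "v \<in> carrier_vec n"
  shows "sqn (transpose_mat F *\<^sub>v v) \<le> K * sqn v"
proof -
  define w where "w = transpose_mat F *\<^sub>v v"
  have w: "w \<in> carrier_vec r" using F v by (simp add: w_def mult_mat_vec_carrier[of _ r n])
  have Fw: "F *\<^sub>v w \<in> carrier_vec n" using F w by simp
  have "sqn w = (F *\<^sub>v w) \<bullet> v"
    using scalar_prod_transpose[OF F w v] by (simp add: sqn_def w_def)
  then have "(sqn w)\<^sup>2 \<le> sqn (F *\<^sub>v w) * sqn v"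
    using scalar_prod_Cauchy_Schwarz[OF Fw v] by simp
  also have "\<dots> \<le> (K * sqn w) * sqn v" by (intro mult_right_mono K w) simp
  finally have *: "sqn w * sqn w \<le> sqn w * (K * sqn v)" by (simp add: power2_eq_square mult_ac)
  show ?thesis
  proof (cases "sqn w = 0")
    case True
    then show ?thesis using K0 by (simp add: w_def)
  next
    case False
    then have "0 < sqn w" using sqn_nonneg[of w] by linarith
    then show ?thesis using * by (simp add: mult_le_cancel_left_pos flip: w_def)
  qed
qed

text \<open>The smallest singular value of the loadings is at least \<open>l / sqrt K\<close>. On
  the span of the \<open>r\<close> leading right singular vectors of the product, the product
  expands by at least \<open>l\<close>; so the \<open>r\<close> by \<open>r\<close> matrix
  \<open>G\<close>, which is the transpose of \<open>F\<close> restricted to this span, is injective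
  and therefore onto. Every \<open>w\<close> is then \<open>G c\<close> with
  \<open>sqn w \<le> K * sqn c\<close>, while \<open>l\<^sup>2 * sqn c\<close> is at most
  \<open>sqn (B w)\<close>.\<close>

lemma loading_lower_bound:
  assumes B: "B \<in> carrier_mat m r" and F: "F \<in> carrier_mat n r" and r: "1 \<le> r" "r \<le> n"
    and l: "0 < l" "l \<le> sing_val r (B * transpose_mat F)"
    and K: "\<And>w. w \<in> carrier_vec r \<Longrightarrow> sqn (F *\<^sub>v w) \<le> K * sqn w" and w: "w \<in> carrier_vec r"
  shows "l\<^sup>2 * sqn w \<le> K * sqn (B *\<^sub>v w)"
proof -
  define M where "M = B * transpose_mat F"
  have FT: "transpose_mat F \<in> carrier_mat r n" using F by simp
  have M: "M \<in> carrier_mat m n" using B FT by (auto simp: M_def)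
  obtain Q d where "gram_diag n M Q d" by (rule gram_spectral[OF M])
  note Q = gram_diagD[OF this]
  have dl: "l\<^sup>2 \<le> d i" if "i < r" for i
  proof -
    have "l \<le> sqrt (d (r - 1))" using l Q(8)[of r] r by (simp add: M_def)
    then have "l\<^sup>2 \<le> d (r - 1)" using power_mono[of l "sqrt (d (r - 1))" 2] l Q(6)[of "r - 1"] r by simp
    also have "\<dots> \<le> d i" using Q(5)[of i "r - 1"] that r by simp
    finally show ?thesis .
  qed
  define G where "G = mat r r (\<lambda>(i, j). (transpose_mat F * Q) $$ (i, j))"
  have G: "G \<in> carrier_mat r r" by (simp add: G_def)
  have FQ: "transpose_mat F * Q \<in> carrier_mat r n" by (rule mult_carrier_mat[OF FT Q(1)])
  have FG: "transpose_mat F *\<^sub>v (Q *\<^sub>v pad_vec n c) = G *\<^sub>v c" if c: "c \<in> carrier_vec r" for c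
    using mult_mat_pad_vec[OF FQ c r(2)] assoc_mult_mat_vec[OF FT Q(1), of "pad_vec n c"]
    by (simp add: G_def)
  have low: "l\<^sup>2 * sqn c \<le> sqn (B *\<^sub>v (G *\<^sub>v c))" if c: "c \<in> carrier_vec r" for c
  proof -
    have Qc: "Q *\<^sub>v pad_vec n c \<in> carrier_vec n" by (rule mult_mat_vec_carrier[OF Q(1)]) simp
    have "l\<^sup>2 * sqn c = (\<Sum>i<r. l\<^sup>2 * (c $ i)\<^sup>2)" by (simp add: sqn_sum[OF c] sum_distrib_left)
    also have "\<dots> \<le> (\<Sum>i<r. d i * (c $ i)\<^sup>2)" by (intro sum_mono mult_right_mono dl) auto
    also have "\<dots> = sqn (M *\<^sub>v (Q *\<^sub>v pad_vec n c))"
      using Q(7)[of "pad_vec n c"] sum_pad_vec(2)[OF c r(2), of d] by simp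
    also have "M *\<^sub>v (Q *\<^sub>v pad_vec n c) = B *\<^sub>v (G *\<^sub>v c)"
      unfolding M_def using assoc_mult_mat_vec[OF B FT Qc] by (simp add: FG[OF c])
    finally show ?thesis .
  qed
  have inj: "c = 0\<^sub>v r" if "c \<in> carrier_vec r" "G *\<^sub>v c = 0\<^sub>v r" for c
  proof -
    have "B *\<^sub>v 0\<^sub>v r = 0\<^sub>v m" using B by (intro eq_vecI) auto
    then have "l\<^sup>2 * sqn c \<le> 0" using low[OF that(1)] that(2) by simp
    moreover have "0 < l\<^sup>2" using l by simp
    ultimately have "sqn c \<le> 0" by (simp add: mult_le_0_iff)
    then have "sqn c = 0" using sqn_nonneg[of c] by linarith
    then show ?thesis using sqn_eq_0[OF that(1)] by simp
  qed
  obtain c where c: "c \<in> carrier_vec r" "G *\<^sub>v c = w" by (rule surjective_of_injective[OF G inj w])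
  have K0: "0 \<le> K"
  proof -
    have "0 \<le> K * sqn (unit_vec r 0)" using K[of "unit_vec r 0"] order_trans[OF sqn_nonneg] by auto
    then show ?thesis using r by (simp add: sqn_def)
  qed
  have "sqn w \<le> K * sqn (Q *\<^sub>v pad_vec n c)"
    using sqn_transpose_le[OF F K K0, of "Q *\<^sub>v pad_vec n c"] FG[OF c(1)] c(2) Q(1) by simp
  also have "sqn (Q *\<^sub>v pad_vec n c) = sqn c"
    using sqn_orthonormal[OF Q(1,2), of "pad_vec n c"] sqn_pad_vec[OF c(1) r(2)] by simp
  finally have "sqn w \<le> K * sqn c" .
  then have "l\<^sup>2 * sqn w \<le> l\<^sup>2 * (K * sqn c)" by (intro mult_left_mono) auto
  also have "\<dots> = K * (l\<^sup>2 * sqn c)" by simp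
  also have "\<dots> \<le> K * sqn (B *\<^sub>v w)" using low[OF c(1)] c(2) K0 by (intro mult_left_mono) auto
  finally show ?thesis .
qed

lemma scalar_prod_orthonormal_transpose:
  fixes Q :: "real mat"
  assumes Q: "Q \<in> carrier_mat n n" "Q * transpose_mat Q = 1\<^sub>m n"
    and u: "u \<in> carrier_vec n" and v: "v \<in> carrier_vec n"
  shows "(transpose_mat Q *\<^sub>v u) \<bullet> (transpose_mat Q *\<^sub>v v) = u \<bullet> v"
proof -
  have c: "transpose_mat Q *\<^sub>v u \<in> carrier_vec n" "transpose_mat Q *\<^sub>v v \<in> carrier_vec n"
    using Q u v by (simp_all add: mult_mat_vec_carrier[of _ n n])
  have "(transpose_mat Q *\<^sub>v u) \<bullet> (transpose_mat Q *\<^sub>v v) = (Q *\<^sub>v (transpose_mat Q *\<^sub>v u)) \<bullet> v"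
    by (rule scalar_prod_transpose[OF Q(1) c(1) v])
  then show ?thesis by (simp only: sqn_orthonormal_transpose(2)[OF Q u])
qed

text \<open>Among the \<open>r + 1\<close> leading right singular vectors some nontrivial
  combination is annihilated by the transpose of \<open>F\<close>, which has only \<open>r\<close>
  rows. On it the matrix acts as \<open>U\<close> alone, yet expands by at least \<open>d r\<close>,
  the squared singular value number \<open>r + 1\<close>.\<close>

lemma rank_perturbation_sing_val:
  assumes B: "B \<in> carrier_mat m r" and F: "F \<in> carrier_mat n r" and U: "U \<in> carrier_mat m n"
    and bound: "\<And>v. v \<in> carrier_vec n \<Longrightarrow> sqn (U *\<^sub>v v) \<le> \<tau> * sqn v"
    and gd: "gram_diag n (B * transpose_mat F + U) Q d" and r: "r < n"
  shows "d r \<le> \<tau>"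
proof -
  note Q = gram_diagD[OF gd]
  have FT: "transpose_mat F \<in> carrier_mat r n" using F by simp
  have FQ: "transpose_mat F * Q \<in> carrier_mat r n" by (rule mult_carrier_mat[OF FT Q(1)])
  define G where "G = mat r (Suc r) (\<lambda>(i, j). (transpose_mat F * Q) $$ (i, j))"
  have G: "G \<in> carrier_mat r (Suc r)" by (simp add: G_def)
  obtain c where c: "c \<in> carrier_vec (Suc r)" "c \<noteq> 0\<^sub>v (Suc r)" "G *\<^sub>v c = 0\<^sub>v r"
    by (rule underdetermined_nonzero_solution[OF G]) auto
  have rn: "Suc r \<le> n" using r by simp
  define x where "x = Q *\<^sub>v pad_vec n c"
  have x: "x \<in> carrier_vec n" unfolding x_def by (rule mult_mat_vec_carrier[OF Q(1)]) simp
  have Fx: "transpose_mat F *\<^sub>v x = 0\<^sub>v r"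
    using mult_mat_pad_vec[OF FQ c(1) rn] assoc_mult_mat_vec[OF FT Q(1), of "pad_vec n c"] c(3)
    by (simp add: G_def x_def)
  have "(B * transpose_mat F + U) *\<^sub>v x = (B * transpose_mat F) *\<^sub>v x + U *\<^sub>v x"
    by (rule add_mult_distrib_mat_vec[OF mult_carrier_mat[OF B FT] U x])
  also have "(B * transpose_mat F) *\<^sub>v x = B *\<^sub>v 0\<^sub>v r"
    using assoc_mult_mat_vec[OF B FT x] Fx by simp
  also have "B *\<^sub>v 0\<^sub>v r = 0\<^sub>v m" using B by (intro eq_vecI) auto
  finally have Xx: "(B * transpose_mat F + U) *\<^sub>v x = U *\<^sub>v x" by (simp add: left_zero_vec[OF mult_mat_vec_carrier[OF U x]])
  have "d r * sqn c = (\<Sum>i<Suc r. d r * (c $ i)\<^sup>2)" by (simp add: sqn_sum[OF c(1)] sum_distrib_left del: sum.lessThan_Suc)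
  also have "\<dots> \<le> (\<Sum>i<Suc r. d i * (c $ i)\<^sup>2)" using r Q(5) by (intro sum_mono mult_right_mono) auto
  also have "\<dots> = sqn ((B * transpose_mat F + U) *\<^sub>v x)"
    using Q(7)[of "pad_vec n c"] sum_pad_vec(2)[OF c(1) rn, of d] by (simp add: x_def)
  also have "\<dots> \<le> \<tau> * sqn x" unfolding Xx by (rule bound[OF x])
  also have "sqn x = sqn c"
    using sqn_orthonormal[OF Q(1,2), of "pad_vec n c"] sqn_pad_vec[OF c(1) rn] by (simp add: x_def)
  finally have "d r * sqn c \<le> \<tau> * sqn c" .
  moreover have "0 < sqn c" using sqn_eq_0[OF c(1)] c(2) sqn_nonneg[of c] by linarith
  ultimately show ?thesis by simp
qed

text \<open>The given singular vectors and the basis \<open>Q\<close> are two unrelated choices,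
  which may differ by a rotation within a multiple singular value. The comparison is therefore made
  at the level \<tau>: the \<open>q\<close> squared singular values above \<tau> are separated from
  the others, so the first \<open>q\<close> given vectors lie in the span of the first
  \<open>q\<close> columns of \<open>Q\<close>, and being orthonormal they fill it. A vector
  orthogonal to them has only coordinates with weight at most \<tau>.\<close>

lemma sqn_perp_top_singular_le:
  assumes B: "B \<in> carrier_mat m r" and F: "F \<in> carrier_mat n r" and U: "U \<in> carrier_mat m n"
    and bound: "\<And>v. v \<in> carrier_vec n \<Longrightarrow> sqn (U *\<^sub>v v) \<le> \<tau> * sqn v" and tau: "0 \<le> \<tau>"
    and X: "X = B * transpose_mat F + U" and top: "top_left_singular R X \<Xi>" and R: "r \<le> R" "R \<le> n"
    and v: "v \<in> carrier_vec n" and perp: "\<And>k. k < R \<Longrightarrow> col (transpose_mat X * \<Xi>) k \<bullet> v = 0"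
  shows "sqn (X *\<^sub>v v) \<le> \<tau> * sqn v"
proof -
  have Xc: "X \<in> carrier_mat m n" unfolding X using B F U by auto
  have XT: "transpose_mat X \<in> carrier_mat n m" using Xc by simp
  obtain Q d where gd: "gram_diag n X Q d" by (rule gram_spectral[OF Xc])
  note Q = gram_diagD[OF gd]
  have QT: "transpose_mat Q \<in> carrier_mat n n" using Q by simp
  \<comment> \<open>The number of squared singular values above \<tau>. The alternative
    \<open>i = n\<close> keeps the minimum well defined when all of them are.\<close>
  define q where "q = (LEAST i. i = n \<or> d i \<le> \<tau>)"
  have q: "q = n \<or> d q \<le> \<tau>" unfolding q_def by (rule LeastI[of _ n]) simp
  have qn: "q \<le> n" unfolding q_def by (rule Least_le) simp
  have qr: "q \<le> r"
  proof (cases "r < n")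
    case True
    then show ?thesis unfolding q_def
      using rank_perturbation_sing_val[OF B F U bound gd[unfolded X] True] by (intro Least_le) simp
  qed (use qn in simp)
  have big: "\<tau> < d i" if "i < q" for i
    using not_less_Least[of i "\<lambda>i. i = n \<or> d i \<le> \<tau>"] that by (auto simp: q_def)
  have small: "d i \<le> \<tau>" if "q \<le> i" "i < n" for i
    using q Q(5)[OF that] that by auto
  from top obtain V where \<Xi>c: "\<Xi> \<in> carrier_mat m R" and V: "V \<in> carrier_mat n R" "transpose_mat V * V = 1\<^sub>m R"
    and sv: "\<forall>k\<in>{1..R}. X *\<^sub>v col V (k - 1) = sing_val k X \<cdot>\<^sub>v col \<Xi> (k - 1) \<and>
           transpose_mat X *\<^sub>v col \<Xi> (k - 1) = sing_val k X \<cdot>\<^sub>v col V (k - 1)"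
    unfolding top_left_singular_def using Xc by auto
  define y where "y k = transpose_mat Q *\<^sub>v col V k" for k
  have Vk: "col V k \<in> carrier_vec n" if "k < R" for k using V that by auto
  have yk: "y k \<in> carrier_vec n" if "k < R" for k
    unfolding y_def by (rule mult_mat_vec_carrier[OF QT Vk[OF that]])
  have sk: "X *\<^sub>v col V k = sqrt (d k) \<cdot>\<^sub>v col \<Xi> k" "transpose_mat X *\<^sub>v col \<Xi> k = sqrt (d k) \<cdot>\<^sub>v col V k"
    if "k < R" for k
    using sv[rule_format, of "Suc k"] Q(8)[of "Suc k"] that R by auto
  have eig: "(d i - d k) * y k $ i = 0" if k: "k < R" and i: "i < n" for i k
  proof -
    have \<Xi>k: "col \<Xi> k \<in> carrier_vec m" using \<Xi>c k by auto
    have "(transpose_mat X * X) *\<^sub>v col V k = transpose_mat X *\<^sub>v (X *\<^sub>v col V k)"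
      by (rule assoc_mult_mat_vec[OF XT Xc Vk[OF k]])
    also have "\<dots> = sqrt (d k) \<cdot>\<^sub>v (sqrt (d k) \<cdot>\<^sub>v col V k)"
      unfolding sk[OF k] mult_mat_vec[OF XT \<Xi>k] ..
    also have "\<dots> = d k \<cdot>\<^sub>v col V k" using Q(6)[of k] k R by (simp add: smult_smult_assoc)
    finally have 1: "(transpose_mat X * X) *\<^sub>v col V k = d k \<cdot>\<^sub>v col V k" .
    have D: "mat_diag n d \<in> carrier_mat n n" by simp
    have Dy: "mat_diag n d *\<^sub>v y k \<in> carrier_vec n" by (rule mult_mat_vec_carrier[OF D yk[OF k]])
    have "(transpose_mat X * X) *\<^sub>v col V k = (Q * mat_diag n d) *\<^sub>v y k"
      unfolding Q(4) y_def by (rule assoc_mult_mat_vec[OF mult_carrier_mat[OF Q(1) D] QT Vk[OF k]])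
    also have "\<dots> = Q *\<^sub>v (mat_diag n d *\<^sub>v y k)" by (rule assoc_mult_mat_vec[OF Q(1) D yk[OF k]])
    finally have "transpose_mat Q *\<^sub>v ((transpose_mat X * X) *\<^sub>v col V k) = mat_diag n d *\<^sub>v y k"
      using orthonormal_cancel[OF Q(1,2) Dy] by simp
    then have "d k \<cdot>\<^sub>v y k = mat_diag n d *\<^sub>v y k"
      unfolding 1 by (simp add: mult_mat_vec[OF QT Vk[OF k]] y_def)
    then have "(d k \<cdot>\<^sub>v y k) $ i = (mat_diag n d *\<^sub>v y k) $ i" by simp
    then show ?thesis using yk[OF k] i by (auto simp: algebra_simps simp del: index_mult_mat_vec)
  qed
  \<comment> \<open>Eigenvectors for different eigenvalues: \<open>d k\<close> lies above \<tau> and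
    \<open>d i\<close> does not, so the coordinate has to vanish.\<close>
  have y0: "y k $ i = 0" if "k < q" "q \<le> i" "i < n" for k i
    using eig[of k i] big[of k] small[of i] that qr R by auto
  have sum_q: "(\<Sum>i<n. y k $ i * f i) = (\<Sum>i<q. y k $ i * f i)" if "k < q" for k f
    using y0[OF that] qn by (intro sum.mono_neutral_cong_right) auto
  define W where "W = mat q q (\<lambda>(i, k). y k $ i)"
  have W: "W \<in> carrier_mat q q" by (simp add: W_def)
  have "transpose_mat W * W = 1\<^sub>m q"
  proof (rule eq_matI)
    fix k l assume "k < dim_row (1\<^sub>m q :: real mat)" "l < dim_col (1\<^sub>m q :: real mat)"
    then have kl: "k < q" "l < q" "k < R" "l < R" using qr R by auto
    have "(transpose_mat W * W) $$ (k, l) = (\<Sum>i<q. y k $ i * y l $ i)"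
      using kl by (simp add: W_def scalar_prod_def lessThan_atLeast0)
    also have "\<dots> = y k \<bullet> y l" using sum_q[OF kl(1), of "\<lambda>i. y l $ i"] yk[OF kl(4)]
      by (simp add: scalar_prod_def lessThan_atLeast0)
    also have "\<dots> = col V k \<bullet> col V l"
      unfolding y_def by (rule scalar_prod_orthonormal_transpose[OF Q(1,3) Vk[OF kl(3)] Vk[OF kl(4)]])
    also have "\<dots> = (transpose_mat V * V) $$ (k, l)" using V(1) kl by simp
    also have "\<dots> = 1\<^sub>m q $$ (k, l)" using V(2) kl by simp
    finally show "(transpose_mat W * W) $$ (k, l) = 1\<^sub>m q $$ (k, l)" .
  qed (auto simp: W_def)
  \<comment> \<open>Orthonormal columns of a square matrix: a left inverse is a right inverse. This
    is the counting argument that the first \<open>q\<close> vectors fill the span.\<close>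
  then have WW: "W * transpose_mat W = 1\<^sub>m q"
    using mat_mult_left_right_inverse[of "transpose_mat W" q W] W by simp
  define c where "c = transpose_mat Q *\<^sub>v v"
  have c: "c \<in> carrier_vec n" unfolding c_def by (rule mult_mat_vec_carrier[OF QT v])
  have vc: "Q *\<^sub>v c = v" "sqn c = sqn v" unfolding c_def by (rule sqn_orthonormal_transpose[OF Q(1,3) v])+
  define c' where "c' = vec q (\<lambda>i. c $ i)"
  have c': "c' \<in> carrier_vec q" by (simp add: c'_def)
  have "transpose_mat W *\<^sub>v c' = 0\<^sub>v q"
  proof (rule eq_vecI)
    fix k assume "k < dim_vec (0\<^sub>v q :: real vec)"
    then have k: "k < q" "k < R" using qr R by auto
    have \<Xi>k: "col \<Xi> k \<in> carrier_vec m" using \<Xi>c k by auto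
    have "col (transpose_mat X * \<Xi>) k = sqrt (d k) \<cdot>\<^sub>v col V k"
      using col_mult2[OF XT \<Xi>c k(2)] sk(2)[OF k(2)] by simp
    then have "sqrt (d k) * (col V k \<bullet> v) = 0" using perp[OF k(2)] Vk[OF k(2)] v by simp
    \<comment> \<open>Orthogonality is given for the columns \<open>sqrt (d k)\<close> times the
      right singular vectors; it transfers to these vectors because \<open>d k\<close> exceeds
      \<tau>, which is nonnegative.\<close>
    moreover have "0 < d k" using big[OF k(1)] tau by linarith
    ultimately have "col V k \<bullet> v = 0" by simp
    then have "y k \<bullet> c = 0"
      unfolding y_def c_def using scalar_prod_orthonormal_transpose[OF Q(1,3) Vk[OF k(2)] v] by simp
    then have "(\<Sum>i<q. y k $ i * c $ i) = 0" using sum_q[OF k(1), of "\<lambda>i. c $ i"] c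
      by (simp add: scalar_prod_def lessThan_atLeast0)
    then show "(transpose_mat W *\<^sub>v c') $ k = 0\<^sub>v q $ k"
      using k by (simp add: W_def c'_def scalar_prod_def lessThan_atLeast0)
  qed (simp add: W_def)
  then have "W *\<^sub>v (transpose_mat W *\<^sub>v c') = 0\<^sub>v q" using W by (intro eq_vecI) auto
  then have "c' = 0\<^sub>v q"
    using assoc_mult_mat_vec[OF W _ c', of "transpose_mat W"] W WW c' by simp
  then have c0: "c $ i = 0" if "i < q" for i
    using that by (metis c'_def index_vec index_zero_vec(1))
  have "sqn (X *\<^sub>v v) = (\<Sum>i<n. d i * (c $ i)\<^sup>2)" using Q(7)[OF c] vc by simp
  also have "\<dots> \<le> (\<Sum>i<n. \<tau> * (c $ i)\<^sup>2)"
  proof (rule sum_mono)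
    fix i assume i: "i \<in> {..<n}"
    show "d i * (c $ i)\<^sup>2 \<le> \<tau> * (c $ i)\<^sup>2"
      using c0[of i] small[of i] i by (cases "i < q") (auto intro!: mult_right_mono)
  qed
  also have "\<dots> = \<tau> * sqn v" unfolding vc(2)[symmetric] sqn_sum[OF c] by (simp add: sum_distrib_left)
  finally show ?thesis .
qed

section \<open>Residuals after projecting off the constant and the estimated factors\<close>

lemma with_ones_carrier: "A \<in> carrier_mat n k \<Longrightarrow> with_ones A \<in> carrier_mat n (1 + k)"
  by (auto simp: with_ones_def)

lemma col_with_ones:
  assumes "A \<in> carrier_mat n k"
  shows "col (with_ones A) 0 = vec n (\<lambda>_. 1)" "j < k \<Longrightarrow> col (with_ones A) (Suc j) = col A j"
  using assms by (auto simp: with_ones_def)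

lemma resid:
  assumes A: "A \<in> carrier_mat n k" and v: "v \<in> carrier_vec n"
  defines "P \<equiv> col_proj (with_ones A)"
  shows "resid A v = v - P *\<^sub>v v" "resid A v \<in> carrier_vec n"
    "\<And>j. j < 1 + k \<Longrightarrow> P *\<^sub>v col (with_ones A) j = col (with_ones A) j"
    "\<And>j. j < k \<Longrightarrow> col A j \<bullet> resid A v = 0"
    "v \<bullet> resid A v = sqn (resid A v)"
proof -
  note W = with_ones_carrier[OF A]
  note P = col_proj[OF W, folded P_def]
  have Pv: "P *\<^sub>v v \<in> carrier_vec n" by (rule mult_mat_vec_carrier[OF P(1) v])
  have "resid A v = (1\<^sub>m n - P) *\<^sub>v v" using A by (simp add: resid_def P_def)
  also have "\<dots> = 1\<^sub>m n *\<^sub>v v - P *\<^sub>v v"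
    by (rule minus_mult_distrib_mat_vec[OF one_carrier_mat P(1) v])
  finally show r: "resid A v = v - P *\<^sub>v v" by (simp only: one_mult_mat_vec[OF v])
  show rc: "resid A v \<in> carrier_vec n" unfolding r using v Pv by simp
  show PW: "P *\<^sub>v col (with_ones A) j = col (with_ones A) j" if "j < 1 + k" for j
    using col_mult2[OF P(1) W that] P(4) by simp
  have sym: "u \<bullet> (P *\<^sub>v w) = (P *\<^sub>v u) \<bullet> w" if "u \<in> carrier_vec n" "w \<in> carrier_vec n" for u w
    using scalar_prod_transpose[OF P(1) that] P(2) by simp
  show "col A j \<bullet> resid A v = 0" if j: "j < k" for j
  proof -
    have x: "col A j \<in> carrier_vec n" using A j by auto
    have "P *\<^sub>v col A j = col A j" using PW[of "Suc j"] col_with_ones(2)[OF A j] j by simp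
    then have "col A j \<bullet> (P *\<^sub>v v) = col A j \<bullet> v" using sym[OF x v] by simp
    then show ?thesis unfolding r using scalar_prod_minus_distrib[OF x v Pv] by simp
  qed
  have "P *\<^sub>v resid A v = 0\<^sub>v n"
  proof -
    have "P *\<^sub>v resid A v = P *\<^sub>v v - P *\<^sub>v (P *\<^sub>v v)"
      unfolding r by (rule mult_minus_distrib_mat_vec[OF P(1) v Pv])
    also have "P *\<^sub>v (P *\<^sub>v v) = P *\<^sub>v v"
      using assoc_mult_mat_vec[OF P(1) P(1) v] by (simp add: P(3))
    finally show ?thesis using Pv by simp
  qed
  then have "(P *\<^sub>v v) \<bullet> resid A v = 0" using sym[OF v rc] v by simp
  then have "(v - P *\<^sub>v v) \<bullet> resid A v = v \<bullet> resid A v"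
    using minus_scalar_prod_distrib[OF v Pv rc] by simp
  then show "v \<bullet> resid A v = sqn (resid A v)" unfolding sqn_def r[symmetric] by simp
qed

text \<open>A self-bounding argument for the residual \<open>w\<close> of \<open>F a\<close>. Both
  \<open>X w\<close> and \<open>U w\<close> have squared norm at most \<tau> times that of
  \<open>w\<close>, so their difference, the common component applied to \<open>w\<close>, has at
  most four times that. The lower bound on the loadings turns this into a bound on the transpose of
  \<open>F\<close> applied to \<open>w\<close>. Finally \<open>sqn w\<close> is \<open>F a\<close>
  paired with \<open>w\<close>, i.e. \<open>a\<close> paired with that vector; Cauchy-Schwarz gives
  a bound of \<open>(sqn w)\<^sup>2\<close> linear in \<open>sqn w\<close>, and one factor
  cancels.\<close>

lemma sqn_resid_factor_le:
  assumes B: "B \<in> carrier_mat m r" and F: "F \<in> carrier_mat n r" and U: "U \<in> carrier_mat m n"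
    and bound: "\<And>v. v \<in> carrier_vec n \<Longrightarrow> sqn (U *\<^sub>v v) \<le> \<tau> * sqn v" and tau: "0 \<le> \<tau>"
    and X: "X = B * transpose_mat F + U" and top: "top_left_singular R X \<Xi>"
    and r: "1 \<le> r" "r \<le> R" "R \<le> n" "0 < m"
    and l: "0 < l" "l \<le> sing_val r (B * transpose_mat F)"
    and K: "\<And>w. w \<in> carrier_vec r \<Longrightarrow> sqn (F *\<^sub>v w) \<le> K * sqn w" and a: "a \<in> carrier_vec r"
  shows "sqn (resid (factor_hat X \<Xi>) (F *\<^sub>v a)) \<le> 4 * K * \<tau> / l\<^sup>2 * sqn a"
proof -
  have FT: "transpose_mat F \<in> carrier_mat r n" using F by simp
  have M: "B * transpose_mat F \<in> carrier_mat m n" by (rule mult_carrier_mat[OF B FT])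
  have Xc: "X \<in> carrier_mat m n" unfolding X using M U by auto
  have \<Xi>c: "\<Xi> \<in> carrier_mat m R" using top Xc by (auto simp: top_left_singular_def)
  have Y: "transpose_mat X * \<Xi> \<in> carrier_mat n R" using Xc \<Xi>c by auto
  define A where "A = factor_hat X \<Xi>"
  have A: "A \<in> carrier_mat n R" using Y Xc by (auto simp: A_def factor_hat_def)
  have Fa: "F *\<^sub>v a \<in> carrier_vec n" using F a by simp
  define w where "w = resid A (F *\<^sub>v a)"
  note res = resid[OF A Fa, folded w_def]
  have w: "w \<in> carrier_vec n" by (rule res(2))
  have perp: "col (transpose_mat X * \<Xi>) k \<bullet> w = 0" if k: "k < R" for k
  proof -
    have "col A k = (1 / sqrt (real m)) \<cdot>\<^sub>v col (transpose_mat X * \<Xi>) k"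
      using Xc \<Xi>c k by (simp add: A_def factor_hat_def del: col_mult)
    then have "(1 / sqrt (real m)) * (col (transpose_mat X * \<Xi>) k \<bullet> w) = 0"
      using res(4)[OF k] w Y k by (simp add: smult_scalar_prod_distrib[of _ n])
    then show ?thesis using r by simp
  qed
  have Xw: "sqn (X *\<^sub>v w) \<le> \<tau> * sqn w"
    by (rule sqn_perp_top_singular_le[OF B F U bound tau X top r(2,3) w perp])
  have FTw: "transpose_mat F *\<^sub>v w \<in> carrier_vec r" by (rule mult_mat_vec_carrier[OF FT w])
  have Mw: "B *\<^sub>v (transpose_mat F *\<^sub>v w) = X *\<^sub>v w - U *\<^sub>v w"
  proof -
    have c: "B *\<^sub>v (transpose_mat F *\<^sub>v w) \<in> carrier_vec m" "U *\<^sub>v w \<in> carrier_vec m"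
      using B FTw U w by auto
    have "X *\<^sub>v w = B *\<^sub>v (transpose_mat F *\<^sub>v w) + U *\<^sub>v w"
      unfolding X add_mult_distrib_mat_vec[OF M U w] assoc_mult_mat_vec[OF B FT w] ..
    then show ?thesis using c B U by (intro eq_vecI) (auto simp del: index_mult_mat_vec)
  qed
  have K0: "0 \<le> K"
  proof -
    have "0 \<le> K * sqn (unit_vec r 0)" using K[of "unit_vec r 0"] order_trans[OF sqn_nonneg] by auto
    then show ?thesis using r by (simp add: sqn_def)
  qed
  have "l\<^sup>2 * sqn (transpose_mat F *\<^sub>v w) \<le> K * sqn (X *\<^sub>v w - U *\<^sub>v w)"
    using loading_lower_bound[OF B F r(1) _ l K FTw] r Mw by simp
  also have "\<dots> \<le> K * (4 * \<tau> * sqn w)"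
  proof (intro mult_left_mono K0)
    have "sqn (X *\<^sub>v w - U *\<^sub>v w) \<le> 2 * sqn (X *\<^sub>v w) + 2 * sqn (U *\<^sub>v w)"
      using Xc U w by (intro sqn_add_le(2)[of _ m]) auto
    then show "sqn (X *\<^sub>v w - U *\<^sub>v w) \<le> 4 * \<tau> * sqn w" using Xw bound[OF w] by linarith
  qed
  finally have 1: "sqn (transpose_mat F *\<^sub>v w) \<le> 4 * K * \<tau> / l\<^sup>2 * sqn w"
    using l by (simp add: field_simps)
  have "sqn w = (F *\<^sub>v a) \<bullet> w" using res(5) by simp
  also have "\<dots> = a \<bullet> (transpose_mat F *\<^sub>v w)" by (rule scalar_prod_transpose[OF F a w, symmetric])
  finally have "(sqn w)\<^sup>2 \<le> sqn a * sqn (transpose_mat F *\<^sub>v w)"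
    using scalar_prod_Cauchy_Schwarz[OF a FTw] by simp
  also have "\<dots> \<le> sqn a * (4 * K * \<tau> / l\<^sup>2 * sqn w)" by (intro mult_left_mono 1) simp
  finally have 2: "sqn w * sqn w \<le> sqn w * (4 * K * \<tau> / l\<^sup>2 * sqn a)" by (simp add: power2_eq_square mult_ac)
  have "sqn w \<le> 4 * K * \<tau> / l\<^sup>2 * sqn a"
  proof (cases "sqn w = 0")
    case True then show ?thesis using K0 tau by simp
  next
    case False
    then have "0 < sqn w" using sqn_nonneg[of w] by linarith
    then show ?thesis using 2 by (simp only: mult_le_cancel_left_pos)
  qed
  then show ?thesis by (simp add: w_def A_def)
qed

text \<open>\<open>sqn (F w)\<close> is \<open>n\<close> times the quadratic form of
  \<open>S\<close> at \<open>w\<close>; Cauchy-Schwarz bounds the form by the largest singular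
  value.\<close>

lemma sqn_factor_le:
  assumes F: "F \<in> carrier_mat n r" "0 < n" "0 < r"
    and S: "sing_val 1 ((1 / real n) \<cdot>\<^sub>m (transpose_mat F * F)) \<le> C" and C: "0 \<le> C" and w: "w \<in> carrier_vec r"
  shows "sqn (F *\<^sub>v w) \<le> real n * C * sqn w"
proof -
  define S where "S = (1 / real n) \<cdot>\<^sub>m (transpose_mat F * F)"
  have G: "transpose_mat F * F \<in> carrier_mat r r" using F by auto
  have Sc: "S \<in> carrier_mat r r" using G by (simp add: S_def)
  have Sw: "S *\<^sub>v w \<in> carrier_vec r" using Sc w by simp
  have FF: "(transpose_mat F * F) *\<^sub>v w = real n \<cdot>\<^sub>v (S *\<^sub>v w)"
  proof (rule eq_vecI)
    fix i assume "i < dim_vec (real n \<cdot>\<^sub>v (S *\<^sub>v w))"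
    then have i: "i < r" using Sc by simp
    have rG: "row (transpose_mat F * F) i \<in> carrier_vec r" by (rule row_carrier_vec[OF i G])
    have "row S i = (1 / real n) \<cdot>\<^sub>v row (transpose_mat F * F) i"
      unfolding S_def by (rule row_smult) (use i F in simp)
    then have "(S *\<^sub>v w) $ i = (1 / real n) * (row (transpose_mat F * F) i \<bullet> w)"
      using index_mult_mat_vec[of i S w] i Sc smult_scalar_prod_distrib[OF rG w] by simp
    moreover have "((transpose_mat F * F) *\<^sub>v w) $ i = row (transpose_mat F * F) i \<bullet> w"
      by (rule index_mult_mat_vec) (use i F in simp)
    moreover have "(real n \<cdot>\<^sub>v (S *\<^sub>v w)) $ i = real n * (S *\<^sub>v w) $ i"
      by (rule index_smult_vec(1)) (use i Sc in simp)
    ultimately show "((transpose_mat F * F) *\<^sub>v w) $ i = (real n \<cdot>\<^sub>v (S *\<^sub>v w)) $ i"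
      using F(2) by (simp only: times_divide_eq_left times_divide_eq_right) simp
  qed (use F Sc in simp)
  have "sqn (F *\<^sub>v w) = w \<bullet> (real n \<cdot>\<^sub>v (S *\<^sub>v w))"
    using sqn_mult_mat_vec[OF F(1) w] unfolding FF .
  also have "\<dots> = real n * (w \<bullet> (S *\<^sub>v w))" by (rule scalar_prod_smult_distrib[OF w Sw])
  also have "\<dots> \<le> real n * (C * sqn w)"
  proof (rule mult_left_mono)
    have "(w \<bullet> (S *\<^sub>v w))\<^sup>2 \<le> sqn w * sqn (S *\<^sub>v w)" by (rule scalar_prod_Cauchy_Schwarz[OF w Sw])
    also have "\<dots> \<le> sqn w * (C\<^sup>2 * sqn w)"
      by (rule mult_left_mono[OF sqn_le_sing_val[OF Sc F(3) _ w] sqn_nonneg]) (use S in \<open>simp only: S_def\<close>)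
    also have "\<dots> = (C * sqn w)\<^sup>2" by (simp add: power2_eq_square)
    finally show "w \<bullet> (S *\<^sub>v w) \<le> C * sqn w" by (rule power2_le_imp_le) (use C in simp)
  qed simp
  finally show ?thesis by (simp only: mult.assoc)
qed

section \<open>Measurability of random projections\<close>

lemma space_mat_borel [simp]: "space (mat_borel n m) = carrier_mat n m"
  by (simp add: mat_borel_def)

lemma measurable_mat_borel_iff:
  "A \<in> measurable M (mat_borel n m) \<longleftrightarrow>
     (\<forall>\<omega>\<in>space M. A \<omega> \<in> carrier_mat n m) \<and>
     (\<forall>i<n. \<forall>j<m. (\<lambda>\<omega>. A \<omega> $$ (i, j)) \<in> borel_measurable M)"
proof -
  let ?I = "{..<n} \<times> {..<m}"
  let ?f = "\<lambda>A::real mat. \<lambda>ij\<in>?I. A $$ ij"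
  have f: "?f \<in> carrier_mat n m \<rightarrow> space (PiM ?I (\<lambda>_. borel :: real measure))"
    by (auto simp: space_PiM)
  show ?thesis
  proof (intro iffI conjI)
    assume A: "A \<in> measurable M (mat_borel n m)"
    show c: "\<forall>\<omega>\<in>space M. A \<omega> \<in> carrier_mat n m" using measurable_space[OF A] by simp
    have "?f \<in> measurable (mat_borel n m) (PiM ?I (\<lambda>_. borel))"
      unfolding mat_borel_def by (rule measurable_vimage_algebra1[OF f])
    from measurable_comp[OF A this] have g: "(\<lambda>\<omega>. ?f (A \<omega>)) \<in> measurable M (PiM ?I (\<lambda>_. borel))"
      by (simp add: o_def)
    show "\<forall>i<n. \<forall>j<m. (\<lambda>\<omega>. A \<omega> $$ (i, j)) \<in> borel_measurable M"
    proof (intro allI impI)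
      fix i j assume ij: "i < n" "j < m"
      have "(\<lambda>\<omega>. ?f (A \<omega>) (i, j)) \<in> borel_measurable M"
        using measurable_comp[OF g measurable_component_singleton[of "(i, j)" ?I]] ij by (simp add: o_def)
      then show "(\<lambda>\<omega>. A \<omega> $$ (i, j)) \<in> borel_measurable M" using ij by simp
    qed
  next
    assume A: "(\<forall>\<omega>\<in>space M. A \<omega> \<in> carrier_mat n m) \<and>
     (\<forall>i<n. \<forall>j<m. (\<lambda>\<omega>. A \<omega> $$ (i, j)) \<in> borel_measurable M)"
    show "A \<in> measurable M (mat_borel n m)"
      unfolding mat_borel_def
    proof (rule measurable_vimage_algebra2)
      show "A \<in> space M \<rightarrow> carrier_mat n m" using A by auto
      show "(\<lambda>\<omega>. ?f (A \<omega>)) \<in> measurable M (PiM ?I (\<lambda>_. borel))"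
        by (rule measurable_restrict) (use A in auto)
    qed
  qed
qed

lemma measurable_mat_borelI:
  assumes "\<And>\<omega>. \<omega> \<in> space M \<Longrightarrow> A \<omega> \<in> carrier_mat n m"
    and "\<And>i j. i < n \<Longrightarrow> j < m \<Longrightarrow> (\<lambda>\<omega>. A \<omega> $$ (i, j)) \<in> borel_measurable M"
  shows "A \<in> measurable M (mat_borel n m)"
  using assms by (simp add: measurable_mat_borel_iff)

lemma measurable_mat_borelD:
  assumes "A \<in> measurable M (mat_borel n m)"
  shows "\<And>\<omega>. \<omega> \<in> space M \<Longrightarrow> A \<omega> \<in> carrier_mat n m"
    and "\<And>i j. i < n \<Longrightarrow> j < m \<Longrightarrow> (\<lambda>\<omega>. A \<omega> $$ (i, j)) \<in> borel_measurable M"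
  using assms by (auto simp: measurable_mat_borel_iff)

lemma measurable_mat_mult:
  assumes A: "A \<in> measurable M (mat_borel n m)" and B: "B \<in> measurable M (mat_borel m k)"
  shows "(\<lambda>\<omega>. A \<omega> * B \<omega>) \<in> measurable M (mat_borel n k)"
proof (rule measurable_mat_borelI)
  note a = measurable_mat_borelD[OF A] and b = measurable_mat_borelD[OF B]
  show "A \<omega> * B \<omega> \<in> carrier_mat n k" if "\<omega> \<in> space M" for \<omega>
    using a(1)[OF that] b(1)[OF that] by auto
  fix i j assume ij: "i < n" "j < k"
  have "(\<lambda>\<omega>. \<Sum>l<m. A \<omega> $$ (i, l) * B \<omega> $$ (l, j)) \<in> borel_measurable M"
    using a b ij by (intro borel_measurable_sum borel_measurable_times) auto
  moreover have "(A \<omega> * B \<omega>) $$ (i, j) = (\<Sum>l<m. A \<omega> $$ (i, l) * B \<omega> $$ (l, j))" if "\<omega> \<in> space M" for \<omega>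
    using a(1)[OF that] b(1)[OF that] ij by (simp add: scalar_prod_def lessThan_atLeast0)
  ultimately show "(\<lambda>\<omega>. (A \<omega> * B \<omega>) $$ (i, j)) \<in> borel_measurable M"
    by (subst measurable_cong) auto
qed

lemma measurable_mat_transpose:
  assumes A: "A \<in> measurable M (mat_borel n m)"
  shows "(\<lambda>\<omega>. transpose_mat (A \<omega>)) \<in> measurable M (mat_borel m n)"
proof (rule measurable_mat_borelI)
  note a = measurable_mat_borelD[OF A]
  show "transpose_mat (A \<omega>) \<in> carrier_mat m n" if "\<omega> \<in> space M" for \<omega>
    using a(1)[OF that] by simp
  fix i j assume ij: "i < m" "j < n"
  have "transpose_mat (A \<omega>) $$ (i, j) = A \<omega> $$ (j, i)" if "\<omega> \<in> space M" for \<omega>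
    using a(1)[OF that] ij by auto
  then show "(\<lambda>\<omega>. transpose_mat (A \<omega>) $$ (i, j)) \<in> borel_measurable M"
    using a(2)[OF ij(2,1)] by (subst measurable_cong) auto
qed

lemma measurable_mat_add:
  assumes A: "A \<in> measurable M (mat_borel n m)" and B: "B \<in> measurable M (mat_borel n m)"
  shows "(\<lambda>\<omega>. A \<omega> + B \<omega>) \<in> measurable M (mat_borel n m)"
proof (rule measurable_mat_borelI)
  note a = measurable_mat_borelD[OF A] and b = measurable_mat_borelD[OF B]
  show "A \<omega> + B \<omega> \<in> carrier_mat n m" if "\<omega> \<in> space M" for \<omega>
    using a(1)[OF that] b(1)[OF that] by auto
  fix i j assume ij: "i < n" "j < m"
  have "(\<lambda>\<omega>. A \<omega> $$ (i, j) + B \<omega> $$ (i, j)) \<in> borel_measurable M"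
    using a b ij by (intro borel_measurable_add) auto
  moreover have "(A \<omega> + B \<omega>) $$ (i, j) = A \<omega> $$ (i, j) + B \<omega> $$ (i, j)" if "\<omega> \<in> space M" for \<omega>
    using a(1)[OF that] b(1)[OF that] ij by auto
  ultimately show "(\<lambda>\<omega>. (A \<omega> + B \<omega>) $$ (i, j)) \<in> borel_measurable M"
    by (subst measurable_cong) auto
qed

lemma measurable_mat_smult:
  assumes A: "A \<in> measurable M (mat_borel n m)" and c: "c \<in> borel_measurable M"
  shows "(\<lambda>\<omega>. c \<omega> \<cdot>\<^sub>m A \<omega>) \<in> measurable M (mat_borel n m)"
proof (rule measurable_mat_borelI)
  note a = measurable_mat_borelD[OF A]
  show "c \<omega> \<cdot>\<^sub>m A \<omega> \<in> carrier_mat n m" if "\<omega> \<in> space M" for \<omega>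
    using a(1)[OF that] by auto
  fix i j assume ij: "i < n" "j < m"
  have "(\<lambda>\<omega>. c \<omega> * A \<omega> $$ (i, j)) \<in> borel_measurable M"
    using a ij c by (intro borel_measurable_times) auto
  moreover have "(c \<omega> \<cdot>\<^sub>m A \<omega>) $$ (i, j) = c \<omega> * A \<omega> $$ (i, j)" if "\<omega> \<in> space M" for \<omega>
    using a(1)[OF that] ij by auto
  ultimately show "(\<lambda>\<omega>. (c \<omega> \<cdot>\<^sub>m A \<omega>) $$ (i, j)) \<in> borel_measurable M"
    by (subst measurable_cong) auto
qed

lemma measurable_mat_const: "A \<in> carrier_mat n m \<Longrightarrow> (\<lambda>_. A) \<in> measurable M (mat_borel n m)"
  by (rule measurable_mat_borelI) auto

section \<open>Determinants, ridge regularisation and the column projection\<close>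

lemma measurable_det:
  assumes A: "A \<in> measurable M (mat_borel n n)"
  shows "(\<lambda>\<omega>. Determinant.det (A \<omega>)) \<in> borel_measurable M"
proof -
  note a = measurable_mat_borelD[OF A]
  have "(\<lambda>\<omega>. \<Sum>p\<in>{p. p permutes {0..<n}}. signof p * (\<Prod>i = 0..<n. A \<omega> $$ (i, p i))) \<in> borel_measurable M"
    using a(2) by (intro borel_measurable_sum borel_measurable_times borel_measurable_prod borel_measurable_const)
       (auto simp: permutes_in_image)
  moreover have "Determinant.det (A \<omega>) = (\<Sum>p\<in>{p. p permutes {0..<n}}. signof p * (\<Prod>i = 0..<n. A \<omega> $$ (i, p i)))"
    if "\<omega> \<in> space M" for \<omega>
    by (rule det_def'[OF a(1)[OF that]])
  ultimately show ?thesis by (subst measurable_cong) auto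
qed

lemma measurable_adj_mat:
  assumes A: "A \<in> measurable M (mat_borel n n)"
  shows "(\<lambda>\<omega>. adj_mat (A \<omega>)) \<in> measurable M (mat_borel n n)"
proof (rule measurable_mat_borelI)
  note a = measurable_mat_borelD[OF A]
  show "adj_mat (A \<omega>) \<in> carrier_mat n n" if "\<omega> \<in> space M" for \<omega>
    by (rule adj_mat(1)[OF a(1)[OF that]])
  fix i j assume ij: "i < n" "j < n"
  have del: "(\<lambda>\<omega>. mat_delete (A \<omega>) j i) \<in> measurable M (mat_borel (n - 1) (n - 1))"
  proof (rule measurable_mat_borelI)
    show "mat_delete (A \<omega>) j i \<in> carrier_mat (n - 1) (n - 1)" if "\<omega> \<in> space M" for \<omega>
      using a(1)[OF that] by (intro mat_delete_carrier)
    fix k l assume kl: "k < n - 1" "l < n - 1"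
    have "mat_delete (A \<omega>) j i $$ (k, l) = A \<omega> $$ (if k < j then k else Suc k, if l < i then l else Suc l)"
      if "\<omega> \<in> space M" for \<omega>
      using a(1)[OF that] kl by (auto simp: mat_delete_def)
    moreover have "(\<lambda>\<omega>. A \<omega> $$ (if k < j then k else Suc k, if l < i then l else Suc l)) \<in> borel_measurable M"
      using kl by (intro a(2)) auto
    ultimately show "(\<lambda>\<omega>. mat_delete (A \<omega>) j i $$ (k, l)) \<in> borel_measurable M"
      by (subst measurable_cong) auto
  qed
  have "(\<lambda>\<omega>. (-1) ^ (j + i) * Determinant.det (mat_delete (A \<omega>) j i)) \<in> borel_measurable M"
    using measurable_det[OF del] by (intro borel_measurable_times) auto
  moreover have "adj_mat (A \<omega>) $$ (i, j) = (-1) ^ (j + i) * Determinant.det (mat_delete (A \<omega>) j i)"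
    if "\<omega> \<in> space M" for \<omega>
    using a(1)[OF that] ij by (auto simp: adj_mat_def cofactor_def)
  ultimately show "(\<lambda>\<omega>. adj_mat (A \<omega>) $$ (i, j)) \<in> borel_measurable M"
    by (subst measurable_cong) auto
qed

text \<open>The inverse of the Gram matrix plus \<delta> times the identity, written by Cramer's
  rule. Its entries are rational functions of those of \<open>A\<close> with nonvanishing
  denominator, hence measurable in \<open>A\<close>, whereas \<open>pinv\<close> is given by a
  description and jumps where the rank drops.\<close>

definition ridge_inv :: "real \<Rightarrow> real mat \<Rightarrow> real mat" where
  "ridge_inv \<delta> A = (let S = transpose_mat A * A + \<delta> \<cdot>\<^sub>m 1\<^sub>m (dim_col A) in (1 / Determinant.det S) \<cdot>\<^sub>m adj_mat S)"

definition ridge_proj :: "real \<Rightarrow> real mat \<Rightarrow> real mat" where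
  "ridge_proj \<delta> A = A * ridge_inv \<delta> A * transpose_mat A"

lemma ridge_inv:
  assumes A: "A \<in> carrier_mat m n" and \<delta>: "0 < \<delta>"
  defines "S \<equiv> transpose_mat A * A + \<delta> \<cdot>\<^sub>m 1\<^sub>m n"
  shows "ridge_inv \<delta> A \<in> carrier_mat n n" "ridge_inv \<delta> A * S = 1\<^sub>m n" "S * ridge_inv \<delta> A = 1\<^sub>m n"
    "\<And>c. c \<in> carrier_vec n \<Longrightarrow> c \<bullet> (S *\<^sub>v c) = sqn (A *\<^sub>v c) + \<delta> * sqn c"
proof -
  have G: "transpose_mat A * A \<in> carrier_mat n n" using A by auto
  have I: "\<delta> \<cdot>\<^sub>m 1\<^sub>m n \<in> carrier_mat n n" by simp
  have S: "S \<in> carrier_mat n n" using G by (simp add: S_def)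
  have form: "c \<bullet> (S *\<^sub>v c) = sqn (A *\<^sub>v c) + \<delta> * sqn c" if c: "c \<in> carrier_vec n" for c
  proof -
    have 1: "(\<delta> \<cdot>\<^sub>m 1\<^sub>m n) *\<^sub>v c = \<delta> \<cdot>\<^sub>v c"
      using c by (intro eq_vecI) (auto simp: smult_scalar_prod_distrib[of _ n])
    have "S *\<^sub>v c = (transpose_mat A * A) *\<^sub>v c + \<delta> \<cdot>\<^sub>v c"
      unfolding S_def add_mult_distrib_mat_vec[OF G I c] 1 ..
    moreover have "(transpose_mat A * A) *\<^sub>v c \<in> carrier_vec n" by (rule mult_mat_vec_carrier[OF G c])
    ultimately show ?thesis
      using sqn_mult_mat_vec[OF A c] c by (simp add: scalar_prod_add_distrib[of _ n] sqn_def)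
  qed
  then show "\<And>c. c \<in> carrier_vec n \<Longrightarrow> c \<bullet> (S *\<^sub>v c) = sqn (A *\<^sub>v c) + \<delta> * sqn c" .
  have "Determinant.det S \<noteq> 0"
  proof
    assume "Determinant.det S = 0"
    then obtain c where c: "c \<in> carrier_vec n" "c \<noteq> 0\<^sub>v n" "S *\<^sub>v c = 0\<^sub>v n"
      using det_0_iff_vec_prod_zero_field[OF S] by auto
    then have "sqn (A *\<^sub>v c) + \<delta> * sqn c = 0" using form[OF c(1)] by simp
    moreover have "0 < sqn c" using sqn_eq_0[OF c(1)] c(2) sqn_nonneg[of c] by linarith
    ultimately show False using \<delta> sqn_nonneg[of "A *\<^sub>v c"] by (smt (verit) mult_pos_pos)
  qed
  moreover have R: "ridge_inv \<delta> A = (1 / Determinant.det S) \<cdot>\<^sub>m adj_mat S"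
    using A by (auto simp: ridge_inv_def Let_def S_def)
  moreover note adj = adj_mat[OF S]
  ultimately show "ridge_inv \<delta> A \<in> carrier_mat n n" "ridge_inv \<delta> A * S = 1\<^sub>m n" "S * ridge_inv \<delta> A = 1\<^sub>m n"
    by (auto simp: mult_smult_assoc_mat[OF adj(1) S] mult_smult_distrib[OF S adj(1)] adj(2,3) intro!: eq_matI)
qed

text \<open>With \<open>y\<close> the ridge solution, the ridge projection of \<open>x\<close> is
  \<open>A y\<close>, and the normal equations give \<open>sqn (A y) + \<delta> * sqn y\<close>
  equal to \<open>A y\<close> paired with \<open>x\<close>. Dropping the term with \<delta> and
  applying Cauchy-Schwarz finishes.\<close>

lemma ridge_proj_contraction:
  assumes A: "A \<in> carrier_mat m n" and \<delta>: "0 < \<delta>" and x: "x \<in> carrier_vec m"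
  shows "sqn (ridge_proj \<delta> A *\<^sub>v x) \<le> sqn x"
proof -
  note K = ridge_inv[OF A \<delta>]
  define S where "S = transpose_mat A * A + \<delta> \<cdot>\<^sub>m 1\<^sub>m n"
  have S: "S \<in> carrier_mat n n" using A by (auto simp: S_def)
  have AT: "transpose_mat A \<in> carrier_mat n m" using A by simp
  have ATx: "transpose_mat A *\<^sub>v x \<in> carrier_vec n" by (rule mult_mat_vec_carrier[OF AT x])
  define y where "y = ridge_inv \<delta> A *\<^sub>v (transpose_mat A *\<^sub>v x)"
  have y: "y \<in> carrier_vec n" unfolding y_def by (rule mult_mat_vec_carrier[OF K(1) ATx])
  have Ay: "A *\<^sub>v y \<in> carrier_vec m" by (rule mult_mat_vec_carrier[OF A y])
  have "ridge_proj \<delta> A *\<^sub>v x = (A * ridge_inv \<delta> A) *\<^sub>v (transpose_mat A *\<^sub>v x)"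
    unfolding ridge_proj_def by (rule assoc_mult_mat_vec[OF mult_carrier_mat[OF A K(1)] AT x])
  also have "\<dots> = A *\<^sub>v y" unfolding y_def by (rule assoc_mult_mat_vec[OF A K(1) ATx])
  finally have Px: "ridge_proj \<delta> A *\<^sub>v x = A *\<^sub>v y" .
  have "S *\<^sub>v y = (S * ridge_inv \<delta> A) *\<^sub>v (transpose_mat A *\<^sub>v x)"
    unfolding y_def by (rule assoc_mult_mat_vec[OF S K(1) ATx, symmetric])
  then have "S *\<^sub>v y = transpose_mat A *\<^sub>v x" using K(3) ATx by (simp add: S_def)
  then have "sqn (A *\<^sub>v y) + \<delta> * sqn y = y \<bullet> (transpose_mat A *\<^sub>v x)" using K(4)[OF y] by (simp add: S_def)
  also have "\<dots> = (A *\<^sub>v y) \<bullet> x" by (rule scalar_prod_transpose[OF A y x])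
  finally have "sqn (A *\<^sub>v y) \<le> (A *\<^sub>v y) \<bullet> x" using \<delta> by (smt (verit) mult_nonneg_nonneg sqn_nonneg)
  then have "(sqn (A *\<^sub>v y))\<^sup>2 \<le> ((A *\<^sub>v y) \<bullet> x)\<^sup>2" by (intro power_mono) auto
  also have "\<dots> \<le> sqn (A *\<^sub>v y) * sqn x" by (rule scalar_prod_Cauchy_Schwarz[OF Ay x])
  finally have "sqn (A *\<^sub>v y) * sqn (A *\<^sub>v y) \<le> sqn (A *\<^sub>v y) * sqn x" by (simp add: power2_eq_square)
  moreover have "0 < sqn (A *\<^sub>v y)" if "sqn (A *\<^sub>v y) \<noteq> 0" using that sqn_nonneg[of "A *\<^sub>v y"] by linarith
  ultimately have "sqn (A *\<^sub>v y) \<le> sqn x"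
    by (cases "sqn (A *\<^sub>v y) = 0") (simp_all add: mult_le_cancel_left_pos)
  then show ?thesis by (simp add: Px)
qed

text \<open>With \<open>H\<close> the transpose of \<open>pinv A\<close> times
  \<open>pinv A\<close>, there is the exact identity \<open>col_proj A = P + \<delta> P H\<close>
  for the ridge projection \<open>P\<close>. Entries of \<open>P\<close> are at most one in modulus
  by contraction, so the error is at most \<delta> times a constant that depends on \<open>A\<close>
  alone.\<close>

lemma ridge_proj_tendsto:
  assumes A: "A \<in> carrier_mat m n" and ij: "i < m" "j < m"
  shows "(\<lambda>k. ridge_proj (1 / real (Suc k)) A $$ (i, j)) \<longlonglongrightarrow> col_proj A $$ (i, j)"
proof -
  have X: "pinv A \<in> carrier_mat n m" "A * pinv A * A = A" "pinv A * A * pinv A = pinv A"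
    "transpose_mat (A * pinv A) = A * pinv A" "transpose_mat (pinv A * A) = pinv A * A"
    using pinv[of A] A by (auto simp: is_pinv_def)
  define H where "H = transpose_mat (pinv A) * pinv A"
  have H: "H \<in> carrier_mat m m" using X by (auto simp: H_def)
  have d: "dim_row A = m" "dim_col A = n" "dim_row (pinv A) = n" "dim_col (pinv A) = m" using A X by auto
  have AX: "pinv A = transpose_mat A * H"
  proof -
    have "pinv A = pinv A * A * pinv A" by (simp only: X(3))
    also have "\<dots> = transpose_mat (pinv A * A) * pinv A" by (simp only: X(5))
    also have "\<dots> = transpose_mat A * transpose_mat (pinv A) * pinv A"
      by (subst mat_mult_transpose) (simp_all add: d)
    also have "\<dots> = transpose_mat A * H" unfolding H_def by (rule mat_mult_assoc) (simp_all add: d)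
    finally show ?thesis .
  qed
  have AT: "transpose_mat A = transpose_mat A * (A * pinv A)"
  proof -
    have "transpose_mat A = transpose_mat (A * pinv A * A)" by (simp only: X(2))
    also have "\<dots> = transpose_mat A * transpose_mat (A * pinv A)" by (rule mat_mult_transpose) (simp add: d)
    finally show ?thesis by (simp only: X(4))
  qed
  have err: "\<bar>ridge_proj \<delta> A $$ (i, j) - col_proj A $$ (i, j)\<bar> \<le> \<delta> * (\<Sum>k<m. \<bar>H $$ (k, j)\<bar>)" if \<delta>: "0 < \<delta>" for \<delta>
  proof -
    note K = ridge_inv[OF A \<delta>]
    let ?K = "ridge_inv \<delta> A" let ?P = "ridge_proj \<delta> A"
    have dK: "dim_row ?K = n" "dim_col ?K = n" using K(1) by auto
    have P: "?P \<in> carrier_mat m m" unfolding ridge_proj_def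
      by (rule mult_carrier_mat[OF mult_carrier_mat[OF A K(1)]]) (use A in simp)
    have G: "transpose_mat A * A \<in> carrier_mat n n" and \<delta>I: "\<delta> \<cdot>\<^sub>m 1\<^sub>m n \<in> carrier_mat n n"
      and AT': "transpose_mat A \<in> carrier_mat n m" using A by auto
    note KG = mult_carrier_mat[OF K(1) G] and AK = mult_carrier_mat[OF A K(1)]
    have \<delta>K: "\<delta> \<cdot>\<^sub>m ?K \<in> carrier_mat n n" and \<delta>AK: "\<delta> \<cdot>\<^sub>m (A * ?K) \<in> carrier_mat m n"
      using K(1) AK by simp_all
    have 1: "?K * (transpose_mat A * A + \<delta> \<cdot>\<^sub>m 1\<^sub>m n) = ?K * (transpose_mat A * A) + \<delta> \<cdot>\<^sub>m ?K"
      unfolding mult_add_distrib_mat[OF K(1) G \<delta>I] mult_smult_distrib[OF K(1) one_carrier_mat]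
        right_mult_one_mat[OF K(1)] ..
    have 2: "A * (?K * (transpose_mat A * A) + \<delta> \<cdot>\<^sub>m ?K) = A * (?K * (transpose_mat A * A)) + \<delta> \<cdot>\<^sub>m (A * ?K)"
      unfolding mult_add_distrib_mat[OF A KG \<delta>K] mult_smult_distrib[OF A K(1)] ..
    have 3: "(A * (?K * (transpose_mat A * A)) + \<delta> \<cdot>\<^sub>m (A * ?K)) * pinv A
        = A * (?K * (transpose_mat A * A)) * pinv A + \<delta> \<cdot>\<^sub>m (A * ?K * pinv A)"
      unfolding add_mult_distrib_mat[OF mult_carrier_mat[OF A KG] \<delta>AK X(1)] mult_smult_assoc_mat[OF AK X(1)] ..
    have "A * (?K * (transpose_mat A * A)) * pinv A = A * ?K * (transpose_mat A * (A * pinv A))"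
      using d dK by (simp add: mat_mult_assoc)
    also have "\<dots> = A * ?K * transpose_mat A" by (subst AT[symmetric]) (rule refl)
    finally have 4: "A * (?K * (transpose_mat A * A)) * pinv A = ?P" by (simp only: ridge_proj_def)
    have "A * ?K * pinv A = A * ?K * (transpose_mat A * H)" by (subst AX) (rule refl)
    also have "\<dots> = A * ?K * transpose_mat A * H" by (rule assoc_mult_mat[OF AK AT' H, symmetric])
    finally have 5: "A * ?K * pinv A = ?P * H" by (simp only: ridge_proj_def)
    \<comment> \<open>The ridge inverse times its own matrix is inserted in the middle of
      \<open>A * pinv A\<close>; expanding that matrix produces the two terms of the
      identity.\<close>
    have "col_proj A = A * (?K * (transpose_mat A * A + \<delta> \<cdot>\<^sub>m 1\<^sub>m n)) * pinv A"
      unfolding K(2) right_mult_one_mat[OF A] by (simp only: col_proj_def)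
    then have eq: "col_proj A = ?P + \<delta> \<cdot>\<^sub>m (?P * H)" by (simp only: 1 2 3 4 5)
    have ent: "\<bar>?P $$ (i, k)\<bar> \<le> 1" if k: "k < m" for k
    proof -
      have u: "(unit_vec m k :: real vec) \<in> carrier_vec m" by simp
      have "?P $$ (i, k) = (?P *\<^sub>v unit_vec m k) $ i" using P ij k by (simp add: carrier_matD[OF P])
      then have "(?P $$ (i, k))\<^sup>2 \<le> (\<Sum>l<m. ((?P *\<^sub>v unit_vec m k) $ l)\<^sup>2)"
        using ij member_le_sum[of i "{..<m}" "\<lambda>l. ((?P *\<^sub>v unit_vec m k) $ l)\<^sup>2"]
        by (simp del: index_mult_mat_vec)
      also have "\<dots> = sqn (?P *\<^sub>v unit_vec m k)" using P by (simp add: sqn_sum[of _ m] mult_mat_vec_carrier[of _ m m] del: index_mult_mat_vec)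
      also have "\<dots> \<le> sqn (unit_vec m k)" by (rule ridge_proj_contraction[OF A \<delta> u])
      also have "\<dots> = 1" using k by (simp add: sqn_def)
      finally show ?thesis by (simp add: abs_square_le_1)
    qed
    have "(?P * H) $$ (i, j) = (\<Sum>k<m. ?P $$ (i, k) * H $$ (k, j))"
      using P H ij by (simp add: scalar_prod_def lessThan_atLeast0)
    also have "\<bar>\<dots>\<bar> \<le> (\<Sum>k<m. \<bar>?P $$ (i, k) * H $$ (k, j)\<bar>)" by (rule sum_abs)
    also have "\<dots> \<le> (\<Sum>k<m. \<bar>H $$ (k, j)\<bar>)"
      using ent by (intro sum_mono) (auto simp: abs_mult intro!: mult_left_le_one_le)
    finally have "\<delta> * \<bar>(?P * H) $$ (i, j)\<bar> \<le> \<delta> * (\<Sum>k<m. \<bar>H $$ (k, j)\<bar>)" using \<delta> by (intro mult_left_mono) auto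
    moreover have "col_proj A $$ (i, j) = ?P $$ (i, j) + \<delta> * (?P * H) $$ (i, j)"
      unfolding eq using P H ij by (simp del: index_mult_mat(1))
    ultimately show ?thesis using \<delta> by (simp add: abs_mult)
  qed
  have lim: "(\<lambda>k. 1 / real (Suc k) * (\<Sum>k<m. \<bar>H $$ (k, j)\<bar>)) \<longlonglongrightarrow> 0"
    using tendsto_mult[OF LIMSEQ_Suc[OF lim_1_over_n] tendsto_const, of "\<Sum>k<m. \<bar>H $$ (k, j)\<bar>"] by simp
  have "(\<lambda>k. ridge_proj (1 / real (Suc k)) A $$ (i, j) - col_proj A $$ (i, j)) \<longlonglongrightarrow> 0"
  proof (rule Lim_null_comparison[OF always_eventually lim], rule allI)
    fix k
    show "norm (ridge_proj (1 / real (Suc k)) A $$ (i, j) - col_proj A $$ (i, j)) \<le> 1 / real (Suc k) * (\<Sum>k<m. \<bar>H $$ (k, j)\<bar>)"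
      unfolding real_norm_def by (rule err) simp
  qed
  then show ?thesis by (simp add: LIM_zero_iff)
qed

lemma measurable_col_proj:
  assumes A: "A \<in> measurable M (mat_borel m n)"
  shows "(\<lambda>\<omega>. col_proj (A \<omega>)) \<in> measurable M (mat_borel m m)"
proof (rule measurable_mat_borelI)
  note a = measurable_mat_borelD[OF A]
  show "col_proj (A \<omega>) \<in> carrier_mat m m" if "\<omega> \<in> space M" for \<omega>
    by (rule col_proj(1)[OF a(1)[OF that]])
  have ridge: "(\<lambda>\<omega>. ridge_proj \<delta> (A \<omega>)) \<in> measurable M (mat_borel m m)" for \<delta>
  proof -
    define S where "S \<omega> = transpose_mat (A \<omega>) * A \<omega> + \<delta> \<cdot>\<^sub>m 1\<^sub>m n" for \<omega>
    have S: "S \<in> measurable M (mat_borel n n)"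
      unfolding S_def
      by (intro measurable_mat_add measurable_mat_mult[of _ _ n m] measurable_mat_transpose A measurable_mat_const) simp
    have "(\<lambda>\<omega>. A \<omega> * ((1 / Determinant.det (S \<omega>)) \<cdot>\<^sub>m adj_mat (S \<omega>)) * transpose_mat (A \<omega>)) \<in> measurable M (mat_borel m m)"
      by (intro measurable_mat_mult[of _ _ m n] measurable_mat_mult[of _ _ n n] measurable_mat_smult measurable_adj_mat
          measurable_mat_transpose A S borel_measurable_divide borel_measurable_const measurable_det[OF S])
    moreover have "ridge_proj \<delta> (A \<omega>) = A \<omega> * ((1 / Determinant.det (S \<omega>)) \<cdot>\<^sub>m adj_mat (S \<omega>)) * transpose_mat (A \<omega>)"
      if "\<omega> \<in> space M" for \<omega>
      using a(1)[OF that] by (auto simp: ridge_proj_def ridge_inv_def Let_def S_def)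
    ultimately show ?thesis by (subst measurable_cong) auto
  qed
  fix i j assume ij: "i < m" "j < m"
  show "(\<lambda>\<omega>. col_proj (A \<omega>) $$ (i, j)) \<in> borel_measurable M"
  proof (rule borel_measurable_LIMSEQ_real)
    show "(\<lambda>k. ridge_proj (1 / real (Suc k)) (A \<omega>) $$ (i, j)) \<longlonglongrightarrow> col_proj (A \<omega>) $$ (i, j)"
      if "\<omega> \<in> space M" for \<omega>
      by (rule ridge_proj_tendsto[OF a(1)[OF that] ij])
    show "(\<lambda>\<omega>. ridge_proj (1 / real (Suc k)) (A \<omega>) $$ (i, j)) \<in> borel_measurable M" for k
      by (rule measurable_mat_borelD(2)[OF ridge ij])
  qed
qed

lemma measurable_with_ones:
  assumes A: "A \<in> measurable M (mat_borel m n)"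
  shows "(\<lambda>\<omega>. with_ones (A \<omega>)) \<in> measurable M (mat_borel m (1 + n))"
proof (rule measurable_mat_borelI)
  note a = measurable_mat_borelD[OF A]
  show "with_ones (A \<omega>) \<in> carrier_mat m (1 + n)" if "\<omega> \<in> space M" for \<omega>
    using a(1)[OF that] by (auto simp: with_ones_def)
  fix i j assume ij: "i < m" "j < 1 + n"
  have "(\<lambda>\<omega>. if j = 0 then 1 else A \<omega> $$ (i, j - 1)) \<in> borel_measurable M"
    using a(2)[of i "j - 1"] ij by (cases "j = 0") auto
  moreover have "with_ones (A \<omega>) $$ (i, j) = (if j = 0 then 1 else A \<omega> $$ (i, j - 1))" if "\<omega> \<in> space M" for \<omega>
    using a(1)[OF that] ij by (auto simp: with_ones_def)
  ultimately show "(\<lambda>\<omega>. with_ones (A \<omega>) $$ (i, j)) \<in> borel_measurable M"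
    by (subst measurable_cong) auto
qed

section \<open>Norm of a random matrix with independent entries\<close>

text \<open>Vertices of the complete bipartite graph on the rows (\<open>Inl\<close>) and the
  columns (\<open>Inr\<close>) of a matrix; its edges are the matrix positions.\<close>

type_synonym vertex = "nat + nat"

text \<open>The default value is never reached along a walk, where consecutive vertices lie on
  opposite sides.\<close>

fun edge :: "vertex \<Rightarrow> vertex \<Rightarrow> nat \<times> nat" where
  "edge (Inl i) (Inr t) = (i, t)"
| "edge (Inr t) (Inl i) = (i, t)"
| "edge _ _ = (0, 0)"

fun nbrs :: "nat \<Rightarrow> nat \<Rightarrow> vertex \<Rightarrow> vertex set" where
  "nbrs n m (Inl i) = Inr ` {..<m}"
| "nbrs n m (Inr t) = Inl ` {..<n}"

text \<open>The start is not part of the list, so that the length of the list is the number of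
  steps.\<close>

fun walks :: "nat \<Rightarrow> nat \<Rightarrow> nat \<Rightarrow> vertex \<Rightarrow> vertex list set" where
  "walks n m 0 a = {[]}"
| "walks n m (Suc k) a = (\<Union>b\<in>nbrs n m a. (#) b ` walks n m k b)"

fun walk_edges :: "vertex \<Rightarrow> vertex list \<Rightarrow> (nat \<times> nat) list" where
  "walk_edges a [] = []"
| "walk_edges a (b # w) = edge a b # walk_edges b w"

text \<open>An entry of the \<open>k\<close>-th power of the bipartite adjacency matrix with edge
  weights \<open>x\<close>; for even length and column vertices it is an entry of a power of the
  Gram matrix.\<close>

fun walk_sum :: "nat \<Rightarrow> nat \<Rightarrow> (nat \<times> nat \<Rightarrow> real) \<Rightarrow> nat \<Rightarrow> vertex \<Rightarrow> vertex \<Rightarrow> real" where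
  "walk_sum n m x 0 a c = (if a = c then 1 else 0)"
| "walk_sum n m x (Suc k) a c = (\<Sum>b\<in>nbrs n m a. x (edge a b) * walk_sum n m x k b c)"

lemma finite_nbrs [simp]: "finite (nbrs n m a)"
  by (cases a) auto

lemma card_nbrs: "card (nbrs n m a) \<le> max n m"
  by (cases a) (auto simp: card_image)

lemma inj_on_edge: "inj_on (edge a) (nbrs n m a)"
  by (cases a) (auto simp: inj_on_def)

lemma finite_walks [simp]: "finite (walks n m k a)"
  by (induction k arbitrary: a) auto

lemma length_walk_edges [simp]: "length (walk_edges a w) = length w"
  by (induction w arbitrary: a) auto

lemma length_walks: "w \<in> walks n m k a \<Longrightarrow> length w = k"
  by (induction k arbitrary: a w) auto

fun vertex_in :: "nat \<Rightarrow> nat \<Rightarrow> vertex \<Rightarrow> bool" where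
  "vertex_in n m (Inl i) \<longleftrightarrow> i < n"
| "vertex_in n m (Inr t) \<longleftrightarrow> t < m"

lemma set_walk_edges:
  "vertex_in n m a \<Longrightarrow> w \<in> walks n m k a \<Longrightarrow> set (walk_edges a w) \<subseteq> {..<n} \<times> {..<m}"
proof (induction k arbitrary: a w)
  case (Suc k)
  then obtain b w' where w: "w = b # w'" "b \<in> nbrs n m a" "w' \<in> walks n m k b" by auto
  have "vertex_in n m b" "edge a b \<in> {..<n} \<times> {..<m}"
    using w(2) Suc.prems(1) by (cases a; auto)+
  then show ?case using Suc.IH[of b w'] w by auto
qed simp

lemma sum_walks_Suc:
  "(\<Sum>w\<in>walks n m (Suc k) a. f w) = (\<Sum>b\<in>nbrs n m a. \<Sum>w\<in>walks n m k b. f (b # w))"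
proof -
  have "(\<Sum>w\<in>walks n m (Suc k) a. f w) = (\<Sum>b\<in>nbrs n m a. sum f ((#) b ` walks n m k b))"
    unfolding walks.simps by (rule sum.UNION_disjoint) auto
  also have "\<dots> = (\<Sum>b\<in>nbrs n m a. \<Sum>w\<in>walks n m k b. f (b # w))"
    by (intro sum.cong refl sum.reindex[THEN trans]) (auto simp: o_def)
  finally show ?thesis .
qed

lemma walk_sum_eq:
  "walk_sum n m x k a c = (\<Sum>w\<in>walks n m k a. if last (a # w) = c then \<Prod>e\<leftarrow>walk_edges a w. x e else 0)"
proof (induction k arbitrary: a)
  case (Suc k)
  show ?case
    unfolding sum_walks_Suc by (simp add: Suc sum_distrib_left if_distrib[of "\<lambda>y. _ * y"] cong: if_cong)
qed simp

text \<open>Each step of a walk either uses an edge of \<open>A\<close> (at most \<open>q\<close> choices, since an edge and its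
  start determine its end) or a new edge, which costs a factor \<open>x\<close>.\<close>

lemma sum_walks_power_card:
  fixes x :: real
  assumes "0 \<le> x" "finite A" "card A + k \<le> q"
  shows "(\<Sum>w\<in>walks n m k a. x ^ card (A \<union> set (walk_edges a w))) \<le> x ^ card A * (real q + real (max n m) * x) ^ k"
  using assms(2,3)
proof (induction k arbitrary: a A)
  case (Suc k)
  let ?c = "real q + real (max n m) * x"
  have c: "0 \<le> ?c" using assms by simp
  let ?S = "{b \<in> nbrs n m a. edge a b \<in> A}"
  have "card (edge a ` ?S) \<le> card A" using Suc.prems by (intro card_mono) auto
  moreover have "card (edge a ` ?S) = card ?S"
    using inj_on_edge[of a n m] by (intro card_image) (auto simp: inj_on_def)
  ultimately have S: "card ?S \<le> q" using Suc.prems by linarith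
  have "(\<Sum>w\<in>walks n m (Suc k) a. x ^ card (A \<union> set (walk_edges a w)))
      = (\<Sum>b\<in>nbrs n m a. \<Sum>w\<in>walks n m k b. x ^ card (insert (edge a b) A \<union> set (walk_edges b w)))"
    unfolding sum_walks_Suc by simp
  also have "\<dots> \<le> (\<Sum>b\<in>nbrs n m a. x ^ card (insert (edge a b) A) * ?c ^ k)"
    using Suc.prems by (intro sum_mono Suc.IH) (auto simp: card_insert_if)
  also have "\<dots> \<le> (\<Sum>b\<in>nbrs n m a. (if edge a b \<in> A then x ^ card A * ?c ^ k else 0) + x * x ^ card A * ?c ^ k)"
    using Suc.prems assms c by (intro sum_mono) (auto simp: card_insert_if insert_absorb)
  also have "\<dots> = real (card ?S) * (x ^ card A * ?c ^ k) + real (card (nbrs n m a)) * (x * x ^ card A * ?c ^ k)"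
    by (simp add: sum.distrib sum.If_cases Int_def)
  also have "\<dots> \<le> real q * (x ^ card A * ?c ^ k) + real (max n m) * (x * x ^ card A * ?c ^ k)"
    using S card_nbrs[of n m a] assms c
    by (intro add_mono mult_right_mono) (auto simp del: of_nat_max)
  also have "\<dots> = x ^ card A * ?c ^ Suc k" by (simp add: algebra_simps)
  finally show ?case .
qed simp

section \<open>Expectations of products along walks\<close>

lemma prod_list_count:
  fixes f :: "'a \<Rightarrow> real"
  shows "(\<Prod>e\<leftarrow>es. f e) = (\<Prod>e\<in>set es. f e ^ count_list es e)"
proof (induction es)
  case (Cons a es)
  show ?case
  proof (cases "a \<in> set es")
    case True
    have "(\<Prod>e\<in>set es. f e ^ count_list (a # es) e) = (\<Prod>e\<in>set es. (if e = a then f a else 1) * f e ^ count_list es e)"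
      by (intro prod.cong) auto
    also have "\<dots> = f a * (\<Prod>e\<in>set es. f e ^ count_list es e)"
      using True by (simp add: prod.distrib)
    finally show ?thesis using Cons True by (simp add: insert_absorb)
  next
    case False
    then have "(\<Prod>e\<in>set es. f e ^ count_list (a # es) e) = (\<Prod>e\<in>set es. f e ^ count_list es e)"
      by (intro prod.cong) auto
    then show ?thesis using Cons False by (simp add: count_notin)
  qed
qed simp

text \<open>Serves to decouple multiplicities: the bound \<open>2 * fact j * K ^ j\<close> for an
  edge used \<open>j\<close> times becomes \<open>4 / n\<^sup>2 * (n * K) ^ j\<close>. The
  multiplicities along a walk of length \<open>n\<close> add up to \<open>n\<close>, so the product
  over edges depends only on the number of distinct edges.\<close>

lemma fact_le_power_diff:
  assumes "2 \<le> j" "j \<le> n"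
  shows "fact j \<le> (2 * real n ^ (j - 2) :: real)"
  using assms
proof (induction j rule: dec_induct)
  case (step j)
  have "fact (Suc j) = real (Suc j) * fact j" by simp
  also have "\<dots> \<le> real n * (2 * real n ^ (j - 2))" using step by (intro mult_mono) auto
  also have "\<dots> = 2 * real n ^ (Suc j - 2)" 
  proof -
    have "Suc j - 2 = Suc (j - 2)" using step by linarith
    then show ?thesis by simp
  qed
  finally show ?case .
qed (simp add: numeral_2_eq_2)

context prob_space
begin

text \<open>By independence the expectation factorises over distinct edges. An edge that occurs
  exactly once contributes its mean, which is zero; otherwise every edge occurs at least twice and
  there are at most \<open>n / 2\<close> distinct ones.\<close>

lemma expectation_prod_list_bound:
  fixes x :: "'i \<Rightarrow> 'a \<Rightarrow> real"
  assumes ind: "indep_vars (\<lambda>_. borel) x I"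
    and mean: "\<And>e. e \<in> I \<Longrightarrow> expectation (x e) = 0"
    and int: "\<And>e j. e \<in> I \<Longrightarrow> integrable M (\<lambda>\<omega>. x e \<omega> ^ j)"
    and mom: "\<And>e j. e \<in> I \<Longrightarrow> expectation (\<lambda>\<omega>. \<bar>x e \<omega>\<bar> ^ j) \<le> 2 * fact j * K ^ j"
    and K: "0 < K" and es: "set es \<subseteq> I" "length es = n"
  shows "integrable M (\<lambda>\<omega>. \<Prod>e\<leftarrow>es. x e \<omega>)"
    and "\<bar>expectation (\<lambda>\<omega>. \<Prod>e\<leftarrow>es. x e \<omega>)\<bar>
      \<le> (if 2 * card (set es) \<le> n then (real n * K) ^ n * (4 / (real n)\<^sup>2) ^ card (set es) else 0)"
proof -
  define c where "c = count_list es"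
  have ind': "indep_vars (\<lambda>_. borel) (\<lambda>e \<omega>. x e \<omega> ^ c e) (set es)"
    by (rule indep_vars_compose2[OF indep_vars_subset[OF ind es(1)]]) auto
  have int': "integrable M (\<lambda>\<omega>. x e \<omega> ^ c e)" if "e \<in> set es" for e
    using int that es by auto
  have eq: "(\<lambda>\<omega>. \<Prod>e\<leftarrow>es. x e \<omega>) = (\<lambda>\<omega>. \<Prod>e\<in>set es. x e \<omega> ^ c e)"
    by (simp add: prod_list_count c_def)
  show "integrable M (\<lambda>\<omega>. \<Prod>e\<leftarrow>es. x e \<omega>)"
    unfolding eq by (rule indep_vars_integrable[OF _ ind' int']) auto
  have E: "expectation (\<lambda>\<omega>. \<Prod>e\<leftarrow>es. x e \<omega>) = (\<Prod>e\<in>set es. expectation (\<lambda>\<omega>. x e \<omega> ^ c e))"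
    unfolding eq by (rule indep_vars_lebesgue_integral[OF _ ind' int']) auto
  have sum_c: "(\<Sum>e\<in>set es. c e) = n"
    unfolding c_def using es by (simp add: sum_count_set)
  show "\<bar>expectation (\<lambda>\<omega>. \<Prod>e\<leftarrow>es. x e \<omega>)\<bar>
      \<le> (if 2 * card (set es) \<le> n then (real n * K) ^ n * (4 / (real n)\<^sup>2) ^ card (set es) else 0)"
  proof (cases "\<exists>e\<in>set es. c e = 1")
    case True
    then obtain e where "e \<in> set es" "c e = 1" by auto
    then have "expectation (\<lambda>\<omega>. x e \<omega> ^ c e) = 0" using mean es by auto
    then have "expectation (\<lambda>\<omega>. \<Prod>e\<leftarrow>es. x e \<omega>) = 0"
      unfolding E using \<open>e \<in> set es\<close> by (intro prod_zero) auto
    then show ?thesis using K by simp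
  next
    case False
    have c2: "2 \<le> c e" if "e \<in> set es" for e
    proof -
      have "0 < c e" unfolding c_def using that by (metis count_list_0_iff gr0I)
      moreover have "c e \<noteq> 1" using False that by auto
      ultimately show ?thesis by linarith
    qed
    have cn: "c e \<le> n" if "e \<in> set es" for e
      using sum_c member_le_sum[of e "set es" c] that by simp
    have "2 * card (set es) \<le> (\<Sum>e\<in>set es. c e)"
      using sum_mono[of "set es" "\<lambda>_. 2" c] c2 by simp
    then have card: "2 * card (set es) \<le> n" using sum_c by simp
    have one: "\<bar>expectation (\<lambda>\<omega>. x e \<omega> ^ c e)\<bar> \<le> 4 / (real n)\<^sup>2 * (real n * K) ^ c e" if e: "e \<in> set es" for e
    proof -
      have n0: "0 < n" using c2[OF e] cn[OF e] by linarith
      have "\<bar>expectation (\<lambda>\<omega>. x e \<omega> ^ c e)\<bar> \<le> expectation (\<lambda>\<omega>. \<bar>x e \<omega>\<bar> ^ c e)"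
        using integral_abs_bound[of M "\<lambda>\<omega>. x e \<omega> ^ c e"] by (simp add: power_abs)
      also have "\<dots> \<le> 2 * fact (c e) * K ^ c e" using mom e es by auto
      also have "\<dots> \<le> 2 * (2 * real n ^ (c e - 2)) * K ^ c e"
        using fact_le_power_diff[OF c2[OF e] cn[OF e]] K by (intro mult_right_mono mult_left_mono) auto
      also have "\<dots> = 4 / (real n)\<^sup>2 * (real n * K) ^ c e"
        using c2[OF e] n0 by (simp add: power_mult_distrib power_diff)
      finally show ?thesis .
    qed
    have "\<bar>expectation (\<lambda>\<omega>. \<Prod>e\<leftarrow>es. x e \<omega>)\<bar> = (\<Prod>e\<in>set es. \<bar>expectation (\<lambda>\<omega>. x e \<omega> ^ c e)\<bar>)"
      unfolding E by (rule abs_prod)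
    also have "\<dots> \<le> (\<Prod>e\<in>set es. 4 / (real n)\<^sup>2 * (real n * K) ^ c e)"
      using one by (intro prod_mono) auto
    also have "\<dots> = (4 / (real n)\<^sup>2) ^ card (set es) * (real n * K) ^ n"
      unfolding prod.distrib prod_constant power_sum[symmetric] sum_c ..
    finally show ?thesis using card by (simp add: mult.commute)
  qed
qed

text \<open>Write \<open>q = 2 k\<close> and \<open>D = max n m\<close>. The condition on
  \<open>k\<close> says \<open>q ^ 3 \<le> 4 D\<close>. For \<open>r \<le> k\<close> distinct edges
  the weight \<open>(4 / q\<^sup>2) ^ r\<close> is then at most
  \<open>(4 D / q ^ 3) ^ k * (q / D) ^ r\<close>, and summing \<open>(q / D) ^ r\<close> over all
  walks gives at most \<open>(q + D * (q / D)) ^ (2 k) = (2 q) ^ (2 k)\<close>. The three factors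
  multiply to the \<open>k\<close>-th power of \<open>16 K\<^sup>2 D q\<close>. Walks are counted
  without regard to their end and repeated edges are counted crudely; the price is the factor
  \<open>k\<close>, later a logarithm.\<close>

lemma expectation_walk_sum_bound:
  fixes x :: "nat \<times> nat \<Rightarrow> 'a \<Rightarrow> real"
  assumes ind: "indep_vars (\<lambda>_. borel) x ({..<n} \<times> {..<m})"
    and mean: "\<And>e. e \<in> {..<n} \<times> {..<m} \<Longrightarrow> expectation (x e) = 0"
    and int: "\<And>e j. e \<in> {..<n} \<times> {..<m} \<Longrightarrow> integrable M (\<lambda>\<omega>. x e \<omega> ^ j)"
    and mom: "\<And>e j. e \<in> {..<n} \<times> {..<m} \<Longrightarrow> expectation (\<lambda>\<omega>. \<bar>x e \<omega>\<bar> ^ j) \<le> 2 * fact j * K ^ j"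
    and K: "0 < K" and a: "vertex_in n m a" and k: "0 < k" "2 * k ^ 3 \<le> max n m"
  shows "integrable M (\<lambda>\<omega>. walk_sum n m (\<lambda>e. x e \<omega>) (2 * k) a c)"
    and "expectation (\<lambda>\<omega>. walk_sum n m (\<lambda>e. x e \<omega>) (2 * k) a c) \<le> (32 * K\<^sup>2 * real (max n m) * real k) ^ k"
proof -
  let ?I = "{..<n} \<times> {..<m}"
  let ?W = "walks n m (2 * k) a"
  define D where "D = real (max n m)"
  define q where "q = real (2 * k)"
  have q0: "0 < q" using k by (simp add: q_def)
  have "0 < k ^ 3" using k by simp
  then have D0: "0 < D" unfolding D_def using k(2) by linarith
  have Dq: "q ^ 3 \<le> 4 * D"
  proof -
    have "real (2 * k ^ 3) \<le> D" unfolding D_def using k(2) by (simp only: of_nat_le_iff)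
    then show ?thesis by (simp add: q_def power3_eq_cube)
  qed
  have len: "length (walk_edges a w) = 2 * k" if "w \<in> ?W" for w
    using length_walks[OF that] by simp
  have b: "integrable M (\<lambda>\<omega>. \<Prod>e\<leftarrow>walk_edges a w. x e \<omega>)"
    "\<bar>expectation (\<lambda>\<omega>. \<Prod>e\<leftarrow>walk_edges a w. x e \<omega>)\<bar>
      \<le> (if 2 * card (set (walk_edges a w)) \<le> 2 * k
          then (q * K) ^ (2 * k) * (4 / q\<^sup>2) ^ card (set (walk_edges a w)) else 0)" if "w \<in> ?W" for w
    unfolding q_def
    by (rule expectation_prod_list_bound[OF ind _ _ _ K set_walk_edges[OF a that] len[OF that]];
        use mean int mom in blast)+
  have intw: "integrable M (\<lambda>\<omega>. if last (a # w) = c then \<Prod>e\<leftarrow>walk_edges a w. x e \<omega> else 0)" if "w \<in> ?W" for w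
    using b(1)[OF that] by (cases "last (a # w) = c") simp_all
  show "integrable M (\<lambda>\<omega>. walk_sum n m (\<lambda>e. x e \<omega>) (2 * k) a c)"
    unfolding walk_sum_eq by (rule Bochner_Integration.integrable_sum) (rule intw)
  have "expectation (\<lambda>\<omega>. walk_sum n m (\<lambda>e. x e \<omega>) (2 * k) a c)
      = (\<Sum>w\<in>?W. expectation (\<lambda>\<omega>. if last (a # w) = c then \<Prod>e\<leftarrow>walk_edges a w. x e \<omega> else 0))"
    unfolding walk_sum_eq by (rule Bochner_Integration.integral_sum) (rule intw)
  also have "\<dots> \<le> (\<Sum>w\<in>?W. (q * K) ^ (2 * k) * (4 * D / q ^ 3) ^ k * (q / D) ^ card ({} \<union> set (walk_edges a w)))"
  proof (rule sum_mono)
    fix w assume w: "w \<in> ?W"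
    define r where "r = card (set (walk_edges a w))"
    have "expectation (\<lambda>\<omega>. if last (a # w) = c then \<Prod>e\<leftarrow>walk_edges a w. x e \<omega> else 0)
        \<le> \<bar>expectation (\<lambda>\<omega>. \<Prod>e\<leftarrow>walk_edges a w. x e \<omega>)\<bar>"
      by (cases "last (a # w) = c") (simp_all only: if_True if_False simp_thms abs_ge_self integral_zero abs_ge_zero)
    also have "\<dots> \<le> (if 2 * r \<le> 2 * k then (q * K) ^ (2 * k) * (4 / q\<^sup>2) ^ r else 0)"
      using b(2)[OF w] unfolding r_def .
    also have "\<dots> \<le> (q * K) ^ (2 * k) * ((4 * D / q ^ 3) ^ k * (q / D) ^ r)"
    proof (cases "r \<le> k")
      case True
      \<comment> \<open>The factor \<open>4 D / q ^ 3\<close> is at least one, so its exponent may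
        be raised from \<open>r\<close> to \<open>k\<close>; what remains depends on the walk only
        through the number of its edges.\<close>
      have "(4 / q\<^sup>2) ^ r = (4 * D / q ^ 3) ^ r * (q / D) ^ r"
        using q0 D0 by (simp add: power2_eq_square power3_eq_cube flip: power_mult_distrib)
      also have "\<dots> \<le> (4 * D / q ^ 3) ^ k * (q / D) ^ r"
        using True Dq q0 D0 by (intro mult_right_mono power_increasing) auto
      finally show ?thesis using True q0 K by (auto intro!: mult_left_mono)
    qed (use q0 D0 K in auto)
    finally show "expectation (\<lambda>\<omega>. if last (a # w) = c then \<Prod>e\<leftarrow>walk_edges a w. x e \<omega> else 0)
        \<le> (q * K) ^ (2 * k) * (4 * D / q ^ 3) ^ k * (q / D) ^ card ({} \<union> set (walk_edges a w))"
      by (simp add: r_def mult.assoc)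
  qed
  also have "\<dots> = (q * K) ^ (2 * k) * (4 * D / q ^ 3) ^ k * (\<Sum>w\<in>?W. (q / D) ^ card ({} \<union> set (walk_edges a w)))"
    by (rule sum_distrib_left[symmetric])
  also have "\<dots> \<le> (q * K) ^ (2 * k) * (4 * D / q ^ 3) ^ k * (2 * q) ^ (2 * k)"
  proof (intro mult_left_mono)
    have "(\<Sum>w\<in>?W. (q / D) ^ card ({} \<union> set (walk_edges a w))) \<le> (q / D) ^ card ({} :: (nat \<times> nat) set) * (real (2 * k) + D * (q / D)) ^ (2 * k)"
      unfolding D_def by (rule sum_walks_power_card) (use q0 in auto)
    also have "\<dots> = (2 * q) ^ (2 * k)" using D0 by (simp add: q_def)
    finally show "(\<Sum>w\<in>?W. (q / D) ^ card ({} \<union> set (walk_edges a w))) \<le> (2 * q) ^ (2 * k)" .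
  qed (use q0 D0 K in auto)
  also have "\<dots> = ((q * K)\<^sup>2 * (4 * D / q ^ 3) * (2 * q)\<^sup>2) ^ k"
    unfolding power_mult by (simp only: power_mult_distrib[symmetric])
  also have "(q * K)\<^sup>2 * (4 * D / q ^ 3) * (2 * q)\<^sup>2 = 32 * K\<^sup>2 * D * real k"
    using q0 by (simp add: q_def power2_eq_square power3_eq_cube field_simps)
  finally show "expectation (\<lambda>\<omega>. walk_sum n m (\<lambda>e. x e \<omega>) (2 * k) a c) \<le> (32 * K\<^sup>2 * real (max n m) * real k) ^ k"
    by (simp add: D_def)
qed

end

section \<open>Walk sums as traces of powers of the Gram matrix\<close>

lemma walk_sum_double:
  "walk_sum n m x (Suc (Suc k)) (Inr t) c
     = (\<Sum>u<m. (\<Sum>i<n. x (i, t) * x (i, u)) * walk_sum n m x k (Inr u) c)"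
proof -
  have "walk_sum n m x (Suc (Suc k)) (Inr t) c
      = (\<Sum>i<n. x (i, t) * (\<Sum>u<m. x (i, u) * walk_sum n m x k (Inr u) c))"
    by (simp add: sum.reindex)
  also have "\<dots> = (\<Sum>i<n. \<Sum>u<m. x (i, t) * x (i, u) * walk_sum n m x k (Inr u) c)"
    by (simp add: sum_distrib_left mult.assoc)
  also have "\<dots> = (\<Sum>u<m. \<Sum>i<n. x (i, t) * x (i, u) * walk_sum n m x k (Inr u) c)"
    by (rule sum.swap)
  finally show ?thesis by (simp add: sum_distrib_right)
qed

lemma trace_sandwich_diag:
  fixes f :: "nat \<Rightarrow> real"
  assumes Q: "Q \<in> carrier_mat n n" "transpose_mat Q * Q = 1\<^sub>m n"
  shows "(\<Sum>t<n. (Q * mat_diag n f * transpose_mat Q) $$ (t, t)) = (\<Sum>i<n. f i)"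
proof -
  have QD: "(Q * mat_diag n f) $$ (t, i) = Q $$ (t, i) * f i" if "t < n" "i < n" for t i
    using that Q(1) by (subst mat_diag_mult_right[OF Q(1)]) simp
  have "(Q * mat_diag n f * transpose_mat Q) $$ (t, t) = (\<Sum>i<n. f i * (Q $$ (t, i) * Q $$ (t, i)))" if "t < n" for t
  proof -
    have "(Q * mat_diag n f * transpose_mat Q) $$ (t, t) = (\<Sum>i<n. (Q * mat_diag n f) $$ (t, i) * Q $$ (t, i))"
      using that Q(1) by (simp add: scalar_prod_def lessThan_atLeast0 del: index_mult_mat(1))
       (simp add: index_mult_mat(1)[of t "Q * mat_diag n f"] scalar_prod_def lessThan_atLeast0 del: index_mult_mat(1))
    then show ?thesis using that by (simp add: QD mult_ac)
  qed
  then have "(\<Sum>t<n. (Q * mat_diag n f * transpose_mat Q) $$ (t, t)) = (\<Sum>t<n. \<Sum>i<n. f i * (Q $$ (t, i) * Q $$ (t, i)))"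
    by simp
  also have "\<dots> = (\<Sum>i<n. f i * (\<Sum>t<n. Q $$ (t, i) * Q $$ (t, i)))"
    by (subst sum.swap) (simp add: sum_distrib_left)
  also have "\<dots> = (\<Sum>i<n. f i)"
  proof (intro sum.cong refl)
    fix i assume i: "i \<in> {..<n}"
    have "(\<Sum>t<n. Q $$ (t, i) * Q $$ (t, i)) = (transpose_mat Q * Q) $$ (i, i)"
      using i Q(1) by (simp add: scalar_prod_def lessThan_atLeast0)
    then show "f i * (\<Sum>t<n. Q $$ (t, i) * Q $$ (t, i)) = f i" using i Q(2) by simp
  qed
  finally show ?thesis .
qed

text \<open>Two steps of a walk starting at a column multiply by the Gram matrix, so the sum over
  closed walks of length \<open>2 k\<close> is the trace of its \<open>k\<close>-th power.\<close>

lemma walk_sum_gram_diag: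
  assumes E: "E \<in> carrier_mat n m" and gd: "gram_diag m E Q d"
  shows "(\<Sum>t<m. walk_sum n m (\<lambda>e. E $$ e) (2 * k) (Inr t) (Inr t)) = (\<Sum>i<m. d i ^ k)"
proof -
  note Q = gram_diagD[OF gd]
  let ?x = "\<lambda>e. E $$ e"
  have "walk_sum n m ?x (2 * k) (Inr t) (Inr s) = (Q * mat_diag m (\<lambda>i. d i ^ k) * transpose_mat Q) $$ (t, s)"
    if "t < m" "s < m" for t s
    using that
  proof (induction k arbitrary: t)
    case 0
    have "Q * mat_diag m (\<lambda>i. d i ^ 0) * transpose_mat Q = 1\<^sub>m m" using Q by simp
    then show ?case using 0 by simp
  next
    case (Suc k)
    let ?B = "Q * mat_diag m (\<lambda>i. d i ^ k) * transpose_mat Q"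
    have B: "?B \<in> carrier_mat m m" using Q(1) by auto
    have G: "transpose_mat E * E \<in> carrier_mat m m" using E by auto
    have "(transpose_mat E * E) * ?B = Q * mat_diag m (\<lambda>i. d i * d i ^ k) * transpose_mat Q"
      unfolding Q(4) by (rule sandwich_diag[OF Q(1,2)])
    then have AB: "(transpose_mat E * E) * ?B = Q * mat_diag m (\<lambda>i. d i ^ Suc k) * transpose_mat Q" by simp
    have "walk_sum n m ?x (2 * Suc k) (Inr t) (Inr s)
        = (\<Sum>u<m. (\<Sum>i<n. E $$ (i, t) * E $$ (i, u)) * walk_sum n m ?x (2 * k) (Inr u) (Inr s))"
      using walk_sum_double[of n m ?x "2 * k" t "Inr s"] by simp
    also have "\<dots> = (\<Sum>u<m. (transpose_mat E * E) $$ (t, u) * ?B $$ (u, s))"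
    proof (intro sum.cong refl)
      fix u assume u: "u \<in> {..<m}"
      have "(\<Sum>i<n. E $$ (i, t) * E $$ (i, u)) = (transpose_mat E * E) $$ (t, u)"
        using u Suc.prems E by (simp add: scalar_prod_def lessThan_atLeast0)
      then show "(\<Sum>i<n. E $$ (i, t) * E $$ (i, u)) * walk_sum n m ?x (2 * k) (Inr u) (Inr s)
          = (transpose_mat E * E) $$ (t, u) * ?B $$ (u, s)"
        using Suc.IH[of u] u Suc.prems by simp
    qed
    also have "\<dots> = ((transpose_mat E * E) * ?B) $$ (t, s)"
    proof -
      have "(A * C) $$ (t, s) = (\<Sum>u<m. A $$ (t, u) * C $$ (u, s))"
        if "A \<in> carrier_mat m m" "C \<in> carrier_mat m m" for A C :: "real mat"
        using that Suc.prems by (simp add: scalar_prod_def lessThan_atLeast0)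
      from this[OF G B] show ?thesis by (rule sym)
    qed
    finally show ?case unfolding AB .
  qed
  then have "(\<Sum>t<m. walk_sum n m ?x (2 * k) (Inr t) (Inr t)) = (\<Sum>t<m. (Q * mat_diag m (\<lambda>i. d i ^ k) * transpose_mat Q) $$ (t, t))"
    by simp
  then show ?thesis using trace_sandwich_diag[OF Q(1,2)] by simp
qed

lemma walk_sum_trace_nonneg:
  assumes E: "E \<in> carrier_mat n m"
  shows "0 \<le> (\<Sum>t<m. walk_sum n m (\<lambda>e. E $$ e) (2 * k) (Inr t) (Inr t))"
proof -
  obtain Q d where gd: "gram_diag m E Q d" by (rule gram_spectral[OF E])
  show ?thesis unfolding walk_sum_gram_diag[OF E gd] using gram_diagD(6)[OF gd] by (intro sum_nonneg) auto
qed

text \<open>The \<open>d i ^ k\<close> are nonnegative, so their sum dominates each of them, in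
  particular the one of the largest eigenvalue.\<close>

lemma sqn_le_walk_sum_trace:
  assumes E: "E \<in> carrier_mat n m" and k: "0 < k" and \<tau>: "0 \<le> \<tau>"
    and le: "(\<Sum>t<m. walk_sum n m (\<lambda>e. E $$ e) (2 * k) (Inr t) (Inr t)) \<le> \<tau> ^ k" and v: "v \<in> carrier_vec m"
  shows "sqn (E *\<^sub>v v) \<le> \<tau> * sqn v"
proof -
  obtain Q d where gd: "gram_diag m E Q d" by (rule gram_spectral[OF E])
  note Q = gram_diagD[OF gd]
  have d: "d i \<le> \<tau>" if "i < m" for i
  proof -
    have "d i ^ k \<le> (\<Sum>i<m. d i ^ k)" using that Q(6) by (intro member_le_sum) auto
    also have "\<dots> \<le> \<tau> ^ k" using le unfolding walk_sum_gram_diag[OF E gd] .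
    finally show ?thesis using \<tau> k by (simp add: power_mono_iff Q(6)[OF that])
  qed
  define c where "c = transpose_mat Q *\<^sub>v v"
  have c: "c \<in> carrier_vec m" using Q v by (simp add: c_def mult_mat_vec_carrier[of _ m m])
  have vc: "Q *\<^sub>v c = v" "sqn c = sqn v" unfolding c_def by (rule sqn_orthonormal_transpose[OF Q(1,3) v])+
  have "sqn (E *\<^sub>v v) = (\<Sum>i<m. d i * (c $ i)\<^sup>2)" using Q(7)[OF c] vc by simp
  also have "\<dots> \<le> (\<Sum>i<m. \<tau> * (c $ i)\<^sup>2)" using d by (intro sum_mono mult_right_mono) auto
  also have "\<dots> = \<tau> * sqn v" unfolding vc(2)[symmetric] sqn_sum[OF c] by (simp add: sum_distrib_left)
  finally show ?thesis .
qed

section \<open>Sub-exponential entries and the operator norm\<close>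

lemma power_le_fact_mult_exp:
  fixes x :: real
  assumes "0 \<le> x"
  shows "x ^ j \<le> fact j * exp x"
proof -
  have "x ^ j /\<^sub>R fact j \<le> (\<Sum>n. x ^ n /\<^sub>R fact n)"
    using sum_le_suminf[OF summable_exp_generic[of x], of "{j}"] assms by simp
  also have "\<dots> = exp x" by (simp add: exp_def)
  finally show ?thesis by (simp add: divide_simps mult.commute)
qed

text \<open>The infimum in the norm need not be attained, so an admissible \<open>K\<close> is taken
  strictly below \<open>C + 1\<close>; that is the source of the \<open>C + 1\<close> in all later
  constants. The moments follow from \<open>x ^ j \<le> fact j * exp x\<close>.\<close>

lemma (in prob_space) psi1_moments:
  assumes X[measurable]: "X \<in> borel_measurable M" and psi: "psi1_norm M X \<le> ennreal C" and C: "0 < C"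
  shows "integrable M (\<lambda>\<omega>. X \<omega> ^ j)"
    and "expectation (\<lambda>\<omega>. \<bar>X \<omega>\<bar> ^ j) \<le> 2 * fact j * (C + 1) ^ j"
proof -
  have C1: "ennreal C < ennreal (C + 1)" using C by (subst ennreal_less_iff) auto
  have "psi1_norm M X < ennreal (C + 1)" by (rule le_less_trans[OF psi C1])
  then obtain y where y: "y \<in> {ennreal K |K. K > 0 \<and> (\<integral>\<^sup>+\<omega>. ennreal (exp (\<bar>X \<omega>\<bar> / K)) \<partial>M) \<le> 2}"
    "y < ennreal (C + 1)"
    unfolding psi1_norm_def Inf_less_iff by blast
  then obtain K where K0: "y = ennreal K" "0 < K" and le2: "(\<integral>\<^sup>+\<omega>. ennreal (exp (\<bar>X \<omega>\<bar> / K)) \<partial>M) \<le> 2"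
    by blast
  have "K < C + 1" using y(2) K0 ennreal_less_iff[of K "C + 1"] by (simp del: ennreal_plus)
  with K0 have K: "0 < K" "K < C + 1" by simp_all
  have bnd: "\<bar>X \<omega>\<bar> ^ j \<le> fact j * (C + 1) ^ j * exp (\<bar>X \<omega>\<bar> / K)" for \<omega>
  proof -
    have "(\<bar>X \<omega>\<bar> / (C + 1)) ^ j \<le> fact j * exp (\<bar>X \<omega>\<bar> / (C + 1))"
      using C by (intro power_le_fact_mult_exp) auto
    also have "\<dots> \<le> fact j * exp (\<bar>X \<omega>\<bar> / K)"
      using K C by (intro mult_left_mono) (auto intro!: divide_left_mono)
    finally show ?thesis using C by (simp add: power_divide field_simps)
  qed
  have exp_int: "integrable M (\<lambda>\<omega>. exp (\<bar>X \<omega>\<bar> / K))"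
    using le2 by (intro integrableI_nonneg) (auto simp: le_less_trans)
  have exp_le: "expectation (\<lambda>\<omega>. exp (\<bar>X \<omega>\<bar> / K)) \<le> 2"
    using le2 by (subst integral_eq_nn_integral) (auto simp: enn2real_leI)
  show 1: "integrable M (\<lambda>\<omega>. X \<omega> ^ j)"
    by (rule Bochner_Integration.integrable_bound[OF integrable_mult_right[OF exp_int, of "fact j * (C + 1) ^ j"]])
       (use bnd C in \<open>auto simp: power_abs abs_mult\<close>)
  have "expectation (\<lambda>\<omega>. \<bar>X \<omega>\<bar> ^ j) \<le> expectation (\<lambda>\<omega>. fact j * (C + 1) ^ j * exp (\<bar>X \<omega>\<bar> / K))"
    using integrable_abs[OF 1] exp_int bnd by (intro integral_mono) (auto simp: power_abs)
  also have "\<dots> = fact j * (C + 1) ^ j * expectation (\<lambda>\<omega>. exp (\<bar>X \<omega>\<bar> / K))" by simp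
  also have "\<dots> \<le> fact j * (C + 1) ^ j * 2" using exp_le C by (intro mult_left_mono) auto
  finally show "expectation (\<lambda>\<omega>. \<bar>X \<omega>\<bar> ^ j) \<le> 2 * fact j * (C + 1) ^ j" by (simp add: mult_ac)
qed

text \<open>Markov's inequality for the trace, whose mean is at most \<open>m * s ^ k\<close>. The
  extra factor \<open>(exp 1)\<^sup>2\<close> in \<tau> over \<open>s\<close> makes the failure
  probability \<open>m * exp (- 2 k)\<close>, so \<open>k\<close> of logarithmic size absorbs the
  number \<open>m\<close> of columns.\<close>

lemma (in prob_space) random_matrix_norm_bound:
  fixes E :: "'a \<Rightarrow> real mat"
  assumes Ec: "\<And>\<omega>. \<omega> \<in> space M \<Longrightarrow> E \<omega> \<in> carrier_mat n m"
    and ind: "indep_vars (\<lambda>_. borel) (\<lambda>it \<omega>. E \<omega> $$ it) ({..<n} \<times> {..<m})"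
    and mean: "\<And>i t. i < n \<Longrightarrow> t < m \<Longrightarrow> expectation (\<lambda>\<omega>. E \<omega> $$ (i, t)) = 0"
    and psi: "\<And>i t. i < n \<Longrightarrow> t < m \<Longrightarrow> psi1_norm M (\<lambda>\<omega>. E \<omega> $$ (i, t)) \<le> ennreal C" and C: "0 < C"
    and k: "0 < k" "2 * k ^ 3 \<le> max n m"
  defines "\<tau> \<equiv> 32 * (exp 1)\<^sup>2 * (C + 1)\<^sup>2 * real (max n m) * real k"
  shows "\<exists>A\<in>events. (\<forall>\<omega>\<in>A. \<forall>v\<in>carrier_vec m. sqn (E \<omega> *\<^sub>v v) \<le> \<tau> * sqn v) \<and> 1 - real m * exp (- 2 * real k) \<le> prob A"
proof -
  let ?x = "\<lambda>it \<omega>. E \<omega> $$ it"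
  have rv: "random_variable borel (?x e)" if "e \<in> {..<n} \<times> {..<m}" for e
    using ind that unfolding indep_vars_def by auto
  have mom: "integrable M (\<lambda>\<omega>. ?x e \<omega> ^ j)" "expectation (\<lambda>\<omega>. \<bar>?x e \<omega>\<bar> ^ j) \<le> 2 * fact j * (C + 1) ^ j"
    if "e \<in> {..<n} \<times> {..<m}" for e j
    using that psi1_moments[OF rv[OF that] _ C, of j] psi by auto
  have K: "0 < C + 1" using C by simp
  have mean': "expectation (?x e) = 0" if "e \<in> {..<n} \<times> {..<m}" for e using that mean by auto
  note b = expectation_walk_sum_bound[OF ind mean' mom K _ k]
  define Z where "Z \<omega> = (\<Sum>t<m. walk_sum n m (\<lambda>e. ?x e \<omega>) (2 * k) (Inr t) (Inr t))" for \<omega>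
  have int_Z: "integrable M Z" unfolding Z_def
    by (intro Bochner_Integration.integrable_sum b(1)) auto
  note [measurable] = borel_measurable_integrable[OF int_Z]
  define s where "s = 32 * (C + 1)\<^sup>2 * real (max n m) * real k"
  have "expectation Z = (\<Sum>t<m. expectation (\<lambda>\<omega>. walk_sum n m (\<lambda>e. ?x e \<omega>) (2 * k) (Inr t) (Inr t)))"
    unfolding Z_def by (intro Bochner_Integration.integral_sum b(1)) auto
  also have "\<dots> \<le> (\<Sum>t<m. s ^ k)"
    unfolding s_def by (intro sum_mono b(2)) auto
  finally have EZ: "expectation Z \<le> real m * s ^ k" by simp
  have Z0: "0 \<le> Z \<omega>" if "\<omega> \<in> space M" for \<omega>
    unfolding Z_def by (rule walk_sum_trace_nonneg[OF Ec[OF that]])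
  have "0 < k ^ 3" using k by simp
  then have "0 < max n m" using k(2) by linarith
  then have s0: "0 < s" using C k unfolding s_def by (intro mult_pos_pos) auto
  have \<tau>s: "\<tau> = (exp 1)\<^sup>2 * s" by (simp add: \<tau>_def s_def)
  have \<tau>0: "0 < \<tau>" using s0 by (simp add: \<tau>s)
  have ratio: "real m * s ^ k / \<tau> ^ k = real m * exp (- 2 * real k)"
  proof -
    have "\<tau> ^ k = exp (2 * real k) * s ^ k"
      by (simp add: \<tau>s power_mult_distrib flip: power_mult exp_of_nat_mult)
    then show ?thesis using s0 by (simp add: exp_minus divide_inverse)
  qed
  define A where "A = {\<omega> \<in> space M. Z \<omega> < \<tau> ^ k}"
  have A: "A \<in> events" unfolding A_def by measurable
  have "prob {\<omega> \<in> space M. \<tau> ^ k \<le> Z \<omega>} \<le> expectation Z / \<tau> ^ k"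
    using int_Z Z0 \<tau>0 by (intro integral_Markov_inequality_measure[where A="{}"]) auto
  also have "\<dots> \<le> real m * s ^ k / \<tau> ^ k" using EZ \<tau>0 by (intro divide_right_mono) auto
  finally have P: "prob {\<omega> \<in> space M. \<tau> ^ k \<le> Z \<omega>} \<le> real m * exp (- 2 * real k)" by (simp only: ratio)
  have "space M - A = {\<omega> \<in> space M. \<tau> ^ k \<le> Z \<omega>}" by (auto simp: A_def)
  then have "prob A \<ge> 1 - real m * exp (- 2 * real k)" using P prob_compl[OF A] by simp
  moreover have "sqn (E \<omega> *\<^sub>v v) \<le> \<tau> * sqn v" if "\<omega> \<in> A" "v \<in> carrier_vec m" for \<omega> v
    using that \<tau>0 k by (intro sqn_le_walk_sum_trace[OF Ec k(1)]) (auto simp: A_def Z_def)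
  ultimately show ?thesis using A by blast
qed

section \<open>Convergence in probability and in distribution\<close>

text \<open>The event \<open>Q T\<close> itself need not be measurable; it only has to contain
  measurable events of probability tending to one. This permits arguing about singular values and
  norms of random matrices without proving them measurable.\<close>

definition whp :: "(nat \<Rightarrow> 'w measure) \<Rightarrow> (nat \<Rightarrow> 'w \<Rightarrow> bool) \<Rightarrow> bool" where
  "whp P Q \<longleftrightarrow> (\<exists>A. (\<forall>\<^sub>F T in sequentially. A T \<in> sets (P T) \<and> (\<forall>\<omega>\<in>A T. Q T \<omega>)) \<and>
     (\<lambda>T. measure (P T) (A T)) \<longlonglongrightarrow> 1)"

text \<open>Convergence in probability in the sense of \<open>whp\<close>, hence meaningful for maps
  not known to be measurable. Measurability is added back only at the end, for the
  estimators.\<close>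

definition pconv :: "(nat \<Rightarrow> 'w measure) \<Rightarrow> (nat \<Rightarrow> 'w \<Rightarrow> real) \<Rightarrow> real \<Rightarrow> bool" where
  "pconv P X l \<longleftrightarrow> (\<forall>\<epsilon>>0. whp P (\<lambda>T \<omega>. \<bar>X T \<omega> - l\<bar> \<le> \<epsilon>))"

locale prob_seq =
  fixes P :: "nat \<Rightarrow> 'w measure"
  assumes prob: "\<And>T. T \<ge> 1 \<Longrightarrow> prob_space (P T)"
begin

lemma whpI:
  assumes "\<forall>\<^sub>F T in sequentially. A T \<in> sets (P T) \<and> (\<forall>\<omega>\<in>A T. Q T \<omega>)"
    and "(\<lambda>T. measure (P T) (A T)) \<longlonglongrightarrow> 1"
  shows "whp P Q"
  using assms unfolding whp_def by blast

lemma whp_mono: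
  assumes "whp P Q" "\<forall>\<^sub>F T in sequentially. \<forall>\<omega>\<in>space (P T). Q T \<omega> \<longrightarrow> Q' T \<omega>"
  shows "whp P Q'"
proof -
  obtain A where A: "\<forall>\<^sub>F T in sequentially. A T \<in> sets (P T) \<and> (\<forall>\<omega>\<in>A T. Q T \<omega>)"
    "(\<lambda>T. measure (P T) (A T)) \<longlonglongrightarrow> 1"
    using assms(1) unfolding whp_def by blast
  have "\<forall>\<^sub>F T in sequentially. A T \<in> sets (P T) \<and> (\<forall>\<omega>\<in>A T. Q' T \<omega>)"
    using A(1) assms(2) by eventually_elim (auto dest: sets.sets_into_space)
  then show ?thesis using A(2) by (rule whpI)
qed

lemma whp_conj:
  assumes "whp P Q" "whp P Q'"
  shows "whp P (\<lambda>T \<omega>. Q T \<omega> \<and> Q' T \<omega>)"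
proof -
  obtain A where A: "\<forall>\<^sub>F T in sequentially. A T \<in> sets (P T) \<and> (\<forall>\<omega>\<in>A T. Q T \<omega>)"
    "(\<lambda>T. measure (P T) (A T)) \<longlonglongrightarrow> 1"
    using assms(1) unfolding whp_def by blast
  obtain B where B: "\<forall>\<^sub>F T in sequentially. B T \<in> sets (P T) \<and> (\<forall>\<omega>\<in>B T. Q' T \<omega>)"
    "(\<lambda>T. measure (P T) (B T)) \<longlonglongrightarrow> 1"
    using assms(2) unfolding whp_def by blast
  have lower: "\<forall>\<^sub>F T in sequentially. measure (P T) (A T) + measure (P T) (B T) - 1 \<le> measure (P T) (A T \<inter> B T)"
    using A(1) B(1) eventually_ge_at_top[of 1]
  proof eventually_elim
    case (elim T)
    interpret prob_space "P T" using elim by (intro prob)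
    have "prob (A T \<union> B T) = prob (A T) + prob (B T) - prob (A T \<inter> B T)"
      using elim by (intro measure_Un3) (auto simp: fmeasurable_eq_sets)
    moreover have "prob (A T \<union> B T) \<le> 1" by (rule prob_le_1)
    ultimately show ?case by linarith
  qed
  have upper: "\<forall>\<^sub>F T in sequentially. measure (P T) (A T \<inter> B T) \<le> 1"
    using eventually_ge_at_top[of 1]
    by eventually_elim (rule prob_space.prob_le_1[OF prob])
  have "(\<lambda>T. measure (P T) (A T) + measure (P T) (B T) - 1) \<longlonglongrightarrow> 1 + 1 - 1"
    by (intro tendsto_intros A B)
  then have "(\<lambda>T. measure (P T) (A T \<inter> B T)) \<longlonglongrightarrow> 1"
    by (intro tendsto_sandwich[OF lower upper]) auto
  moreover have "\<forall>\<^sub>F T in sequentially. A T \<inter> B T \<in> sets (P T) \<and> (\<forall>\<omega>\<in>A T \<inter> B T. Q T \<omega> \<and> Q' T \<omega>)"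
    using A(1) B(1) by eventually_elim auto
  ultimately show ?thesis by (intro whpI[of "\<lambda>T. A T \<inter> B T"])
qed

text \<open>A set outside the sigma-algebra has \<open>measure\<close> zero by convention. A limit
  of one therefore forces the events to be measurable eventually.\<close>

lemma whp_wp_to_one:
  assumes "wp_to_one P Q"
  shows "whp P Q"
proof (rule whpI[of "\<lambda>T. {\<omega> \<in> space (P T). Q T \<omega>}"])
  show lim: "(\<lambda>T. measure (P T) {\<omega> \<in> space (P T). Q T \<omega>}) \<longlonglongrightarrow> 1"
    using assms by (simp add: wp_to_one_def)
  have "\<forall>\<^sub>F T in sequentially. measure (P T) {\<omega> \<in> space (P T). Q T \<omega>} > 0"
    by (rule order_tendstoD(1)[OF lim]) simp
  then show "\<forall>\<^sub>F T in sequentially. {\<omega> \<in> space (P T). Q T \<omega>} \<in> sets (P T) \<and> (\<forall>\<omega>\<in>{\<omega> \<in> space (P T). Q T \<omega>}. Q T \<omega>)"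
  proof eventually_elim
    case (elim T)
    have "{\<omega> \<in> space (P T). Q T \<omega>} \<in> sets (P T)"
      using elim measure_notin_sets by (metis less_irrefl)
    then show ?case by auto
  qed
qed

lemma whp_eventually:
  assumes "\<forall>\<^sub>F T in sequentially. \<forall>\<omega>\<in>space (P T). Q T \<omega>"
  shows "whp P Q"
proof (rule whpI[of "\<lambda>T. space (P T)"])
  show "(\<lambda>T. measure (P T) (space (P T))) \<longlonglongrightarrow> 1"
    by (rule tendsto_eventually, use eventually_ge_at_top[of 1] in eventually_elim)
       (rule prob_space.prob_space[OF prob])
qed (use assms in simp)

lemma whp_lower_bound:
  assumes "\<forall>\<^sub>F T in sequentially. \<exists>A\<in>sets (P T). (\<forall>\<omega>\<in>A. Q T \<omega>) \<and> 1 - e T \<le> measure (P T) A"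
    and e: "e \<longlonglongrightarrow> 0"
  shows "whp P Q"
proof -
  from assms(1) obtain T0 where T0: "\<And>T. T \<ge> T0 \<Longrightarrow> \<exists>A\<in>sets (P T). (\<forall>\<omega>\<in>A. Q T \<omega>) \<and> 1 - e T \<le> measure (P T) A"
    unfolding eventually_sequentially by blast
  then obtain A where A: "\<And>T. T \<ge> T0 \<Longrightarrow> A T \<in> sets (P T) \<and> (\<forall>\<omega>\<in>A T. Q T \<omega>) \<and> 1 - e T \<le> measure (P T) (A T)"
    by metis
  show ?thesis
  proof (rule whpI)
    show "\<forall>\<^sub>F T in sequentially. A T \<in> sets (P T) \<and> (\<forall>\<omega>\<in>A T. Q T \<omega>)"
      using eventually_ge_at_top[of T0] by eventually_elim (use A in auto)
    have low: "\<forall>\<^sub>F T in sequentially. 1 - e T \<le> measure (P T) (A T)"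
      using eventually_ge_at_top[of T0] by eventually_elim (use A in auto)
    have up: "\<forall>\<^sub>F T in sequentially. measure (P T) (A T) \<le> 1"
      using eventually_ge_at_top[of 1] by eventually_elim (rule prob_space.prob_le_1[OF prob])
    have "(\<lambda>T. 1 - e T) \<longlonglongrightarrow> 1 - 0" by (intro tendsto_intros e)
    then show "(\<lambda>T. measure (P T) (A T)) \<longlonglongrightarrow> 1"
      by (intro tendsto_sandwich[OF low up]) auto
  qed
qed

lemma pconv_cont2:
  fixes f :: "real \<times> real \<Rightarrow> real"
  assumes X: "pconv P X l" and Y: "pconv P Y m" and f: "isCont f (l, m)"
  shows "pconv P (\<lambda>T \<omega>. f (X T \<omega>, Y T \<omega>)) (f (l, m))"
  unfolding pconv_def
proof (intro allI impI)
  fix \<epsilon> :: real assume "0 < \<epsilon>"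
  then obtain d where d: "0 < d" "\<And>z. dist z (l, m) < d \<Longrightarrow> dist (f z) (f (l, m)) < \<epsilon>"
    using f unfolding continuous_at_eps_delta by blast
  have "whp P (\<lambda>T \<omega>. \<bar>X T \<omega> - l\<bar> \<le> d / 3 \<and> \<bar>Y T \<omega> - m\<bar> \<le> d / 3)"
    using X[unfolded pconv_def, rule_format, of "d / 3"] Y[unfolded pconv_def, rule_format, of "d / 3"] d(1)
    by (intro whp_conj) simp_all
  then show "whp P (\<lambda>T \<omega>. \<bar>f (X T \<omega>, Y T \<omega>) - f (l, m)\<bar> \<le> \<epsilon>)"
  proof (rule whp_mono, intro always_eventually allI ballI impI)
    fix T \<omega> assume "\<bar>X T \<omega> - l\<bar> \<le> d / 3 \<and> \<bar>Y T \<omega> - m\<bar> \<le> d / 3"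
    then have "dist (X T \<omega>, Y T \<omega>) (l, m) < d"
      using d(1) sqrt_sum_squares_le_sum_abs[of "X T \<omega> - l" "Y T \<omega> - m"]
      by (simp add: dist_Pair_Pair dist_real_def)
    from d(2)[OF this] show "\<bar>f (X T \<omega>, Y T \<omega>) - f (l, m)\<bar> \<le> \<epsilon>" by (simp add: dist_real_def)
  qed
qed

lemma pconv_cont:
  assumes X: "pconv P X l" and f: "isCont f l"
  shows "pconv P (\<lambda>T \<omega>. f (X T \<omega>)) (f l)"
  using pconv_cont2[OF X X, of "\<lambda>z. f (fst z)"] f by (simp add: isCont_o2)

lemma pconv_add: "pconv P X l \<Longrightarrow> pconv P Y m \<Longrightarrow> pconv P (\<lambda>T \<omega>. X T \<omega> + Y T \<omega>) (l + m)"
  using pconv_cont2[of X l Y m "\<lambda>z. fst z + snd z"] by simp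

lemma pconv_diff: "pconv P X l \<Longrightarrow> pconv P Y m \<Longrightarrow> pconv P (\<lambda>T \<omega>. X T \<omega> - Y T \<omega>) (l - m)"
  using pconv_cont2[of X l Y m "\<lambda>z. fst z - snd z"] by simp

lemma pconv_mult: "pconv P X l \<Longrightarrow> pconv P Y m \<Longrightarrow> pconv P (\<lambda>T \<omega>. X T \<omega> * Y T \<omega>) (l * m)"
  using pconv_cont2[of X l Y m "\<lambda>z. fst z * snd z"] by simp

lemma pconv_cmult: "pconv P X l \<Longrightarrow> pconv P (\<lambda>T \<omega>. a * X T \<omega>) (a * l)"
  using pconv_cont[of X l "\<lambda>x. a * x"] by simp

lemma pconv_sqrt: "pconv P X l \<Longrightarrow> pconv P (\<lambda>T \<omega>. sqrt (X T \<omega>)) (sqrt l)"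
  by (rule pconv_cont) (auto intro!: continuous_intros)

lemma pconv_const_seq:
  assumes "a \<longlonglongrightarrow> l"
  shows "pconv P (\<lambda>T \<omega>. a T) l"
  unfolding pconv_def
proof (intro allI impI whp_eventually)
  fix \<epsilon> :: real assume "0 < \<epsilon>"
  from tendstoD[OF assms this] show "\<forall>\<^sub>F T in sequentially. \<forall>\<omega>\<in>space (P T). \<bar>a T - l\<bar> \<le> \<epsilon>"
    by eventually_elim (auto simp: dist_real_def)
qed

lemma pconv_0_le:
  assumes Y: "pconv P Y 0" and le: "whp P (\<lambda>T \<omega>. \<bar>X T \<omega>\<bar> \<le> Y T \<omega>)"
  shows "pconv P X 0"
  unfolding pconv_def
proof (intro allI impI)
  fix \<epsilon> :: real assume "0 < \<epsilon>"
  then have "whp P (\<lambda>T \<omega>. \<bar>Y T \<omega> - 0\<bar> \<le> \<epsilon> \<and> \<bar>X T \<omega>\<bar> \<le> Y T \<omega>)"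
    using Y le unfolding pconv_def by (intro whp_conj) auto
  then show "whp P (\<lambda>T \<omega>. \<bar>X T \<omega> - 0\<bar> \<le> \<epsilon>)"
    by (rule whp_mono) (intro always_eventually allI ballI, linarith)
qed

lemma pconv_cong:
  assumes X: "pconv P X l" and eq: "whp P (\<lambda>T \<omega>. X T \<omega> = Y T \<omega>)"
  shows "pconv P Y l"
  unfolding pconv_def
proof (intro allI impI)
  fix \<epsilon> :: real assume "0 < \<epsilon>"
  then have "whp P (\<lambda>T \<omega>. \<bar>X T \<omega> - l\<bar> \<le> \<epsilon> \<and> X T \<omega> = Y T \<omega>)"
    using X eq unfolding pconv_def by (intro whp_conj) auto
  then show "whp P (\<lambda>T \<omega>. \<bar>Y T \<omega> - l\<bar> \<le> \<epsilon>)"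
    by (rule whp_mono) (intro always_eventually allI ballI, auto)
qed

lemma pconv_L1:
  assumes int: "\<forall>\<^sub>F T in sequentially. integrable (P T) (X T)"
    and nonneg: "\<forall>\<^sub>F T in sequentially. \<forall>\<omega>\<in>space (P T). 0 \<le> X T \<omega>"
    and le: "\<forall>\<^sub>F T in sequentially. integral\<^sup>L (P T) (X T) \<le> e T" and e: "e \<longlonglongrightarrow> 0"
  shows "pconv P X 0"
  unfolding pconv_def
proof (intro allI impI)
  fix \<epsilon> :: real assume \<epsilon>: "0 < \<epsilon>"
  show "whp P (\<lambda>T \<omega>. \<bar>X T \<omega> - 0\<bar> \<le> \<epsilon>)"
  proof (rule whp_lower_bound)
    show "\<forall>\<^sub>F T in sequentially. \<exists>A\<in>sets (P T). (\<forall>\<omega>\<in>A. \<bar>X T \<omega> - 0\<bar> \<le> \<epsilon>) \<and> 1 - e T / \<epsilon> \<le> measure (P T) A"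
      using int nonneg le eventually_ge_at_top[of 1]
    proof eventually_elim
      case (elim T)
      interpret prob_space "P T" using elim by (intro prob)
      note [measurable] = borel_measurable_integrable[OF elim(1)]
      let ?A = "{\<omega> \<in> space (P T). X T \<omega> < \<epsilon>}"
      have A: "?A \<in> events" by measurable
      have "prob {\<omega> \<in> space (P T). \<epsilon> \<le> X T \<omega>} \<le> expectation (X T) / \<epsilon>"
        using elim \<epsilon> by (intro integral_Markov_inequality_measure[where A="{}"]) auto
      also have "\<dots> \<le> e T / \<epsilon>" using elim \<epsilon> by (intro divide_right_mono) auto
      also have "{\<omega> \<in> space (P T). \<epsilon> \<le> X T \<omega>} = space (P T) - ?A" by auto
      finally have "1 - e T / \<epsilon> \<le> prob ?A" using prob_compl[OF A] by simp
      then show ?case using A elim by (intro bexI[of _ ?A]) auto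
    qed
    show "(\<lambda>T. e T / \<epsilon>) \<longlonglongrightarrow> 0" using tendsto_divide[OF e tendsto_const[of \<epsilon>]] \<epsilon> by simp
  qed
qed

text \<open>A sequence tending to zero times one that is bounded in mean square. On the event where
  \<open>X\<close> is at most \<open>d\<close>, it suffices that \<open>Y\<close> is below
  \<open>\<epsilon> / d\<close>, which fails with probability at most
  \<open>K * d\<^sup>2 / \<epsilon>\<^sup>2\<close>; so one needs \<open>d\<close> tending to zero
  with \<open>T\<close>.\<close>

lemma pconv_mult_L2_bounded:
  assumes X: "pconv P X 0"
    and int: "\<forall>\<^sub>F T in sequentially. integrable (P T) (\<lambda>\<omega>. (Y T \<omega>)\<^sup>2)"
    and le: "\<forall>\<^sub>F T in sequentially. integral\<^sup>L (P T) (\<lambda>\<omega>. (Y T \<omega>)\<^sup>2) \<le> K"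
  shows "pconv P (\<lambda>T \<omega>. X T \<omega> * Y T \<omega>) 0"
proof -
  text \<open>A sequence converging to \<open>0\<close> in probability does so at some deterministic rate.\<close>
  have "\<exists>T0. \<forall>T\<ge>T0. \<exists>A\<in>sets (P T). (\<forall>\<omega>\<in>A. \<bar>X T \<omega>\<bar> \<le> 1 / real (Suc k)) \<and> 1 - 1 / real (Suc k) \<le> measure (P T) A" for k
  proof -
    have "0 < 1 / real (Suc k)" by simp
    then have "whp P (\<lambda>T \<omega>. \<bar>X T \<omega> - 0\<bar> \<le> 1 / real (Suc k))" using X unfolding pconv_def by blast
    then obtain A where A: "\<forall>\<^sub>F T in sequentially. A T \<in> sets (P T) \<and> (\<forall>\<omega>\<in>A T. \<bar>X T \<omega> - 0\<bar> \<le> 1 / real (Suc k))"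
      "(\<lambda>T. measure (P T) (A T)) \<longlonglongrightarrow> 1" unfolding whp_def by blast
    have "\<forall>\<^sub>F T in sequentially. 1 - 1 / real (Suc k) < measure (P T) (A T)"
      by (rule order_tendstoD(1)[OF A(2)]) simp
    with A(1) have "\<forall>\<^sub>F T in sequentially. \<exists>A\<in>sets (P T). (\<forall>\<omega>\<in>A. \<bar>X T \<omega>\<bar> \<le> 1 / real (Suc k)) \<and> 1 - 1 / real (Suc k) \<le> measure (P T) A"
    proof eventually_elim
      case (elim T)
      then show ?case by (intro bexI[of _ "A T"]) auto
    qed
    then show ?thesis unfolding eventually_sequentially .
  qed
  then obtain T0 where T0: "\<And>k T. T \<ge> T0 k \<Longrightarrow>
      \<exists>A\<in>sets (P T). (\<forall>\<omega>\<in>A. \<bar>X T \<omega>\<bar> \<le> 1 / real (Suc k)) \<and> 1 - 1 / real (Suc k) \<le> measure (P T) A" by metis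
  show ?thesis
    unfolding pconv_def
  proof (intro allI impI)
    fix \<epsilon> :: real assume \<epsilon>: "0 < \<epsilon>"
    \<comment> \<open>The largest index, bounded by \<open>T\<close>, whose threshold has been
      passed. Inserting 0 keeps the set nonempty; the rate \<open>1 / Suc (k T)\<close> tends to
      zero because every index is reached eventually.\<close>
    define k where "k T = Max (insert 0 {k. k \<le> T \<and> T0 k \<le> T})" for T
    have kfin: "finite (insert 0 {k. k \<le> T \<and> T0 k \<le> T})" for T by auto
    have kT: "k T = 0 \<or> T0 (k T) \<le> T" for T
      using Max_in[OF kfin, of T] by (auto simp: k_def)
    have k_lim: "filterlim k at_top sequentially"
      unfolding filterlim_at_top
    proof
      fix j
      show "\<forall>\<^sub>F T in sequentially. j \<le> k T"
        using eventually_ge_at_top[of "max j (T0 j)"]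
        by eventually_elim (auto simp: k_def intro!: Max_ge)
    qed
    have lim1: "(\<lambda>T. 1 / real (Suc (k T))) \<longlonglongrightarrow> 0"
      using filterlim_compose[OF LIMSEQ_Suc[OF lim_1_over_n] k_lim] .
    define e where "e T = 1 / real (Suc (k T)) + \<bar>K\<bar> * (1 / real (Suc (k T)))\<^sup>2 / \<epsilon>\<^sup>2" for T
    have "e \<longlonglongrightarrow> 0 + \<bar>K\<bar> * 0\<^sup>2 / \<epsilon>\<^sup>2" unfolding e_def by (intro tendsto_intros lim1) (use \<epsilon> in auto)
    then have e0: "e \<longlonglongrightarrow> 0" by simp
    have "\<forall>\<^sub>F T in sequentially. 1 \<le> k T" using k_lim unfolding filterlim_at_top by blast
    then have "\<forall>\<^sub>F T in sequentially. \<exists>A\<in>sets (P T). (\<forall>\<omega>\<in>A. \<bar>X T \<omega> * Y T \<omega> - 0\<bar> \<le> \<epsilon>) \<and> 1 - e T \<le> measure (P T) A"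
      using int le eventually_ge_at_top[of 1]
    proof eventually_elim
      case (elim T)
      interpret prob_space "P T" using elim by (intro prob)
      define d where "d = 1 / real (Suc (k T))"
      have d: "0 < d" by (simp add: d_def)
      have "T0 (k T) \<le> T" using kT[of T] elim by auto
      from T0[OF this] obtain A where A: "A \<in> events" "\<And>\<omega>. \<omega> \<in> A \<Longrightarrow> \<bar>X T \<omega>\<bar> \<le> d" "1 - d \<le> prob A"
        unfolding d_def by blast
      note [measurable] = borel_measurable_integrable[OF elim(2)]
      let ?B = "{\<omega> \<in> space (P T). (Y T \<omega>)\<^sup>2 < (\<epsilon> / d)\<^sup>2}"
      have B: "?B \<in> events" by measurable
      have pos: "0 < (\<epsilon> / d)\<^sup>2" using \<epsilon> d by simp
      have "prob {\<omega> \<in> space (P T). (\<epsilon> / d)\<^sup>2 \<le> (Y T \<omega>)\<^sup>2} \<le> expectation (\<lambda>\<omega>. (Y T \<omega>)\<^sup>2) / (\<epsilon> / d)\<^sup>2"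
        using elim pos by (intro integral_Markov_inequality_measure[where A="{}"]) auto
      also have "\<dots> \<le> \<bar>K\<bar> / (\<epsilon> / d)\<^sup>2" using elim by (intro divide_right_mono) auto
      also have "{\<omega> \<in> space (P T). (\<epsilon> / d)\<^sup>2 \<le> (Y T \<omega>)\<^sup>2} = space (P T) - ?B" by auto
      finally have PB: "1 - \<bar>K\<bar> * d\<^sup>2 / \<epsilon>\<^sup>2 \<le> prob ?B" using prob_compl[OF B] by (simp add: power_divide)
      have "prob (A \<union> ?B) = prob A + prob ?B - prob (A \<inter> ?B)"
        using A B by (intro measure_Un3) (auto simp: fmeasurable_eq_sets)
      moreover have "prob (A \<union> ?B) \<le> 1" by (rule prob_le_1)
      ultimately have "1 - e T \<le> prob (A \<inter> ?B)" using PB A(3) unfolding e_def d_def[symmetric] by linarith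
      moreover have "\<bar>X T \<omega> * Y T \<omega> - 0\<bar> \<le> \<epsilon>" if "\<omega> \<in> A \<inter> ?B" for \<omega>
      proof -
        have "\<bar>Y T \<omega>\<bar>\<^sup>2 < (\<epsilon> / d)\<^sup>2" using that by simp
        then have "\<bar>Y T \<omega>\<bar> < \<epsilon> / d" by (rule power2_less_imp_less) (use \<epsilon> d in simp)
        then have "\<bar>Y T \<omega>\<bar> \<le> \<epsilon> / d" by simp
        then have "\<bar>X T \<omega>\<bar> * \<bar>Y T \<omega>\<bar> \<le> d * (\<epsilon> / d)" using A(2)[of \<omega>] that d by (intro mult_mono) auto
        then show ?thesis using d by (simp add: abs_mult)
      qed
      ultimately show ?case using A(1) B by (intro bexI[of _ "A \<inter> ?B"]) auto
    qed
    then show "whp P (\<lambda>T \<omega>. \<bar>X T \<omega> * Y T \<omega> - 0\<bar> \<le> \<epsilon>)" by (rule whp_lower_bound[OF _ e0])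
  qed
qed

lemma conv_in_probI:
  assumes meas: "\<forall>\<^sub>F T in sequentially. X T \<in> borel_measurable (P T)" and X: "pconv P X l"
  shows "conv_in_prob P X l"
  unfolding conv_in_prob_def
proof (intro conjI allI impI meas)
  fix \<epsilon> :: real assume "0 < \<epsilon>"
  then obtain A where A: "\<forall>\<^sub>F T in sequentially. A T \<in> sets (P T) \<and> (\<forall>\<omega>\<in>A T. \<bar>X T \<omega> - l\<bar> \<le> \<epsilon>)"
    "(\<lambda>T. measure (P T) (A T)) \<longlonglongrightarrow> 1"
    using X unfolding pconv_def whp_def by blast
  have le: "\<forall>\<^sub>F T in sequentially. measure (P T) {\<omega> \<in> space (P T). \<epsilon> < \<bar>X T \<omega> - l\<bar>} \<le> 1 - measure (P T) (A T)"
    using A(1) meas eventually_ge_at_top[of 1]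
  proof eventually_elim
    case (elim T)
    interpret prob_space "P T" using elim by (intro prob)
    have "prob {\<omega> \<in> space (P T). \<epsilon> < \<bar>X T \<omega> - l\<bar>} \<le> prob (space (P T) - A T)"
      using elim by (intro finite_measure_mono) (auto simp: not_less)
    then show ?case using prob_compl[of "A T"] elim by simp
  qed
  have "(\<lambda>T. 1 - measure (P T) (A T)) \<longlonglongrightarrow> 1 - 1" by (intro tendsto_intros A)
  then show "(\<lambda>T. measure (P T) {\<omega> \<in> space (P T). \<epsilon> < \<bar>X T \<omega> - l\<bar>}) \<longlonglongrightarrow> 0"
    by (intro tendsto_sandwich[OF _ le tendsto_const]) auto
qed

text \<open>The limit theorem for \<open>Z\<close> is available for characteristic functions. Where
  \<open>Y\<close> and \<open>Z\<close> differ by at most \<epsilon>, the integrands differ by at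
  most \<open>\<epsilon> * \<bar>t\<bar>\<close>, and elsewhere by at most 2; continuity of
  characteristic functions then yields weak convergence for \<open>Y\<close>.\<close>

lemma slutsky_char:
  assumes Y: "\<forall>\<^sub>F T in sequentially. Y T \<in> borel_measurable (P T)"
    and Z: "\<forall>\<^sub>F T in sequentially. Z T \<in> borel_measurable (P T)"
    and diff: "pconv P (\<lambda>T \<omega>. Y T \<omega> - Z T \<omega>) 0"
    and char: "\<And>t. (\<lambda>T. char (distr (P T) borel (Z T)) t) \<longlonglongrightarrow> char \<mu> t" and \<mu>: "real_distribution \<mu>"
  shows "conv_in_distr P Y \<mu>"
proof -
  define good where "good T \<longleftrightarrow> T \<ge> 1 \<and> Y T \<in> borel_measurable (P T) \<and> Z T \<in> borel_measurable (P T)" for T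
  have good: "\<forall>\<^sub>F T in sequentially. good T"
    using Y Z eventually_ge_at_top[of 1] by eventually_elim (simp add: good_def)
  \<comment> \<open>The continuity theorem asks for a distribution at every index, while
    measurability holds only eventually; the exceptional indices are filled with the limit
    law.\<close>
  define D where "D T = (if good T then distr (P T) borel (Y T) else \<mu>)" for T
  have D: "real_distribution (D T)" for T
  proof (cases "good T")
    case True
    then interpret prob_space "P T" by (intro prob) (simp add: good_def)
    show ?thesis using True by (auto simp: D_def good_def intro!: real_distribution_distr)
  qed (use \<mu> in \<open>simp add: D_def\<close>)
  have "(\<lambda>T. char (D T) t) \<longlonglongrightarrow> char \<mu> t" for t
  proof -
    have "(\<lambda>T. char (D T) t - char (distr (P T) borel (Z T)) t) \<longlonglongrightarrow> 0"
    proof (rule tendstoI)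
      fix e :: real assume e: "0 < e"
      define \<epsilon> where "\<epsilon> = e / (2 * (\<bar>t\<bar> + 1))"
      have \<epsilon>: "0 < \<epsilon>" using e by (simp add: \<epsilon>_def)
      then obtain A where A: "\<forall>\<^sub>F T in sequentially. A T \<in> sets (P T) \<and> (\<forall>\<omega>\<in>A T. \<bar>Y T \<omega> - Z T \<omega> - 0\<bar> \<le> \<epsilon>)"
        "(\<lambda>T. measure (P T) (A T)) \<longlonglongrightarrow> 1"
        using diff unfolding pconv_def whp_def by blast
      have "\<forall>\<^sub>F T in sequentially. 1 - e / 4 < measure (P T) (A T)"
        by (rule order_tendstoD(1)[OF A(2)]) (use e in simp)
      then show "\<forall>\<^sub>F T in sequentially. dist (char (D T) t - char (distr (P T) borel (Z T)) t) 0 < e"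
        using A(1) good
      proof eventually_elim
        case (elim T)
        interpret prob_space "P T" using elim by (intro prob) (simp add: good_def)
        have [measurable]: "Y T \<in> borel_measurable (P T)" "Z T \<in> borel_measurable (P T)" "A T \<in> events"
          using elim by (auto simp: good_def)
        have int: "integrable (P T) (\<lambda>\<omega>. iexp (t * Y T \<omega>))" "integrable (P T) (\<lambda>\<omega>. iexp (t * Z T \<omega>))"
          by (rule integrable_iexp; measurable)+
        have bnd: "norm (iexp (t * Y T \<omega>) - iexp (t * Z T \<omega>)) \<le> \<epsilon> * \<bar>t\<bar> + 2 * indicator (space (P T) - A T) \<omega>"
          if "\<omega> \<in> space (P T)" for \<omega>
        proof (cases "\<omega> \<in> A T")
          case True
          have "norm (iexp (t * Y T \<omega>) - iexp (t * Z T \<omega>)) = norm (iexp (t * Z T \<omega>) * (iexp (t * (Y T \<omega> - Z T \<omega>)) - 1))"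
            by (simp add: algebra_simps flip: exp_add)
          also have "\<dots> = norm (iexp (t * (Y T \<omega> - Z T \<omega>)) - 1)" by (simp add: norm_mult)
          also have "\<dots> \<le> \<bar>t * (Y T \<omega> - Z T \<omega>)\<bar>" using iexp_approx1[of "t * (Y T \<omega> - Z T \<omega>)" 0] by simp
          also have "\<dots> \<le> \<epsilon> * \<bar>t\<bar>" using True elim by (auto simp: abs_mult mult.commute[of \<epsilon>] intro!: mult_left_mono)
          finally show ?thesis using True by simp
        next
          case False
          have "norm (iexp (t * Y T \<omega>) - iexp (t * Z T \<omega>)) \<le> norm (iexp (t * Y T \<omega>)) + norm (iexp (t * Z T \<omega>))"
            by (rule norm_triangle_ineq4)
          then show ?thesis using False that \<epsilon> by (simp add: add_increasing)
        qed
        have "char (D T) t - char (distr (P T) borel (Z T)) t = (\<integral>\<omega>. iexp (t * Y T \<omega>) - iexp (t * Z T \<omega>) \<partial>P T)"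
          using elim int by (simp add: D_def char_def integral_distr)
        also have "norm \<dots> \<le> (\<integral>\<omega>. norm (iexp (t * Y T \<omega>) - iexp (t * Z T \<omega>)) \<partial>P T)"
          by (rule integral_norm_bound)
        also have "\<dots> \<le> (\<integral>\<omega>. \<epsilon> * \<bar>t\<bar> + 2 * indicator (space (P T) - A T) \<omega> \<partial>P T)"
        proof (rule integral_mono)
          show "integrable (P T) (\<lambda>\<omega>. norm (iexp (t * Y T \<omega>) - iexp (t * Z T \<omega>)))"
            by (intro integrable_norm Bochner_Integration.integrable_diff int)
          show "integrable (P T) (\<lambda>\<omega>. \<epsilon> * \<bar>t\<bar> + 2 * indicator (space (P T) - A T) \<omega>)"
            by (intro Bochner_Integration.integrable_add integrable_mult_right integrable_const integrable_real_indicator)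
               (auto simp: less_top[symmetric])
        qed (rule bnd)
        also have "\<dots> = \<epsilon> * \<bar>t\<bar> + 2 * prob (space (P T) - A T)"
        proof -
          have i2: "integrable (P T) (\<lambda>\<omega>. 2 * indicat_real (space (P T) - A T) \<omega>)"
            by (intro integrable_mult_right integrable_real_indicator) (auto simp: less_top[symmetric])
          show ?thesis by (subst Bochner_Integration.integral_add[OF integrable_const i2]) (simp add: prob_space)
        qed
        also have "\<dots> = \<epsilon> * \<bar>t\<bar> + 2 * (1 - prob (A T))" by (simp add: prob_compl)
        also have "\<dots> < e"
        proof -
          have "\<epsilon> * \<bar>t\<bar> \<le> \<epsilon> * (\<bar>t\<bar> + 1)" using \<epsilon> by simp
          also have "\<dots> = e / 2"
          proof -
            have "e / (2 * u) * u = e / 2" if "u \<noteq> 0" for u using that by simp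
            from this[of "\<bar>t\<bar> + 1"] show ?thesis unfolding \<epsilon>_def by linarith
          qed
          finally show ?thesis using elim(1) by simp
        qed
        finally show ?case by (simp add: dist_norm)
      qed
    qed
    from tendsto_add[OF this char[of t]] show ?thesis by simp
  qed
  then have "weak_conv_m D \<mu>" by (rule levy_continuity[OF D \<mu>])
  moreover have "\<forall>\<^sub>F T in sequentially. D T = distr (P T) borel (Y T)"
    using good by eventually_elim (simp add: D_def)
  ultimately have "weak_conv_m (\<lambda>T. distr (P T) borel (Y T)) \<mu>"
    unfolding weak_conv_m_def weak_conv_def
  proof (intro allI impI)
    fix x assume D: "\<forall>x. isCont (cdf \<mu>) x \<longrightarrow> (\<lambda>T. cdf (D T) x) \<longlonglongrightarrow> cdf \<mu> x"
      and ev: "\<forall>\<^sub>F T in sequentially. D T = distr (P T) borel (Y T)" and x: "isCont (cdf \<mu>) x"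
    have "\<forall>\<^sub>F T in sequentially. cdf (D T) x = cdf (distr (P T) borel (Y T)) x"
      using ev by eventually_elim simp
    moreover have "(\<lambda>T. cdf (D T) x) \<longlonglongrightarrow> cdf \<mu> x" using D x by simp
    ultimately show "(\<lambda>T. cdf (distr (P T) borel (Y T)) x) \<longlonglongrightarrow> cdf \<mu> x"
      by (rule Lim_transform_eventually[rotated])
  qed
  then show ?thesis using Y by (simp add: conv_in_distr_def)
qed

end

section \<open>Independence and the central limit theorem\<close>

lemma (in prob_space) sigma_sets_vimage:
  assumes "X \<in> measurable M N"
  shows "sigma_sets (space M) {X -` A \<inter> space M |A. A \<in> sets N} = {X -` A \<inter> space M |A. A \<in> sets N}"
proof -
  have X: "X \<in> space M \<rightarrow> space N" using assms by (auto dest: measurable_space)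
  have "sets (vimage_algebra (space M) X N) = {X -` A \<inter> space M |A. A \<in> sets N}"
    by (rule sets_vimage_algebra2[OF X])
  then show ?thesis
    using sets.sigma_sets_eq[of "vimage_algebra (space M) X N"] by simp
qed

lemma (in prob_space) indep_elems_indep_var:
  fixes f :: "'b \<Rightarrow> real" and g :: "'c \<Rightarrow> real"
  assumes ind: "indep_elems M S X S' Y" and f: "f \<in> borel_measurable S" and g: "g \<in> borel_measurable S'"
  shows "indep_var borel (\<lambda>\<omega>. f (X \<omega>)) borel (\<lambda>\<omega>. g (Y \<omega>))"
proof -
  have X: "X \<in> measurable M S" and Y: "Y \<in> measurable M S'"
    and set: "indep_set {X -` A \<inter> space M |A. A \<in> sets S} {Y -` A \<inter> space M |A. A \<in> sets S'}"
    using ind by (auto simp: indep_elems_def)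
  have fX: "(\<lambda>\<omega>. f (X \<omega>)) \<in> borel_measurable M" and gY: "(\<lambda>\<omega>. g (Y \<omega>)) \<in> borel_measurable M"
    using measurable_compose[OF X f] measurable_compose[OF Y g] .
  have sub1: "{(\<lambda>\<omega>. f (X \<omega>)) -` A \<inter> space M |A. A \<in> sets borel} \<subseteq> {X -` A \<inter> space M |A. A \<in> sets S}"
  proof clarify
    fix A :: "real set" assume "A \<in> sets borel"
    then have "f -` A \<inter> space S \<in> sets S" by (rule measurable_sets[OF f])
    moreover have "(\<lambda>\<omega>. f (X \<omega>)) -` A \<inter> space M = X -` (f -` A \<inter> space S) \<inter> space M"
      using measurable_space[OF X] by auto
    ultimately show "\<exists>B. (\<lambda>\<omega>. f (X \<omega>)) -` A \<inter> space M = X -` B \<inter> space M \<and> B \<in> sets S" by blast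
  qed
  have sub2: "{(\<lambda>\<omega>. g (Y \<omega>)) -` A \<inter> space M |A. A \<in> sets borel} \<subseteq> {Y -` A \<inter> space M |A. A \<in> sets S'}"
  proof clarify
    fix A :: "real set" assume "A \<in> sets borel"
    then have "g -` A \<inter> space S' \<in> sets S'" by (rule measurable_sets[OF g])
    moreover have "(\<lambda>\<omega>. g (Y \<omega>)) -` A \<inter> space M = Y -` (g -` A \<inter> space S') \<inter> space M"
      using measurable_space[OF Y] by auto
    ultimately show "\<exists>B. (\<lambda>\<omega>. g (Y \<omega>)) -` A \<inter> space M = Y -` B \<inter> space M \<and> B \<in> sets S'" by blast
  qed
  have "indep_set {(\<lambda>\<omega>. f (X \<omega>)) -` A \<inter> space M |A. A \<in> sets borel} {(\<lambda>\<omega>. g (Y \<omega>)) -` A \<inter> space M |A. A \<in> sets borel}"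
    using set unfolding indep_set_def
    by (rule indep_sets_mono_sets) (use sub1 sub2 in \<open>auto split: bool.split\<close>)
  then show ?thesis
    unfolding indep_var_eq sigma_sets_vimage[OF fX] sigma_sets_vimage[OF gY] using fX gY by simp
qed

lemma (in prob_space) char_scaled_iid_sum:
  assumes ind: "indep_vars (\<lambda>_. borel) X {..<n}" and law: "\<And>i. i < n \<Longrightarrow> distr M borel (X i) = \<mu>"
  shows "char (distr M borel (\<lambda>\<omega>. (\<Sum>i<n. X i \<omega>) / c)) t = char \<mu> (t / c) ^ n"
proof -
  have rv[measurable]: "random_variable borel (X i)" if "i < n" for i
    using ind that by (auto simp: indep_vars_def)
  have ind': "indep_vars (\<lambda>_. borel) (\<lambda>i \<omega>. X i \<omega> / c) {..<n}"
    by (rule indep_vars_compose2[OF ind]) auto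
  have "char (distr M borel (\<lambda>\<omega>. (\<Sum>i<n. X i \<omega>) / c)) t = char (distr M borel (\<lambda>\<omega>. \<Sum>i<n. X i \<omega> / c)) t"
    by (simp add: sum_divide_distrib)
  also have "\<dots> = (\<Prod>i<n. char (distr M borel (\<lambda>\<omega>. X i \<omega> / c)) t)"
    by (rule char_distr_sum[OF ind'])
  also have "\<dots> = (\<Prod>i<n. char \<mu> (t / c))"
  proof (intro prod.cong refl)
    fix i assume i: "i \<in> {..<n}"
    then have [measurable]: "random_variable borel (X i)" by (simp add: rv)
    show "char (distr M borel (\<lambda>\<omega>. X i \<omega> / c)) t = char \<mu> (t / c)"
      using i by (simp add: char_def integral_distr flip: law)
  qed
  finally show ?thesis by simp
qed

text \<open>The central limit theorem as a statement about one law: the infinite product of \<mu>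
  carries an i.i.d. sequence, and the characteristic function of its scaled sums is the displayed
  power. No probability space is left in the statement, so it transfers to samples whose space
  changes with the sample size.\<close>

lemma clt_char:
  fixes \<mu> :: "real measure"
  assumes \<mu>: "real_distribution \<mu>" and mean: "(\<integral>x. x \<partial>\<mu>) = 0" and int: "integrable \<mu> (\<lambda>x. x\<^sup>2)"
    and var: "(\<integral>x. x\<^sup>2 \<partial>\<mu>) = \<sigma>\<^sup>2" and \<sigma>: "0 < \<sigma>"
  shows "(\<lambda>n. char \<mu> (t / sqrt (real n * \<sigma>\<^sup>2)) ^ n) \<longlonglongrightarrow> char std_normal_distribution t"
proof -
  interpret \<mu>: real_distribution \<mu> by (rule \<mu>)
  interpret pp: product_prob_space "\<lambda>_::nat. \<mu>" UNIV ..
  let ?M = "PiM UNIV (\<lambda>_::nat. \<mu>)"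
  define X :: "nat \<Rightarrow> (nat \<Rightarrow> real) \<Rightarrow> real" where "X n \<omega> = \<omega> n" for n \<omega>
  have X[measurable]: "X n \<in> borel_measurable ?M" for n
    unfolding X_def using measurable_component_singleton[of n UNIV "\<lambda>_. \<mu>"]
    by (simp add: measurable_cong_sets[OF refl \<mu>.events_eq_borel])
  have law: "distr ?M borel (X n) = \<mu>" for n
  proof -
    have "distr ?M borel (X n) = distr ?M \<mu> (\<lambda>\<omega>. \<omega> n)"
      unfolding X_def by (rule distr_cong) auto
    then show ?thesis using pp.PiM_component[of n] by simp
  qed
  have ind: "pp.P.indep_vars (\<lambda>_. borel) X UNIV"
  proof -
    have "distr ?M (PiM UNIV (\<lambda>_. borel)) (\<lambda>\<omega>. \<lambda>i\<in>UNIV. X i \<omega>) = distr ?M ?M (\<lambda>\<omega>. \<omega>)"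
      by (rule distr_cong) (auto simp: X_def intro!: sets_PiM_cong)
    also have "\<dots> = ?M" by simp
    also have "\<dots> = PiM UNIV (\<lambda>i. distr ?M borel (X i))" by (simp add: law)
    finally show ?thesis by (subst pp.P.indep_vars_iff_distr_eq_PiM) auto
  qed
  have E: "(\<integral>\<omega>. f (X n \<omega>) \<partial>?M) = (\<integral>x. f x \<partial>\<mu>)" if [measurable]: "f \<in> borel_measurable borel" for f :: "real \<Rightarrow> real" and n
    by (subst law[of n, symmetric], subst integral_distr) auto
  have "weak_conv_m (\<lambda>n. distr ?M borel (\<lambda>x. (\<Sum>i<n. X i x) / sqrt (n * \<sigma>\<^sup>2))) std_normal_distribution"
  proof (rule pp.P.central_limit_theorem_zero_mean[OF ind _ \<sigma> _ _ law])
    show m0: "pp.P.expectation (X n) = 0" for n using E[of "\<lambda>x. x" n] mean by simp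
    show "integrable ?M (\<lambda>x. (X n x)\<^sup>2)" for n
      using int by (subst (asm) law[of n, symmetric], subst (asm) integrable_distr_eq) auto
    show "pp.P.variance (X n) = \<sigma>\<^sup>2" for n using E[of "\<lambda>x. x\<^sup>2" n] var m0 by simp
  qed
  then have "(\<lambda>n. char (distr ?M borel (\<lambda>x. (\<Sum>i<n. X i x) / sqrt (n * \<sigma>\<^sup>2))) t) \<longlonglongrightarrow> char std_normal_distribution t"
    by (rule levy_continuity1[rotated 2]) (auto intro!: pp.P.real_distribution_distr real_dist_normal_dist)
  moreover have "char (distr ?M borel (\<lambda>x. (\<Sum>i<n. X i x) / sqrt (n * \<sigma>\<^sup>2))) t = char \<mu> (t / sqrt (real n * \<sigma>\<^sup>2)) ^ n" for n
    by (rule pp.P.char_scaled_iid_sum[OF pp.P.indep_vars_subset[OF ind] law]) auto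
  ultimately show ?thesis by simp
qed

text \<open>Every sample size has its own probability space; only the law \<open>L\<close> is
  common. \<open>W\<close> will be the pair \<open>(F, U)\<close>. Its independence is required of
  the whole noise block jointly, so that products of noise terms can be separated from functions of
  \<open>W\<close>.\<close>

locale noise_seq = prob_seq P for P :: "nat \<Rightarrow> 'w measure" +
  fixes \<xi> :: "nat \<Rightarrow> nat \<Rightarrow> 'w \<Rightarrow> real \<times> real \<times> real" and L :: "(real \<times> real \<times> real) measure"
    and S :: "nat \<Rightarrow> 'b measure" and W :: "nat \<Rightarrow> 'w \<Rightarrow> 'b"
  assumes indep: "\<And>T. T \<ge> 1 \<Longrightarrow> prob_space.indep_vars (P T) (\<lambda>_. borel) (\<xi> T) {..<T}"
    and law: "\<And>T t. T \<ge> 1 \<Longrightarrow> t < T \<Longrightarrow> distr (P T) borel (\<xi> T t) = L"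
    and indepW: "\<And>T. T \<ge> 1 \<Longrightarrow>
      indep_elems (P T) (PiM {..<T} (\<lambda>_. borel)) (\<lambda>\<omega>. \<lambda>t\<in>{..<T}. \<xi> T t \<omega>) (S T) (W T)"
begin

lemma rv_\<xi>:
  assumes T: "T \<ge> 1" "t < T"
  shows "\<xi> T t \<in> borel_measurable (P T)"
proof -
  interpret prob_space "P T" by (rule prob[OF T(1)])
  show ?thesis using indep[OF T(1)] T(2) unfolding indep_vars_def by simp
qed

lemma prob_L: "prob_space L" and sets_L [measurable_cong, simp]: "sets L = sets borel"
proof -
  interpret prob_space "P 1" by (rule prob) simp
  show "prob_space L" using prob_space_distr[OF rv_\<xi>[of 1 0]] law[of 1 0] by simp
  show "sets L = sets borel" using law[of 1 0, symmetric] by simp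
qed

lemma law_integral:
  fixes h :: "real \<times> real \<times> real \<Rightarrow> real"
  assumes [measurable]: "h \<in> borel_measurable borel" and T: "T \<ge> 1" "t < T"
  shows "(\<integral>\<omega>. h (\<xi> T t \<omega>) \<partial>P T) = (\<integral>x. h x \<partial>L)"
    and "integrable (P T) (\<lambda>\<omega>. h (\<xi> T t \<omega>)) \<longleftrightarrow> integrable L h"
proof -
  note [measurable] = rv_\<xi>[OF T]
  show "(\<integral>\<omega>. h (\<xi> T t \<omega>) \<partial>P T) = (\<integral>x. h x \<partial>L)"
    by (subst law[OF T, symmetric], subst integral_distr) auto
  show "integrable (P T) (\<lambda>\<omega>. h (\<xi> T t \<omega>)) \<longleftrightarrow> integrable L h"
    by (subst law[OF T, symmetric], subst integrable_distr_eq) auto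
qed

lemma integrable_L_of_square:
  fixes h :: "real \<times> real \<times> real \<Rightarrow> real"
  assumes [measurable]: "h \<in> borel_measurable borel" and h2: "integrable L (\<lambda>x. (h x)\<^sup>2)"
  shows "integrable L h"
proof -
  interpret prob_space L by (rule prob_L)
  show ?thesis by (rule square_integrable_imp_integrable[OF _ h2]) measurable
qed

lemma pair_moment:
  fixes h :: "real \<times> real \<times> real \<Rightarrow> real"
  assumes h[measurable]: "h \<in> borel_measurable borel" and h2: "integrable L (\<lambda>x. (h x)\<^sup>2)"
    and h0: "(\<integral>x. h x \<partial>L) = 0" and T: "T \<ge> 1" "t < T" "s < T"
  shows "integrable (P T) (\<lambda>\<omega>. h (\<xi> T t \<omega>) * h (\<xi> T s \<omega>))"
    and "(\<integral>\<omega>. h (\<xi> T t \<omega>) * h (\<xi> T s \<omega>) \<partial>P T) = (if t = s then (\<integral>x. (h x)\<^sup>2 \<partial>L) else 0)"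
proof -
  interpret prob_space "P T" by (rule prob[OF T(1)])
  have hint: "integrable (P T) (\<lambda>\<omega>. h (\<xi> T u \<omega>))" if "u < T" for u
    using law_integral(2)[OF h T(1) that] integrable_L_of_square[OF h h2] by simp
  have ind: "indep_vars (\<lambda>_. borel) (\<lambda>u \<omega>. h (\<xi> T u \<omega>)) {..<T}"
    by (rule indep_vars_compose2[OF indep[OF T(1)]]) auto
  have "integrable (P T) (\<lambda>\<omega>. h (\<xi> T t \<omega>) * h (\<xi> T s \<omega>)) \<and>
     (\<integral>\<omega>. h (\<xi> T t \<omega>) * h (\<xi> T s \<omega>) \<partial>P T) = (if t = s then (\<integral>x. (h x)\<^sup>2 \<partial>L) else 0)"
  proof (cases "t = s")
    case True
    have "(\<lambda>x. (h x)\<^sup>2) \<in> borel_measurable borel" by measurable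
    from law_integral[OF this T(1,2)] show ?thesis using True h2 by (simp add: power2_eq_square)
  next
    case False
    have ind2: "indep_vars (\<lambda>_. borel) (\<lambda>u \<omega>. h (\<xi> T u \<omega>)) {t, s}"
      by (rule indep_vars_subset[OF ind]) (use T in auto)
    have eq: "(\<lambda>\<omega>. \<Prod>u\<in>{t, s}. h (\<xi> T u \<omega>)) = (\<lambda>\<omega>. h (\<xi> T t \<omega>) * h (\<xi> T s \<omega>))"
      using False by simp
    have "integrable (P T) (\<lambda>\<omega>. \<Prod>u\<in>{t, s}. h (\<xi> T u \<omega>))"
      by (rule indep_vars_integrable[OF _ ind2]) (use T hint in auto)
    moreover have "(\<integral>\<omega>. (\<Prod>u\<in>{t, s}. h (\<xi> T u \<omega>)) \<partial>P T) = (\<Prod>u\<in>{t, s}. \<integral>\<omega>. h (\<xi> T u \<omega>) \<partial>P T)"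
      by (rule indep_vars_lebesgue_integral[OF _ ind2]) (use T hint in auto)
    ultimately show ?thesis
      unfolding eq using False law_integral(1)[OF h T(1,2)] h0 by simp
  qed
  then show "integrable (P T) (\<lambda>\<omega>. h (\<xi> T t \<omega>) * h (\<xi> T s \<omega>))"
    "(\<integral>\<omega>. h (\<xi> T t \<omega>) * h (\<xi> T s \<omega>) \<partial>P T) = (if t = s then (\<integral>x. (h x)\<^sup>2 \<partial>L) else 0)" by auto
qed

text \<open>Random weights that are functions of \<open>W\<close> may be treated as if they were
  deterministic: in the expanded square each term is a function of the noise times a function of
  \<open>W\<close>, and independence removes the off-diagonal terms. The bound \<open>b\<close> is
  there for integrability only and does not enter the value.\<close>

lemma weighted_sum_moment:
  fixes h :: "real \<times> real \<times> real \<Rightarrow> real" and w :: "nat \<Rightarrow> 'b \<Rightarrow> real"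
  assumes h[measurable]: "h \<in> borel_measurable borel" and h2: "integrable L (\<lambda>x. (h x)\<^sup>2)"
    and h0: "(\<integral>x. h x \<partial>L) = 0" and T: "T \<ge> 1"
    and w: "\<And>t. t < T \<Longrightarrow> w t \<in> borel_measurable (S T)"
    and b: "\<And>t \<omega>. t < T \<Longrightarrow> \<omega> \<in> space (P T) \<Longrightarrow> \<bar>w t (W T \<omega>)\<bar> \<le> b"
  shows "integrable (P T) (\<lambda>\<omega>. (\<Sum>t<T. w t (W T \<omega>) * h (\<xi> T t \<omega>))\<^sup>2)"
    and "(\<integral>\<omega>. (\<Sum>t<T. w t (W T \<omega>) * h (\<xi> T t \<omega>))\<^sup>2 \<partial>P T)
      = (\<integral>x. (h x)\<^sup>2 \<partial>L) * (\<Sum>t<T. \<integral>\<omega>. (w t (W T \<omega>))\<^sup>2 \<partial>P T)"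
proof -
  interpret prob_space "P T" by (rule prob[OF T])
  note iW = indepW[OF T]
  have WT: "W T \<in> measurable (P T) (S T)" using iW by (simp add: indep_elems_def)
  have wm[measurable]: "(\<lambda>\<omega>. w t (W T \<omega>)) \<in> borel_measurable (P T)" if "t < T" for t
    by (rule measurable_compose[OF WT w[OF that]])
  let ?F = "\<lambda>t s \<omega>. (h (\<xi> T t \<omega>) * h (\<xi> T s \<omega>)) * (w t (W T \<omega>) * w s (W T \<omega>))"
  have wint: "integrable (P T) (\<lambda>\<omega>. w t (W T \<omega>) * w s (W T \<omega>))" if "t < T" "s < T" for t s
  proof (rule integrable_const_bound[of _ "b * b"])
    show "AE \<omega> in P T. norm (w t (W T \<omega>) * w s (W T \<omega>)) \<le> b * b"
    proof (rule AE_I2)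
      fix \<omega> assume "\<omega> \<in> space (P T)"
      then show "norm (w t (W T \<omega>) * w s (W T \<omega>)) \<le> b * b"
        using b[OF that(1)] b[OF that(2)] by (auto simp: abs_mult intro!: mult_mono order_trans[OF abs_ge_zero])
    qed
    show "(\<lambda>\<omega>. w t (W T \<omega>) * w s (W T \<omega>)) \<in> borel_measurable (P T)"
      using wm[OF that(1)] wm[OF that(2)] by measurable
  qed
  have F: "integrable (P T) (?F t s)"
    "(\<integral>\<omega>. ?F t s \<omega> \<partial>P T) = (if t = s then (\<integral>x. (h x)\<^sup>2 \<partial>L) * (\<integral>\<omega>. (w t (W T \<omega>))\<^sup>2 \<partial>P T) else 0)"
    if ts: "t < T" "s < T" for t s
  proof -
    let ?f = "\<lambda>x :: nat \<Rightarrow> real \<times> real \<times> real. h (x t) * h (x s)"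
    let ?g = "\<lambda>x. w t x * w s x"
    have "(\<lambda>x :: nat \<Rightarrow> real \<times> real \<times> real. x u) \<in> measurable (PiM {..<T} (\<lambda>_. borel)) borel" if "u < T" for u
      using that by (intro measurable_component_singleton) auto
    from measurable_compose[OF this h] have hm: "(\<lambda>x. h (x u)) \<in> borel_measurable (PiM {..<T} (\<lambda>_. borel))" if "u < T" for u
      using that by simp
    have f: "?f \<in> borel_measurable (PiM {..<T} (\<lambda>_. borel))"
      using hm[OF ts(1)] hm[OF ts(2)] by measurable
    have g: "?g \<in> borel_measurable (S T)" using w[OF ts(1)] w[OF ts(2)] by measurable
    have iv: "indep_var borel (\<lambda>\<omega>. h (\<xi> T t \<omega>) * h (\<xi> T s \<omega>)) borel (\<lambda>\<omega>. w t (W T \<omega>) * w s (W T \<omega>))"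
      using indep_elems_indep_var[OF iW f g] ts by simp
    note pm = pair_moment[OF h h2 h0 T ts]
    show "integrable (P T) (?F t s)"
      by (rule indep_var_integrable[OF iv pm(1) wint[OF ts]])
    have "(\<integral>\<omega>. ?F t s \<omega> \<partial>P T) = (\<integral>\<omega>. h (\<xi> T t \<omega>) * h (\<xi> T s \<omega>) \<partial>P T) * (\<integral>\<omega>. w t (W T \<omega>) * w s (W T \<omega>) \<partial>P T)"
      by (rule indep_var_lebesgue_integral[OF iv pm(1) wint[OF ts]])
    then show "(\<integral>\<omega>. ?F t s \<omega> \<partial>P T) = (if t = s then (\<integral>x. (h x)\<^sup>2 \<partial>L) * (\<integral>\<omega>. (w t (W T \<omega>))\<^sup>2 \<partial>P T) else 0)"
      unfolding pm(2) by (simp add: power2_eq_square)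
  qed
  have eq: "(\<lambda>\<omega>. (\<Sum>t<T. w t (W T \<omega>) * h (\<xi> T t \<omega>))\<^sup>2) = (\<lambda>\<omega>. \<Sum>t<T. \<Sum>s<T. ?F t s \<omega>)"
    by (simp add: power2_eq_square sum_product mult_ac)
  show "integrable (P T) (\<lambda>\<omega>. (\<Sum>t<T. w t (W T \<omega>) * h (\<xi> T t \<omega>))\<^sup>2)"
    unfolding eq by (rule Bochner_Integration.integrable_sum, rule Bochner_Integration.integrable_sum, rule F) auto
  have "(\<integral>\<omega>. (\<Sum>t<T. \<Sum>s<T. ?F t s \<omega>) \<partial>P T) = (\<Sum>t<T. \<Sum>s<T. \<integral>\<omega>. ?F t s \<omega> \<partial>P T)"
  proof -
    have "(\<integral>\<omega>. (\<Sum>t<T. \<Sum>s<T. ?F t s \<omega>) \<partial>P T) = (\<Sum>t<T. \<integral>\<omega>. (\<Sum>s<T. ?F t s \<omega>) \<partial>P T)"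
      by (rule Bochner_Integration.integral_sum, rule Bochner_Integration.integrable_sum, rule F) auto
    also have "\<dots> = (\<Sum>t<T. \<Sum>s<T. \<integral>\<omega>. ?F t s \<omega> \<partial>P T)"
      by (rule sum.cong[OF refl], rule Bochner_Integration.integral_sum, rule F) auto
    finally show ?thesis .
  qed
  also have "\<dots> = (\<Sum>t<T. \<Sum>s<T. if t = s then (\<integral>x. (h x)\<^sup>2 \<partial>L) * (\<integral>\<omega>. (w t (W T \<omega>))\<^sup>2 \<partial>P T) else 0)"
    by (intro sum.cong refl F) auto
  also have "\<dots> = (\<integral>x. (h x)\<^sup>2 \<partial>L) * (\<Sum>t<T. \<integral>\<omega>. (w t (W T \<omega>))\<^sup>2 \<partial>P T)"
    by (simp add: sum_distrib_left)
  finally show "(\<integral>\<omega>. (\<Sum>t<T. w t (W T \<omega>) * h (\<xi> T t \<omega>))\<^sup>2 \<partial>P T)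
      = (\<integral>x. (h x)\<^sup>2 \<partial>L) * (\<Sum>t<T. \<integral>\<omega>. (w t (W T \<omega>))\<^sup>2 \<partial>P T)" unfolding eq .
qed

lemma sum_moment:
  fixes h :: "real \<times> real \<times> real \<Rightarrow> real"
  assumes h: "h \<in> borel_measurable borel" and h2: "integrable L (\<lambda>x. (h x)\<^sup>2)"
    and h0: "(\<integral>x. h x \<partial>L) = 0" and T: "T \<ge> 1"
  shows "integrable (P T) (\<lambda>\<omega>. (\<Sum>t<T. h (\<xi> T t \<omega>))\<^sup>2)"
    and "(\<integral>\<omega>. (\<Sum>t<T. h (\<xi> T t \<omega>))\<^sup>2 \<partial>P T) = real T * (\<integral>x. (h x)\<^sup>2 \<partial>L)"
  using weighted_sum_moment[OF h h2 h0 T, of "\<lambda>_ _. 1" 1] prob_space.prob_space[OF prob[OF T]] by simp_all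

lemma lln:
  fixes h :: "real \<times> real \<times> real \<Rightarrow> real"
  assumes h[measurable]: "h \<in> borel_measurable borel" and h2: "integrable L (\<lambda>x. (h x)\<^sup>2)"
  shows "pconv P (\<lambda>T \<omega>. (\<Sum>t<T. h (\<xi> T t \<omega>)) / real T) (\<integral>x. h x \<partial>L)"
proof -
  interpret L: prob_space L by (rule prob_L)
  define c where "c = (\<integral>x. h x \<partial>L)"
  define k where "k x = h x - c" for x
  have k[measurable]: "k \<in> borel_measurable borel" unfolding k_def by measurable
  have hi: "integrable L h" by (rule integrable_L_of_square[OF h h2])
  have k2: "integrable L (\<lambda>x. (k x)\<^sup>2)"
    unfolding k_def power2_diff
    by (intro Bochner_Integration.integrable_add Bochner_Integration.integrable_diff h2 L.integrable_const
        integrable_mult_left integrable_mult_right hi)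
  have k0: "(\<integral>x. k x \<partial>L) = 0" unfolding k_def using hi by (simp add: c_def L.prob_space)
  note m = sum_moment[OF k k2 k0]
  have "pconv P (\<lambda>T \<omega>. ((\<Sum>t<T. k (\<xi> T t \<omega>)) / real T)\<^sup>2) 0"
  proof (rule pconv_L1)
    show "\<forall>\<^sub>F T in sequentially. integrable (P T) (\<lambda>\<omega>. ((\<Sum>t<T. k (\<xi> T t \<omega>)) / real T)\<^sup>2)"
      using eventually_ge_at_top[of 1] by eventually_elim (simp add: power_divide m(1))
    show "\<forall>\<^sub>F T in sequentially. (\<integral>\<omega>. ((\<Sum>t<T. k (\<xi> T t \<omega>)) / real T)\<^sup>2 \<partial>P T) \<le> (\<integral>x. (k x)\<^sup>2 \<partial>L) * (1 / real T)"
      using eventually_ge_at_top[of 1] by eventually_elim (simp only: power_divide integral_divide_zero m(2), simp add: power2_eq_square)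
    show "(\<lambda>T. (\<integral>x. (k x)\<^sup>2 \<partial>L) * (1 / real T)) \<longlonglongrightarrow> 0"
      using tendsto_mult[OF tendsto_const lim_1_over_n] by simp
  qed auto
  from pconv_sqrt[OF this] have "pconv P (\<lambda>T \<omega>. \<bar>(\<Sum>t<T. k (\<xi> T t \<omega>)) / real T\<bar>) 0" by simp
  then have "pconv P (\<lambda>T \<omega>. (\<Sum>t<T. k (\<xi> T t \<omega>)) / real T) 0"
    by (rule pconv_0_le) (rule whp_eventually, simp)
  then have 1: "pconv P (\<lambda>T \<omega>. (\<Sum>t<T. k (\<xi> T t \<omega>)) / real T + c) (0 + c)"
    by (rule pconv_add) (rule pconv_const_seq, simp)
  have "pconv P (\<lambda>T \<omega>. (\<Sum>t<T. h (\<xi> T t \<omega>)) / real T) (0 + c)"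
  proof (rule pconv_cong[OF 1])
    show "whp P (\<lambda>T \<omega>. (\<Sum>t<T. k (\<xi> T t \<omega>)) / real T + c = (\<Sum>t<T. h (\<xi> T t \<omega>)) / real T)"
      by (rule whp_eventually, use eventually_ge_at_top[of 1] in eventually_elim)
         (simp add: k_def sum_subtractf diff_divide_distrib)
  qed
  then show ?thesis by (simp add: c_def)
qed

lemma clt:
  fixes h :: "real \<times> real \<times> real \<Rightarrow> real"
  assumes h[measurable]: "h \<in> borel_measurable borel" and h2: "integrable L (\<lambda>x. (h x)\<^sup>2)"
    and h0: "(\<integral>x. h x \<partial>L) = 0" and pos: "0 < (\<integral>x. (h x)\<^sup>2 \<partial>L)"
  shows "(\<lambda>T. char (distr (P T) borel (\<lambda>\<omega>. (\<Sum>t<T. h (\<xi> T t \<omega>)) / sqrt (real T * (\<integral>x. (h x)\<^sup>2 \<partial>L)))) u)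
     \<longlonglongrightarrow> char std_normal_distribution u"
proof -
  interpret L: prob_space L by (rule prob_L)
  define \<mu> where "\<mu> = distr L borel h"
  have \<mu>: "real_distribution \<mu>" unfolding \<mu>_def by (rule L.real_distribution_distr) measurable
  define \<sigma> where "\<sigma> = sqrt (\<integral>x. (h x)\<^sup>2 \<partial>L)"
  have \<sigma>: "0 < \<sigma>" "\<sigma>\<^sup>2 = (\<integral>x. (h x)\<^sup>2 \<partial>L)" using pos by (auto simp: \<sigma>_def)
  have lim: "(\<lambda>n. char \<mu> (u / sqrt (real n * \<sigma>\<^sup>2)) ^ n) \<longlonglongrightarrow> char std_normal_distribution u"
    by (rule clt_char[OF \<mu> _ _ _ \<sigma>(1)]) (use h0 h2 in \<open>simp_all add: \<mu>_def integral_distr integrable_distr_eq \<sigma>(2)\<close>)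
  have "\<forall>\<^sub>F T in sequentially. char \<mu> (u / sqrt (real T * \<sigma>\<^sup>2)) ^ T
      = char (distr (P T) borel (\<lambda>\<omega>. (\<Sum>t<T. h (\<xi> T t \<omega>)) / sqrt (real T * \<sigma>\<^sup>2))) u"
    using eventually_ge_at_top[of 1]
  proof eventually_elim
    case (elim T)
    interpret prob_space "P T" by (rule prob[OF elim])
    have ind: "indep_vars (\<lambda>_. borel) (\<lambda>t \<omega>. h (\<xi> T t \<omega>)) {..<T}"
      by (rule indep_vars_compose2[OF indep[OF elim]]) auto
    have "distr (P T) borel (\<lambda>\<omega>. h (\<xi> T t \<omega>)) = \<mu>" if "t < T" for t
      unfolding \<mu>_def law[OF elim that, symmetric]
      by (subst distr_distr) (use rv_\<xi>[OF elim that] in \<open>auto simp: o_def\<close>)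
    from char_scaled_iid_sum[OF ind this] show ?case by simp
  qed
  from Lim_transform_eventually[OF lim this] show ?thesis by (simp only: \<sigma>(2))
qed

end

section \<open>The instrumental variable estimator with small projections\<close>

definition nrm :: "nat \<Rightarrow> (nat \<Rightarrow> real) \<Rightarrow> real" where
  "nrm T v = (\<Sum>t<T. (v t)\<^sup>2)"

definition ip :: "nat \<Rightarrow> (nat \<Rightarrow> real) \<Rightarrow> (nat \<Rightarrow> real) \<Rightarrow> real" where
  "ip T u v = (\<Sum>t<T. u t * v t)"

lemma nrm_nonneg [simp]: "0 \<le> nrm T v"
  by (simp add: nrm_def sum_nonneg)

lemma ip_commute: "ip T u v = ip T v u"
  by (simp add: ip_def mult.commute)

lemma ip_add_left: "ip T (\<lambda>t. u t + v t) w = ip T u w + ip T v w"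
  by (simp add: ip_def algebra_simps sum.distrib)

lemma ip_add_right: "ip T w (\<lambda>t. u t + v t) = ip T w u + ip T w v"
  by (simp add: ip_def algebra_simps sum.distrib)

lemma ip_diff_right: "ip T w (\<lambda>t. u t - v t) = ip T w u - ip T w v"
  by (simp add: ip_def algebra_simps sum_subtractf)

lemma nrm_scale: "nrm T (\<lambda>t. a * v t) = a\<^sup>2 * nrm T v"
  by (simp add: nrm_def power_mult_distrib sum_distrib_left)

lemma square_add_le: "(a + b)\<^sup>2 \<le> 2 * a\<^sup>2 + 2 * (b::real)\<^sup>2" and square_diff_le: "(a - b)\<^sup>2 \<le> 2 * a\<^sup>2 + 2 * (b::real)\<^sup>2"
  using sum_squares_bound[of a b] sum_squares_bound[of a "- b"]
  by (simp_all add: power2_eq_square algebra_simps)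

lemma nrm_add_le: "nrm T (\<lambda>t. u t + v t) \<le> 2 * nrm T u + 2 * nrm T v"
  and nrm_diff_le: "nrm T (\<lambda>t. u t - v t) \<le> 2 * nrm T u + 2 * nrm T v"
  unfolding nrm_def sum_distrib_left sum.distrib[symmetric]
  by (intro sum_mono square_add_le square_diff_le)+

lemma abs_ip_le: "\<bar>ip T u v\<bar> \<le> sqrt (nrm T u * nrm T v)"
  using Cauchy_Schwarz_ineq_sum[of u v "{..<T}"] unfolding ip_def nrm_def
  by (intro real_le_rsqrt) simp

lemma sum_fourth_le: "(\<Sum>t<T. (v t) ^ 4) \<le> (nrm T v)\<^sup>2"
proof -
  have "(\<Sum>t<T. (v t) ^ 4) = (\<Sum>t<T. (v t)\<^sup>2 * (v t)\<^sup>2)" by (simp add: power4_eq_xxxx power2_eq_square mult.assoc)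
  also have "\<dots> \<le> (\<Sum>t<T. (v t)\<^sup>2 * nrm T v)"
    unfolding nrm_def by (intro sum_mono mult_left_mono member_le_sum) auto
  also have "\<dots> = (nrm T v)\<^sup>2" by (simp add: nrm_def power2_eq_square sum_distrib_right)
  finally show ?thesis .
qed

lemma nrm_mult_le: "nrm T (\<lambda>t. u t * v t) \<le> sqrt (\<Sum>t<T. (u t) ^ 4) * nrm T v"
proof -
  have "nrm T (\<lambda>t. u t * v t) = ip T (\<lambda>t. (u t)\<^sup>2) (\<lambda>t. (v t)\<^sup>2)"
    by (simp add: nrm_def ip_def power_mult_distrib)
  also have "\<dots> \<le> sqrt (nrm T (\<lambda>t. (u t)\<^sup>2) * nrm T (\<lambda>t. (v t)\<^sup>2))"
    using abs_ip_le[of T "\<lambda>t. (u t)\<^sup>2" "\<lambda>t. (v t)\<^sup>2"] by linarith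
  also have "\<dots> \<le> sqrt ((\<Sum>t<T. (u t) ^ 4) * (nrm T v)\<^sup>2)"
    using sum_fourth_le[where v=v and T=T]
    by (intro real_sqrt_le_mono mult_mono) (auto simp: nrm_def sum_nonneg)
  finally show ?thesis by (simp add: real_sqrt_mult)
qed

lemma nrm_mult_le': "nrm T (\<lambda>t. u t * v t) \<le> nrm T u * nrm T v"
proof -
  have "sqrt (\<Sum>t<T. (u t) ^ 4) \<le> nrm T u" using sum_fourth_le[where v=u and T=T] by (simp add: real_le_lsqrt)
  then show ?thesis using nrm_mult_le[of T u v] by (meson mult_right_mono nrm_nonneg order_trans)
qed

section \<open>Remainder vectors of squared norm \<open>o_P(sqrt T)\<close>\<close>

context prob_seq
begin

text \<open>The scale is chosen so that the inner product of two such vectors, divided by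
  \<open>sqrt T\<close>, tends to zero by Cauchy-Schwarz.\<close>

definition small :: "(nat \<Rightarrow> 'w \<Rightarrow> nat \<Rightarrow> real) \<Rightarrow> bool" where
  "small V \<longleftrightarrow> pconv P (\<lambda>T \<omega>. nrm T (V T \<omega>) / sqrt (real T)) 0"

lemma whp_alwaysI: "(\<And>T \<omega>. T \<ge> 1 \<Longrightarrow> \<omega> \<in> space (P T) \<Longrightarrow> Q T \<omega>) \<Longrightarrow> whp P Q"
  by (rule whp_eventually, use eventually_ge_at_top[of 1] in eventually_elim) blast

lemma small_le:
  assumes "small U" "small V" and "\<And>T \<omega>. nrm T (X T \<omega>) \<le> 2 * nrm T (U T \<omega>) + 2 * nrm T (V T \<omega>)"
  shows "small X"
  unfolding small_def
proof (rule pconv_0_le)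
  show "pconv P (\<lambda>T \<omega>. 2 * (nrm T (U T \<omega>) / sqrt (real T)) + 2 * (nrm T (V T \<omega>) / sqrt (real T))) 0"
    using pconv_add[OF pconv_cmult[of _ 0 2] pconv_cmult[of _ 0 2]] assms(1,2) unfolding small_def by fastforce
  show "whp P (\<lambda>T \<omega>. \<bar>nrm T (X T \<omega>) / sqrt (real T)\<bar> \<le> 2 * (nrm T (U T \<omega>) / sqrt (real T)) + 2 * (nrm T (V T \<omega>) / sqrt (real T)))"
  proof (rule whp_alwaysI)
    fix T \<omega> assume "(1::nat) \<le> T"
    then have "nrm T (X T \<omega>) / sqrt (real T) \<le> (2 * nrm T (U T \<omega>) + 2 * nrm T (V T \<omega>)) / sqrt (real T)"
      by (intro divide_right_mono assms(3)) auto
    then show "\<bar>nrm T (X T \<omega>) / sqrt (real T)\<bar> \<le> 2 * (nrm T (U T \<omega>) / sqrt (real T)) + 2 * (nrm T (V T \<omega>) / sqrt (real T))"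
      by (simp add: add_divide_distrib)
  qed
qed

lemma small_diff: "small U \<Longrightarrow> small V \<Longrightarrow> small (\<lambda>T \<omega> t. U T \<omega> t - V T \<omega> t)"
  by (rule small_le[of U V], assumption+) (rule nrm_diff_le)

lemma pconv_inverse_sqrt: "pconv P (\<lambda>T \<omega>. 1 / sqrt (real T)) 0"
  by (rule pconv_const_seq) real_asymp

lemma small_over_T:
  assumes "small V" shows "pconv P (\<lambda>T \<omega>. nrm T (V T \<omega>) / real T) 0"
proof -
  have "pconv P (\<lambda>T \<omega>. nrm T (V T \<omega>) / sqrt (real T) * (1 / sqrt (real T))) (0 * 0)"
    using assms unfolding small_def by (intro pconv_mult pconv_inverse_sqrt)
  then show ?thesis by simp
qed

lemma small_ip_sqrt:
  assumes "small U" "small V"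
  shows "pconv P (\<lambda>T \<omega>. ip T (U T \<omega>) (V T \<omega>) / sqrt (real T)) 0"
proof (rule pconv_0_le)
  have "pconv P (\<lambda>T \<omega>. sqrt (nrm T (U T \<omega>) / sqrt (real T) * (nrm T (V T \<omega>) / sqrt (real T)))) (sqrt (0 * 0))"
    using assms unfolding small_def by (intro pconv_sqrt pconv_mult)
  then show "pconv P (\<lambda>T \<omega>. sqrt (nrm T (U T \<omega>) / sqrt (real T) * (nrm T (V T \<omega>) / sqrt (real T)))) 0" by simp
  show "whp P (\<lambda>T \<omega>. \<bar>ip T (U T \<omega>) (V T \<omega>) / sqrt (real T)\<bar>
      \<le> sqrt (nrm T (U T \<omega>) / sqrt (real T) * (nrm T (V T \<omega>) / sqrt (real T))))"
  proof (rule whp_alwaysI)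
    fix T \<omega> assume T: "(1::nat) \<le> T"
    have "\<bar>ip T (U T \<omega>) (V T \<omega>)\<bar> / sqrt (real T) \<le> sqrt (nrm T (U T \<omega>) * nrm T (V T \<omega>)) / sqrt (real T)"
      by (intro divide_right_mono abs_ip_le) simp
    then show "\<bar>ip T (U T \<omega>) (V T \<omega>) / sqrt (real T)\<bar>
      \<le> sqrt (nrm T (U T \<omega>) / sqrt (real T) * (nrm T (V T \<omega>) / sqrt (real T)))"
      by (simp add: real_sqrt_divide real_sqrt_mult)
  qed
qed

lemma small_ip_bounded:
  assumes X: "pconv P (\<lambda>T \<omega>. nrm T (X T \<omega>) / real T) c" and V: "pconv P (\<lambda>T \<omega>. nrm T (V T \<omega>) / real T) 0"
  shows "pconv P (\<lambda>T \<omega>. ip T (X T \<omega>) (V T \<omega>) / real T) 0"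
proof (rule pconv_0_le)
  have "pconv P (\<lambda>T \<omega>. sqrt (nrm T (X T \<omega>) / real T * (nrm T (V T \<omega>) / real T))) (sqrt (c * 0))"
    using assms by (intro pconv_sqrt pconv_mult)
  then show "pconv P (\<lambda>T \<omega>. sqrt (nrm T (X T \<omega>) / real T * (nrm T (V T \<omega>) / real T))) 0" by simp
  show "whp P (\<lambda>T \<omega>. \<bar>ip T (X T \<omega>) (V T \<omega>) / real T\<bar> \<le> sqrt (nrm T (X T \<omega>) / real T * (nrm T (V T \<omega>) / real T)))"
  proof (rule whp_alwaysI)
    fix T \<omega> assume T: "(1::nat) \<le> T"
    have "\<bar>ip T (X T \<omega>) (V T \<omega>)\<bar> / real T \<le> sqrt (nrm T (X T \<omega>) * nrm T (V T \<omega>)) / real T"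
      by (intro divide_right_mono abs_ip_le) simp
    then show "\<bar>ip T (X T \<omega>) (V T \<omega>) / real T\<bar> \<le> sqrt (nrm T (X T \<omega>) / real T * (nrm T (V T \<omega>) / real T))"
      by (simp add: real_sqrt_divide real_sqrt_mult)
  qed
qed

text \<open>For the variance estimator, where noise multiplies a remainder entrywise. Cauchy-Schwarz
  on squares together with the fact that the 4-norm is at most the 2-norm leaves
  \<open>sqrt (\<Sum> X ^ 4)\<close>, of order \<open>sqrt T\<close>, times \<open>nrm V\<close>,
  which is \<open>o_P(sqrt T)\<close>.\<close>

lemma small_mult_fourth:
  assumes X: "pconv P (\<lambda>T \<omega>. (\<Sum>t<T. (X T \<omega> t) ^ 4) / real T) c" and V: "small V"
  shows "pconv P (\<lambda>T \<omega>. nrm T (\<lambda>t. X T \<omega> t * V T \<omega> t) / real T) 0"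
proof (rule pconv_0_le)
  have "pconv P (\<lambda>T \<omega>. sqrt ((\<Sum>t<T. (X T \<omega> t) ^ 4) / real T) * (nrm T (V T \<omega>) / sqrt (real T))) (sqrt c * 0)"
    using assms unfolding small_def by (intro pconv_sqrt pconv_mult)
  then show "pconv P (\<lambda>T \<omega>. sqrt ((\<Sum>t<T. (X T \<omega> t) ^ 4) / real T) * (nrm T (V T \<omega>) / sqrt (real T))) 0" by simp
  show "whp P (\<lambda>T \<omega>. \<bar>nrm T (\<lambda>t. X T \<omega> t * V T \<omega> t) / real T\<bar>
      \<le> sqrt ((\<Sum>t<T. (X T \<omega> t) ^ 4) / real T) * (nrm T (V T \<omega>) / sqrt (real T)))"
  proof (rule whp_alwaysI)
    fix T \<omega> assume T: "(1::nat) \<le> T"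
    have "nrm T (\<lambda>t. X T \<omega> t * V T \<omega> t) / real T \<le> sqrt (\<Sum>t<T. (X T \<omega> t) ^ 4) * nrm T (V T \<omega>) / real T"
      by (intro divide_right_mono nrm_mult_le) simp
    then show "\<bar>nrm T (\<lambda>t. X T \<omega> t * V T \<omega> t) / real T\<bar>
      \<le> sqrt ((\<Sum>t<T. (X T \<omega> t) ^ 4) / real T) * (nrm T (V T \<omega>) / sqrt (real T))"
      by (simp add: real_sqrt_divide)
  qed
qed

lemma small_mult:
  assumes U: "small U" and V: "small V"
  shows "pconv P (\<lambda>T \<omega>. nrm T (\<lambda>t. U T \<omega> t * V T \<omega> t) / real T) 0"
proof (rule pconv_0_le)
  have "pconv P (\<lambda>T \<omega>. nrm T (U T \<omega>) / sqrt (real T) * (nrm T (V T \<omega>) / sqrt (real T))) (0 * 0)"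
    using assms unfolding small_def by (intro pconv_mult)
  then show "pconv P (\<lambda>T \<omega>. nrm T (U T \<omega>) / sqrt (real T) * (nrm T (V T \<omega>) / sqrt (real T))) 0" by simp
  show "whp P (\<lambda>T \<omega>. \<bar>nrm T (\<lambda>t. U T \<omega> t * V T \<omega> t) / real T\<bar>
      \<le> nrm T (U T \<omega>) / sqrt (real T) * (nrm T (V T \<omega>) / sqrt (real T)))"
  proof (rule whp_alwaysI)
    fix T \<omega> assume T: "(1::nat) \<le> T"
    have "nrm T (\<lambda>t. U T \<omega> t * V T \<omega> t) / real T \<le> nrm T (U T \<omega>) * nrm T (V T \<omega>) / real T"
      by (intro divide_right_mono nrm_mult_le') simp
    then show "\<bar>nrm T (\<lambda>t. U T \<omega> t * V T \<omega> t) / real T\<bar>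
      \<le> nrm T (U T \<omega>) / sqrt (real T) * (nrm T (V T \<omega>) / sqrt (real T))" by simp
  qed
qed

end

text \<open>The abstract setting of the limit theory. \<open>p\<close> is the projection on the
  constant and the estimated factors, as a function of the data \<open>W\<close>; \<open>Ay\<close>,
  \<open>Ag\<close>, \<open>Az\<close> are what it leaves of the factor parts, with
  \<open>Ay\<close> belonging to the equation for \<open>y\<close> minus \<beta> times
  \<open>g\<close>. All requirements hold from \<open>T0\<close> on, and \<open>K\<close> bounds the
  trace, i.e. the rank, of the projection.\<close>

locale iv_limit = noise_seq P \<xi> L S W
  for P :: "nat \<Rightarrow> 'w measure" and \<xi> L and S :: "nat \<Rightarrow> 'b measure" and W +
  fixes p :: "nat \<Rightarrow> 'b \<Rightarrow> nat \<Rightarrow> nat \<Rightarrow> real" and Ay Ag Az :: "nat \<Rightarrow> 'b \<Rightarrow> nat \<Rightarrow> real"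
    and \<kappa> :: "nat \<Rightarrow> real" and K :: real and T0 :: nat
  assumes T0: "1 \<le> T0"
    and p_meas: "\<And>T t s. T0 \<le> T \<Longrightarrow> t < T \<Longrightarrow> s < T \<Longrightarrow> (\<lambda>x. p T x t s) \<in> borel_measurable (S T)"
    and A_meas: "\<And>T t. T0 \<le> T \<Longrightarrow> t < T \<Longrightarrow> (\<lambda>x. Ay T x t) \<in> borel_measurable (S T)"
      "\<And>T t. T0 \<le> T \<Longrightarrow> t < T \<Longrightarrow> (\<lambda>x. Ag T x t) \<in> borel_measurable (S T)"
      "\<And>T t. T0 \<le> T \<Longrightarrow> t < T \<Longrightarrow> (\<lambda>x. Az T x t) \<in> borel_measurable (S T)"
    and p_sym: "\<And>T \<omega> t s. T0 \<le> T \<Longrightarrow> \<omega> \<in> space (P T) \<Longrightarrow> t < T \<Longrightarrow> s < T \<Longrightarrow> p T (W T \<omega>) t s = p T (W T \<omega>) s t"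
    and p_idem: "\<And>T \<omega> t s. T0 \<le> T \<Longrightarrow> \<omega> \<in> space (P T) \<Longrightarrow> t < T \<Longrightarrow> s < T \<Longrightarrow>
      (\<Sum>u<T. p T (W T \<omega>) t u * p T (W T \<omega>) u s) = p T (W T \<omega>) t s"
    and p_trace: "\<And>T \<omega>. T0 \<le> T \<Longrightarrow> \<omega> \<in> space (P T) \<Longrightarrow> (\<Sum>t<T. p T (W T \<omega>) t t) \<le> K"
    and A_small: "whp P (\<lambda>T \<omega>. nrm T (Ay T (W T \<omega>)) \<le> \<kappa> T)" "whp P (\<lambda>T \<omega>. nrm T (Ag T (W T \<omega>)) \<le> \<kappa> T)"
      "whp P (\<lambda>T \<omega>. nrm T (Az T (W T \<omega>)) \<le> \<kappa> T)"
    and \<kappa>: "\<And>T. 0 \<le> \<kappa> T" "(\<lambda>T. \<kappa> T / sqrt (real T)) \<longlonglongrightarrow> 0"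
    and moment8: "integrable L (\<lambda>x. (fst x) ^ 8)" "integrable L (\<lambda>x. (fst (snd x)) ^ 8)" "integrable L (\<lambda>x. (snd (snd x)) ^ 8)"
    and mean0: "(\<integral>x. fst x \<partial>L) = 0" "(\<integral>x. fst (snd x) \<partial>L) = 0" "(\<integral>x. snd (snd x) \<partial>L) = 0"
      "(\<integral>x. fst x * snd (snd x) \<partial>L) = 0"
begin

definition "e\<eta> T \<omega> t = fst (\<xi> T t \<omega>)"
definition "eg T \<omega> t = fst (snd (\<xi> T t \<omega>))"
definition "ez T \<omega> t = snd (snd (\<xi> T t \<omega>))"
definition "pr T \<omega> v t = (\<Sum>s<T. p T (W T \<omega>) t s * v s)"
definition "\<gamma> = (\<integral>x. fst (snd x) * snd (snd x) \<partial>L)"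
definition "\<tau>2 = (\<integral>x. (snd (snd x) * fst x)\<^sup>2 \<partial>L)"

text \<open>The residuals of \<open>y - \<beta> g\<close>, \<open>g\<close> and \<open>z\<close>;
  the constant has been projected out.\<close>

definition "ru T \<omega> t = Ay T (W T \<omega>) t + (e\<eta> T \<omega> t - pr T \<omega> (e\<eta> T \<omega>) t)"
definition "rg T \<omega> t = Ag T (W T \<omega>) t + (eg T \<omega> t - pr T \<omega> (eg T \<omega>) t)"
definition "rz T \<omega> t = Az T (W T \<omega>) t + (ez T \<omega> t - pr T \<omega> (ez T \<omega>) t)"

definition "mhat T \<omega> = ip T (rz T \<omega>) (rg T \<omega>) / real T"
definition "nhat T \<omega> = ip T (rz T \<omega>) (ru T \<omega>) / sqrt (real T)"
definition "n0 T \<omega> = ip T (ez T \<omega>) (e\<eta> T \<omega>) / sqrt (real T)"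
text \<open>The estimation error of \<beta>, provided the denominator is nonzero. At a zero
  denominator it is 0, whereas the estimator itself is then 0 and errs by
  \<open>- \<beta>\<close>.\<close>

definition "bdev T \<omega> = inverse (ip T (rz T \<omega>) (rg T \<omega>)) * ip T (rz T \<omega>) (ru T \<omega>)"
definition "eh T \<omega> t = ru T \<omega> t - bdev T \<omega> * rg T \<omega> t"
definition "Shat T \<omega> = nrm T (\<lambda>t. rz T \<omega> t * eh T \<omega> t) / real T"

lemma integrable_moment:
  fixes h :: "real \<times> real \<times> real \<Rightarrow> real"
  assumes h[measurable]: "h \<in> borel_measurable borel"
    and le: "\<And>x. \<bar>h x\<bar> \<le> 1 + (fst x) ^ 8 + (fst (snd x)) ^ 8 + (snd (snd x)) ^ 8"
  shows "integrable L h"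
proof -
  interpret L: prob_space L by (rule prob_L)
  have "integrable L (\<lambda>x. 1 + (fst x) ^ 8 + (fst (snd x)) ^ 8 + (snd (snd x)) ^ 8)"
    using moment8 by (intro Bochner_Integration.integrable_add L.integrable_const)
  then show ?thesis
  proof (rule Bochner_Integration.integrable_bound)
    show "AE x in L. norm (h x) \<le> norm (1 + (fst x) ^ 8 + (fst (snd x)) ^ 8 + (snd (snd x)) ^ 8)"
      using le by (intro AE_I2) (simp add: order_trans[OF _ abs_ge_self])
  qed measurable
qed

lemma power_bounds:
  fixes a b :: real
  shows "a\<^sup>2 \<le> 1 + a ^ 8" "a ^ 4 \<le> 1 + a ^ 8" "(a * b)\<^sup>2 \<le> 1 + a ^ 8 + b ^ 8" "((a * b)\<^sup>2)\<^sup>2 \<le> a ^ 8 + b ^ 8"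
proof -
  have *: "x \<le> 1 + x\<^sup>2" for x :: real using sum_squares_bound[of x 1] by (simp add: power2_eq_square) 
    (smt (verit) mult_nonneg_nonneg zero_le_square)
  show 4: "a ^ 4 \<le> 1 + a ^ 8" for a :: real using *[of "a ^ 4"] by (simp flip: power_mult)
  have "a\<^sup>2 \<le> 1 + a ^ 8" for a :: real
  proof (cases "a\<^sup>2 \<le> 1")
    case False
    then have "(a\<^sup>2) ^ 1 \<le> (a\<^sup>2) ^ 4" by (intro power_increasing) auto
    then show ?thesis by (simp flip: power_mult)
  qed (simp add: add_increasing2)
  then show "a\<^sup>2 \<le> 1 + a ^ 8" .
  have ab: "((a * b)\<^sup>2)\<^sup>2 \<le> a ^ 8 + b ^ 8"
  proof -
    have "((a * b)\<^sup>2)\<^sup>2 = a ^ 4 * b ^ 4" by (simp add: power_mult_distrib flip: power_mult)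
    also have "\<dots> \<le> (a ^ 4)\<^sup>2 + (b ^ 4)\<^sup>2"
    proof -
      have "x * y \<le> x\<^sup>2 + y\<^sup>2" if "0 \<le> x * y" for x y :: real
        using sum_squares_bound[of x y] that by linarith
      from this[of "a ^ 4" "b ^ 4"] show ?thesis by simp
    qed
    finally show ?thesis by (simp flip: power_mult)
  qed
  then show "((a * b)\<^sup>2)\<^sup>2 \<le> a ^ 8 + b ^ 8" .
  show "(a * b)\<^sup>2 \<le> 1 + a ^ 8 + b ^ 8" using *[of "(a * b)\<^sup>2"] ab by linarith
qed

text \<open>The law of large numbers below works through second moments of the summands, so averages
  of fourth powers and of squared products of two noise terms call for eighth moments.\<close>

lemma moment_facts:
  "integrable L (\<lambda>x. (fst x)\<^sup>2)" "integrable L (\<lambda>x. (fst (snd x))\<^sup>2)" "integrable L (\<lambda>x. (snd (snd x))\<^sup>2)"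
  "integrable L (\<lambda>x. ((fst (snd x))\<^sup>2)\<^sup>2)" "integrable L (\<lambda>x. ((snd (snd x))\<^sup>2)\<^sup>2)"
  "integrable L (\<lambda>x. ((fst x) ^ 4)\<^sup>2)" "integrable L (\<lambda>x. ((snd (snd x)) ^ 4)\<^sup>2)"
  "integrable L (\<lambda>x. (fst (snd x) * snd (snd x))\<^sup>2)" "integrable L (\<lambda>x. (snd (snd x) * fst x)\<^sup>2)"
  "integrable L (\<lambda>x. ((snd (snd x) * fst x)\<^sup>2)\<^sup>2)"
proof -
  note pb = power_bounds
  have sq: "((a::real)\<^sup>2)\<^sup>2 = a ^ 4" "((a::real) ^ 4)\<^sup>2 = a ^ 8" for a by (simp_all flip: power_mult)
  have pb2: "((a::real)\<^sup>2)\<^sup>2 \<le> 1 + a ^ 8" for a using pb(2)[of a] by (simp only: sq)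
  have nn: "0 \<le> (fst x) ^ 8" "0 \<le> (fst (snd x)) ^ 8" "0 \<le> (snd (snd x)) ^ 8" for x :: "real \<times> real \<times> real" by simp_all
  show "integrable L (\<lambda>x. (fst x)\<^sup>2)"
  proof (rule integrable_moment)
    show "(\<lambda>x::real \<times> real \<times> real. (fst x)\<^sup>2) \<in> borel_measurable borel"
      by (intro borel_measurable_continuous_onI continuous_intros)
    show "\<bar>(fst x)\<^sup>2\<bar> \<le> 1 + (fst x) ^ 8 + (fst (snd x)) ^ 8 + (snd (snd x)) ^ 8" for x :: "real \<times> real \<times> real"
      unfolding abs_power2 using pb(1)[of "fst x"] nn[of x] by linarith
  qed
  show "integrable L (\<lambda>x. (fst (snd x))\<^sup>2)"
  proof (rule integrable_moment)
    show "(\<lambda>x::real \<times> real \<times> real. (fst (snd x))\<^sup>2) \<in> borel_measurable borel"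
      by (intro borel_measurable_continuous_onI continuous_intros)
    show "\<bar>(fst (snd x))\<^sup>2\<bar> \<le> 1 + (fst x) ^ 8 + (fst (snd x)) ^ 8 + (snd (snd x)) ^ 8" for x :: "real \<times> real \<times> real"
      unfolding abs_power2 using pb(1)[of "fst (snd x)"] nn[of x] by linarith
  qed
  show "integrable L (\<lambda>x. (snd (snd x))\<^sup>2)"
  proof (rule integrable_moment)
    show "(\<lambda>x::real \<times> real \<times> real. (snd (snd x))\<^sup>2) \<in> borel_measurable borel"
      by (intro borel_measurable_continuous_onI continuous_intros)
    show "\<bar>(snd (snd x))\<^sup>2\<bar> \<le> 1 + (fst x) ^ 8 + (fst (snd x)) ^ 8 + (snd (snd x)) ^ 8" for x :: "real \<times> real \<times> real"
      unfolding abs_power2 using pb(1)[of "snd (snd x)"] nn[of x] by linarith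
  qed
  show "integrable L (\<lambda>x. ((fst (snd x))\<^sup>2)\<^sup>2)"
  proof (rule integrable_moment)
    show "(\<lambda>x::real \<times> real \<times> real. ((fst (snd x))\<^sup>2)\<^sup>2) \<in> borel_measurable borel"
      by (intro borel_measurable_continuous_onI continuous_intros)
    show "\<bar>((fst (snd x))\<^sup>2)\<^sup>2\<bar> \<le> 1 + (fst x) ^ 8 + (fst (snd x)) ^ 8 + (snd (snd x)) ^ 8" for x :: "real \<times> real \<times> real"
      unfolding abs_power2 using pb2[of "fst (snd x)"] nn[of x] by linarith
  qed
  show "integrable L (\<lambda>x. ((snd (snd x))\<^sup>2)\<^sup>2)"
  proof (rule integrable_moment)
    show "(\<lambda>x::real \<times> real \<times> real. ((snd (snd x))\<^sup>2)\<^sup>2) \<in> borel_measurable borel"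
      by (intro borel_measurable_continuous_onI continuous_intros)
    show "\<bar>((snd (snd x))\<^sup>2)\<^sup>2\<bar> \<le> 1 + (fst x) ^ 8 + (fst (snd x)) ^ 8 + (snd (snd x)) ^ 8" for x :: "real \<times> real \<times> real"
      unfolding abs_power2 using pb2[of "snd (snd x)"] nn[of x] by linarith
  qed
  show "integrable L (\<lambda>x. ((fst x) ^ 4)\<^sup>2)" "integrable L (\<lambda>x. ((snd (snd x)) ^ 4)\<^sup>2)"
    unfolding sq by (rule moment8)+
  show "integrable L (\<lambda>x. (fst (snd x) * snd (snd x))\<^sup>2)"
  proof (rule integrable_moment)
    show "(\<lambda>x::real \<times> real \<times> real. (fst (snd x) * snd (snd x))\<^sup>2) \<in> borel_measurable borel"
      by (intro borel_measurable_continuous_onI continuous_intros)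
    show "\<bar>(fst (snd x) * snd (snd x))\<^sup>2\<bar> \<le> 1 + (fst x) ^ 8 + (fst (snd x)) ^ 8 + (snd (snd x)) ^ 8" for x :: "real \<times> real \<times> real"
      unfolding abs_power2 using pb(3)[of "fst (snd x)" "snd (snd x)"] nn[of x] by linarith
  qed
  show "integrable L (\<lambda>x. (snd (snd x) * fst x)\<^sup>2)"
  proof (rule integrable_moment)
    show "(\<lambda>x::real \<times> real \<times> real. (snd (snd x) * fst x)\<^sup>2) \<in> borel_measurable borel"
      by (intro borel_measurable_continuous_onI continuous_intros)
    show "\<bar>(snd (snd x) * fst x)\<^sup>2\<bar> \<le> 1 + (fst x) ^ 8 + (fst (snd x)) ^ 8 + (snd (snd x)) ^ 8" for x :: "real \<times> real \<times> real"
      unfolding abs_power2 using pb(3)[of "snd (snd x)" "fst x"] nn[of x] by linarith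
  qed
  show "integrable L (\<lambda>x. ((snd (snd x) * fst x)\<^sup>2)\<^sup>2)"
  proof (rule integrable_moment)
    show "(\<lambda>x::real \<times> real \<times> real. ((snd (snd x) * fst x)\<^sup>2)\<^sup>2) \<in> borel_measurable borel"
      by (intro borel_measurable_continuous_onI continuous_intros)
    show "\<bar>((snd (snd x) * fst x)\<^sup>2)\<^sup>2\<bar> \<le> 1 + (fst x) ^ 8 + (fst (snd x)) ^ 8 + (snd (snd x)) ^ 8" for x :: "real \<times> real \<times> real"
      unfolding abs_power2 using pb(4)[of "snd (snd x)" "fst x"] nn[of x] by linarith
  qed
qed

text \<open>For a symmetric idempotent matrix the squared norm of a row is its diagonal entry, which
  therefore dominates its own square.\<close>

lemma p_le_1:
  assumes "T0 \<le> T" "\<omega> \<in> space (P T)" "t < T" "s < T"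
  shows "\<bar>p T (W T \<omega>) t s\<bar> \<le> 1" and "(\<Sum>u<T. (p T (W T \<omega>) t u)\<^sup>2) = p T (W T \<omega>) t t"
proof -
  let ?p = "p T (W T \<omega>)"
  have eq: "(\<Sum>u<T. (?p t u)\<^sup>2) = ?p t t" if "t < T" for t
  proof -
    have "(\<Sum>u<T. (?p t u)\<^sup>2) = (\<Sum>u<T. ?p t u * ?p u t)"
      using p_sym[OF assms(1,2)] that by (intro sum.cong) (auto simp: power2_eq_square)
    then show ?thesis using p_idem[OF assms(1,2) that that] by simp
  qed
  show "(\<Sum>u<T. (?p t u)\<^sup>2) = ?p t t" by (rule eq[OF assms(3)])
  have le: "(?p t u)\<^sup>2 \<le> ?p t t" if "u < T" for u
    unfolding eq[OF assms(3), symmetric] by (rule member_le_sum) (use that in auto)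
  have "?p t t * ?p t t \<le> ?p t t" using le[OF assms(3)] by (simp add: power2_eq_square)
  moreover have "0 \<le> ?p t t" using le[OF assms(3)] by (rule order_trans[rotated]) simp
  ultimately have "?p t t \<le> 1" by (metis mult_left_le_imp_le mult.right_neutral order_le_less zero_le_one)
  then have "(?p t s)\<^sup>2 \<le> 1" using le[OF assms(4)] by linarith
  then show "\<bar>?p t s\<bar> \<le> 1" by (simp add: abs_square_le_1)
qed

lemma W_meas: "1 \<le> T \<Longrightarrow> W T \<in> measurable (P T) (S T)"
  using indepW by (simp add: indep_elems_def)

text \<open>Given the data, the expected squared norm of projected centred noise is its variance
  times the trace of the projection. The trace is at most \<open>K\<close>, so the norm stays
  bounded in mean instead of growing with \<open>T\<close>.\<close>

lemma small_proj:
  fixes h :: "real \<times> real \<times> real \<Rightarrow> real"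
  assumes h: "h \<in> borel_measurable borel" and h2: "integrable L (\<lambda>x. (h x)\<^sup>2)" and h0: "(\<integral>x. h x \<partial>L) = 0"
  shows "small (\<lambda>T \<omega>. pr T \<omega> (\<lambda>t. h (\<xi> T t \<omega>)))"
  unfolding small_def
proof (rule pconv_L1)
  let ?v = "\<integral>x. (h x)\<^sup>2 \<partial>L"
  have v0: "0 \<le> ?v" by simp
  have main: "integrable (P T) (\<lambda>\<omega>. nrm T (pr T \<omega> (\<lambda>t. h (\<xi> T t \<omega>))))"
    "(\<integral>\<omega>. nrm T (pr T \<omega> (\<lambda>t. h (\<xi> T t \<omega>))) \<partial>P T) \<le> ?v * K" if T: "T0 \<le> T" for T
  proof -
    have T1: "1 \<le> T" using T T0 by simp
    interpret prob_space "P T" by (rule prob[OF T1])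
    have wm: "(\<lambda>x. p T x t s) \<in> borel_measurable (S T)" if "t < T" "s < T" for t s
      using p_meas[OF T that] .
    note wsm = weighted_sum_moment[OF h h2 h0 T1, where b=1]
    have i: "integrable (P T) (\<lambda>\<omega>. (pr T \<omega> (\<lambda>t. h (\<xi> T t \<omega>)) t)\<^sup>2)"
      "(\<integral>\<omega>. (pr T \<omega> (\<lambda>t. h (\<xi> T t \<omega>)) t)\<^sup>2 \<partial>P T) = ?v * (\<Sum>s<T. \<integral>\<omega>. (p T (W T \<omega>) t s)\<^sup>2 \<partial>P T)" if t: "t < T" for t
      unfolding pr_def
      by (rule wsm[where w = "\<lambda>s x. p T x t s"]; use wm[OF t] p_le_1(1)[OF T _ t] in blast)+
    have pint: "integrable (P T) (\<lambda>\<omega>. (p T (W T \<omega>) t s)\<^sup>2)" if ts: "t < T" "s < T" for t s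
    proof (rule integrable_const_bound[of _ 1])
      show "AE \<omega> in P T. norm ((p T (W T \<omega>) t s)\<^sup>2) \<le> 1"
        using p_le_1(1)[OF T _ ts] by (intro AE_I2) (simp add: abs_square_le_1)
      show "(\<lambda>\<omega>. (p T (W T \<omega>) t s)\<^sup>2) \<in> borel_measurable (P T)"
        using measurable_compose[OF W_meas[OF T1] wm[OF ts]] by measurable
    qed
    show "integrable (P T) (\<lambda>\<omega>. nrm T (pr T \<omega> (\<lambda>t. h (\<xi> T t \<omega>))))"
      unfolding nrm_def by (rule Bochner_Integration.integrable_sum) (simp add: i)
    have "(\<integral>\<omega>. nrm T (pr T \<omega> (\<lambda>t. h (\<xi> T t \<omega>))) \<partial>P T) = (\<Sum>t<T. ?v * (\<Sum>s<T. \<integral>\<omega>. (p T (W T \<omega>) t s)\<^sup>2 \<partial>P T))"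
      unfolding nrm_def by (subst Bochner_Integration.integral_sum) (simp_all add: i)
    also have "\<dots> = ?v * (\<Sum>t<T. \<integral>\<omega>. (\<Sum>s<T. (p T (W T \<omega>) t s)\<^sup>2) \<partial>P T)"
      unfolding sum_distrib_left[symmetric]
      by (intro arg_cong2[of _ _ _ _ "(*)"] refl sum.cong, subst Bochner_Integration.integral_sum) (simp_all add: pint)
    also have "\<dots> = ?v * (\<integral>\<omega>. (\<Sum>t<T. \<Sum>s<T. (p T (W T \<omega>) t s)\<^sup>2) \<partial>P T)"
      by (subst Bochner_Integration.integral_sum) (auto intro!: Bochner_Integration.integrable_sum pint)
    also have "\<dots> \<le> ?v * K"
    proof (rule mult_left_mono[OF _ v0])
      have "(\<Sum>t<T. \<Sum>s<T. (p T (W T \<omega>) t s)\<^sup>2) \<le> K" if "\<omega> \<in> space (P T)" for \<omega>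
        using p_trace[OF T that] by (simp add: p_le_1(2)[OF T that])
      then have "(\<integral>\<omega>. (\<Sum>t<T. \<Sum>s<T. (p T (W T \<omega>) t s)\<^sup>2) \<partial>P T) \<le> (\<integral>\<omega>. K \<partial>P T)"
        by (intro integral_mono) (auto intro!: Bochner_Integration.integrable_sum pint)
      then show "(\<integral>\<omega>. (\<Sum>t<T. \<Sum>s<T. (p T (W T \<omega>) t s)\<^sup>2) \<partial>P T) \<le> K" by (simp add: prob_space)
    qed
    finally show "(\<integral>\<omega>. nrm T (pr T \<omega> (\<lambda>t. h (\<xi> T t \<omega>))) \<partial>P T) \<le> ?v * K" .
  qed
  show "\<forall>\<^sub>F T in sequentially. integrable (P T) (\<lambda>\<omega>. nrm T (pr T \<omega> (\<lambda>t. h (\<xi> T t \<omega>))) / sqrt (real T))"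
    using eventually_ge_at_top[of T0] by eventually_elim (rule integrable_divide, rule main)
  show "\<forall>\<^sub>F T in sequentially. \<forall>\<omega>\<in>space (P T). 0 \<le> nrm T (pr T \<omega> (\<lambda>t. h (\<xi> T t \<omega>))) / sqrt (real T)" by simp
  show "\<forall>\<^sub>F T in sequentially. (\<integral>\<omega>. nrm T (pr T \<omega> (\<lambda>t. h (\<xi> T t \<omega>))) / sqrt (real T) \<partial>P T) \<le> ?v * K * (1 / sqrt (real T))"
    using eventually_ge_at_top[of T0]
    by eventually_elim (simp add: divide_right_mono main(2))
  have "(\<lambda>T. 1 / sqrt (real T)) \<longlonglongrightarrow> 0" by real_asymp
  from tendsto_mult[OF tendsto_const this, of "?v * K"]
  show "(\<lambda>T. ?v * K * (1 / sqrt (real T))) \<longlonglongrightarrow> 0" by simp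
qed

lemma small_A:
  assumes "whp P (\<lambda>T \<omega>. nrm T (A T (W T \<omega>)) \<le> \<kappa> T)"
  shows "small (\<lambda>T \<omega>. A T (W T \<omega>))"
  unfolding small_def
proof (rule pconv_0_le[OF pconv_const_seq[OF \<kappa>(2)]], rule whp_mono[OF assms])
  show "\<forall>\<^sub>F T in sequentially. \<forall>\<omega>\<in>space (P T). nrm T (A T (W T \<omega>)) \<le> \<kappa> T \<longrightarrow>
      \<bar>nrm T (A T (W T \<omega>)) / sqrt (real T)\<bar> \<le> \<kappa> T / sqrt (real T)"
    by (intro always_eventually allI ballI impI) (simp add: divide_right_mono)
qed

text \<open>By independence the second moment of the inner product is the noise variance times the
  mean of \<open>nrm T A\<close>, at most of order \<open>\<kappa> T\<close>, and dividing by
  \<open>T\<close> leaves a null sequence. Plain Cauchy-Schwarz would not reach this.\<close>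

lemma ip_A_noise:
  fixes h :: "real \<times> real \<times> real \<Rightarrow> real"
  assumes h: "h \<in> borel_measurable borel" and h2: "integrable L (\<lambda>x. (h x)\<^sup>2)" and h0: "(\<integral>x. h x \<partial>L) = 0"
    and Am: "\<And>T t. T0 \<le> T \<Longrightarrow> t < T \<Longrightarrow> (\<lambda>x. A T x t) \<in> borel_measurable (S T)"
    and small: "whp P (\<lambda>T \<omega>. nrm T (A T (W T \<omega>)) \<le> \<kappa> T)"
  shows "pconv P (\<lambda>T \<omega>. ip T (A T (W T \<omega>)) (\<lambda>t. h (\<xi> T t \<omega>)) / sqrt (real T)) 0"
proof -
  let ?v = "\<integral>x. (h x)\<^sup>2 \<partial>L"
  have v0: "0 \<le> ?v" by simp
  \<comment> \<open>The bound on \<open>A\<close> holds only with high probability and gives no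
    moments, hence the truncation. The truncated vector is still a function of \<open>W\<close>
    alone, so independence is kept, and it agrees with \<open>A\<close> on the good event.\<close>
  define B where "B T x t = (if nrm T (A T x) \<le> \<kappa> T then A T x t else 0)" for T x t
  have nB: "nrm T (B T x) \<le> \<kappa> T" for T x using \<kappa>(1)[of T]
    by (cases "nrm T (A T x) \<le> \<kappa> T") (simp_all add: B_def nrm_def)
  have main: "integrable (P T) (\<lambda>\<omega>. (ip T (B T (W T \<omega>)) (\<lambda>t. h (\<xi> T t \<omega>)))\<^sup>2)"
    "(\<integral>\<omega>. (ip T (B T (W T \<omega>)) (\<lambda>t. h (\<xi> T t \<omega>)))\<^sup>2 \<partial>P T) \<le> ?v * \<kappa> T" if T: "T0 \<le> T" for T
  proof -
    have T1: "1 \<le> T" using T T0 by simp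
    interpret prob_space "P T" by (rule prob[OF T1])
    have nm: "(\<lambda>x. nrm T (A T x)) \<in> borel_measurable (S T)"
      unfolding nrm_def by (intro borel_measurable_sum borel_measurable_power Am[OF T]) auto
    have Bm: "(\<lambda>x. B T x t) \<in> borel_measurable (S T)" if "t < T" for t
    proof -
      note [measurable] = nm Am[OF T that]
      show ?thesis unfolding B_def by measurable
    qed
    have Bb: "\<bar>B T x t\<bar> \<le> sqrt (\<kappa> T)" if "t < T" for x t
    proof (rule real_le_rsqrt)
      have "(B T x t)\<^sup>2 \<le> nrm T (B T x)" unfolding nrm_def by (rule member_le_sum) (use that in auto)
      then show "\<bar>B T x t\<bar>\<^sup>2 \<le> \<kappa> T" using nB[of T x] by simp
    qed
    note wsm = weighted_sum_moment[OF h h2 h0 T1, of "\<lambda>t x. B T x t" "sqrt (\<kappa> T)", OF Bm Bb]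
    show "integrable (P T) (\<lambda>\<omega>. (ip T (B T (W T \<omega>)) (\<lambda>t. h (\<xi> T t \<omega>)))\<^sup>2)" unfolding ip_def by (rule wsm(1)) auto
    have Bint: "integrable (P T) (\<lambda>\<omega>. (B T (W T \<omega>) t)\<^sup>2)" if "t < T" for t
    proof (rule integrable_const_bound[of _ "\<kappa> T"])
      have "(B T x t)\<^sup>2 \<le> \<kappa> T" for x
        using power_mono[OF Bb[OF that, of x], of 2] \<kappa>(1)[of T] by simp
      then show "AE \<omega> in P T. norm ((B T (W T \<omega>) t)\<^sup>2) \<le> \<kappa> T" by simp
      show "(\<lambda>\<omega>. (B T (W T \<omega>) t)\<^sup>2) \<in> borel_measurable (P T)"
        using measurable_compose[OF W_meas[OF T1] Bm[OF that]] by measurable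
    qed
    have "(\<integral>\<omega>. (ip T (B T (W T \<omega>)) (\<lambda>t. h (\<xi> T t \<omega>)))\<^sup>2 \<partial>P T) = ?v * (\<Sum>t<T. \<integral>\<omega>. (B T (W T \<omega>) t)\<^sup>2 \<partial>P T)"
      unfolding ip_def by (rule wsm(2)) auto
    also have "(\<Sum>t<T. \<integral>\<omega>. (B T (W T \<omega>) t)\<^sup>2 \<partial>P T) = (\<integral>\<omega>. nrm T (B T (W T \<omega>)) \<partial>P T)"
      unfolding nrm_def by (rule Bochner_Integration.integral_sum[symmetric]) (simp add: Bint)
    also have "?v * \<dots> \<le> ?v * \<kappa> T"
    proof (rule mult_left_mono[OF _ v0])
      have "(\<integral>\<omega>. nrm T (B T (W T \<omega>)) \<partial>P T) \<le> (\<integral>\<omega>. \<kappa> T \<partial>P T)"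
        unfolding nrm_def using nB unfolding nrm_def
        by (intro integral_mono Bochner_Integration.integrable_sum Bint) auto
      then show "(\<integral>\<omega>. nrm T (B T (W T \<omega>)) \<partial>P T) \<le> \<kappa> T" by (simp add: prob_space)
    qed
    finally show "(\<integral>\<omega>. (ip T (B T (W T \<omega>)) (\<lambda>t. h (\<xi> T t \<omega>)))\<^sup>2 \<partial>P T) \<le> ?v * \<kappa> T" .
  qed
  have "pconv P (\<lambda>T \<omega>. (ip T (B T (W T \<omega>)) (\<lambda>t. h (\<xi> T t \<omega>)))\<^sup>2 / real T) 0"
  proof (rule pconv_L1)
    show "\<forall>\<^sub>F T in sequentially. integrable (P T) (\<lambda>\<omega>. (ip T (B T (W T \<omega>)) (\<lambda>t. h (\<xi> T t \<omega>)))\<^sup>2 / real T)"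
      using eventually_ge_at_top[of T0] by eventually_elim (rule integrable_divide, rule main)
    show "\<forall>\<^sub>F T in sequentially. (\<integral>\<omega>. (ip T (B T (W T \<omega>)) (\<lambda>t. h (\<xi> T t \<omega>)))\<^sup>2 / real T \<partial>P T)
        \<le> ?v * (\<kappa> T / sqrt (real T)) * (1 / sqrt (real T))"
      using eventually_ge_at_top[of T0]
      by eventually_elim (simp add: divide_right_mono main(2))
    have "(\<lambda>T. 1 / sqrt (real T)) \<longlonglongrightarrow> 0" by real_asymp
    from tendsto_mult[OF tendsto_mult[OF tendsto_const \<kappa>(2), of ?v] this]
    show "(\<lambda>T. ?v * (\<kappa> T / sqrt (real T)) * (1 / sqrt (real T))) \<longlonglongrightarrow> 0" by simp
  qed simp
  from pconv_sqrt[OF this] have 1: "pconv P (\<lambda>T \<omega>. \<bar>ip T (B T (W T \<omega>)) (\<lambda>t. h (\<xi> T t \<omega>))\<bar> / sqrt (real T)) 0"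
    by (simp add: real_sqrt_divide)
  show ?thesis
  proof (rule pconv_0_le[OF 1], rule whp_mono[OF small])
    show "\<forall>\<^sub>F T in sequentially. \<forall>\<omega>\<in>space (P T). nrm T (A T (W T \<omega>)) \<le> \<kappa> T \<longrightarrow>
       \<bar>ip T (A T (W T \<omega>)) (\<lambda>t. h (\<xi> T t \<omega>)) / sqrt (real T)\<bar> \<le> \<bar>ip T (B T (W T \<omega>)) (\<lambda>t. h (\<xi> T t \<omega>))\<bar> / sqrt (real T)"
      by (intro always_eventually allI ballI impI) (simp add: B_def ip_def)
  qed
qed

end

context iv_limit
begin

section \<open>Limits of numerator, denominator and variance estimator\<close>

lemma meas_comp:
  "(\<lambda>x::real \<times> real \<times> real. fst x) \<in> borel_measurable borel"
  "(\<lambda>x::real \<times> real \<times> real. fst (snd x)) \<in> borel_measurable borel"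
  "(\<lambda>x::real \<times> real \<times> real. snd (snd x)) \<in> borel_measurable borel"
  by (intro borel_measurable_continuous_onI continuous_intros)+

lemma meas_prod:
  "(\<lambda>x::real \<times> real \<times> real. fst (snd x) * snd (snd x)) \<in> borel_measurable borel"
  "(\<lambda>x::real \<times> real \<times> real. snd (snd x) * fst x) \<in> borel_measurable borel"
  "(\<lambda>x::real \<times> real \<times> real. (snd (snd x) * fst x)\<^sup>2) \<in> borel_measurable borel"
  "(\<lambda>x::real \<times> real \<times> real. (fst (snd x))\<^sup>2) \<in> borel_measurable borel"
  "(\<lambda>x::real \<times> real \<times> real. (snd (snd x))\<^sup>2) \<in> borel_measurable borel"
  "(\<lambda>x::real \<times> real \<times> real. (fst x) ^ 4) \<in> borel_measurable borel"
  "(\<lambda>x::real \<times> real \<times> real. (snd (snd x)) ^ 4) \<in> borel_measurable borel"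
  by (intro borel_measurable_continuous_onI continuous_intros)+

lemma small_pr:
  "small (\<lambda>T \<omega>. pr T \<omega> (e\<eta> T \<omega>))" "small (\<lambda>T \<omega>. pr T \<omega> (eg T \<omega>))" "small (\<lambda>T \<omega>. pr T \<omega> (ez T \<omega>))"
  unfolding e\<eta>_def[abs_def] eg_def[abs_def] ez_def[abs_def]
  by (rule small_proj[OF meas_comp(1) moment_facts(1) mean0(1)] small_proj[OF meas_comp(2) moment_facts(2) mean0(2)]
      small_proj[OF meas_comp(3) moment_facts(3) mean0(3)])+

definition "dy T \<omega> t = Ay T (W T \<omega>) t - pr T \<omega> (e\<eta> T \<omega>) t"
definition "dg T \<omega> t = Ag T (W T \<omega>) t - pr T \<omega> (eg T \<omega>) t"
definition "dz T \<omega> t = Az T (W T \<omega>) t - pr T \<omega> (ez T \<omega>) t"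

lemma small_d: "small dy" "small dg" "small dz"
  unfolding dy_def[abs_def] dg_def[abs_def] dz_def[abs_def]
  by (rule small_diff[OF small_A[OF A_small(1)] small_pr(1)] small_diff[OF small_A[OF A_small(2)] small_pr(2)]
      small_diff[OF small_A[OF A_small(3)] small_pr(3)])+

lemma r_eq: "ru T \<omega> = (\<lambda>t. e\<eta> T \<omega> t + dy T \<omega> t)" "rg T \<omega> = (\<lambda>t. eg T \<omega> t + dg T \<omega> t)" "rz T \<omega> = (\<lambda>t. ez T \<omega> t + dz T \<omega> t)"
  by (simp_all add: ru_def rg_def rz_def dy_def dg_def dz_def fun_eq_iff)

lemma lln_noise:
  "pconv P (\<lambda>T \<omega>. ip T (ez T \<omega>) (eg T \<omega>) / real T) \<gamma>"
  "pconv P (\<lambda>T \<omega>. nrm T (\<lambda>t. ez T \<omega> t * e\<eta> T \<omega> t) / real T) \<tau>2"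
  "pconv P (\<lambda>T \<omega>. nrm T (eg T \<omega>) / real T) (\<integral>x. (fst (snd x))\<^sup>2 \<partial>L)"
  "pconv P (\<lambda>T \<omega>. nrm T (ez T \<omega>) / real T) (\<integral>x. (snd (snd x))\<^sup>2 \<partial>L)"
  "pconv P (\<lambda>T \<omega>. (\<Sum>t<T. (e\<eta> T \<omega> t) ^ 4) / real T) (\<integral>x. (fst x) ^ 4 \<partial>L)"
  "pconv P (\<lambda>T \<omega>. (\<Sum>t<T. (ez T \<omega> t) ^ 4) / real T) (\<integral>x. (snd (snd x)) ^ 4 \<partial>L)"
  using lln[OF meas_prod(1) moment_facts(8)] lln[OF meas_prod(3) moment_facts(10)]
    lln[OF meas_prod(4) moment_facts(4)] lln[OF meas_prod(5) moment_facts(5)]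
    lln[OF meas_prod(6) moment_facts(6)] lln[OF meas_prod(7) moment_facts(7)]
  by (simp_all add: nrm_def ip_def e\<eta>_def eg_def ez_def \<gamma>_def \<tau>2_def mult.commute)

lemma pr_self_adjoint:
  assumes T: "T0 \<le> T" and \<omega>: "\<omega> \<in> space (P T)"
  shows "ip T u (pr T \<omega> v) = ip T (pr T \<omega> u) (pr T \<omega> v)"
proof -
  let ?p = "p T (W T \<omega>)"
  have "ip T (pr T \<omega> u) (pr T \<omega> v) = (\<Sum>t<T. (\<Sum>s<T. ?p t s * u s) * pr T \<omega> v t)"
    by (simp add: ip_def pr_def)
  also have "\<dots> = (\<Sum>t<T. \<Sum>s<T. u s * (?p s t * pr T \<omega> v t))"
    unfolding sum_distrib_right using p_sym[OF T \<omega>] by (intro sum.cong refl) (simp add: mult_ac)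
  also have "\<dots> = (\<Sum>s<T. u s * (\<Sum>t<T. ?p s t * pr T \<omega> v t))"
    by (subst sum.swap) (simp add: sum_distrib_left)
  also have "\<dots> = (\<Sum>s<T. u s * pr T \<omega> v s)"
  proof (intro sum.cong refl arg_cong2[of _ _ _ _ "(*)"])
    fix s assume s: "s \<in> {..<T}"
    have "(\<Sum>t<T. ?p s t * pr T \<omega> v t) = (\<Sum>t<T. \<Sum>r<T. ?p s t * ?p t r * v r)"
      by (simp add: pr_def sum_distrib_left mult.assoc)
    also have "\<dots> = (\<Sum>r<T. (\<Sum>t<T. ?p s t * ?p t r) * v r)"
      by (subst sum.swap) (simp add: sum_distrib_right)
    also have "\<dots> = pr T \<omega> v s" using p_idem[OF T \<omega>] s by (simp add: pr_def)
    finally show "(\<Sum>t<T. ?p s t * pr T \<omega> v t) = pr T \<omega> v s" .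
  qed
  finally show ?thesis by (simp add: ip_def)
qed

text \<open>Noise and its own projection are dependent and the noise is long, so neither
  independence nor a direct norm bound applies. Replacing the first vector by its projection, which
  leaves the inner product unchanged, makes both vectors small.\<close>

lemma ip_noise_pr:
  "pconv P (\<lambda>T \<omega>. ip T (ez T \<omega>) (pr T \<omega> (e\<eta> T \<omega>)) / sqrt (real T)) 0"
  "pconv P (\<lambda>T \<omega>. ip T (e\<eta> T \<omega>) (pr T \<omega> (ez T \<omega>)) / sqrt (real T)) 0"
proof -
  have ev: "whp P (\<lambda>T \<omega>. ip T (pr T \<omega> (u T \<omega>)) (pr T \<omega> (v T \<omega>)) / sqrt (real T) = ip T (u T \<omega>) (pr T \<omega> (v T \<omega>)) / sqrt (real T))" for u v
    by (rule whp_eventually, use eventually_ge_at_top[of T0] in eventually_elim) (simp add: pr_self_adjoint[symmetric])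
  show "pconv P (\<lambda>T \<omega>. ip T (ez T \<omega>) (pr T \<omega> (e\<eta> T \<omega>)) / sqrt (real T)) 0"
    by (rule pconv_cong[OF small_ip_sqrt[OF small_pr(3,1)] ev])
  show "pconv P (\<lambda>T \<omega>. ip T (e\<eta> T \<omega>) (pr T \<omega> (ez T \<omega>)) / sqrt (real T)) 0"
    by (rule pconv_cong[OF small_ip_sqrt[OF small_pr(1,3)] ev])
qed

text \<open>Division by \<open>T\<close> instead of \<open>sqrt T\<close> is generous enough for
  Cauchy-Schwarz on the cross terms; only the leading term contributes to the limit.\<close>

theorem mhat_limit: "pconv P mhat \<gamma>"
proof -
  have "pconv P (\<lambda>T \<omega>. ip T (ez T \<omega>) (eg T \<omega>) / real T + ip T (ez T \<omega>) (dg T \<omega>) / real T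
      + ip T (eg T \<omega>) (dz T \<omega>) / real T + ip T (dz T \<omega>) (dg T \<omega>) / sqrt (real T) * (1 / sqrt (real T))) (\<gamma> + 0 + 0 + 0 * 0)"
    by (intro pconv_add pconv_mult lln_noise(1) small_ip_bounded[OF lln_noise(4) small_over_T[OF small_d(2)]]
        small_ip_bounded[OF lln_noise(3) small_over_T[OF small_d(3)]] small_ip_sqrt[OF small_d(3,2)] pconv_inverse_sqrt)
  moreover have "mhat = (\<lambda>T \<omega>. ip T (ez T \<omega>) (eg T \<omega>) / real T + ip T (ez T \<omega>) (dg T \<omega>) / real T
      + ip T (eg T \<omega>) (dz T \<omega>) / real T + ip T (dz T \<omega>) (dg T \<omega>) / sqrt (real T) * (1 / sqrt (real T)))"
    by (simp add: mhat_def[abs_def] r_eq ip_add_left ip_add_right add_divide_distrib fun_eq_iff ip_commute[of _ "dz _ _" "eg _ _"])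
  ultimately show ?thesis by simp
qed

text \<open>Here the normalisation is \<open>sqrt T\<close>, so each cross term is separated into a
  factor part, independent of the noise, and a projected noise part.\<close>

theorem nhat_limit: "pconv P (\<lambda>T \<omega>. nhat T \<omega> - n0 T \<omega>) 0"
proof -
  have 1: "pconv P (\<lambda>T \<omega>. ip T (ez T \<omega>) (dy T \<omega>) / sqrt (real T)) 0"
  proof -
    have "pconv P (\<lambda>T \<omega>. ip T (Ay T (W T \<omega>)) (ez T \<omega>) / sqrt (real T) - ip T (ez T \<omega>) (pr T \<omega> (e\<eta> T \<omega>)) / sqrt (real T)) (0 - 0)"
      unfolding ez_def[abs_def]
      by (intro pconv_diff ip_A_noise[OF meas_comp(3) moment_facts(3) mean0(3) A_meas(1) A_small(1)]
          ip_noise_pr(1)[unfolded ez_def[abs_def]])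
    then show ?thesis by (simp add: dy_def[abs_def] ip_diff_right diff_divide_distrib ip_commute[of _ "ez _ _" "Ay _ _"])
  qed
  have 2: "pconv P (\<lambda>T \<omega>. ip T (e\<eta> T \<omega>) (dz T \<omega>) / sqrt (real T)) 0"
  proof -
    have "pconv P (\<lambda>T \<omega>. ip T (Az T (W T \<omega>)) (e\<eta> T \<omega>) / sqrt (real T) - ip T (e\<eta> T \<omega>) (pr T \<omega> (ez T \<omega>)) / sqrt (real T)) (0 - 0)"
      unfolding e\<eta>_def[abs_def]
      by (intro pconv_diff ip_A_noise[OF meas_comp(1) moment_facts(1) mean0(1) A_meas(3) A_small(3)]
          ip_noise_pr(2)[unfolded e\<eta>_def[abs_def]])
    then show ?thesis by (simp add: dz_def[abs_def] ip_diff_right diff_divide_distrib ip_commute[of _ "e\<eta> _ _" "Az _ _"])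
  qed
  have "pconv P (\<lambda>T \<omega>. ip T (ez T \<omega>) (dy T \<omega>) / sqrt (real T) + ip T (e\<eta> T \<omega>) (dz T \<omega>) / sqrt (real T)
      + ip T (dz T \<omega>) (dy T \<omega>) / sqrt (real T)) (0 + 0 + 0)"
    by (intro pconv_add 1 2 small_ip_sqrt[OF small_d(3,1)])
  moreover have "(\<lambda>T \<omega>. nhat T \<omega> - n0 T \<omega>) = (\<lambda>T \<omega>. ip T (ez T \<omega>) (dy T \<omega>) / sqrt (real T) + ip T (e\<eta> T \<omega>) (dz T \<omega>) / sqrt (real T)
      + ip T (dz T \<omega>) (dy T \<omega>) / sqrt (real T))"
    by (simp add: nhat_def[abs_def] n0_def[abs_def] r_eq ip_add_left ip_add_right add_divide_distrib fun_eq_iff ip_commute[of _ "dz _ _" "e\<eta> _ _"])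
  ultimately show ?thesis by simp
qed

lemma mean_ez_eta: "(\<integral>x. snd (snd x) * fst x \<partial>L) = 0"
  using mean0(4) by (simp add: mult.commute)

lemma n0_second_moment:
  assumes T: "1 \<le> T"
  shows "integrable (P T) (\<lambda>\<omega>. (n0 T \<omega>)\<^sup>2)" "(\<integral>\<omega>. (n0 T \<omega>)\<^sup>2 \<partial>P T) = \<tau>2"
proof -
  note m = sum_moment[OF meas_prod(2) moment_facts(9) mean_ez_eta T]
  have eq: "(\<lambda>\<omega>. (n0 T \<omega>)\<^sup>2) = (\<lambda>\<omega>. (\<Sum>t<T. snd (snd (\<xi> T t \<omega>)) * fst (\<xi> T t \<omega>))\<^sup>2 / real T)"
    by (simp add: n0_def ip_def ez_def e\<eta>_def power_divide fun_eq_iff)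
  show "integrable (P T) (\<lambda>\<omega>. (n0 T \<omega>)\<^sup>2)" unfolding eq by (rule integrable_divide) (rule m(1))
  show "(\<integral>\<omega>. (n0 T \<omega>)\<^sup>2 \<partial>P T) = \<tau>2" unfolding eq integral_divide_zero m(2) using T by (simp add: \<tau>2_def)
qed

text \<open>\<open>nhat\<close> is a term of constant second moment plus a term tending to zero.
  Used to show that the error in \<beta> perturbs the fitted residuals only by a small
  vector.\<close>

lemma nhat_square_small: "pconv P (\<lambda>T \<omega>. (nhat T \<omega>)\<^sup>2 / sqrt (real T)) 0"
proof (rule pconv_0_le)
  have lim: "(\<lambda>T. 1 / sqrt (real T)) \<longlonglongrightarrow> 0" by real_asymp
  have 1: "pconv P (\<lambda>T \<omega>. (n0 T \<omega>)\<^sup>2 / sqrt (real T)) 0"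
  proof (rule pconv_L1)
    show "\<forall>\<^sub>F T in sequentially. integrable (P T) (\<lambda>\<omega>. (n0 T \<omega>)\<^sup>2 / sqrt (real T))"
      using eventually_ge_at_top[of 1] by eventually_elim (rule integrable_divide, rule n0_second_moment)
    show "\<forall>\<^sub>F T in sequentially. (\<integral>\<omega>. (n0 T \<omega>)\<^sup>2 / sqrt (real T) \<partial>P T) \<le> \<tau>2 * (1 / sqrt (real T))"
      using eventually_ge_at_top[of 1] by eventually_elim (simp add: n0_second_moment(2))
    show "(\<lambda>T. \<tau>2 * (1 / sqrt (real T))) \<longlonglongrightarrow> 0" using tendsto_mult[OF tendsto_const lim, of \<tau>2] by simp
  qed simp
  have 2: "pconv P (\<lambda>T \<omega>. (nhat T \<omega> - n0 T \<omega>) * (nhat T \<omega> - n0 T \<omega>) * (1 / sqrt (real T))) (0 * 0 * 0)"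
    by (intro pconv_mult nhat_limit pconv_inverse_sqrt)
  have "pconv P (\<lambda>T \<omega>. 2 * ((n0 T \<omega>)\<^sup>2 / sqrt (real T)) + 2 * ((nhat T \<omega> - n0 T \<omega>) * (nhat T \<omega> - n0 T \<omega>) * (1 / sqrt (real T)))) (2 * 0 + 2 * (0 * 0 * 0))"
    by (intro pconv_add pconv_cmult 1 2)
  then show "pconv P (\<lambda>T \<omega>. 2 * ((n0 T \<omega>)\<^sup>2 / sqrt (real T)) + 2 * ((nhat T \<omega> - n0 T \<omega>) * (nhat T \<omega> - n0 T \<omega>) * (1 / sqrt (real T)))) 0" by simp
  show "whp P (\<lambda>T \<omega>. \<bar>(nhat T \<omega>)\<^sup>2 / sqrt (real T)\<bar> \<le> 2 * ((n0 T \<omega>)\<^sup>2 / sqrt (real T)) + 2 * ((nhat T \<omega> - n0 T \<omega>) * (nhat T \<omega> - n0 T \<omega>) * (1 / sqrt (real T))))"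
  proof (rule whp_alwaysI)
    fix T \<omega>
    have "(nhat T \<omega>)\<^sup>2 \<le> 2 * (n0 T \<omega>)\<^sup>2 + 2 * (nhat T \<omega> - n0 T \<omega>)\<^sup>2"
      using square_add_le[of "n0 T \<omega>" "nhat T \<omega> - n0 T \<omega>"] by simp
    then have "(nhat T \<omega>)\<^sup>2 / sqrt (real T) \<le> (2 * (n0 T \<omega>)\<^sup>2 + 2 * (nhat T \<omega> - n0 T \<omega>)\<^sup>2) / sqrt (real T)"
      by (rule divide_right_mono) simp
    then show "\<bar>(nhat T \<omega>)\<^sup>2 / sqrt (real T)\<bar> \<le> 2 * ((n0 T \<omega>)\<^sup>2 / sqrt (real T)) + 2 * ((nhat T \<omega> - n0 T \<omega>) * (nhat T \<omega> - n0 T \<omega>) * (1 / sqrt (real T)))"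
      by (simp add: add_divide_distrib power2_eq_square)
  qed
qed

lemma bdev_eq: "1 \<le> T \<Longrightarrow> bdev T \<omega> = inverse (mhat T \<omega>) * nhat T \<omega> / sqrt (real T)"
  unfolding bdev_def mhat_def nhat_def
  by (cases "ip T (rz T \<omega>) (rg T \<omega>) = 0") (simp_all add: field_simps)

text \<open>The square of \<open>bdev\<close> is of order \<open>1 / T\<close> and
  \<open>nrm T\<close> of \<open>rg\<close> is of order \<open>T\<close>, so the product is bounded
  in probability, which is far below \<open>sqrt T\<close>. The bound \<open>?B\<close> makes this
  explicit in terms of sequences with known limits.\<close>

lemma small_bdev:
  assumes \<gamma>: "\<gamma> \<noteq> 0"
  shows "small (\<lambda>T \<omega> t. bdev T \<omega> * rg T \<omega> t)"
  unfolding small_def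
proof (rule pconv_0_le)
  have im: "pconv P (\<lambda>T \<omega>. inverse (mhat T \<omega>)) (inverse \<gamma>)"
    using \<gamma> by (intro pconv_cont[OF mhat_limit]) (auto intro!: continuous_intros)
  let ?c = "\<integral>x. (fst (snd x))\<^sup>2 \<partial>L"
  let ?B = "\<lambda>T \<omega>. (nhat T \<omega>)\<^sup>2 / sqrt (real T) * (inverse (mhat T \<omega>) * inverse (mhat T \<omega>))
      * (2 * (nrm T (eg T \<omega>) / real T) + 2 * (nrm T (dg T \<omega>) / real T))"
  have "pconv P ?B (0 * (inverse \<gamma> * inverse \<gamma>) * (2 * ?c + 2 * 0))"
    by (rule pconv_mult[OF pconv_mult[OF nhat_square_small pconv_mult[OF im im]]
          pconv_add[OF pconv_cmult[OF lln_noise(3)] pconv_cmult[OF small_over_T[OF small_d(2)]]]])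
  then show "pconv P ?B 0" by simp
  show "whp P (\<lambda>T \<omega>. \<bar>nrm T (\<lambda>t. bdev T \<omega> * rg T \<omega> t) / sqrt (real T)\<bar> \<le> ?B T \<omega>)"
  proof (rule whp_alwaysI)
    fix T \<omega> assume T: "(1::nat) \<le> T"
    have b2: "(bdev T \<omega>)\<^sup>2 = (nhat T \<omega>)\<^sup>2 * (inverse (mhat T \<omega>) * inverse (mhat T \<omega>)) / real T"
      unfolding bdev_eq[OF T] using T by (simp add: power_divide power_mult_distrib power2_eq_square mult_ac)
    have "nrm T (\<lambda>t. bdev T \<omega> * rg T \<omega> t) \<le> (bdev T \<omega>)\<^sup>2 * (2 * nrm T (eg T \<omega>) + 2 * nrm T (dg T \<omega>))"
      unfolding nrm_scale r_eq by (intro mult_left_mono nrm_add_le) simp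
    then have "nrm T (\<lambda>t. bdev T \<omega> * rg T \<omega> t) / sqrt (real T)
        \<le> (bdev T \<omega>)\<^sup>2 * (2 * nrm T (eg T \<omega>) + 2 * nrm T (dg T \<omega>)) / sqrt (real T)"
      by (rule divide_right_mono) simp
    also have "\<dots> = ?B T \<omega>" unfolding b2 by (simp add: add_divide_distrib distrib_left mult_ac)
    finally show "\<bar>nrm T (\<lambda>t. bdev T \<omega> * rg T \<omega> t) / sqrt (real T)\<bar> \<le> ?B T \<omega>" by simp
  qed
qed

text \<open>The products of fitted residuals are \<open>v + w\<close>, with \<open>v\<close> the
  products of the true noise terms and \<open>nrm T w = o_P(T)\<close>. The squared norm of
  \<open>v\<close> obeys the law of large numbers, and the cross term is handled by
  Cauchy-Schwarz.\<close>

theorem Shat_limit: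
  assumes \<gamma>: "\<gamma> \<noteq> 0"
  shows "pconv P Shat \<tau>2"
proof -
  define d where "d T \<omega> t = dy T \<omega> t - bdev T \<omega> * rg T \<omega> t" for T \<omega> t
  have sd: "small d" unfolding d_def[abs_def] by (rule small_diff[OF small_d(1) small_bdev[OF \<gamma>]])
  have eh: "eh T \<omega> = (\<lambda>t. e\<eta> T \<omega> t + d T \<omega> t)" for T \<omega>
    by (simp add: eh_def[abs_def] d_def r_eq fun_eq_iff)
  define v where "v T \<omega> t = ez T \<omega> t * e\<eta> T \<omega> t" for T \<omega> t
  define w where "w T \<omega> t = ez T \<omega> t * d T \<omega> t + (e\<eta> T \<omega> t * dz T \<omega> t + dz T \<omega> t * d T \<omega> t)" for T \<omega> t
  have vw: "(\<lambda>t. rz T \<omega> t * eh T \<omega> t) = (\<lambda>t. v T \<omega> t + w T \<omega> t)" for T \<omega>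
    by (simp add: r_eq eh v_def w_def algebra_simps fun_eq_iff)
  have nv: "pconv P (\<lambda>T \<omega>. nrm T (v T \<omega>) / real T) \<tau>2"
    unfolding v_def[abs_def] by (rule lln_noise(2))
  have nw: "pconv P (\<lambda>T \<omega>. nrm T (w T \<omega>) / real T) 0"
  proof (rule pconv_0_le)
    let ?B = "\<lambda>T \<omega>. 2 * (nrm T (\<lambda>t. ez T \<omega> t * d T \<omega> t) / real T) + 2 * (2 * (nrm T (\<lambda>t. e\<eta> T \<omega> t * dz T \<omega> t) / real T)
        + 2 * (nrm T (\<lambda>t. dz T \<omega> t * d T \<omega> t) / real T))"
    have "pconv P ?B (2 * 0 + 2 * (2 * 0 + 2 * 0))"
      by (intro pconv_add pconv_cmult small_mult_fourth[OF lln_noise(6) sd] small_mult_fourth[OF lln_noise(5) small_d(3)]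
          small_mult[OF small_d(3) sd])
    then show "pconv P ?B 0" by simp
    show "whp P (\<lambda>T \<omega>. \<bar>nrm T (w T \<omega>) / real T\<bar> \<le> ?B T \<omega>)"
    proof (rule whp_alwaysI)
      fix T \<omega>
      have "nrm T (w T \<omega>) \<le> 2 * nrm T (\<lambda>t. ez T \<omega> t * d T \<omega> t) + 2 * nrm T (\<lambda>t. e\<eta> T \<omega> t * dz T \<omega> t + dz T \<omega> t * d T \<omega> t)"
        unfolding w_def by (rule nrm_add_le)
      also have "\<dots> \<le> 2 * nrm T (\<lambda>t. ez T \<omega> t * d T \<omega> t) + 2 * (2 * nrm T (\<lambda>t. e\<eta> T \<omega> t * dz T \<omega> t) + 2 * nrm T (\<lambda>t. dz T \<omega> t * d T \<omega> t))"
        using nrm_add_le[of T "\<lambda>t. e\<eta> T \<omega> t * dz T \<omega> t" "\<lambda>t. dz T \<omega> t * d T \<omega> t"] by simp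
      finally have "nrm T (w T \<omega>) / real T \<le> (2 * nrm T (\<lambda>t. ez T \<omega> t * d T \<omega> t) + 2 * (2 * nrm T (\<lambda>t. e\<eta> T \<omega> t * dz T \<omega> t) + 2 * nrm T (\<lambda>t. dz T \<omega> t * d T \<omega> t))) / real T"
        by (rule divide_right_mono) simp
      then show "\<bar>nrm T (w T \<omega>) / real T\<bar> \<le> ?B T \<omega>" by (simp add: add_divide_distrib)
    qed
  qed
  have "pconv P (\<lambda>T \<omega>. nrm T (v T \<omega>) / real T + 2 * (ip T (v T \<omega>) (w T \<omega>) / real T) + nrm T (w T \<omega>) / real T) (\<tau>2 + 2 * 0 + 0)"
    by (intro pconv_add pconv_cmult nv nw small_ip_bounded[OF nv nw])
  moreover have "nrm T (\<lambda>t. v T \<omega> t + w T \<omega> t) = nrm T (v T \<omega>) + 2 * ip T (v T \<omega>) (w T \<omega>) + nrm T (w T \<omega>)" for T \<omega>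
    by (simp add: nrm_def ip_def power2_sum sum.distrib sum_distrib_left mult.assoc)
  ultimately show ?thesis
    by (simp add: Shat_def[abs_def] vw add_divide_distrib)
qed

end

section \<open>The projection on the estimated factors\<close>

lemma resid_index:
  assumes A: "A \<in> carrier_mat n k" and v: "v \<in> carrier_vec n" and t: "t < n"
  shows "resid A v $ t = v $ t - (\<Sum>s<n. col_proj (with_ones A) $$ (t, s) * v $ s)"
proof -
  note P = col_proj(1)[OF with_ones_carrier[OF A]]
  have "(col_proj (with_ones A) *\<^sub>v v) $ t = (\<Sum>s<n. col_proj (with_ones A) $$ (t, s) * v $ s)"
    using P v t by (simp add: scalar_prod_def lessThan_atLeast0)
  then show ?thesis using resid(1)[OF A v] P v t by simp
qed

lemma col_proj_ones_entries:
  assumes A: "A \<in> carrier_mat n k"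
  defines "p \<equiv> \<lambda>t s. col_proj (with_ones A) $$ (t, s)"
  shows "\<And>t s. t < n \<Longrightarrow> s < n \<Longrightarrow> p t s = p s t"
    and "\<And>t s. t < n \<Longrightarrow> s < n \<Longrightarrow> (\<Sum>u<n. p t u * p u s) = p t s"
    and "(\<Sum>t<n. p t t) \<le> 1 + real k"
    and "\<And>t. t < n \<Longrightarrow> (\<Sum>s<n. p t s) = 1"
proof -
  note W = with_ones_carrier[OF A]
  note P = col_proj[OF W]
  show "p t s = p s t" if "t < n" "s < n" for t s
    using P(1,2) that unfolding p_def by (metis carrier_matD index_transpose_mat(1))
  show "(\<Sum>u<n. p t u * p u s) = p t s" if "t < n" "s < n" for t s
  proof -
    have "(col_proj (with_ones A) * col_proj (with_ones A)) $$ (t, s) = (\<Sum>u<n. p t u * p u s)"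
      using P(1) that by (simp add: p_def scalar_prod_def lessThan_atLeast0)
    then show ?thesis by (simp add: P(3) p_def)
  qed
  show "(\<Sum>t<n. p t t) \<le> 1 + real k" using P(5) by (simp add: p_def)
  show "(\<Sum>s<n. p t s) = 1" if t: "t < n" for t
  proof -
    have "(col_proj (with_ones A) *\<^sub>v vec n (\<lambda>_. 1)) $ t = (\<Sum>s<n. p t s)"
      using P(1) t by (simp add: p_def scalar_prod_def lessThan_atLeast0)
    moreover have "col_proj (with_ones A) *\<^sub>v vec n (\<lambda>_. 1) = vec n (\<lambda>_. 1)"
      using resid(3)[OF A zero_carrier_vec, of 0] col_with_ones(1)[OF A] by simp
    ultimately show ?thesis using t by simp
  qed
qed

section \<open>Measurability and rates for the estimated factors\<close>

lemma measurable_factor_hat: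
  assumes X: "X \<in> measurable M (mat_borel n m)" and \<Xi>: "\<Xi> \<in> measurable (mat_borel n m) (mat_borel n k)"
  shows "(\<lambda>\<omega>. factor_hat (X \<omega>) (\<Xi> (X \<omega>))) \<in> measurable M (mat_borel m k)"
proof -
  have "(\<lambda>\<omega>. (1 / sqrt (real n)) \<cdot>\<^sub>m (transpose_mat (X \<omega>) * \<Xi> (X \<omega>))) \<in> measurable M (mat_borel m k)"
    by (intro measurable_mat_smult measurable_mat_mult[of _ _ m n] measurable_mat_transpose X
        measurable_compose[OF X \<Xi>] borel_measurable_const)
  moreover have "factor_hat (X \<omega>) (\<Xi> (X \<omega>)) = (1 / sqrt (real n)) \<cdot>\<^sub>m (transpose_mat (X \<omega>) * \<Xi> (X \<omega>))"
    if "\<omega> \<in> space M" for \<omega>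
    using measurable_mat_borelD(1)[OF X that] by (simp add: factor_hat_def)
  ultimately show ?thesis by (subst measurable_cong) auto
qed

text \<open>The bound of the moment method at walk parameter \<open>k\<close>, the rounded-up
  logarithm of \<open>T\<close>.\<close>

definition noise_level :: "real \<Rightarrow> nat \<Rightarrow> nat \<Rightarrow> real" where
  "noise_level C n T = 32 * (exp 1)\<^sup>2 * (C + 1)\<^sup>2 * real (max n T) * real (nat \<lceil>ln (real T)\<rceil>)"

text \<open>With \<open>k\<close> at least \<open>ln T\<close> the failure probability
  \<open>T * exp (- 2 k)\<close> is at most \<open>1 / T\<close>, and a logarithmic \<open>k\<close>
  satisfies the cubic restriction of the moment method for large \<open>T\<close>.\<close>

lemma (in prob_seq) whp_random_matrix_norm:
  fixes E :: "nat \<Rightarrow> 'w \<Rightarrow> real mat" and N :: "nat \<Rightarrow> nat"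
  assumes Ec: "\<And>T \<omega>. T \<ge> 1 \<Longrightarrow> \<omega> \<in> space (P T) \<Longrightarrow> E T \<omega> \<in> carrier_mat (N T) T"
    and ind: "\<And>T. T \<ge> 1 \<Longrightarrow> prob_space.indep_vars (P T) (\<lambda>_. borel) (\<lambda>it \<omega>. E T \<omega> $$ it) ({..<N T} \<times> {..<T})"
    and mean: "\<And>T i t. T \<ge> 1 \<Longrightarrow> i < N T \<Longrightarrow> t < T \<Longrightarrow> (\<integral>\<omega>. E T \<omega> $$ (i, t) \<partial>P T) = 0"
    and psi: "\<And>T i t. T \<ge> 1 \<Longrightarrow> i < N T \<Longrightarrow> t < T \<Longrightarrow> psi1_norm (P T) (\<lambda>\<omega>. E T \<omega> $$ (i, t)) \<le> ennreal C"
    and C: "0 < C"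
  shows "whp P (\<lambda>T \<omega>. \<forall>v\<in>carrier_vec T. sqn (E T \<omega> *\<^sub>v v) \<le> noise_level C (N T) T * sqn v)"
proof (rule whp_lower_bound)
  have "\<forall>\<^sub>F T in sequentially. 2 * (ln (real T) + 1) ^ 3 \<le> real T" by real_asymp
  then show "\<forall>\<^sub>F T in sequentially. \<exists>A\<in>sets (P T). (\<forall>\<omega>\<in>A. \<forall>v\<in>carrier_vec T. sqn (E T \<omega> *\<^sub>v v) \<le> noise_level C (N T) T * sqn v)
      \<and> 1 - 1 / real T \<le> measure (P T) A"
    using eventually_ge_at_top[of 2]
  proof eventually_elim
    case (elim T)
    then have T: "T \<ge> 1" by simp
    interpret prob_space "P T" by (rule prob[OF T])
    define k where "k = nat \<lceil>ln (real T)\<rceil>"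
    have lnT: "0 < ln (real T)" using elim by simp
    then have k0: "0 < k" by (simp add: k_def)
    have kr: "real k \<le> ln (real T) + 1" "ln (real T) \<le> real k" using lnT by (simp_all add: k_def)
    have "2 * real k ^ 3 \<le> 2 * (ln (real T) + 1) ^ 3" using kr by (intro mult_left_mono power_mono) auto
    also have "\<dots> \<le> real T" by (rule elim)
    finally have "real (2 * k ^ 3) \<le> real T" by simp
    then have k3: "2 * k ^ 3 \<le> max (N T) T" by (simp only: of_nat_le_iff)
    have "real T * exp (- 2 * real k) \<le> real T * exp (- 2 * ln (real T))" using kr by (intro mult_left_mono) auto
    also have "\<dots> = 1 / real T"
    proof -
      have "exp (- 2 * ln (real T)) = inverse (exp (ln (real T)) * exp (ln (real T)))"
        by (simp add: exp_minus mult_exp_exp)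
      then show ?thesis using T by (simp add: field_simps)
    qed
    finally have small: "real T * exp (- 2 * real k) \<le> 1 / real T" .
    obtain A where A: "A \<in> events" "1 - real T * exp (- 2 * real k) \<le> prob A"
      "\<forall>\<omega>\<in>A. \<forall>v\<in>carrier_vec T. sqn (E T \<omega> *\<^sub>v v) \<le> 32 * (exp 1)\<^sup>2 * (C + 1)\<^sup>2 * real (max (N T) T) * real k * sqn v"
      using random_matrix_norm_bound[OF Ec[OF T] ind[OF T] mean[OF T] psi[OF T] C k0 k3] by blast
    show ?case
      using A small by (intro bexI[of _ A]) (auto simp: noise_level_def k_def)
  qed
  show "(\<lambda>T. 1 / real T) \<longlonglongrightarrow> 0" by (rule lim_1_over_n)
qed

text \<open>Since \<open>N / T\<close> converges, the noise level is of order
  \<open>T * ln T\<close>; dividing it by \<open>sqrt T\<close> and by the squared signal strength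
  leaves the very ratio \<open>sqrt T * ln T / \<nu>\<^sup>2\<close>.\<close>

lemma noise_level_rate:
  fixes \<nu> :: "nat \<Rightarrow> real" and N :: "nat \<Rightarrow> nat"
  assumes N: "(\<lambda>T. real (N T) / real T) \<longlonglongrightarrow> \<phi>"
    and \<nu>: "(\<lambda>T. sqrt (real T) * ln (real T)) \<in> o(\<lambda>T. (\<nu> T)\<^sup>2)"
  shows "(\<lambda>T. noise_level C (N T) T / (\<nu> T)\<^sup>2 / sqrt (real T)) \<longlonglongrightarrow> 0"
proof -
  define a where "a T = 32 * (exp 1)\<^sup>2 * (C + 1)\<^sup>2 * max (real (N T) / real T) 1 * (real (nat \<lceil>ln (real T)\<rceil>) / ln (real T))" for T
  have "(\<lambda>T. real (nat \<lceil>ln (real T)\<rceil>) / ln (real T)) \<longlonglongrightarrow> 1" by real_asymp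
  then have a: "a \<longlonglongrightarrow> 32 * (exp 1)\<^sup>2 * (C + 1)\<^sup>2 * max \<phi> 1 * 1"
    unfolding a_def by (intro tendsto_intros N tendsto_max)
  have "(\<lambda>T. sqrt (real T) * ln (real T) / (\<nu> T)\<^sup>2) \<longlonglongrightarrow> 0" by (rule smalloD_tendsto[OF \<nu>])
  from tendsto_mult[OF a this] have lim: "(\<lambda>T. a T * (sqrt (real T) * ln (real T) / (\<nu> T)\<^sup>2)) \<longlonglongrightarrow> 0" by simp
  have ev: "\<forall>\<^sub>F T in sequentially. a T * (sqrt (real T) * ln (real T) / (\<nu> T)\<^sup>2) = noise_level C (N T) T / (\<nu> T)\<^sup>2 / sqrt (real T)"
    using eventually_ge_at_top[of 2]
  proof eventually_elim
    case (elim T)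
    have ln: "ln (real T) \<noteq> 0" using elim by simp
    have m: "real (max (N T) T) = max (real (N T) / real T) 1 * real T"
      using elim by (simp add: max_def field_simps)
    have s: "sqrt (real T) = real T / sqrt (real T)" by (simp add: real_div_sqrt)
    show ?case unfolding noise_level_def a_def m using ln by (subst (1) s) (simp add: field_simps)
  qed
  show ?thesis by (rule Lim_transform_eventually[OF lim ev])
qed

lemma (in prob_seq) whp_factor_resid_small:
  fixes E F M U X :: "nat \<Rightarrow> 'w \<Rightarrow> real mat" and B \<Sigma> :: "nat \<Rightarrow> real mat" and N :: "nat \<Rightarrow> nat" and \<nu> :: "nat \<Rightarrow> real"
    and Sf :: "nat \<Rightarrow> 'w \<Rightarrow> real mat" and \<Xi> :: "nat \<Rightarrow> real mat \<Rightarrow> real mat"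
  assumes r: "1 \<le> r" "r \<le> R" and c: "0 < c" "c \<le> C"
    and N1: "\<And>T. T \<ge> 1 \<Longrightarrow> N T \<ge> 1"
    and Bc: "\<And>T. T \<ge> 1 \<Longrightarrow> B T \<in> carrier_mat (N T) r"
    and Fc: "\<And>T \<omega>. T \<ge> 1 \<Longrightarrow> \<omega> \<in> space (P T) \<Longrightarrow> F T \<omega> \<in> carrier_mat T r"
    and Ec: "\<And>T \<omega>. T \<ge> 1 \<Longrightarrow> \<omega> \<in> space (P T) \<Longrightarrow> E T \<omega> \<in> carrier_mat (N T) T"
    and pd: "\<And>T. T \<ge> 1 \<Longrightarrow> pos_def (N T) (\<Sigma> T)"
    and eigs: "\<And>T. T \<ge> 1 \<Longrightarrow> set_mset (eigs (\<Sigma> T)) \<subseteq> {c..C}"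
    and U: "\<And>T \<omega>. T \<ge> 1 \<Longrightarrow> \<omega> \<in> space (P T) \<Longrightarrow> U T \<omega> = mat_sqrt (\<Sigma> T) * E T \<omega>"
    and Sf: "\<And>T \<omega>. T \<ge> 1 \<Longrightarrow> \<omega> \<in> space (P T) \<Longrightarrow> Sf T \<omega> = (1 / real T) \<cdot>\<^sub>m (transpose_mat (F T \<omega>) * F T \<omega>)"
    and norm: "whp P (\<lambda>T \<omega>. \<forall>v\<in>carrier_vec T. sqn (E T \<omega> *\<^sub>v v) \<le> \<tau> T * sqn v)"
    and tau: "\<And>T. 0 \<le> \<tau> T" and \<nu>: "\<forall>\<^sub>F T in sequentially. 0 < \<nu> T"
    and spec: "whp P (\<lambda>T \<omega>. c * \<nu> T * sqrt (real T) \<le> sing_val r (B T * transpose_mat (F T \<omega>)) \<and> sing_val 1 (Sf T \<omega>) \<le> C)"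
    and top: "\<And>T A. T0 \<le> T \<Longrightarrow> A \<in> carrier_mat (N T) T \<Longrightarrow> top_left_singular R A (\<Xi> T A)"
    and T0: "1 \<le> T0" "R \<le> T0" and X: "\<And>T \<omega>. X T \<omega> = B T * transpose_mat (F T \<omega>) + U T \<omega>"
    and a: "a \<in> carrier_vec r"
  shows "whp P (\<lambda>T \<omega>. sqn (resid (factor_hat (X T \<omega>) (\<Xi> T (X T \<omega>))) (F T \<omega> *\<^sub>v a)) \<le> 4 * C\<^sup>2 / c\<^sup>2 * (\<tau> T / (\<nu> T)\<^sup>2) * sqn a)"
proof (rule whp_mono[OF whp_conj[OF norm spec]])
  show "\<forall>\<^sub>F T in sequentially. \<forall>\<omega>\<in>space (P T).
      (\<forall>v\<in>carrier_vec T. sqn (E T \<omega> *\<^sub>v v) \<le> \<tau> T * sqn v) \<and>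
      c * \<nu> T * sqrt (real T) \<le> sing_val r (B T * transpose_mat (F T \<omega>)) \<and> sing_val 1 (Sf T \<omega>) \<le> C \<longrightarrow>
      sqn (resid (factor_hat (X T \<omega>) (\<Xi> T (X T \<omega>))) (F T \<omega> *\<^sub>v a)) \<le> 4 * C\<^sup>2 / c\<^sup>2 * (\<tau> T / (\<nu> T)\<^sup>2) * sqn a"
    using \<nu> eventually_ge_at_top[of T0]
  proof eventually_elim
    case (elim T)
    have T: "T \<ge> 1" using elim T0 by simp
    show ?case
    proof (intro ballI impI, elim conjE)
      fix \<omega> assume \<omega>: "\<omega> \<in> space (P T)" and nE: "\<forall>v\<in>carrier_vec T. sqn (E T \<omega> *\<^sub>v v) \<le> \<tau> T * sqn v"
        and lo: "c * \<nu> T * sqrt (real T) \<le> sing_val r (B T * transpose_mat (F T \<omega>))" and hi: "sing_val 1 (Sf T \<omega>) \<le> C"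
      have C0: "0 \<le> C" using c by simp
      note E' = Ec[OF T \<omega>] and F' = Fc[OF T \<omega>] and B' = Bc[OF T]
      have Sc: "mat_sqrt (\<Sigma> T) \<in> carrier_mat (N T) (N T)"
        using mat_sqrt(1)[OF pd[OF T]] by (simp add: pos_semidef_def sym_mat_def)
      have U': "U T \<omega> \<in> carrier_mat (N T) T" unfolding U[OF T \<omega>] by (rule mult_carrier_mat[OF Sc E'])
      have bound: "sqn (U T \<omega> *\<^sub>v v) \<le> (C * \<tau> T) * sqn v" if v: "v \<in> carrier_vec T" for v
      proof -
        have Ev: "E T \<omega> *\<^sub>v v \<in> carrier_vec (N T)" by (rule mult_mat_vec_carrier[OF E' v])
        have "set_mset (eigs (\<Sigma> T)) \<subseteq> {..C}" using eigs[OF T] by auto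
        from sqn_mat_sqrt_le[OF pd[OF T] this Ev]
        have "sqn (U T \<omega> *\<^sub>v v) \<le> C * sqn (E T \<omega> *\<^sub>v v)"
          unfolding U[OF T \<omega>] assoc_mult_mat_vec[OF Sc E' v] .
        also have "\<dots> \<le> C * (\<tau> T * sqn v)" using nE v C0 by (intro mult_left_mono) auto
        finally show ?thesis by simp
      qed
      have X': "X T \<omega> \<in> carrier_mat (N T) T" unfolding X using B' F' U' by auto
      have K: "sqn (F T \<omega> *\<^sub>v w) \<le> real T * C * sqn w" if "w \<in> carrier_vec r" for w
        by (rule sqn_factor_le[OF F']) (use T r hi Sf[OF T \<omega>] C0 that in auto)
      have l0: "0 < c * \<nu> T * sqrt (real T)" using c elim T by simp
      \<comment> \<open>The bound for one matrix with \<open>K = T * C\<close>, noise level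
        \<open>C * \<tau>\<close> after multiplication by the square root of the covariance, and
        \<open>l = c * \<nu> * sqrt T\<close>; the factor \<open>T\<close> cancels between
        \<open>K\<close> and the square of \<open>l\<close>.\<close>
      have "sqn (resid (factor_hat (X T \<omega>) (\<Xi> T (X T \<omega>))) (F T \<omega> *\<^sub>v a))
          \<le> 4 * (real T * C) * (C * \<tau> T) / (c * \<nu> T * sqrt (real T))\<^sup>2 * sqn a"
      proof (rule sqn_resid_factor_le[OF B' F' U' bound _ X])
        show "top_left_singular R (X T \<omega>) (\<Xi> T (X T \<omega>))" by (rule top[OF elim(2) X'])
        show "R \<le> T" using T0 elim by simp
        show "0 < N T" using N1[OF T] by simp
      qed (use r C0 tau lo l0 a K in auto)
      also have "4 * (real T * C) * (C * \<tau> T) / (c * \<nu> T * sqrt (real T))\<^sup>2 = 4 * C\<^sup>2 / c\<^sup>2 * (\<tau> T / (\<nu> T)\<^sup>2)"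
      proof -
        have sq: "(c * \<nu> T * sqrt (real T))\<^sup>2 = c\<^sup>2 * (\<nu> T)\<^sup>2 * real T" by (simp add: power_mult_distrib)
        show ?thesis unfolding sq using T c elim by (simp add: field_simps power2_eq_square)
      qed
      finally show "sqn (resid (factor_hat (X T \<omega>) (\<Xi> T (X T \<omega>))) (F T \<omega> *\<^sub>v a)) \<le> 4 * C\<^sup>2 / c\<^sup>2 * (\<tau> T / (\<nu> T)\<^sup>2) * sqn a" .
    qed
  qed
qed

theorem theorem3p1:
  fixes P :: "nat \<Rightarrow> 'w measure"
    and r R :: nat and N :: "nat \<Rightarrow> nat" and \<phi> c C :: real
    and B \<Sigma>\<^sub>e :: "nat \<Rightarrow> real mat"
    and F E M U X :: "nat \<Rightarrow> 'w \<Rightarrow> real mat"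
    and S\<^sub>f :: "nat \<Rightarrow> 'w \<Rightarrow> real mat"
    and \<eta> \<epsilon>\<^sub>g \<epsilon>\<^sub>z y g z :: "nat \<Rightarrow> nat \<Rightarrow> 'w \<Rightarrow> real"
    and L :: "(real \<times> real \<times> real) measure"
    and \<mu>\<^sub>y \<mu>\<^sub>g \<mu>\<^sub>z \<beta> \<gamma> \<sigma>2 :: real and \<rho> \<alpha>\<^sub>g \<alpha>\<^sub>z :: "real vec"
    and \<nu> :: "nat \<Rightarrow> real"
    and \<Xi> :: "nat \<Rightarrow> real mat \<Rightarrow> real mat"
    and Fhat :: "nat \<Rightarrow> 'w \<Rightarrow> real mat" and Y G Z :: "nat \<Rightarrow> 'w \<Rightarrow> real vec"
    and betahat sigma2hat :: "nat \<Rightarrow> 'w \<Rightarrow> real"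
  assumes "r \<le> R" and "0 < c" and "c \<le> C"
    and "0 < \<phi>" and "\<phi> \<noteq> 1" and "\<And>T. T \<ge> 1 \<Longrightarrow> N T \<ge> 1"
    and "(\<lambda>T. real (N T) / real T) \<longlonglongrightarrow> \<phi>"
    and "\<And>T. T \<ge> 1 \<Longrightarrow> prob_space (P T)"
    \<comment> \<open>the panel\<close>
    and "\<And>T. T \<ge> 1 \<Longrightarrow> B T \<in> carrier_mat (N T) r"
    and "\<And>T. T \<ge> 1 \<Longrightarrow> pos_def (N T) (\<Sigma>\<^sub>e T)"
    and "\<And>T. T \<ge> 1 \<Longrightarrow> F T \<in> measurable (P T) (mat_borel T r)"
    and "\<And>T. T \<ge> 1 \<Longrightarrow> E T \<in> measurable (P T) (mat_borel (N T) T)"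
    and M_def: "\<And>T \<omega>. T \<ge> 1 \<Longrightarrow> \<omega> \<in> space (P T) \<Longrightarrow> M T \<omega> = B T * transpose_mat (F T \<omega>)"
    and U_def: "\<And>T \<omega>. T \<ge> 1 \<Longrightarrow> \<omega> \<in> space (P T) \<Longrightarrow> U T \<omega> = mat_sqrt (\<Sigma>\<^sub>e T) * E T \<omega>"
    and X_def: "\<And>T \<omega>. T \<ge> 1 \<Longrightarrow> \<omega> \<in> space (P T) \<Longrightarrow> X T \<omega> = M T \<omega> + U T \<omega>"
    and S\<^sub>f_def: "\<And>T \<omega>. T \<ge> 1 \<Longrightarrow> \<omega> \<in> space (P T) \<Longrightarrow>
           S\<^sub>f T \<omega> = (1 / real T) \<cdot>\<^sub>m (transpose_mat (F T \<omega>) * F T \<omega>)"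
    and "\<And>T t j. T \<ge> 1 \<Longrightarrow> t < T \<Longrightarrow> j < r \<Longrightarrow>
           integrable (P T) (\<lambda>\<omega>. F T \<omega> $$ (t, j)) \<and> (\<integral>\<omega>. F T \<omega> $$ (t, j) \<partial>P T) = 0"
    and "\<And>T. T \<ge> 1 \<Longrightarrow> indep_elems (P T) (mat_borel T r) (F T) (mat_borel (N T) T) (U T)"
    \<comment> \<open>the structural equations\<close>
    and "\<rho> \<in> carrier_vec r" and "\<alpha>\<^sub>g \<in> carrier_vec r" and "\<alpha>\<^sub>z \<in> carrier_vec r"
    and y: "\<And>T t \<omega>. T \<ge> 1 \<Longrightarrow> t < T \<Longrightarrow> \<omega> \<in> space (P T) \<Longrightarrow>
           y T t \<omega> = \<mu>\<^sub>y + \<beta> * g T t \<omega> + \<rho> \<bullet> row (F T \<omega>) t + \<eta> T t \<omega>"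
    and g: "\<And>T t \<omega>. T \<ge> 1 \<Longrightarrow> t < T \<Longrightarrow> \<omega> \<in> space (P T) \<Longrightarrow>
           g T t \<omega> = \<mu>\<^sub>g + \<alpha>\<^sub>g \<bullet> row (F T \<omega>) t + \<epsilon>\<^sub>g T t \<omega>"
    and z: "\<And>T t \<omega>. T \<ge> 1 \<Longrightarrow> t < T \<Longrightarrow> \<omega> \<in> space (P T) \<Longrightarrow>
           z T t \<omega> = \<mu>\<^sub>z + \<alpha>\<^sub>z \<bullet> row (F T \<omega>) t + \<epsilon>\<^sub>z T t \<omega>"
    \<comment> \<open>(a)\<close>
    and a_indep: "\<And>T. T \<ge> 1 \<Longrightarrow> prob_space.indep_vars (P T) (\<lambda>_. borel)
           (\<lambda>it \<omega>. E T \<omega> $$ it) ({..<N T} \<times> {..<T})"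
    and a_moments: "\<And>T i t. T \<ge> 1 \<Longrightarrow> i < N T \<Longrightarrow> t < T \<Longrightarrow>
           (\<integral>\<omega>. E T \<omega> $$ (i, t) \<partial>P T) = 0 \<and> (\<integral>\<omega>. (E T \<omega> $$ (i, t))\<^sup>2 \<partial>P T) = 1 \<and>
           psi1_norm (P T) (\<lambda>\<omega>. E T \<omega> $$ (i, t)) \<le> ennreal C"
    \<comment> \<open>(b)\<close>
    and b_eigs: "\<And>T. T \<ge> 1 \<Longrightarrow> set_mset (eigs (\<Sigma>\<^sub>e T)) \<subseteq> {c..C}"
    and b_regular: "regular_edges_and_bulks (\<lambda>T. esd (\<Sigma>\<^sub>e T)) (\<lambda>T. real (N T) / real T)"
    \<comment> \<open>(c)\<close>
    and c_B: "\<And>T i. r \<ge> 1 \<Longrightarrow> T \<ge> 1 \<Longrightarrow> i < N T \<Longrightarrow> vnorm (row (B T) i) \<le> C"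
    and c_F: "r \<ge> 1 \<Longrightarrow> bigO_prob P (\<lambda>T \<omega>. Max ((\<lambda>t. vnorm (row (F T \<omega>) t)) ` {..<T})) (\<lambda>T. ln (real T))"
    \<comment> \<open>(d)\<close>
    and d_rate: "r \<ge> 1 \<Longrightarrow> filterlim \<nu> at_top sequentially"
                "r \<ge> 1 \<Longrightarrow> \<nu> \<in> O(\<lambda>T. sqrt (real (N T)))"
    and d_spectrum: "r \<ge> 1 \<Longrightarrow> wp_to_one P (\<lambda>T \<omega>.
           c * \<nu> T * sqrt (real T) \<le> sing_val r (M T \<omega>) \<and>
           (\<forall>k\<in>{1..<r}. sing_val (k + 1) (M T \<omega>) < sing_val k (M T \<omega>)) \<and>
           sing_val 1 (M T \<omega>) \<le> C * \<nu> T * sqrt (real T) \<and>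
           c \<le> sing_val r (S\<^sub>f T \<omega>) \<and> sing_val 1 (S\<^sub>f T \<omega>) \<le> C)"
    \<comment> \<open>(e); \<^term>\<open>L\<close> is the common law of the triples\<close>
    and e_indep: "\<And>T. T \<ge> 1 \<Longrightarrow> prob_space.indep_vars (P T) (\<lambda>_. borel)
           (\<lambda>t \<omega>. (\<eta> T t \<omega>, \<epsilon>\<^sub>g T t \<omega>, \<epsilon>\<^sub>z T t \<omega>)) {..<T}"
    and e_law: "\<And>T t. T \<ge> 1 \<Longrightarrow> t < T \<Longrightarrow>
           distr (P T) borel (\<lambda>\<omega>. (\<eta> T t \<omega>, \<epsilon>\<^sub>g T t \<omega>, \<epsilon>\<^sub>z T t \<omega>)) = L"
    and e_indep_FU: "\<And>T. T \<ge> 1 \<Longrightarrow> indep_elems (P T)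
           (PiM {..<T} (\<lambda>_. borel)) (\<lambda>\<omega>. \<lambda>t\<in>{..<T}. (\<eta> T t \<omega>, \<epsilon>\<^sub>g T t \<omega>, \<epsilon>\<^sub>z T t \<omega>))
           (mat_borel T r \<Otimes>\<^sub>M mat_borel (N T) T) (\<lambda>\<omega>. (F T \<omega>, U T \<omega>))"
    and e_moments: "(\<integral>(h, eg, ez). h \<partial>L) = 0" "(\<integral>(h, eg, ez). eg \<partial>L) = 0"
           "(\<integral>(h, eg, ez). ez \<partial>L) = 0" "(\<integral>(h, eg, ez). h * ez \<partial>L) = 0"
    and \<gamma>_def: "\<gamma> = (\<integral>(h, eg, ez). eg * ez \<partial>L)" and "\<gamma> \<noteq> 0"
    \<comment> \<open>(f)\<close>
    and f: "r \<ge> 1 \<Longrightarrow> (\<lambda>T. sqrt (real T) * ln (real T)) \<in> o(\<lambda>T. (\<nu> T)\<^sup>2)"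
    \<comment> \<open>(g)\<close>
    and g_bound: "(\<integral>\<^sup>+(h, eg, ez). ennreal (\<bar>h\<bar> ^ 8) \<partial>L) + (\<integral>\<^sup>+(h, eg, ez). ennreal (\<bar>eg\<bar> ^ 8) \<partial>L)
           + (\<integral>\<^sup>+(h, eg, ez). ennreal (\<bar>ez\<bar> ^ 8) \<partial>L) \<le> ennreal C"
    and g_pos: "(\<integral>(h, eg, ez). ez\<^sup>2 * h\<^sup>2 \<partial>L) > 0"
    \<comment> \<open>(h)\<close>
    and h: "r \<ge> 1 \<Longrightarrow> bigO_prob P
           (\<lambda>T \<omega>. vnorm (vec r (\<lambda>j. (\<Sum>t<T. F T \<omega> $$ (t, j)) / sqrt (real T)))) (\<lambda>T. 1)"
    \<comment> \<open>(i)\<close>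
    and i: "r \<ge> 2 \<Longrightarrow> \<exists>c'>0. wp_to_one P (\<lambda>T \<omega>. \<forall>k\<in>{1..<r}.
           sing_val k (M T \<omega>) - sing_val (k + 1) (M T \<omega>) \<ge> c' * \<nu> T * sqrt (real T))"
    \<comment> \<open>the estimators\<close>
    and \<Xi>_meas: "\<And>T. T \<ge> 1 \<Longrightarrow> R \<le> N T \<Longrightarrow> R \<le> T \<Longrightarrow>
           \<Xi> T \<in> measurable (mat_borel (N T) T) (mat_borel (N T) R)"
    and \<Xi>: "\<And>T A. T \<ge> 1 \<Longrightarrow> R \<le> N T \<Longrightarrow> R \<le> T \<Longrightarrow> A \<in> carrier_mat (N T) T \<Longrightarrow>
           top_left_singular R A (\<Xi> T A)"
    and Fhat_def: "\<And>T \<omega>. Fhat T \<omega> = factor_hat (X T \<omega>) (\<Xi> T (X T \<omega>))"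
    and Y_def: "\<And>T \<omega>. Y T \<omega> = vec T (\<lambda>t. y T t \<omega>)"
    and G_def: "\<And>T \<omega>. G T \<omega> = vec T (\<lambda>t. g T t \<omega>)"
    and Z_def: "\<And>T \<omega>. Z T \<omega> = vec T (\<lambda>t. z T t \<omega>)"
    and betahat_def: "\<And>T \<omega>. betahat T \<omega> = beta_hat (Fhat T \<omega>) (Y T \<omega>) (G T \<omega>) (Z T \<omega>)"
    and sigma2hat_def: "\<And>T \<omega>. sigma2hat T \<omega> = sigma2_hat (Fhat T \<omega>) (Y T \<omega>) (G T \<omega>) (Z T \<omega>)"
    and \<sigma>2_def: "\<sigma>2 = inverse (\<gamma>\<^sup>2) * (\<integral>(h, eg, ez). ez\<^sup>2 * h\<^sup>2 \<partial>L)"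
  shows "conv_in_distr P
           (\<lambda>T \<omega>. sqrt (real T) * inverse (sqrt (sigma2hat T \<omega>)) * (betahat T \<omega> - \<beta>))
           std_normal_distribution
       \<and> conv_in_prob P sigma2hat \<sigma>2
       \<and> ((\<forall>T\<ge>1. \<forall>t<T. \<forall>\<omega>\<in>space (P T). z T t \<omega> = g T t \<omega>) \<longrightarrow>
            \<sigma>2 = inverse ((\<integral>(h, eg, ez). eg\<^sup>2 \<partial>L)\<^sup>2) * (\<integral>(h, eg, ez). eg\<^sup>2 * h\<^sup>2 \<partial>L))"
proof -

  \<comment> \<open>Sample sizes for which the estimator is defined\<close>
  interpret prob_seq P by (rule prob_seq.intro) (rule assms(8))
  note N1 = assms(6) and Bc = assms(9) and pd = assms(10) and Fm = assms(11) and Em = assms(12) and FU_indep = assms(18)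
  have Fc: "F T \<omega> \<in> carrier_mat T r" if "T \<ge> 1" "\<omega> \<in> space (P T)" for T \<omega>
    using measurable_mat_borelD(1)[OF Fm[OF that(1)] that(2)] .
  have Ec: "E T \<omega> \<in> carrier_mat (N T) T" if "T \<ge> 1" "\<omega> \<in> space (P T)" for T \<omega>
    using measurable_mat_borelD(1)[OF Em[OF that(1)] that(2)] .
  have C0: "0 < C" using assms(2,3) by linarith
  \<comment> \<open>\<open>N / T\<close> has a positive limit, so eventually both dimensions are at
    least \<open>R\<close>; only then do the properties of \<Xi> apply.\<close>
  have "\<forall>\<^sub>F T in sequentially. \<phi> / 2 < real (N T) / real T"
    by (rule order_tendstoD(1)[OF assms(7)]) (use assms(4) in simp)
  moreover have "\<forall>\<^sub>F T in sequentially. real R \<le> \<phi> / 2 * real T" using assms(4) by real_asymp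
  ultimately have "\<forall>\<^sub>F T in sequentially. R \<le> N T \<and> R \<le> T \<and> 1 \<le> T"
    using eventually_ge_at_top[of "max 1 R"]
  proof eventually_elim
    case (elim T)
    then have T: "1 \<le> T" "R \<le> T" by auto
    have "real R \<le> real (N T)" using elim(1,2) T by (simp add: field_simps)
    then show ?case using T by simp
  qed
  then obtain T1 where T1: "\<And>T. T \<ge> T1 \<Longrightarrow> R \<le> N T \<and> R \<le> T \<and> 1 \<le> T" unfolding eventually_sequentially by blast
  define T0 where "T0 = max (max 1 R) T1"
  have T0: "1 \<le> T0" "R \<le> T0" and T0D: "\<And>T. T0 \<le> T \<Longrightarrow> 1 \<le> T" "\<And>T. T0 \<le> T \<Longrightarrow> R \<le> N T" "\<And>T. T0 \<le> T \<Longrightarrow> R \<le> T"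
    using T1 by (auto simp: T0_def)

  \<comment> \<open>The noise triples, and the projection as a function of the data\<close>
  define \<xi> where "\<xi> T t \<omega> = (\<eta> T t \<omega>, \<epsilon>\<^sub>g T t \<omega>, \<epsilon>\<^sub>z T t \<omega>)" for T t \<omega>
  define W where "W T \<omega> = (F T \<omega>, U T \<omega>)" for T \<omega>
  define S where "S T = mat_borel T r \<Otimes>\<^sub>M mat_borel (N T) T" for T
  interpret noise_seq P \<xi> L S W
    by unfold_locales (use e_indep e_law e_indep_FU in \<open>simp_all add: \<xi>_def[abs_def] W_def[abs_def] S_def[abs_def]\<close>)
  have Wsp: "W T \<omega> \<in> space (S T)" if "T \<ge> 1" "\<omega> \<in> space (P T)" for T \<omega>
    using measurable_space[of "W T" "P T" "S T"] indepW[OF that(1)] that(2) by (auto simp: indep_elems_def)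
  have Uc: "U T \<omega> \<in> carrier_mat (N T) T" if "T \<ge> 1" "\<omega> \<in> space (P T)" for T \<omega>
    using Wsp[OF that] by (auto simp: W_def S_def space_pair_measure)

  \<comment> \<open>The panel is rebuilt from a pair \<open>(F, U)\<close>, the loadings being
    deterministic. The estimated factors, the projection and the projected factor parts are thereby
    functions of \<open>W\<close>, which is what independence from the noise refers to.\<close>
  define Xf where "Xf T x = B T * transpose_mat (fst x) + snd x" for T and x :: "real mat \<times> real mat"
  define Ff where "Ff T x = factor_hat (Xf T x) (\<Xi> T (Xf T x))" for T and x :: "real mat \<times> real mat"
  define p where "p T x t s = col_proj (with_ones (Ff T x)) $$ (t, s)" for T and x :: "real mat \<times> real mat" and t s
  define fa where "fa x a s = (\<Sum>j<r. fst x $$ (s, j) * a $ j)" for x :: "real mat \<times> real mat" and a :: "real vec" and s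
  define A where "A a T x t = fa x a t - (\<Sum>s<T. p T x t s * fa x a s)" for a :: "real vec" and T and x :: "real mat \<times> real mat" and t

  have Xeq: "X T \<omega> = Xf T (W T \<omega>)" if "T \<ge> 1" "\<omega> \<in> space (P T)" for T \<omega>
    using X_def[OF that] M_def[OF that] by (simp add: Xf_def W_def)
  have Fheq: "Fhat T \<omega> = Ff T (W T \<omega>)" if "T \<ge> 1" "\<omega> \<in> space (P T)" for T \<omega>
    using Xeq[OF that] by (simp add: Fhat_def Ff_def)
  have fst_m: "fst \<in> measurable (S T) (mat_borel T r)" and snd_m: "snd \<in> measurable (S T) (mat_borel (N T) T)" for T
    unfolding S_def by measurable
  have Xfm: "Xf T \<in> measurable (S T) (mat_borel (N T) T)" if T: "T \<ge> 1" for T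
    unfolding Xf_def
    by (intro measurable_mat_add measurable_mat_mult[of _ _ "N T" r] measurable_mat_transpose measurable_mat_const
        Bc[OF T] fst_m snd_m)
  have Ffm: "Ff T \<in> measurable (S T) (mat_borel T R)" if T: "T0 \<le> T" for T
    unfolding Ff_def by (rule measurable_factor_hat[OF Xfm \<Xi>_meas]) (use T0D T in auto)
  have pm: "(\<lambda>x. p T x t s) \<in> borel_measurable (S T)" if "T0 \<le> T" "t < T" "s < T" for T t s
    unfolding p_def
    by (rule measurable_mat_borelD(2)[OF measurable_col_proj[OF measurable_with_ones[OF Ffm[OF that(1)]]] that(2,3)])
  have fm: "(\<lambda>x. fa x a s) \<in> borel_measurable (S T)" if "s < T" for a T s
    unfolding fa_def
    by (intro borel_measurable_sum borel_measurable_times borel_measurable_const measurable_mat_borelD(2)[OF fst_m])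
       (use that in auto)
  have Am: "(\<lambda>x. A a T x t) \<in> borel_measurable (S T)" if "T0 \<le> T" "t < T" for a T t
    unfolding A_def
    by (intro borel_measurable_diff borel_measurable_sum borel_measurable_times fm pm) (use that in auto)
  have Ffc: "Ff T (W T \<omega>) \<in> carrier_mat T R" if "T0 \<le> T" "\<omega> \<in> space (P T)" for T \<omega>
    by (rule measurable_mat_borelD(1)[OF Ffm[OF that(1)] Wsp[OF T0D(1)[OF that(1)] that(2)]])
  have p_entries:
    "\<And>t s. t < T \<Longrightarrow> s < T \<Longrightarrow> p T (W T \<omega>) t s = p T (W T \<omega>) s t"
    "\<And>t s. t < T \<Longrightarrow> s < T \<Longrightarrow> (\<Sum>u<T. p T (W T \<omega>) t u * p T (W T \<omega>) u s) = p T (W T \<omega>) t s"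
    "(\<Sum>t<T. p T (W T \<omega>) t t) \<le> 1 + real R"
    "\<And>t. t < T \<Longrightarrow> (\<Sum>s<T. p T (W T \<omega>) t s) = 1" if "T0 \<le> T" "\<omega> \<in> space (P T)" for T \<omega>
    using col_proj_ones_entries[OF Ffc[OF that]] unfolding p_def by blast+
  have res: "resid (Fhat T \<omega>) v $ t = v $ t - (\<Sum>s<T. p T (W T \<omega>) t s * v $ s)"
    if "T0 \<le> T" "\<omega> \<in> space (P T)" "v \<in> carrier_vec T" "t < T" for T \<omega> v t
    using resid_index[OF Ffc[OF that(1,2)] that(3,4)] Fheq[OF T0D(1)[OF that(1)] that(2)] by (simp add: p_def)
  have res_c: "resid (Fhat T \<omega>) v \<in> carrier_vec T" if "T0 \<le> T" "\<omega> \<in> space (P T)" "v \<in> carrier_vec T" for T \<omega> v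
    using resid(2)[OF Ffc[OF that(1,2)] that(3)] Fheq[OF T0D(1)[OF that(1)] that(2)] by simp
  have fa_eq: "fa (W T \<omega>) a t = (F T \<omega> *\<^sub>v a) $ t" if "T \<ge> 1" "\<omega> \<in> space (P T)" "t < T" "a \<in> carrier_vec r" for T \<omega> t a
    using Fc[OF that(1,2)] that by (simp add: fa_def W_def scalar_prod_def lessThan_atLeast0)
  have fa_row: "fa (W T \<omega>) a t = a \<bullet> row (F T \<omega>) t" if "T \<ge> 1" "\<omega> \<in> space (P T)" "t < T" "a \<in> carrier_vec r" for T \<omega> t a
    using Fc[OF that(1,2)] that by (simp add: fa_def W_def scalar_prod_def lessThan_atLeast0 mult.commute)

  \<comment> \<open>The rate for the projected factor parts\<close>
  define \<kappa> where "\<kappa> T = (if r = 0 then 0 else 4 * C\<^sup>2 / c\<^sup>2 * (noise_level C (N T) T / (\<nu> T)\<^sup>2) * (sqn \<rho> + sqn \<alpha>\<^sub>g + sqn \<alpha>\<^sub>z))" for T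
  have nl0: "0 \<le> noise_level C n T" for n T by (simp add: noise_level_def)
  have \<kappa>0: "0 \<le> \<kappa> T" for T using nl0 by (simp add: \<kappa>_def)
  have \<kappa>_lim: "(\<lambda>T. \<kappa> T / sqrt (real T)) \<longlonglongrightarrow> 0"
  proof (cases "r = 0")
    case False
    then have "(\<lambda>T. noise_level C (N T) T / (\<nu> T)\<^sup>2 / sqrt (real T)) \<longlonglongrightarrow> 0"
      by (intro noise_level_rate[OF assms(7)] f) simp
    from tendsto_mult[OF tendsto_const this, of "4 * C\<^sup>2 / c\<^sup>2 * (sqn \<rho> + sqn \<alpha>\<^sub>g + sqn \<alpha>\<^sub>z)"]
    show ?thesis using False by (simp add: \<kappa>_def mult_ac)
  qed (simp add: \<kappa>_def)
  \<comment> \<open>The sum of the three squared norms in \<kappa> lets a single rate serve \<rho>,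
    \<open>\<alpha>\<^sub>g\<close> and \<open>\<alpha>\<^sub>z\<close>.\<close>
  have A_small: "whp P (\<lambda>T \<omega>. nrm T (A a T (W T \<omega>)) \<le> \<kappa> T)"
    if a: "a \<in> carrier_vec r" "sqn a \<le> sqn \<rho> + sqn \<alpha>\<^sub>g + sqn \<alpha>\<^sub>z" for a
  proof (cases "r = 0")
    \<comment> \<open>Without factors the sums over factor indices are empty, and the projected part
      is exactly zero, in agreement with the value 0 of \<kappa>.\<close>
    case True
    then have "nrm T (A a T (W T \<omega>)) \<le> \<kappa> T" for T \<omega> by (simp add: nrm_def A_def fa_def \<kappa>_def)
    then show ?thesis by (intro whp_alwaysI) simp
  next
    case False
    then have r1: "1 \<le> r" by simp
    have norm: "whp P (\<lambda>T \<omega>. \<forall>v\<in>carrier_vec T. sqn (E T \<omega> *\<^sub>v v) \<le> noise_level C (N T) T * sqn v)"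
      by (rule whp_random_matrix_norm[OF Ec a_indep _ _ C0]) (use a_moments in auto)
    have "filterlim \<nu> at_top sequentially" by (rule d_rate(1)[OF r1])
    then have \<nu>: "\<forall>\<^sub>F T in sequentially. 0 < \<nu> T" by (simp add: filterlim_at_top_dense)
    have spec: "whp P (\<lambda>T \<omega>. c * \<nu> T * sqrt (real T) \<le> sing_val r (B T * transpose_mat (F T \<omega>)) \<and> sing_val 1 (S\<^sub>f T \<omega>) \<le> C)"
    proof (rule whp_mono[OF whp_wp_to_one[OF d_spectrum[OF r1]]], use eventually_ge_at_top[of 1] in eventually_elim)
      case (elim T)
      then show ?case using M_def[OF elim] by auto
    qed
    have "whp P (\<lambda>T \<omega>. sqn (resid (factor_hat (B T * transpose_mat (F T \<omega>) + U T \<omega>) (\<Xi> T (B T * transpose_mat (F T \<omega>) + U T \<omega>))) (F T \<omega> *\<^sub>v a))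
        \<le> 4 * C\<^sup>2 / c\<^sup>2 * (noise_level C (N T) T / (\<nu> T)\<^sup>2) * sqn a)"
      by (rule whp_factor_resid_small[OF r1 assms(1,2,3) N1 Bc Fc Ec pd b_eigs U_def S\<^sub>f_def norm nl0 \<nu> spec _ T0 refl a(1)])
         (use \<Xi> T0D in blast)+
    then show ?thesis
    proof (rule whp_mono, use eventually_ge_at_top[of T0] in eventually_elim, intro ballI impI)
      fix T \<omega> assume T: "T0 \<le> T" and \<omega>: "\<omega> \<in> space (P T)"
        and le: "sqn (resid (factor_hat (B T * transpose_mat (F T \<omega>) + U T \<omega>) (\<Xi> T (B T * transpose_mat (F T \<omega>) + U T \<omega>))) (F T \<omega> *\<^sub>v a))
        \<le> 4 * C\<^sup>2 / c\<^sup>2 * (noise_level C (N T) T / (\<nu> T)\<^sup>2) * sqn a"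
      have Fa: "F T \<omega> *\<^sub>v a \<in> carrier_vec T" by (rule mult_mat_vec_carrier[OF Fc[OF T0D(1)[OF T] \<omega>] a(1)])
      have At: "A a T (W T \<omega>) t = resid (Fhat T \<omega>) (F T \<omega> *\<^sub>v a) $ t" if "t < T" for t
        unfolding res[OF T \<omega> Fa that] A_def using fa_eq[OF T0D(1)[OF T] \<omega> _ a(1)] that by simp
      have "nrm T (A a T (W T \<omega>)) = sqn (resid (Fhat T \<omega>) (F T \<omega> *\<^sub>v a))"
        unfolding nrm_def sqn_sum[OF res_c[OF T \<omega> Fa]] by (simp add: At)
      also have "\<dots> \<le> 4 * C\<^sup>2 / c\<^sup>2 * (noise_level C (N T) T / (\<nu> T)\<^sup>2) * sqn a"
        using le Fheq[OF T0D(1)[OF T] \<omega>] by (simp add: Ff_def Xf_def W_def)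
      also have "\<dots> \<le> \<kappa> T"
      proof -
        have "4 * C\<^sup>2 / c\<^sup>2 * (noise_level C (N T) T / (\<nu> T)\<^sup>2) * sqn a
          \<le> 4 * C\<^sup>2 / c\<^sup>2 * (noise_level C (N T) T / (\<nu> T)\<^sup>2) * (sqn \<rho> + sqn \<alpha>\<^sub>g + sqn \<alpha>\<^sub>z)"
          using nl0 by (intro mult_left_mono a(2)) simp
        then show ?thesis using False by (simp only: \<kappa>_def if_False)
      qed
      finally show "nrm T (A a T (W T \<omega>)) \<le> \<kappa> T" .
    qed
  qed

  \<comment> \<open>Moments of the noise law and the limit theory\<close>
  have L8: "integrable L (\<lambda>x. (fst x) ^ 8)" "integrable L (\<lambda>x. (fst (snd x)) ^ 8)" "integrable L (\<lambda>x. (snd (snd x)) ^ 8)"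
  proof -
    have fin: "(\<integral>\<^sup>+x. ennreal (\<bar>fst x\<bar> ^ 8) \<partial>L) + (\<integral>\<^sup>+x. ennreal (\<bar>fst (snd x)\<bar> ^ 8) \<partial>L)
        + (\<integral>\<^sup>+x. ennreal (\<bar>snd (snd x)\<bar> ^ 8) \<partial>L) \<le> ennreal C"
      using g_bound by (simp add: case_prod_beta')
    have int8: "integrable L (\<lambda>x. (h x) ^ 8)"
      if "h \<in> borel_measurable borel" "(\<integral>\<^sup>+x. ennreal (\<bar>h x\<bar> ^ 8) \<partial>L) \<le> ennreal C" for h :: "real \<times> real \<times> real \<Rightarrow> real"
    proof (rule integrableI_nonneg)
      have [measurable]: "h \<in> borel_measurable L" using that(1) measurable_cong_sets[OF sets_L refl] by blast
      show "(\<lambda>x. (h x) ^ 8) \<in> borel_measurable L" by measurable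
      have "(\<integral>\<^sup>+x. ennreal ((h x) ^ 8) \<partial>L) = (\<integral>\<^sup>+x. ennreal (\<bar>h x\<bar> ^ 8) \<partial>L)" by (simp add: power_even_abs)
      also have "\<dots> < \<infinity>" using that(2) by (rule le_less_trans) simp
      finally show "(\<integral>\<^sup>+x. ennreal ((h x) ^ 8) \<partial>L) < \<infinity>" .
    qed simp
    have m: "(\<lambda>x::real \<times> real \<times> real. fst x) \<in> borel_measurable borel"
      "(\<lambda>x::real \<times> real \<times> real. fst (snd x)) \<in> borel_measurable borel"
      "(\<lambda>x::real \<times> real \<times> real. snd (snd x)) \<in> borel_measurable borel"
      by (intro borel_measurable_continuous_onI continuous_intros)+
    show "integrable L (\<lambda>x. (fst x) ^ 8)"
      by (rule int8[OF m(1)], rule order_trans[OF _ fin]) (simp add: add.assoc)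
    show "integrable L (\<lambda>x. (fst (snd x)) ^ 8)"
      by (rule int8[OF m(2)], rule order_trans[OF _ fin]) (simp add: add.assoc add.left_commute)
    show "integrable L (\<lambda>x. (snd (snd x)) ^ 8)"
      by (rule int8[OF m(3)], rule order_trans[OF _ fin]) (simp add: add.commute)
  qed
  interpret V: iv_limit P \<xi> L S W p "A \<rho>" "A \<alpha>\<^sub>g" "A \<alpha>\<^sub>z" \<kappa> "1 + real R" T0
  proof unfold_locales
    show "(\<integral>x. fst x \<partial>L) = 0" "(\<integral>x. fst (snd x) \<partial>L) = 0" "(\<integral>x. snd (snd x) \<partial>L) = 0"
      "(\<integral>x. fst x * snd (snd x) \<partial>L) = 0" using e_moments by (simp_all add: case_prod_beta')
    show "whp P (\<lambda>T \<omega>. nrm T (A \<rho> T (W T \<omega>)) \<le> \<kappa> T)" "whp P (\<lambda>T \<omega>. nrm T (A \<alpha>\<^sub>g T (W T \<omega>)) \<le> \<kappa> T)"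
      "whp P (\<lambda>T \<omega>. nrm T (A \<alpha>\<^sub>z T (W T \<omega>)) \<le> \<kappa> T)"
      by (rule A_small; use assms(19,20,21) in simp)+
  qed (rule T0(1) \<kappa>0 \<kappa>_lim L8 | (rule pm Am p_entries(1,2,3); assumption))+
  have \<gamma>: "V.\<gamma> = \<gamma>" "\<gamma> \<noteq> 0" and \<tau>2: "V.\<tau>2 = (\<integral>(h, eg, ez). ez\<^sup>2 * h\<^sup>2 \<partial>L)"
    using \<gamma>_def assms(42) by (simp_all add: V.\<gamma>_def V.\<tau>2_def case_prod_beta' power_mult_distrib)
  have \<tau>2_pos: "0 < V.\<tau>2" using g_pos by (simp add: \<tau>2)
  have \<sigma>2: "\<sigma>2 = inverse \<gamma> * V.\<tau>2 * inverse \<gamma>" using \<sigma>2_def by (simp add: \<tau>2 power2_eq_square)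


  \<comment> \<open>The estimators in terms of the residuals\<close>
  let ?rz = V.rz and ?rg = V.rg and ?ru = V.ru
  have Zc: "Z T \<omega> \<in> carrier_vec T" "G T \<omega> \<in> carrier_vec T" "Y T \<omega> \<in> carrier_vec T" for T \<omega>
    by (simp_all add: Z_def G_def Y_def)
  \<comment> \<open>The intercept drops out because the rows of the projection sum to one: the
    constant vector lies in its range.\<close>
  have lin: "resid (Fhat T \<omega>) v $ t = A a T (W T \<omega>) t + (e t - V.pr T \<omega> e t)"
    if T: "T0 \<le> T" and \<omega>: "\<omega> \<in> space (P T)" and t: "t < T" and a: "a \<in> carrier_vec r" and v: "v \<in> carrier_vec T"
      and vt: "\<And>s. s < T \<Longrightarrow> v $ s = \<mu> + a \<bullet> row (F T \<omega>) s + e s" for T \<omega> t a v \<mu> and e :: "nat \<Rightarrow> real"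
  proof -
    have vs: "v $ s = \<mu> + fa (W T \<omega>) a s + e s" if "s < T" for s
      using vt[OF that] fa_row[OF T0D(1)[OF T] \<omega> that a] by simp
    have "(\<Sum>s<T. p T (W T \<omega>) t s * v $ s)
        = \<mu> * (\<Sum>s<T. p T (W T \<omega>) t s) + (\<Sum>s<T. p T (W T \<omega>) t s * fa (W T \<omega>) a s) + V.pr T \<omega> e t"
      by (simp add: vs V.pr_def distrib_left sum.distrib sum_distrib_left mult.commute)
    then show ?thesis
      using p_entries(4)[OF T \<omega> t] vs[OF t] by (simp add: res[OF T \<omega> v t] A_def)
  qed
  have rZ: "resid (Fhat T \<omega>) (Z T \<omega>) $ t = ?rz T \<omega> t" if "T0 \<le> T" "\<omega> \<in> space (P T)" "t < T" for T \<omega> t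
    unfolding V.rz_def
    by (rule lin[OF that assms(21) Zc(1), where \<mu> = \<mu>\<^sub>z])
       (use z[OF T0D(1)[OF that(1)] _ that(2)] in \<open>simp add: Z_def V.ez_def \<xi>_def\<close>)
  have rG: "resid (Fhat T \<omega>) (G T \<omega>) $ t = ?rg T \<omega> t" if "T0 \<le> T" "\<omega> \<in> space (P T)" "t < T" for T \<omega> t
    unfolding V.rg_def
    by (rule lin[OF that assms(20) Zc(2), where \<mu> = \<mu>\<^sub>g])
       (use g[OF T0D(1)[OF that(1)] _ that(2)] in \<open>simp add: G_def V.eg_def \<xi>_def\<close>)
  have rY: "resid (Fhat T \<omega>) (Y T \<omega>) $ t = \<beta> * ?rg T \<omega> t + ?ru T \<omega> t" if "T0 \<le> T" "\<omega> \<in> space (P T)" "t < T" for T \<omega> t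
  proof -
    \<comment> \<open>In \<open>Y - \<beta> G\<close> the regressor cancels and only intercept,
      factors and \<eta> remain, so the linear formula applies with coefficient \<rho>.\<close>
    let ?y = "Y T \<omega> - \<beta> \<cdot>\<^sub>v G T \<omega>"
    have yc: "?y \<in> carrier_vec T" using Zc by simp
    have "resid (Fhat T \<omega>) ?y $ t = ?ru T \<omega> t"
      unfolding V.ru_def
      by (rule lin[OF that assms(19) yc, where \<mu> = \<mu>\<^sub>y])
         (use y[OF T0D(1)[OF that(1)] _ that(2)] in \<open>simp add: Y_def G_def V.e\<eta>_def \<xi>_def\<close>)
    moreover have "resid (Fhat T \<omega>) ?y $ t = resid (Fhat T \<omega>) (Y T \<omega>) $ t - \<beta> * resid (Fhat T \<omega>) (G T \<omega>) $ t"
      using that(3) Zc(2,3)[of T \<omega>]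
      by (simp add: res[OF that(1,2) yc that(3)] res[OF that(1,2) Zc(2) that(3)] res[OF that(1,2) Zc(3) that(3)]
          algebra_simps sum_subtractf sum_distrib_left)
    ultimately show ?thesis using rG[OF that] by simp
  qed
  have sp: "u \<bullet> v = (\<Sum>t<T. u $ t * v $ t)" if "v \<in> carrier_vec T" for u v :: "real vec" and T
    using that by (simp add: scalar_prod_def lessThan_atLeast0)
  define I where "I T \<omega> = ip T (?rz T \<omega>) (?rg T \<omega>)" for T \<omega>
  \<comment> \<open>Explicit expressions in the residuals that agree with the estimators for
    \<open>T \<ge> T0\<close>, also at a zero denominator; measurability is proved for
    these.\<close>
  define bh where "bh T \<omega> = inverse (I T \<omega>) * (\<beta> * I T \<omega> + ip T (?rz T \<omega>) (?ru T \<omega>))" for T \<omega>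
  define s2 where "s2 T \<omega> = inverse (I T \<omega> / real T) *
     (1 / real T * (\<Sum>t<T. (?rz T \<omega> t)\<^sup>2 * (\<beta> * ?rg T \<omega> t + ?ru T \<omega> t - bh T \<omega> * ?rg T \<omega> t)\<^sup>2)) * inverse (I T \<omega> / real T)" for T \<omega>
  have ZG: "resid (Fhat T \<omega>) (Z T \<omega>) \<bullet> resid (Fhat T \<omega>) (G T \<omega>) = I T \<omega>" if "T0 \<le> T" "\<omega> \<in> space (P T)" for T \<omega>
    unfolding sp[OF res_c[OF that Zc(2)]] I_def ip_def using rZ[OF that] rG[OF that] by simp
  have ZY: "resid (Fhat T \<omega>) (Z T \<omega>) \<bullet> resid (Fhat T \<omega>) (Y T \<omega>) = \<beta> * I T \<omega> + ip T (?rz T \<omega>) (?ru T \<omega>)"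
    if "T0 \<le> T" "\<omega> \<in> space (P T)" for T \<omega>
    unfolding sp[OF res_c[OF that Zc(3)]] I_def ip_def using rZ[OF that] rY[OF that]
    by (simp add: algebra_simps sum.distrib sum_distrib_left)
  have bh: "betahat T \<omega> = bh T \<omega>" if "T0 \<le> T" "\<omega> \<in> space (P T)" for T \<omega>
    by (simp add: betahat_def beta_hat_def bh_def ZG[OF that] ZY[OF that])
  have Fhat_dim: "dim_row (Fhat T \<omega>) = T" if "T0 \<le> T" "\<omega> \<in> space (P T)" for T \<omega>
    using Ffc[OF that] Fheq[OF T0D(1)[OF that(1)] that(2)] by simp
  have s2: "sigma2hat T \<omega> = s2 T \<omega>" if "T0 \<le> T" "\<omega> \<in> space (P T)" for T \<omega>
  proof -
    have "eta_hat (Fhat T \<omega>) (Y T \<omega>) (G T \<omega>) (Z T \<omega>) $ t = \<beta> * ?rg T \<omega> t + ?ru T \<omega> t - bh T \<omega> * ?rg T \<omega> t" if t: "t < T" for t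
    proof -
      have G: "resid (Fhat T \<omega>) (G T \<omega>) \<in> carrier_vec T" by (rule res_c[OF \<open>T0 \<le> T\<close> \<open>\<omega> \<in> space (P T)\<close> Zc(2)])
      then have "eta_hat (Fhat T \<omega>) (Y T \<omega>) (G T \<omega>) (Z T \<omega>) $ t =
          resid (Fhat T \<omega>) (Y T \<omega>) $ t - betahat T \<omega> * resid (Fhat T \<omega>) (G T \<omega>) $ t"
        using t by (simp add: eta_hat_def betahat_def)
      then show ?thesis
        unfolding bh[OF \<open>T0 \<le> T\<close> \<open>\<omega> \<in> space (P T)\<close>] rY[OF \<open>T0 \<le> T\<close> \<open>\<omega> \<in> space (P T)\<close> t]
          rG[OF \<open>T0 \<le> T\<close> \<open>\<omega> \<in> space (P T)\<close> t] .
    qed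
    then show ?thesis
      by (simp add: sigma2hat_def sigma2_hat_def Let_def Fhat_dim[OF that] s2_def ZG[OF that] rZ[OF that])
  qed

  \<comment> \<open>Measurability of the estimators\<close>
  have meas: "(\<lambda>\<omega>. ?rz T \<omega> t) \<in> borel_measurable (P T)" "(\<lambda>\<omega>. ?rg T \<omega> t) \<in> borel_measurable (P T)"
    "(\<lambda>\<omega>. ?ru T \<omega> t) \<in> borel_measurable (P T)" if T: "T0 \<le> T" and t: "t < T" for T t
  proof -
    have Wm: "W T \<in> measurable (P T) (S T)" by (rule V.W_meas[OF T0D(1)[OF T]])
    have Am': "(\<lambda>\<omega>. A a T (W T \<omega>) t) \<in> borel_measurable (P T)" for a
      by (rule measurable_compose[OF Wm Am[OF T t]])
    have pm': "(\<lambda>\<omega>. p T (W T \<omega>) t s) \<in> borel_measurable (P T)" if "s < T" for s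
      by (rule measurable_compose[OF Wm pm[OF T t that]])
    have em: "V.ez T \<omega> s = snd (snd (\<xi> T s \<omega>))" "V.eg T \<omega> s = fst (snd (\<xi> T s \<omega>))" "V.e\<eta> T \<omega> s = fst (\<xi> T s \<omega>)" for \<omega> s
      by (simp_all add: V.ez_def V.eg_def V.e\<eta>_def)
    have \<xi>m: "(\<lambda>\<omega>. snd (snd (\<xi> T s \<omega>))) \<in> borel_measurable (P T)" "(\<lambda>\<omega>. fst (snd (\<xi> T s \<omega>))) \<in> borel_measurable (P T)"
      "(\<lambda>\<omega>. fst (\<xi> T s \<omega>)) \<in> borel_measurable (P T)" if "s < T" for s
      by (rule measurable_compose[OF rv_\<xi>[OF T0D(1)[OF T] that] V.meas_comp(3)]
          measurable_compose[OF rv_\<xi>[OF T0D(1)[OF T] that] V.meas_comp(2)]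
          measurable_compose[OF rv_\<xi>[OF T0D(1)[OF T] that] V.meas_comp(1)])+
    show "(\<lambda>\<omega>. ?rz T \<omega> t) \<in> borel_measurable (P T)" "(\<lambda>\<omega>. ?rg T \<omega> t) \<in> borel_measurable (P T)"
      "(\<lambda>\<omega>. ?ru T \<omega> t) \<in> borel_measurable (P T)"
      unfolding V.rz_def V.rg_def V.ru_def V.pr_def em
      by (intro borel_measurable_add borel_measurable_diff borel_measurable_sum borel_measurable_times Am' pm' \<xi>m t; simp)+
  qed
  have Im: "(\<lambda>\<omega>. I T \<omega>) \<in> borel_measurable (P T)" "(\<lambda>\<omega>. ip T (?rz T \<omega>) (?ru T \<omega>)) \<in> borel_measurable (P T)" if "T0 \<le> T" for T
    unfolding I_def ip_def by (intro borel_measurable_sum borel_measurable_times meas that; simp)+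
  have bhm: "(\<lambda>\<omega>. bh T \<omega>) \<in> borel_measurable (P T)" if "T0 \<le> T" for T
    unfolding bh_def by (intro borel_measurable_times borel_measurable_add borel_measurable_inverse borel_measurable_const Im that)
  have s2m: "(\<lambda>\<omega>. s2 T \<omega>) \<in> borel_measurable (P T)" if "T0 \<le> T" for T
    unfolding s2_def
    by (intro borel_measurable_times borel_measurable_add borel_measurable_diff borel_measurable_inverse borel_measurable_divide
        borel_measurable_const borel_measurable_sum borel_measurable_power Im bhm meas that; simp)
  have betam: "betahat T \<in> borel_measurable (P T)" and sigmam: "sigma2hat T \<in> borel_measurable (P T)" if "T0 \<le> T" for T
    using bhm[OF that] s2m[OF that] bh[OF that] s2[OF that] by (simp_all cong: measurable_cong)

  \<comment> \<open>Consistency of the variance estimator\<close>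
  have whp0: "whp P (\<lambda>T \<omega>. V.mhat T \<omega> \<noteq> 0)"
  proof -
    have "whp P (\<lambda>T \<omega>. \<bar>V.mhat T \<omega> - \<gamma>\<bar> \<le> \<bar>\<gamma>\<bar> / 2)"
      using V.mhat_limit[unfolded pconv_def \<gamma>(1), rule_format, of "\<bar>\<gamma>\<bar> / 2"] \<gamma>(2) by simp
    then show ?thesis by (rule whp_mono) (use \<gamma>(2) in \<open>auto intro!: always_eventually\<close>)
  qed
  have im: "pconv P (\<lambda>T \<omega>. inverse (V.mhat T \<omega>)) (inverse \<gamma>)"
    by (rule pconv_cont[OF V.mhat_limit[unfolded \<gamma>(1)], of inverse]) (use \<gamma>(2) in \<open>auto intro!: continuous_intros\<close>)
  have Sh: "pconv P V.Shat V.\<tau>2" by (rule V.Shat_limit) (simp add: \<gamma>)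
  define sg where "sg T \<omega> = inverse (V.mhat T \<omega>) * V.Shat T \<omega> * inverse (V.mhat T \<omega>)" for T \<omega>
  have sg_lim: "pconv P sg \<sigma>2" unfolding sg_def[abs_def] \<sigma>2 by (rule pconv_mult[OF pconv_mult[OF im Sh] im])
  \<comment> \<open>Off the event of a nonzero denominator the conventions for
    \<open>inverse 0\<close> break the identity for the error; that event has probability tending to
    one since \<gamma> is nonzero.\<close>
  have on_good: "betahat T \<omega> - \<beta> = inverse (V.mhat T \<omega>) * V.nhat T \<omega> / sqrt (real T) \<and> sigma2hat T \<omega> = sg T \<omega>"
    if T: "T0 \<le> T" and \<omega>: "\<omega> \<in> space (P T)" and m: "V.mhat T \<omega> \<noteq> 0" for T \<omega>
  proof -
    have I0: "I T \<omega> \<noteq> 0" using m by (auto simp: V.mhat_def I_def)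
    have b: "bh T \<omega> = \<beta> + V.bdev T \<omega>" using I0 by (simp add: bh_def V.bdev_def I_def distrib_left)
    have e: "\<beta> * ?rg T \<omega> t + ?ru T \<omega> t - bh T \<omega> * ?rg T \<omega> t = V.eh T \<omega> t" for t
      by (simp add: b V.eh_def algebra_simps)
    have "s2 T \<omega> = sg T \<omega>"
      unfolding s2_def e sg_def V.Shat_def V.mhat_def I_def[symmetric] nrm_def by (simp add: power_mult_distrib)
    moreover have "betahat T \<omega> - \<beta> = V.bdev T \<omega>" using bh[OF T \<omega>] b by simp
    ultimately show ?thesis using s2[OF T \<omega>] V.bdev_eq[OF T0D(1)[OF T]] by simp
  qed
  have sigma_lim: "pconv P sigma2hat \<sigma>2"
  proof (rule pconv_cong[OF sg_lim], rule whp_mono[OF whp0])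
    show "\<forall>\<^sub>F T in sequentially. \<forall>\<omega>\<in>space (P T). V.mhat T \<omega> \<noteq> 0 \<longrightarrow> sg T \<omega> = sigma2hat T \<omega>"
      using eventually_ge_at_top[of T0] by eventually_elim (use on_good in auto)
  qed
  have part2: "conv_in_prob P sigma2hat \<sigma>2"
    by (rule conv_in_probI[OF _ sigma_lim], use eventually_ge_at_top[of T0] in eventually_elim) (rule sigmam)

  \<comment> \<open>Asymptotic normality\<close>
  define q where "q T \<omega> = inverse (sqrt (sg T \<omega>)) * inverse (V.mhat T \<omega>)" for T \<omega>
  define q0 where "q0 = inverse (sqrt \<sigma>2) * inverse \<gamma>"
  have \<sigma>2_pos: "0 < \<sigma>2"
  proof -
    have "\<sigma>2 = V.\<tau>2 * (inverse \<gamma>)\<^sup>2" unfolding \<sigma>2 by (simp add: power2_eq_square)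
    then show ?thesis using \<tau>2_pos \<gamma>(2) by simp
  qed
  have q_lim: "pconv P q q0"
    unfolding q_def[abs_def] q0_def
    by (rule pconv_mult[OF _ im], rule pconv_cont[OF pconv_sqrt[OF sg_lim], of inverse])
       (use \<sigma>2_pos in \<open>auto intro!: continuous_intros\<close>)
  \<comment> \<open>The standard error is a square root and retains only the modulus of \<gamma>,
    while the denominator of the estimator keeps its sign; a factor \<open>sgn \<gamma>\<close>
    survives.\<close>
  have q0_sgn: "q0 = sgn \<gamma> / sqrt V.\<tau>2"
  proof -
    have "sqrt \<sigma>2 = sqrt V.\<tau>2 * \<bar>inverse \<gamma>\<bar>"
    proof -
      have "\<sigma>2 = V.\<tau>2 * (inverse \<gamma>)\<^sup>2" unfolding \<sigma>2 by (simp add: power2_eq_square)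
      then show ?thesis by (simp only: real_sqrt_mult real_sqrt_abs)
    qed
    then have "q0 = inverse (sqrt V.\<tau>2 * \<bar>inverse \<gamma>\<bar>) * inverse \<gamma>" by (simp only: q0_def)
    also have "\<dots> = sgn \<gamma> / sqrt V.\<tau>2" by (cases "\<gamma> > 0") (use \<gamma>(2) in \<open>auto simp: field_simps\<close>)
    finally show ?thesis .
  qed
  \<comment> \<open>The sign is moved into the summands, where it changes neither their mean zero
    nor their second moment, so the central limit theorem applies whatever the sign of
    \<gamma>.\<close>
  define Q where "Q T \<omega> = (\<Sum>t<T. sgn \<gamma> * (snd (snd (\<xi> T t \<omega>)) * fst (\<xi> T t \<omega>))) / sqrt (real T * V.\<tau>2)" for T \<omega>
  have Q_eq: "Q T \<omega> = q0 * V.n0 T \<omega>" for T \<omega>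
    by (simp add: Q_def q0_sgn V.n0_def ip_def V.ez_def V.e\<eta>_def real_sqrt_mult sum_distrib_left[symmetric])
  have hm: "(\<lambda>x::real \<times> real \<times> real. sgn \<gamma> * (snd (snd x) * fst x)) \<in> borel_measurable borel"
    by (intro borel_measurable_times borel_measurable_const V.meas_prod(2))
  have sg2: "(sgn \<gamma> * x)\<^sup>2 = x\<^sup>2" for x using \<gamma>(2) by (simp add: power_mult_distrib sgn_if)
  have charQ: "(\<lambda>T. char (distr (P T) borel (Q T)) u) \<longlonglongrightarrow> char std_normal_distribution u" for u
    using clt[OF hm, of u] V.moment_facts(9) V.mean_ez_eta \<tau>2_pos
    by (simp add: sg2 V.\<tau>2_def[symmetric] Q_def[abs_def])
  have Qm: "Q T \<in> borel_measurable (P T)" if "T0 \<le> T" for T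
    unfolding Q_def
    by (intro borel_measurable_divide borel_measurable_sum borel_measurable_const
        measurable_compose[OF rv_\<xi>[OF T0D(1)[OF that]] hm]) auto
  let ?stat = "\<lambda>T \<omega>. sqrt (real T) * inverse (sqrt (sigma2hat T \<omega>)) * (betahat T \<omega> - \<beta>)"
  have part1: "conv_in_distr P ?stat std_normal_distribution"
  proof (rule slutsky_char[OF _ _ _ charQ real_dist_normal_dist])
    show "\<forall>\<^sub>F T in sequentially. ?stat T \<in> borel_measurable (P T)"
      using eventually_ge_at_top[of T0]
    proof eventually_elim
      case (elim T)
      note [measurable] = betam[OF elim] sigmam[OF elim]
      show ?case by measurable
    qed
    show "\<forall>\<^sub>F T in sequentially. Q T \<in> borel_measurable (P T)"
      using eventually_ge_at_top[of T0] by eventually_elim (rule Qm)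
    have n0i: "\<forall>\<^sub>F T in sequentially. integrable (P T) (\<lambda>\<omega>. (V.n0 T \<omega>)\<^sup>2)"
      using eventually_ge_at_top[of 1] by eventually_elim (rule V.n0_second_moment(1))
    have n0e: "\<forall>\<^sub>F T in sequentially. (\<integral>\<omega>. (V.n0 T \<omega>)\<^sup>2 \<partial>P T) \<le> V.\<tau>2"
      using eventually_ge_at_top[of 1] by eventually_elim (simp add: V.n0_second_moment(2))
    have qd: "pconv P (\<lambda>T \<omega>. q T \<omega> - q0) 0" using pconv_diff[OF q_lim pconv_const_seq[OF tendsto_const, of q0]] by simp
    \<comment> \<open>On the good event the statistic is \<open>q * nhat\<close>, and
      \<open>q * nhat - q0 * n0\<close> splits as shown. In the first term \<open>n0\<close> does
      not converge in probability, hence the version of the product rule for sequences bounded in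
      mean square.\<close>
    have "pconv P (\<lambda>T \<omega>. (q T \<omega> - q0) * V.n0 T \<omega> + q T \<omega> * (V.nhat T \<omega> - V.n0 T \<omega>)) (0 + q0 * 0)"
      by (rule pconv_add[OF pconv_mult_L2_bounded[OF qd n0i n0e] pconv_mult[OF q_lim V.nhat_limit]])
    then have lim: "pconv P (\<lambda>T \<omega>. (q T \<omega> - q0) * V.n0 T \<omega> + q T \<omega> * (V.nhat T \<omega> - V.n0 T \<omega>)) 0" by simp
    show "pconv P (\<lambda>T \<omega>. ?stat T \<omega> - Q T \<omega>) 0"
    proof (rule pconv_cong[OF lim], rule whp_mono[OF whp0])
      show "\<forall>\<^sub>F T in sequentially. \<forall>\<omega>\<in>space (P T). V.mhat T \<omega> \<noteq> 0 \<longrightarrow>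
          (q T \<omega> - q0) * V.n0 T \<omega> + q T \<omega> * (V.nhat T \<omega> - V.n0 T \<omega>) = ?stat T \<omega> - Q T \<omega>"
        using eventually_ge_at_top[of T0]
      proof eventually_elim
        case (elim T)
        have "sqrt (real T) \<noteq> 0" using T0D(1)[OF elim] by simp
        then show ?case using on_good[OF elim] by (auto simp: Q_eq q_def algebra_simps)
      qed
    qed
  qed

  \<comment> \<open>The case of identical instrument and regressor\<close>
  have part3: "\<sigma>2 = inverse ((\<integral>(h, eg, ez). eg\<^sup>2 \<partial>L)\<^sup>2) * (\<integral>(h, eg, ez). eg\<^sup>2 * h\<^sup>2 \<partial>L)"
    if zg: "\<forall>T\<ge>1. \<forall>t<T. \<forall>\<omega>\<in>space (P T). z T t \<omega> = g T t \<omega>"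
  proof -
    \<comment> \<open>The law \<open>L\<close> is common to all sample sizes, so a single
      observation at \<open>T = 1\<close> settles the question.\<close>
    interpret P1: prob_space "P 1" by (rule prob) simp
    interpret L: prob_space L by (rule prob_L)
    define h where "h x = fst (snd x) - snd (snd x)" for x :: "real \<times> real \<times> real"
    define k where "k x = (\<mu>\<^sub>z - \<mu>\<^sub>g) + (fa x \<alpha>\<^sub>z 0 - fa x \<alpha>\<^sub>g 0)" for x
    have hm: "h \<in> borel_measurable borel" unfolding h_def by (intro borel_measurable_diff V.meas_comp)
    have km: "k \<in> borel_measurable (S 1)" unfolding k_def by (intro borel_measurable_add borel_measurable_diff borel_measurable_const fm) simp_all
    have hk: "h (\<xi> 1 0 \<omega>) = k (W 1 \<omega>)" if "\<omega> \<in> space (P 1)" for \<omega>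
    proof -
      have "z 1 0 \<omega> = g 1 0 \<omega>" using zg that by simp
      then show ?thesis
        using z[of 1 0 \<omega>] g[of 1 0 \<omega>] that fa_row[of 1 \<omega> 0] assms(20,21) by (simp add: h_def k_def \<xi>_def)
    qed
    have h2: "integrable L (\<lambda>x. (h x)\<^sup>2)"
    proof (rule Bochner_Integration.integrable_bound)
      show "integrable L (\<lambda>x. 2 * (fst (snd x))\<^sup>2 + 2 * (snd (snd x))\<^sup>2)"
        by (intro Bochner_Integration.integrable_add integrable_mult_right V.moment_facts)
      show "(\<lambda>x. (h x)\<^sup>2) \<in> borel_measurable L"
        using borel_measurable_power[OF hm, of 2] measurable_cong_sets[OF sets_L refl] by blast
    qed (use square_diff_le in \<open>auto simp: h_def intro!: AE_I2\<close>)
    have hL: "integrable L h" by (rule integrable_L_of_square[OF hm h2])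
    have h0: "(\<integral>x. h x \<partial>L) = 0"
      unfolding h_def using integrable_L_of_square[OF V.meas_comp(2) V.moment_facts(2)]
        integrable_L_of_square[OF V.meas_comp(3) V.moment_facts(3)] V.mean0 by simp
    have f0: "(\<lambda>x :: nat \<Rightarrow> real \<times> real \<times> real. h (x 0)) \<in> borel_measurable (PiM {..<1} (\<lambda>_. borel))"
      by (rule measurable_compose[OF _ hm], rule measurable_component_singleton) simp
    have iv: "P1.indep_var borel (\<lambda>\<omega>. h (\<xi> 1 0 \<omega>)) borel (\<lambda>\<omega>. k (W 1 \<omega>))"
      using P1.indep_elems_indep_var[OF indepW[OF order_refl] f0 km] by simp
    have hi: "integrable (P 1) (\<lambda>\<omega>. h (\<xi> 1 0 \<omega>))" using law_integral(2)[OF hm, of 1 0] hL by simp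
    have ki: "integrable (P 1) (\<lambda>\<omega>. k (W 1 \<omega>))"
      using hi by (rule Bochner_Integration.integrable_cong[THEN iffD1, rotated 2]) (use hk in auto)
    have "(\<integral>x. (h x)\<^sup>2 \<partial>L) = (\<integral>\<omega>. (h (\<xi> 1 0 \<omega>))\<^sup>2 \<partial>P 1)"
      using law_integral(1)[OF borel_measurable_power[OF hm, of 2], of 1 0] by simp
    \<comment> \<open>One of the two equal factors is rewritten as a function of the data;
      independence then factorises the mean square of \<open>h\<close>, and the mean of
      \<open>h\<close> is zero.\<close>
    also have "\<dots> = (\<integral>\<omega>. h (\<xi> 1 0 \<omega>) * k (W 1 \<omega>) \<partial>P 1)"
      by (rule Bochner_Integration.integral_cong) (use hk in \<open>auto simp: power2_eq_square\<close>)
    also have "\<dots> = 0"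
      unfolding P1.indep_var_lebesgue_integral[OF iv hi ki] using law_integral(1)[OF hm, of 1 0] h0 by simp
    finally have "AE x in L. (h x)\<^sup>2 = 0" using integral_nonneg_eq_0_iff_AE[OF h2] by simp
    then have AE: "AE x in L. fst (snd x) = snd (snd x)" by eventually_elim (simp add: h_def)
    have cm: "(\<lambda>x. j x) \<in> borel_measurable L" if "j \<in> borel_measurable borel" for j :: "real \<times> real \<times> real \<Rightarrow> real"
      using that measurable_cong_sets[OF sets_L refl] by blast
    have g2: "\<gamma> = (\<integral>x. (fst (snd x))\<^sup>2 \<partial>L)"
      unfolding \<gamma>(1)[symmetric] V.\<gamma>_def
      by (rule integral_cong_AE[OF cm[OF V.meas_prod(1)] cm[OF V.meas_prod(4)]])
         (use AE in eventually_elim, simp add: power2_eq_square)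
    have pm2: "(\<lambda>x::real \<times> real \<times> real. (fst (snd x))\<^sup>2 * (fst x)\<^sup>2) \<in> borel_measurable borel"
      by (intro borel_measurable_continuous_onI continuous_intros)
    have t2: "V.\<tau>2 = (\<integral>x. (fst (snd x))\<^sup>2 * (fst x)\<^sup>2 \<partial>L)"
      unfolding V.\<tau>2_def
      by (rule integral_cong_AE[OF cm[OF V.meas_prod(3)] cm[OF pm2]])
         (use AE in eventually_elim, simp add: power_mult_distrib)
    have "\<sigma>2 = inverse (\<gamma>\<^sup>2) * V.\<tau>2" unfolding \<sigma>2 by (simp add: power2_eq_square)
    then show ?thesis unfolding t2 g2 by (simp add: case_prod_beta')
  qed
  show ?thesis using part1 part2 part3 by blast
qed

end
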